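(* Let $\mathcal H$ be a Hopf algebra over a field $k$ of characteristic $0$ with antipode $S$ satisfying $S^2=1$ (i.e. $(\epsilon,1)$ is a modular pair in involution). Then $\Omega^R(\mathcal H)$ is a differential graded subalgebra of $\Omega(\mathcal H)$, stable under $b$ and the Karoubi operator $\kappa$ (and under $b'$ and $\kappa'$), and hence is a mixed subcomplex of $(\Omega(\mathcal H),b,B)$. The same is true of $\Omega^L(\mathcal H)$. Moreover, the periodic cohomology of $\Omega^R(\mathcal H)$, with the mixed complex structure induced from $(\Omega(\mathcal H),b',B')$, is naturally isomorphic to the periodic Hopf-type cohomology $HP^*_{\epsilon,1}(\mathcal H)$ of $\mathcal H$.
   Context: Notation: $\Delta(h)=\sum h_{(1)}\otimes h_{(2)}$ is the diagonal, $\epsilon$ the counit, $m$ the multiplication of $\mathcal H$. Universal calculus: $\Omega(\mathcal H)=\bigoplus_{n\ge0}\Omega_n(\mathcal H)$ is the universal unital differential graded algebra of $\mathcal H$: $\Omega_0(\mathcal H)=\mathcal H$, $\Omega_1(\mathcal H)=\ker(m:\mathcal H\otimes\mathcal H\to\mathcal H)$, $\Omega_n(\mathcal H)=\Omega_1(\mathcal H)\otimes_{\mathcal H}\cdots\otimes_{\mathcal H}\Omega_1(\mathcal H)$ ($n$ factors), $d(x)=1\otimes x-x\otimes1$ for $x\in\mathcal H$. Every element of $\Omega_n(\mathcal H)$ is a sum of elements $a_0\,da_1\cdots da_n$, $a_j\in\mathcal H$, and $d(a_0\,da_1\cdots da_n)=da_0\,da_1\cdots da_n$. Coactions: $\Delta_R:\Omega(\mathcal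 H)\to\Omega(\mathcal H)\otimes\mathcal H$ and $\Delta_L:\Omega(\mathcal H)\to\mathcal H\otimes\Omega(\mathcal H)$ are the algebra morphisms $\Delta_R(a_0da_1\cdots da_n)=\sum a_{0,(1)}da_{1,(1)}\cdots da_{n,(1)}\otimes a_{0,(2)}a_{1,(2)}\cdots a_{n,(2)}$, $\Delta_L(a_0da_1\cdots da_n)=\sum a_{0,(1)}a_{1,(1)}\cdots a_{n,(1)}\otimes a_{0,(2)}da_{1,(2)}\cdots da_{n,(2)}$. $\Omega^R(\mathcal H)=\{\theta:\Delta_R(\theta)=\theta\otimes1\}$, $\Omega^L(\mathcal H)=\{\theta:\Delta_L(\theta)=1\otimes\theta\}$. Operators on $\Omega(\mathcal H)$ (with $a\in\mathcal H$, $\omega$ homogeneous of degree $|\omega|$): $b$ and $b'$ vanish on $\Omega_0(\mathcal H)$ and $b(\omega\,da)=(-1)^{|\omega|}(\omega a-a\omega)$, $b'(da\,\omega)=a\omega-\omega a$. $\kappa=1-bd-db$, so $\kappa(\omega\,da)=(-1)^{|\omega|}da\,\omega$; $\kappa'=1-b'd-db'$, so $\kappa'(da\,\omega)=(-1)^{|\omega|}\omega\,da$. On $\Omega_n(\mathcal H)$, $B=\sum_{j=0}^n\kappa^jd$ and $B'=\sum_{j=0}^n(\kappa')^jd$. Periodic cohomology of a graded space $(C_n)_{n\ge0}$ with two anticommuting square-zero differentials, one raising and one lowering the degree by one: the cohomology of the super-complex $CP_i=\prod_{n\equiv i\ (\mathrm{mod}\ 2)}C_n$, $i=0,1$, with differential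 the sum of the two. Hopf-type periodic cohomology: $HP^*_{\epsilon,1}(\mathcal H)$ is the periodic cohomology of the cocyclic module $\mathcal H^\sharp_n=\mathcal H^{\otimes n}$ with $\delta_0(h_1,\dots,h_n)=(1,h_1,\dots,h_n)$; $\delta_i(h_1,\dots,h_n)=(h_1,\dots,\Delta(h_i),\dots,h_n)$ for $1\le i\le n$; $\delta_{n+1}(h_1,\dots,h_n)=(h_1,\dots,h_n,1)$; $\sigma_i(h_1,\dots,h_n)=\epsilon(h_i)(h_1,\dots,\widehat{h_i},\dots,h_n)$ for $1\le i\le n$; $\tau_n(h_1,\dots,h_n)=S(h_1)\cdot(h_2,\dots,h_n,1)$, where $h\cdot(h_1,\dots,h_n)=\sum(h_{(1)}h_1,\dots,h_{(n)}h_n)$. Its two differentials are $\sum_{i=0}^{n+1}(-1)^i\delta_i:\mathcal H^\sharp_n\to\mathcal H^\sharp_{n+1}$ and $N_n\circ\tilde\sigma_0\circ(1-(-1)^{n+1}\tau_{n+1}):\mathcal H^\sharp_{n+1}\to\mathcal H^\sharp_n$, where $\tilde\sigma_0=\sigma_{n+1}\tau_{n+1}$, i.e. $\tilde\sigma_0(h_1,\dots,h_{n+1})=S(h_1)\cdot(h_2,\dots,h_{n+1})$, and $N_n=\sum_{i=0}^n(-1)^{in}\tau_n^i$.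
   Formalization: With direct products and the un-normalized cocyclic module the last claim fails (already for H = k); it is proved instead with direct sums on both sides for the full cocyclic module, and with direct products on both sides for the normalized cocyclic module. *)

theory Defs
  imports
    "HOL-Algebra.Algebraic_Closure_Type"
    "HOL-Library.Function_Algebras"
    "HOL-Library.Set_Algebras"
begin

section \<open>Spaces of functions\<close>

definition fscale :: "'k::field \<Rightarrow> ('b \<Rightarrow> 'k) \<Rightarrow> 'b \<Rightarrow> 'k"  (infixr \<open>*\<^sub>k\<close> 75)
  where "c *\<^sub>k f = (\<lambda>x. c * f x)"

interpretation fs: vector_space "fscale :: 'k::field \<Rightarrow> ('b \<Rightarrow> 'k) \<Rightarrow> 'b \<Rightarrow> 'k"
  by unfold_locales (auto simp: fscale_def algebra_simps)

definition linear_on ::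
  "('b \<Rightarrow> 'k::field) set \<Rightarrow> (('b \<Rightarrow> 'k) \<Rightarrow> ('c \<Rightarrow> 'k)) \<Rightarrow> bool"
  where "linear_on V f \<longleftrightarrow>
    (\<forall>x\<in>V. \<forall>y\<in>V. f (x + y) = f x + f y) \<and> (\<forall>c. \<forall>x\<in>V. f (c *\<^sub>k x) = c *\<^sub>k f x)"

text \<open>Used for properties \<open>P\<close> that prescribe a linear map on a spanning set of \<open>V\<close>.\<close>

definition the_linear_map ::
  "('b \<Rightarrow> 'k::field) set \<Rightarrow> ((('b \<Rightarrow> 'k) \<Rightarrow> ('c \<Rightarrow> 'k)) \<Rightarrow> bool) \<Rightarrow> ('b \<Rightarrow> 'k) \<Rightarrow> ('c \<Rightarrow> 'k)"
  where "the_linear_map V P = (THE f. f \<in> extensional V \<and> linear_on V f \<and> P f)"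


section \<open>Tensor powers of a vector space\<close>

text \<open>
  Let \<open>M\<close> be a vector space over \<open>'k\<close>.  A pure tensor \<open>x\<^sub>1 \<otimes> \<dots> \<otimes> x\<^sub>n\<close> is
  represented by the functional that evaluates \<open>n\<close>-linear forms on \<open>M\<close> at \<open>(x\<^sub>1, \<dots>, x\<^sub>n)\<close>, and
  \<open>M\<^sup>\<otimes>\<^sup>n\<close> is the span of the pure tensors.  Lemma \<open>tens_sum_eq_0_iff\<close> below says that this
  is the free vector space on \<open>M\<^sup>n\<close> modulo the multilinearity relations.  Tensors
  of different degrees are independent of each other, so that one type contains the whole direct
  sum of the tensor powers.
\<close>

type_synonym ('k, 'a) tensor = "('a list \<Rightarrow> 'k) \<Rightarrow> 'k"

definition multilinear :: "('k::field, 'a, 'm) module_scheme \<Rightarrow> nat \<Rightarrow> ('a list \<Rightarrow> 'k) \<Rightarrow> bool"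
  where "multilinear M n \<phi> \<longleftrightarrow>
    (\<forall>xs ys x y c. set xs \<subseteq> carrier M \<and> set ys \<subseteq> carrier M \<and> x \<in> carrier M \<and> y \<in> carrier M \<and>
        length xs + 1 + length ys = n \<longrightarrow>
      \<phi> (xs @ (x \<oplus>\<^bsub>M\<^esub> y) # ys) = \<phi> (xs @ x # ys) + \<phi> (xs @ y # ys) \<and>
      \<phi> (xs @ (c \<odot>\<^bsub>M\<^esub> x) # ys) = c * \<phi> (xs @ x # ys))"

definition tens :: "('k::field, 'a, 'm) module_scheme \<Rightarrow> 'a list \<Rightarrow> ('k, 'a) tensor"
  where "tens M xs = (\<lambda>\<phi>. if multilinear M (length xs) \<phi> then \<phi> xs else 0)"

definition tpower :: "('k::field, 'a, 'm) module_scheme \<Rightarrow> nat \<Rightarrow> ('k, 'a) tensor set"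
  where "tpower M n = fs.span {tens M xs | xs. length xs = n \<and> set xs \<subseteq> carrier M}"

definition free_gen :: "'b \<Rightarrow> 'b \<Rightarrow> 'k::field"
  where "free_gen b = (\<lambda>c. of_bool (b = c))"

definition mlin_relations :: "('k::field, 'a, 'm) module_scheme \<Rightarrow> nat \<Rightarrow> ('a list \<Rightarrow> 'k) set"
  where "mlin_relations M n =
    {free_gen (xs @ (x \<oplus>\<^bsub>M\<^esub> y) # ys) - free_gen (xs @ x # ys) - free_gen (xs @ y # ys)
       | xs ys x y. set xs \<subseteq> carrier M \<and> set ys \<subseteq> carrier M \<and> x \<in> carrier M \<and> y \<in> carrier M \<and>
           length xs + 1 + length ys = n} \<union>
    {free_gen (xs @ (c \<odot>\<^bsub>M\<^esub> x) # ys) - c *\<^sub>k free_gen (xs @ x # ys)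
       | xs ys x c. set xs \<subseteq> carrier M \<and> set ys \<subseteq> carrier M \<and> x \<in> carrier M \<and>
           length xs + 1 + length ys = n}"

lemma fs_functional_separation:
  fixes v :: "'b \<Rightarrow> 'k::field"
  assumes "v \<notin> fs.span R"
  obtains g where "Vector_Spaces.linear fscale (*) g" "\<And>r. r \<in> R \<Longrightarrow> g r = 0" "g v = (1::'k)"
proof -
  interpret kk: vector_space "(*) :: 'k \<Rightarrow> 'k \<Rightarrow> 'k"
    by unfold_locales (auto simp: algebra_simps)
  interpret p: vector_space_pair "fscale :: 'k \<Rightarrow> ('b \<Rightarrow> 'k) \<Rightarrow> 'b \<Rightarrow> 'k" "(*) :: 'k \<Rightarrow> 'k \<Rightarrow> 'k" ..
  obtain A where A: "A \<subseteq> R" "fs.independent A" "R \<subseteq> fs.span A"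
    using fs.maximal_independent_subset by blast
  have "v \<notin> fs.span A"
    using assms A(1) fs.span_mono by blast
  hence "fs.independent (insert v A)"
    using A(2) by (simp add: fs.independent_insertI)
  then obtain g where g: "Vector_Spaces.linear fscale (*) g"
      "\<forall>x\<in>insert v A. g x = (if x = v then 1 else 0 :: 'k)"
    using p.linear_independent_extend[of "insert v A" "\<lambda>x. if x = v then 1 else 0"] by blast
  interpret g: Vector_Spaces.linear fscale "(*)" g by (rule g(1))
  have "v \<notin> A" using \<open>v \<notin> fs.span A\<close> fs.span_base by blast
  hence "g x = 0" if "x \<in> A" for x using g(2) that by auto
  hence "g x = 0" if "x \<in> fs.span A" for x
    using g.eq_0_on_span that by blast
  hence "\<And>r. r \<in> R \<Longrightarrow> g r = 0" using A(3) by blast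
  moreover have "g v = 1" using g(2) by simp
  ultimately show thesis by (rule that[OF g(1)])
qed

lemma tens_sum_eq_0_iff:
  fixes M :: "('k::field, 'a, 'm) module_scheme"
  assumes "finite L" and len: "\<And>xs. xs \<in> L \<Longrightarrow> length xs = n"
  shows "(\<Sum>xs\<in>L. c xs *\<^sub>k tens M xs) = 0 \<longleftrightarrow>
    (\<Sum>xs\<in>L. c xs *\<^sub>k free_gen xs) \<in> fs.span (mlin_relations M n)"
    (is "?t = 0 \<longleftrightarrow> ?v \<in> _")
proof -
  define e :: "'a list \<Rightarrow> 'a list \<Rightarrow> 'k" where "e = free_gen"
  have sum_app: "(\<Sum>x\<in>L. F x) y = (\<Sum>x\<in>L. F x y)" for F :: "'a list \<Rightarrow> 'z \<Rightarrow> 'k" and y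
    using \<open>finite L\<close> by (induction L rule: finite_induct) auto
  have t: "?t \<phi> = (\<Sum>xs\<in>L. c xs * \<phi> xs)" if "multilinear M n \<phi>" for \<phi>
    unfolding sum_app by (rule sum.cong) (use that len in \<open>auto simp: tens_def fscale_def\<close>)
  have t': "?t \<phi> = 0" if "\<not> multilinear M n \<phi>" for \<phi>
    unfolding sum_app by (rule sum.neutral) (use that len in \<open>auto simp: tens_def fscale_def\<close>)
  show ?thesis
  proof
    assume t0: "?t = 0"
    show "?v \<in> fs.span (mlin_relations M n)"
    proof (rule ccontr)
      assume "?v \<notin> fs.span (mlin_relations M n)"
      then obtain g where g: "Vector_Spaces.linear fscale (*) g"
          "\<And>r. r \<in> mlin_relations M n \<Longrightarrow> g r = 0" "g ?v = (1::'k)"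
        by (rule fs_functional_separation) blast
      interpret g: Vector_Spaces.linear fscale "(*)" g by (rule g(1))
      have "multilinear M n (\<lambda>xs. g (e xs))"
        unfolding multilinear_def
      proof (intro allI impI conjI; elim conjE)
        fix xs ys x y and c :: 'k
        assume *: "set xs \<subseteq> carrier M" "set ys \<subseteq> carrier M" "x \<in> carrier M" "y \<in> carrier M"
          "length xs + 1 + length ys = n"
        have "e (xs @ (x \<oplus>\<^bsub>M\<^esub> y) # ys) - e (xs @ x # ys) - e (xs @ y # ys) \<in> mlin_relations M n"
          unfolding mlin_relations_def e_def using * by blast
        from g(2)[OF this] show "g (e (xs @ (x \<oplus>\<^bsub>M\<^esub> y) # ys)) = g (e (xs @ x # ys)) + g (e (xs @ y # ys))"
          by (simp add: g.add g.diff algebra_simps)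
        have "e (xs @ (c \<odot>\<^bsub>M\<^esub> x) # ys) - c *\<^sub>k e (xs @ x # ys) \<in> mlin_relations M n"
          unfolding mlin_relations_def e_def using * by blast
        from g(2)[OF this] show "g (e (xs @ (c \<odot>\<^bsub>M\<^esub> x) # ys)) = c * g (e (xs @ x # ys))"
          by (simp add: g.diff g.scale)
      qed
      from t[OF this] t0 have "(\<Sum>xs\<in>L. c xs * g (e xs)) = 0" by simp
      moreover have "g ?v = (\<Sum>xs\<in>L. c xs * g (e xs))"
        by (simp add: g.sum g.scale e_def)
      ultimately show False using g(3) by simp
    qed
  next
    assume v: "?v \<in> fs.span (mlin_relations M n)"
    have "?t \<phi> = 0" for \<phi>
    proof (cases "multilinear M n \<phi>")
      case False thus ?thesis by (rule t')
    next
      case True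
      define ev :: "('a list \<Rightarrow> 'k) \<Rightarrow> 'k" where "ev = (\<lambda>f. \<Sum>xs | f xs \<noteq> 0. f xs * \<phi> xs)"
      define S where "S = {f :: 'a list \<Rightarrow> 'k. finite {x. f x \<noteq> 0} \<and> ev f = 0}"
      have ev: "ev f = (\<Sum>xs\<in>Y. f xs * \<phi> xs)" if "finite Y" "{x. f x \<noteq> 0} \<subseteq> Y" for f Y
        unfolding ev_def by (rule sum.mono_neutral_left) (use that in auto)
      have "fs.subspace S"
      proof (rule fs.subspaceI)
        show "0 \<in> S" by (simp add: S_def ev_def)
      next
        fix f g assume fg: "f \<in> S" "g \<in> S"
        define Y where "Y = {x. f x \<noteq> 0} \<union> {x. g x \<noteq> 0}"
        have Y: "finite Y" using fg by (auto simp: Y_def S_def)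
        have sub: "{x. (f + g) x \<noteq> 0} \<subseteq> Y" by (auto simp: Y_def)
        have "ev (f + g) = ev f + ev g"
          by (subst (1 2 3) ev[OF Y]) (auto simp: Y_def algebra_simps sum.distrib)
        thus "f + g \<in> S" using fg finite_subset[OF sub Y] by (simp add: S_def)
      next
        fix a and f assume f: "f \<in> S"
        define Y where "Y = {x. f x \<noteq> 0}"
        have Y: "finite Y" using f by (auto simp: Y_def S_def)
        have sub: "{x. (a *\<^sub>k f) x \<noteq> 0} \<subseteq> Y" by (auto simp: Y_def fscale_def)
        have "ev (a *\<^sub>k f) = a * ev f"
          by (subst (1 2) ev[OF Y]) (auto simp: Y_def fscale_def sum_distrib_left mult.assoc)
        thus "a *\<^sub>k f \<in> S" using f finite_subset[OF sub Y] by (simp add: S_def)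
      qed
      moreover have "mlin_relations M n \<subseteq> S"
      proof
        fix r assume "r \<in> mlin_relations M n"
        then consider
          (add) xs ys x y where "r = e (xs @ (x \<oplus>\<^bsub>M\<^esub> y) # ys) - e (xs @ x # ys) - e (xs @ y # ys)"
            "set xs \<subseteq> carrier M" "set ys \<subseteq> carrier M" "x \<in> carrier M" "y \<in> carrier M"
            "length xs + 1 + length ys = n"
        | (scale) xs ys x a where "r = e (xs @ (a \<odot>\<^bsub>M\<^esub> x) # ys) - a *\<^sub>k e (xs @ x # ys)"
            "set xs \<subseteq> carrier M" "set ys \<subseteq> carrier M" "x \<in> carrier M"
            "length xs + 1 + length ys = n"
          unfolding mlin_relations_def e_def by blast
        thus "r \<in> S"
        proof cases
          case add
          let ?Y = "{xs @ (x \<oplus>\<^bsub>M\<^esub> y) # ys, xs @ x # ys, xs @ y # ys}"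
          have sub: "{z. r z \<noteq> 0} \<subseteq> ?Y" by (auto simp: add(1) e_def free_gen_def)
          have "ev r = (\<Sum>z\<in>?Y. r z * \<phi> z)" by (rule ev) (use sub in auto)
          also have "\<dots> = (\<Sum>z\<in>?Y. e (xs @ (x \<oplus>\<^bsub>M\<^esub> y) # ys) z * \<phi> z)
              - (\<Sum>z\<in>?Y. e (xs @ x # ys) z * \<phi> z) - (\<Sum>z\<in>?Y. e (xs @ y # ys) z * \<phi> z)"
            by (simp only: add(1) sum_subtractf[symmetric]) (simp only: fun_diff_def left_diff_distrib)
          also have "\<dots> = \<phi> (xs @ (x \<oplus>\<^bsub>M\<^esub> y) # ys) - \<phi> (xs @ x # ys) - \<phi> (xs @ y # ys)"
          proof -
            have "(\<Sum>z\<in>?Y. e w z * \<phi> z) = \<phi> w" if "w \<in> ?Y" for w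
            proof -
              have "(\<Sum>z\<in>?Y. e w z * \<phi> z) = (\<Sum>z\<in>?Y. if z = w then \<phi> z else 0)"
                by (rule sum.cong) (auto simp: e_def free_gen_def)
              also have "\<dots> = \<phi> w" using that by (subst sum.delta) auto
              finally show ?thesis .
            qed
            thus ?thesis by simp
          qed
          also have "\<dots> = 0" using True add unfolding multilinear_def by simp
          finally show ?thesis using finite_subset[OF sub] by (auto simp: S_def)
        next
          case scale
          let ?Y = "{xs @ (a \<odot>\<^bsub>M\<^esub> x) # ys, xs @ x # ys}"
          have sub: "{z. r z \<noteq> 0} \<subseteq> ?Y" by (auto simp: scale(1) e_def free_gen_def fscale_def)
          have "ev r = (\<Sum>z\<in>?Y. r z * \<phi> z)" by (rule ev) (use sub in auto)
          also have "\<dots> = (\<Sum>z\<in>?Y. e (xs @ (a \<odot>\<^bsub>M\<^esub> x) # ys) z * \<phi> z)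
              - a * (\<Sum>z\<in>?Y. e (xs @ x # ys) z * \<phi> z)"
            by (simp only: scale(1) sum_subtractf[symmetric] sum_distrib_left)
              (simp only: fun_diff_def left_diff_distrib fscale_def mult.assoc)
          also have "\<dots> = \<phi> (xs @ (a \<odot>\<^bsub>M\<^esub> x) # ys) - a * \<phi> (xs @ x # ys)"
          proof -
            have "(\<Sum>z\<in>?Y. e w z * \<phi> z) = \<phi> w" if "w \<in> ?Y" for w
            proof -
              have "(\<Sum>z\<in>?Y. e w z * \<phi> z) = (\<Sum>z\<in>?Y. if z = w then \<phi> z else 0)"
                by (rule sum.cong) (auto simp: e_def free_gen_def)
              also have "\<dots> = \<phi> w" using that by (subst sum.delta) auto
              finally show ?thesis .
            qed
            thus ?thesis by simp
          qed
          also have "\<dots> = 0" using True scale unfolding multilinear_def by simp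
          finally show ?thesis using finite_subset[OF sub] by (auto simp: S_def)
        qed
      qed
      ultimately have "?v \<in> S" using v fs.span_minimal by blast
      hence "ev ?v = 0" by (simp add: S_def)
      moreover have "ev ?v = (\<Sum>xs\<in>L. c xs * \<phi> xs)"
      proof -
        have vx: "?v z = (if z \<in> L then c z else 0)" for z
        proof -
          have "?v z = (\<Sum>xs\<in>L. if xs = z then c xs else 0)"
            unfolding sum_app by (rule sum.cong) (auto simp: fscale_def free_gen_def)
          thus ?thesis using \<open>finite L\<close> by (simp add: sum.delta)
        qed
        have "ev ?v = (\<Sum>xs\<in>L. ?v xs * \<phi> xs)"
          by (rule ev[OF \<open>finite L\<close>]) (auto simp: vx)
        thus ?thesis by (simp add: vx)
      qed
      ultimately show ?thesis using t[OF True] by simp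
    qed
    thus "?t = 0" by auto
  qed
qed

text \<open>
  \<open>tbind t f\<close> is the linear extension of \<open>f\<close>: it sends \<open>\<Sum> c\<^sub>j tens xs\<^sub>j\<close> to
  \<open>\<Sum> c\<^sub>j f xs\<^sub>j\<close>, provided that \<open>f\<close> is multilinear.  Thus \<open>tbind (\<Delta> h) (\<lambda>[h\<^sub>1, h\<^sub>2]. \<dots>)\<close> is a Sweedler sum.
\<close>

definition tbind :: "('k, 'a) tensor \<Rightarrow> ('a list \<Rightarrow> ('k, 'b) tensor) \<Rightarrow> ('k, 'b) tensor"
  where "tbind t f = (\<lambda>\<phi>. t (\<lambda>xs. f xs \<phi>))"

definition tcat ::
  "('k::field, 'a, 'm) module_scheme \<Rightarrow> ('k, 'a) tensor \<Rightarrow> ('k, 'a) tensor \<Rightarrow> ('k, 'a) tensor"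
  where "tcat M s t = tbind s (\<lambda>xs. tbind t (\<lambda>ys. tens M (xs @ ys)))"


section \<open>Hopf algebras\<close>

record ('k, 'a) hopf = "('k, 'a) module" +
  comult :: "'a \<Rightarrow> ('k, 'a) tensor"
  counit :: "'a \<Rightarrow> 'k"
  antipode :: "'a \<Rightarrow> 'a"

definition tsquare_mult ::
  "('k::field, 'a) hopf \<Rightarrow> ('k, 'a) tensor \<Rightarrow> ('k, 'a) tensor \<Rightarrow> ('k, 'a) tensor"
  where "tsquare_mult H s t =
    tbind s (\<lambda>xs. tbind t (\<lambda>ys. tens H [xs ! 0 \<otimes>\<^bsub>H\<^esub> ys ! 0, xs ! 1 \<otimes>\<^bsub>H\<^esub> ys ! 1]))"

text \<open>
  In the counit and antipode axioms \<open>H\<close> is identified with its first tensor power,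
  \<open>x\<close> being \<open>tens H [x]\<close>.
\<close>

locale hopf_algebra =
  ring H + module "ring_of_type_algebra :: 'k ring" H
  for H :: "('k::field, 'a) hopf" (structure) +
  assumes mult_smult_left: "\<lbrakk>x \<in> carrier H; y \<in> carrier H\<rbrakk> \<Longrightarrow> (c \<odot> x) \<otimes> y = c \<odot> (x \<otimes> y)"
    and mult_smult_right: "\<lbrakk>x \<in> carrier H; y \<in> carrier H\<rbrakk> \<Longrightarrow> x \<otimes> (c \<odot> y) = c \<odot> (x \<otimes> y)"
    and comult_closed: "x \<in> carrier H \<Longrightarrow> comult H x \<in> tpower H 2"
    and comult_add: "\<lbrakk>x \<in> carrier H; y \<in> carrier H\<rbrakk> \<Longrightarrow> comult H (x \<oplus> y) = comult H x + comult H y"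
    and comult_smult: "x \<in> carrier H \<Longrightarrow> comult H (c \<odot> x) = c *\<^sub>k comult H x"
    and comult_one: "comult H \<one> = tens H [\<one>, \<one>]"
    and comult_mult: "\<lbrakk>x \<in> carrier H; y \<in> carrier H\<rbrakk> \<Longrightarrow>
          comult H (x \<otimes> y) = tsquare_mult H (comult H x) (comult H y)"
    and counit_add: "\<lbrakk>x \<in> carrier H; y \<in> carrier H\<rbrakk> \<Longrightarrow> counit H (x \<oplus> y) = counit H x + counit H y"
    and counit_smult: "x \<in> carrier H \<Longrightarrow> counit H (c \<odot> x) = c * counit H x"
    and counit_one: "counit H \<one> = 1"
    and counit_mult: "\<lbrakk>x \<in> carrier H; y \<in> carrier H\<rbrakk> \<Longrightarrow> counit H (x \<otimes> y) = counit H x * counit H y"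
    and coassoc: "x \<in> carrier H \<Longrightarrow>
          tbind (comult H x) (\<lambda>h. tcat H (comult H (h ! 0)) (tens H [h ! 1])) =
          tbind (comult H x) (\<lambda>h. tcat H (tens H [h ! 0]) (comult H (h ! 1)))"
    and counit_left: "x \<in> carrier H \<Longrightarrow>
          tbind (comult H x) (\<lambda>h. counit H (h ! 0) *\<^sub>k tens H [h ! 1]) = tens H [x]"
    and counit_right: "x \<in> carrier H \<Longrightarrow>
          tbind (comult H x) (\<lambda>h. counit H (h ! 1) *\<^sub>k tens H [h ! 0]) = tens H [x]"
    and antipode_closed: "x \<in> carrier H \<Longrightarrow> antipode H x \<in> carrier H"
    and antipode_add: "\<lbrakk>x \<in> carrier H; y \<in> carrier H\<rbrakk> \<Longrightarrow>
          antipode H (x \<oplus> y) = antipode H x \<oplus> antipode H y"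
    and antipode_smult: "x \<in> carrier H \<Longrightarrow> antipode H (c \<odot> x) = c \<odot> antipode H x"
    and antipode_left: "x \<in> carrier H \<Longrightarrow>
          tbind (comult H x) (\<lambda>h. tens H [antipode H (h ! 0) \<otimes> h ! 1]) = tens H [counit H x \<odot> \<one>]"
    and antipode_right: "x \<in> carrier H \<Longrightarrow>
          tbind (comult H x) (\<lambda>h. tens H [h ! 0 \<otimes> antipode H (h ! 1)]) = tens H [counit H x \<odot> \<one>]"

locale involutive_hopf_algebra = hopf_algebra +
  assumes antipode_involutive: "x \<in> carrier H \<Longrightarrow> antipode H (antipode H x) = x"

definition tmap :: "('k::field, 'b) hopf \<Rightarrow> ('a \<Rightarrow> 'b) \<Rightarrow> ('k, 'a) tensor \<Rightarrow> ('k, 'b) tensor"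
  where "tmap H' f t = tbind t (\<lambda>xs. tens H' (map f xs))"

definition hopf_hom :: "('k::field, 'a) hopf \<Rightarrow> ('k, 'b) hopf \<Rightarrow> ('a \<Rightarrow> 'b) set"
  where "hopf_hom H H' = {f \<in> ring_hom H H'.
    (\<forall>c. \<forall>x\<in>carrier H. f (c \<odot>\<^bsub>H\<^esub> x) = c \<odot>\<^bsub>H'\<^esub> f x) \<and>
    (\<forall>x\<in>carrier H. comult H' (f x) = tmap H' f (comult H x)) \<and>
    (\<forall>x\<in>carrier H. counit H' (f x) = counit H x) \<and>
    (\<forall>x\<in>carrier H. antipode H' (f x) = f (antipode H x))}"


section \<open>The universal differential graded algebra\<close>

text \<open>
  The algebra \<open>\<Omega>(H)\<close> lives inside the tensor algebra over \<open>H\<close> of the bimodule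
  \<open>H \<otimes> H\<close>, whose part of degree \<open>n\<close> is \<open>(H \<otimes> H) \<otimes>\<^sub>H \<dots> \<otimes>\<^sub>H (H \<otimes> H) = H\<^sup>\<otimes>\<^sup>(\<^sup>n\<^sup>+\<^sup>1\<^sup>)\<close>, with
  product \<open>(x\<^sub>0 \<otimes> \<dots> \<otimes> x\<^sub>m) \<cdot> (y\<^sub>0 \<otimes> \<dots> \<otimes> y\<^sub>n) = x\<^sub>0 \<otimes> \<dots> \<otimes> x\<^sub>m y\<^sub>0 \<otimes> \<dots> \<otimes> y\<^sub>n\<close>.
  In it the balanced tensor power of \<open>\<Omega>\<^sub>1\<close>, the kernel of the multiplication, is the span of
  the products of \<open>n\<close> elements of \<open>\<Omega>\<^sub>1\<close>.
\<close>

definition odot :: "('k::field, 'a) hopf \<Rightarrow> ('k, 'a) tensor \<Rightarrow> ('k, 'a) tensor \<Rightarrow> ('k, 'a) tensor"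
  where "odot H s t = tbind s (\<lambda>xs. tbind t (\<lambda>ys.
    tens H (butlast xs @ (last xs \<otimes>\<^bsub>H\<^esub> hd ys) # tl ys)))"

definition Omega1 :: "('k::field, 'a) hopf \<Rightarrow> ('k, 'a) tensor set"
  where "Omega1 H = {t \<in> tpower H 2. tbind t (\<lambda>xs. tens H [xs ! 0 \<otimes>\<^bsub>H\<^esub> xs ! 1]) = 0}"

primrec Omega_deg :: "('k::field, 'a) hopf \<Rightarrow> nat \<Rightarrow> ('k, 'a) tensor set" where
  "Omega_deg H 0 = tpower H 1"
| "Omega_deg H (Suc n) = fs.span {odot H \<omega> \<eta> | \<omega> \<eta>. \<omega> \<in> Omega1 H \<and> \<eta> \<in> Omega_deg H n}"

definition Omega :: "('k::field, 'a) hopf \<Rightarrow> ('k, 'a) tensor set"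
  where "Omega H = fs.span (\<Union>n. Omega_deg H n)"

definition diff1 :: "('k::field, 'a) hopf \<Rightarrow> 'a \<Rightarrow> ('k, 'a) tensor"
  where "diff1 H a = tens H [\<one>\<^bsub>H\<^esub>, a] - tens H [a, \<one>\<^bsub>H\<^esub>]"

text \<open>\<open>form H [a\<^sub>0, \<dots>, a\<^sub>n]\<close> is \<open>a\<^sub>0 da\<^sub>1 \<dots> da\<^sub>n\<close>.\<close>

definition form :: "('k::field, 'a) hopf \<Rightarrow> 'a list \<Rightarrow> ('k, 'a) tensor"
  where "form H as = foldl (\<lambda>\<omega> a. odot H \<omega> (diff1 H a)) (tens H [hd as]) (tl as)"

definition dO :: "('k::field, 'a) hopf \<Rightarrow> ('k, 'a) tensor \<Rightarrow> ('k, 'a) tensor"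
  where "dO H = the_linear_map (Omega H)
    (\<lambda>D. \<forall>as. as \<noteq> [] \<and> set as \<subseteq> carrier H \<longrightarrow> D (form H as) = form H (\<one>\<^bsub>H\<^esub> # as))"

definition bO :: "('k::field, 'a) hopf \<Rightarrow> ('k, 'a) tensor \<Rightarrow> ('k, 'a) tensor"
  where "bO H = the_linear_map (Omega H) (\<lambda>D. (\<forall>\<omega>\<in>Omega_deg H 0. D \<omega> = 0) \<and>
    (\<forall>n. \<forall>\<omega>\<in>Omega_deg H n. \<forall>a\<in>carrier H.
      D (odot H \<omega> (diff1 H a)) = (-1) ^ n *\<^sub>k (odot H \<omega> (tens H [a]) - odot H (tens H [a]) \<omega>)))"

definition bO' :: "('k::field, 'a) hopf \<Rightarrow> ('k, 'a) tensor \<Rightarrow> ('k, 'a) tensor"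
  where "bO' H = the_linear_map (Omega H) (\<lambda>D. (\<forall>\<omega>\<in>Omega_deg H 0. D \<omega> = 0) \<and>
    (\<forall>n. \<forall>\<omega>\<in>Omega_deg H n. \<forall>a\<in>carrier H.
      D (odot H (diff1 H a) \<omega>) = odot H (tens H [a]) \<omega> - odot H \<omega> (tens H [a])))"

definition karoubi :: "('k::field, 'a) hopf \<Rightarrow> ('k, 'a) tensor \<Rightarrow> ('k, 'a) tensor"
  where "karoubi H \<omega> = \<omega> - bO H (dO H \<omega>) - dO H (bO H \<omega>)"

definition karoubi' :: "('k::field, 'a) hopf \<Rightarrow> ('k, 'a) tensor \<Rightarrow> ('k, 'a) tensor"
  where "karoubi' H \<omega> = \<omega> - bO' H (dO H \<omega>) - dO H (bO' H \<omega>)"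

text \<open>\<open>BO H n\<close> and \<open>BO' H n\<close> are the components of \<open>B\<close> and \<open>B'\<close> on forms of degree \<open>n\<close>.\<close>

definition BO :: "('k::field, 'a) hopf \<Rightarrow> nat \<Rightarrow> ('k, 'a) tensor \<Rightarrow> ('k, 'a) tensor"
  where "BO H n \<omega> = (\<Sum>j\<le>n. (karoubi H ^^ j) (dO H \<omega>))"

definition BO' :: "('k::field, 'a) hopf \<Rightarrow> nat \<Rightarrow> ('k, 'a) tensor \<Rightarrow> ('k, 'a) tensor"
  where "BO' H n \<omega> = (\<Sum>j\<le>n. (karoubi' H ^^ j) (dO H \<omega>))"


section \<open>Coactions and coinvariant forms\<close>

text \<open>
  \<open>sweedler H [a\<^sub>0, \<dots>, a\<^sub>n] g\<close> is the sum of
  \<open>g [a\<^sub>0\<^sub>,\<^sub>(\<^sub>1\<^sub>), \<dots>, a\<^sub>n\<^sub>,\<^sub>(\<^sub>1\<^sub>)] [a\<^sub>0\<^sub>,\<^sub>(\<^sub>2\<^sub>), \<dots>, a\<^sub>n\<^sub>,\<^sub>(\<^sub>2\<^sub>)]\<close>.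
\<close>

fun sweedler ::
  "('k::field, 'a) hopf \<Rightarrow> 'a list \<Rightarrow> ('a list \<Rightarrow> 'a list \<Rightarrow> ('k, 'a) tensor) \<Rightarrow> ('k, 'a) tensor"
  where
  "sweedler H [] g = g [] []"
| "sweedler H (a # as) g =
    tbind (comult H a) (\<lambda>h. sweedler H as (\<lambda>us vs. g (h ! 0 # us) (h ! 1 # vs)))"

definition lprod :: "('k, 'a) hopf \<Rightarrow> 'a list \<Rightarrow> 'a"
  where "lprod H xs = foldr (\<lambda>x y. x \<otimes>\<^bsub>H\<^esub> y) xs \<one>\<^bsub>H\<^esub>"

text \<open>
  As \<open>\<Omega>\<^sub>n\<close> is a subspace of \<open>H\<^sup>\<otimes>\<^sup>(\<^sup>n\<^sup>+\<^sup>1\<^sup>)\<close>, both \<open>\<Omega>\<^sub>n \<otimes> H\<close> and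
  \<open>H \<otimes> \<Omega>\<^sub>n\<close> are subspaces of \<open>H\<^sup>\<otimes>\<^sup>(\<^sup>n\<^sup>+\<^sup>2\<^sup>)\<close>.
\<close>

definition coactR :: "('k::field, 'a) hopf \<Rightarrow> ('k, 'a) tensor \<Rightarrow> ('k, 'a) tensor"
  where "coactR H = the_linear_map (Omega H) (\<lambda>D. \<forall>as. as \<noteq> [] \<and> set as \<subseteq> carrier H \<longrightarrow>
    D (form H as) = sweedler H as (\<lambda>us vs. tcat H (form H us) (tens H [lprod H vs])))"

definition coactL :: "('k::field, 'a) hopf \<Rightarrow> ('k, 'a) tensor \<Rightarrow> ('k, 'a) tensor"
  where "coactL H = the_linear_map (Omega H) (\<lambda>D. \<forall>as. as \<noteq> [] \<and> set as \<subseteq> carrier H \<longrightarrow>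
    D (form H as) = sweedler H as (\<lambda>us vs. tcat H (tens H [lprod H us]) (form H vs)))"

definition OmegaR :: "('k::field, 'a) hopf \<Rightarrow> ('k, 'a) tensor set"
  where "OmegaR H = {\<theta> \<in> Omega H. coactR H \<theta> = tcat H \<theta> (tens H [\<one>\<^bsub>H\<^esub>])}"

definition OmegaL :: "('k::field, 'a) hopf \<Rightarrow> ('k, 'a) tensor set"
  where "OmegaL H = {\<theta> \<in> Omega H. coactL H \<theta> = tcat H (tens H [\<one>\<^bsub>H\<^esub>]) \<theta>}"

definition dg_subalgebra :: "('k::field, 'a) hopf \<Rightarrow> ('k, 'a) tensor set \<Rightarrow> bool"
  where "dg_subalgebra H A \<longleftrightarrow>
    fs.subspace A \<and> A \<subseteq> Omega H \<and> A = fs.span (\<Union>n. A \<inter> Omega_deg H n) \<and>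
    tens H [\<one>\<^bsub>H\<^esub>] \<in> A \<and> (\<forall>\<omega>\<in>A. \<forall>\<eta>\<in>A. odot H \<omega> \<eta> \<in> A) \<and> (\<forall>\<omega>\<in>A. dO H \<omega> \<in> A)"


section \<open>Mixed complexes and their periodic cohomology\<close>

text \<open>
  The lowering differential \<open>l n\<close> goes from degree \<open>n + 1\<close> to degree \<open>n\<close>, the raising
  differential \<open>u n\<close> from degree \<open>n\<close> to degree \<open>n + 1\<close>.
\<close>

definition mixed_complex ::
  "(nat \<Rightarrow> ('b \<Rightarrow> 'k::field) set) \<Rightarrow> (nat \<Rightarrow> ('b \<Rightarrow> 'k) \<Rightarrow> ('b \<Rightarrow> 'k)) \<Rightarrow>
   (nat \<Rightarrow> ('b \<Rightarrow> 'k) \<Rightarrow> ('b \<Rightarrow> 'k)) \<Rightarrow> bool"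
  where "mixed_complex C l u \<longleftrightarrow> (\<forall>n.
    fs.subspace (C n) \<and>
    linear_on (C (Suc n)) (l n) \<and> l n ` C (Suc n) \<subseteq> C n \<and>
    linear_on (C n) (u n) \<and> u n ` C n \<subseteq> C (Suc n) \<and>
    (\<forall>x\<in>C (Suc (Suc n)). l n (l (Suc n) x) = 0) \<and>
    (\<forall>x\<in>C n. u (Suc n) (u n x) = 0) \<and>
    (\<forall>x\<in>C (Suc n). l (Suc n) (u (Suc n) x) + u n (l n x) = 0)) \<and>
    (\<forall>x\<in>C 0. l 0 (u 0 x) = 0)"

definition mixed_subcomplex ::
  "(nat \<Rightarrow> ('b \<Rightarrow> 'k::field) set) \<Rightarrow> (nat \<Rightarrow> ('b \<Rightarrow> 'k) set) \<Rightarrow>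
   (nat \<Rightarrow> ('b \<Rightarrow> 'k) \<Rightarrow> ('b \<Rightarrow> 'k)) \<Rightarrow> (nat \<Rightarrow> ('b \<Rightarrow> 'k) \<Rightarrow> ('b \<Rightarrow> 'k)) \<Rightarrow> bool"
  where "mixed_subcomplex C' C l u \<longleftrightarrow> mixed_complex C l u \<and>
    (\<forall>n. fs.subspace (C' n) \<and> C' n \<subseteq> C n \<and> l n ` C' (Suc n) \<subseteq> C' n \<and> u n ` C' n \<subseteq> C' (Suc n))"

text \<open>
  Cochains are families \<open>x\<close> with \<open>x n\<close> of degree \<open>n\<close>.  A super-complex is a
  pair of the cochain spaces of parity \<open>i \<in> {0, 1}\<close> and the differential.  In \<open>cp_prod\<close>
  the cochain spaces are direct products, in \<open>cp_sum\<close> direct sums.  The difference matters: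
  in characteristic 0 the direct product super-complex of a cocyclic module is acyclic unless the
  module is first normalized, already for the cocyclic module of the Hopf algebra \<open>k\<close>.
\<close>

type_synonym ('b, 'k) cochain = "nat \<Rightarrow> 'b \<Rightarrow> 'k"
type_synonym ('b, 'k) supercomplex =
  "(nat \<Rightarrow> ('b, 'k) cochain set) \<times> (('b, 'k) cochain \<Rightarrow> ('b, 'k) cochain)"

definition parity_prod :: "(nat \<Rightarrow> ('b \<Rightarrow> 'k::field) set) \<Rightarrow> nat \<Rightarrow> ('b, 'k) cochain set"
  where "parity_prod C i = {x. \<forall>n. x n \<in> C n \<and> (n mod 2 \<noteq> i \<longrightarrow> x n = 0)}"

definition parity_sum :: "(nat \<Rightarrow> ('b \<Rightarrow> 'k::field) set) \<Rightarrow> nat \<Rightarrow> ('b, 'k) cochain set"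
  where "parity_sum C i = {x \<in> parity_prod C i. finite {n. x n \<noteq> 0}}"

definition total_diff ::
  "(nat \<Rightarrow> ('b \<Rightarrow> 'k) \<Rightarrow> ('b \<Rightarrow> 'k)) \<Rightarrow> (nat \<Rightarrow> ('b \<Rightarrow> 'k::field) \<Rightarrow> ('b \<Rightarrow> 'k)) \<Rightarrow>
   ('b, 'k) cochain \<Rightarrow> ('b, 'k) cochain"
  where "total_diff l u x = (\<lambda>n. l n (x (Suc n)) + (case n of 0 \<Rightarrow> 0 | Suc m \<Rightarrow> u m (x m)))"

definition cp_prod ::
  "(nat \<Rightarrow> ('b \<Rightarrow> 'k::field) set) \<Rightarrow> (nat \<Rightarrow> ('b \<Rightarrow> 'k) \<Rightarrow> ('b \<Rightarrow> 'k)) \<Rightarrow>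
   (nat \<Rightarrow> ('b \<Rightarrow> 'k) \<Rightarrow> ('b \<Rightarrow> 'k)) \<Rightarrow> ('b, 'k) supercomplex"
  where "cp_prod C l u = (parity_prod C, total_diff l u)"

definition cp_sum ::
  "(nat \<Rightarrow> ('b \<Rightarrow> 'k::field) set) \<Rightarrow> (nat \<Rightarrow> ('b \<Rightarrow> 'k) \<Rightarrow> ('b \<Rightarrow> 'k)) \<Rightarrow>
   (nat \<Rightarrow> ('b \<Rightarrow> 'k) \<Rightarrow> ('b \<Rightarrow> 'k)) \<Rightarrow> ('b, 'k) supercomplex"
  where "cp_sum C l u = (parity_sum C, total_diff l u)"

definition cocycles :: "('b, 'k::field) supercomplex \<Rightarrow> nat \<Rightarrow> ('b, 'k) cochain set"
  where "cocycles K i = {x \<in> fst K i. snd K x = 0}"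

definition coboundaries :: "('b, 'k::field) supercomplex \<Rightarrow> nat \<Rightarrow> ('b, 'k) cochain set"
  where "coboundaries K i = snd K ` fst K (1 - i)"

definition cohomology :: "('b, 'k::field) supercomplex \<Rightarrow> nat \<Rightarrow> ('b, 'k) cochain set set"
  where "cohomology K i = {x +o coboundaries K i | x. x \<in> cocycles K i}"

text \<open>
  Cohomology classes are cosets; their sum is the sum of sets.  \<open>class_image U F Z\<close>
  is the coset of \<open>U\<close> that contains the image of the class \<open>Z\<close> under \<open>F\<close>.
\<close>

definition class_image :: "'c::plus set \<Rightarrow> ('b \<Rightarrow> 'c) \<Rightarrow> 'b set \<Rightarrow> 'c set"
  where "class_image U F Z = F ` Z + U"

definition class_scale ::
  "('b, 'k::field) supercomplex \<Rightarrow> nat \<Rightarrow> 'k \<Rightarrow> ('b, 'k) cochain set \<Rightarrow> ('b, 'k) cochain set"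
  where "class_scale K i c = class_image (coboundaries K i) (\<lambda>x n. c *\<^sub>k x n)"

definition cohomology_iso ::
  "('b, 'k::field) supercomplex \<Rightarrow> ('c, 'k) supercomplex \<Rightarrow> nat \<Rightarrow>
   (('b, 'k) cochain set \<Rightarrow> ('c, 'k) cochain set) \<Rightarrow> bool"
  where "cohomology_iso K L i \<Phi> \<longleftrightarrow>
    bij_betw \<Phi> (cohomology K i) (cohomology L i) \<and>
    (\<forall>Z\<in>cohomology K i. \<forall>W\<in>cohomology K i. \<Phi> (Z + W) = \<Phi> Z + \<Phi> W) \<and>
    (\<forall>c. \<forall>Z\<in>cohomology K i. \<Phi> (class_scale K i c Z) = class_scale L i c (\<Phi> Z))"

text \<open>
  A natural isomorphism between the cohomologies of two super-complexes that are made
  functorially, by applying maps factorwise to tensors, from Hopf algebras with involutive antipode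
  whose elements are taken from \<open>'a\<close>.
\<close>

definition naturally_isomorphic_cohomology ::
  "(('k::field, 'a) hopf \<Rightarrow> ('a list \<Rightarrow> 'k, 'k) supercomplex) \<Rightarrow>
   (('k, 'a) hopf \<Rightarrow> ('a list \<Rightarrow> 'k, 'k) supercomplex) \<Rightarrow> bool"
  where "naturally_isomorphic_cohomology K L \<longleftrightarrow> (\<exists>\<Phi>.
    (\<forall>H. involutive_hopf_algebra H \<longrightarrow> (\<forall>i\<in>{0, 1}. cohomology_iso (K H) (L H) i (\<Phi> H i))) \<and>
    (\<forall>H H' f. involutive_hopf_algebra H \<and> involutive_hopf_algebra H' \<and> f \<in> hopf_hom H H' \<longrightarrow>
      (\<forall>i\<in>{0, 1}. \<forall>Z\<in>cohomology (K H) i.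
        \<Phi> H' i (class_image (coboundaries (K H') i) (\<lambda>x n. tmap H' f (x n)) Z) =
        class_image (coboundaries (L H') i) (\<lambda>x n. tmap H' f (x n)) (\<Phi> H i Z))))"


section \<open>The cocyclic module of a Hopf algebra\<close>

text \<open>The diagonal action \<open>h \<cdot> (h\<^sub>1, \<dots>, h\<^sub>n)\<close>; on the empty tuple it is the counit.\<close>

fun diag_act :: "('k::field, 'a) hopf \<Rightarrow> 'a \<Rightarrow> 'a list \<Rightarrow> ('k, 'a) tensor" where
  "diag_act H h [] = counit H h *\<^sub>k tens H []"
| "diag_act H h (x # xs) =
    tbind (comult H h) (\<lambda>y. tcat H (tens H [y ! 0 \<otimes>\<^bsub>H\<^esub> x]) (diag_act H (y ! 1) xs))"

definition coface :: "('k::field, 'a) hopf \<Rightarrow> nat \<Rightarrow> nat \<Rightarrow> ('k, 'a) tensor \<Rightarrow> ('k, 'a) tensor"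
  where "coface H n i t = tbind t (\<lambda>hs.
    if i = 0 then tens H (\<one>\<^bsub>H\<^esub> # hs)
    else if i \<le> n then
      tcat H (tens H (take (i - 1) hs)) (tcat H (comult H (hs ! (i - 1))) (tens H (drop i hs)))
    else tens H (hs @ [\<one>\<^bsub>H\<^esub>]))"

definition codegen :: "('k::field, 'a) hopf \<Rightarrow> nat \<Rightarrow> ('k, 'a) tensor \<Rightarrow> ('k, 'a) tensor"
  where "codegen H i t = tbind t (\<lambda>hs.
    counit H (hs ! (i - 1)) *\<^sub>k tens H (take (i - 1) hs @ drop i hs))"

definition cocyc :: "('k::field, 'a) hopf \<Rightarrow> ('k, 'a) tensor \<Rightarrow> ('k, 'a) tensor"
  where "cocyc H t = tbind t (\<lambda>hs.
    case hs of [] \<Rightarrow> tens H [] | h # hs' \<Rightarrow> diag_act H (antipode H h) (hs' @ [\<one>\<^bsub>H\<^esub>]))"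

definition extra_codegen :: "('k::field, 'a) hopf \<Rightarrow> nat \<Rightarrow> ('k, 'a) tensor \<Rightarrow> ('k, 'a) tensor"
  where "extra_codegen H n t = codegen H (n + 1) (cocyc H t)"

definition cocyc_norm :: "('k::field, 'a) hopf \<Rightarrow> nat \<Rightarrow> ('k, 'a) tensor \<Rightarrow> ('k, 'a) tensor"
  where "cocyc_norm H n t = (\<Sum>i\<le>n. (-1) ^ (i * n) *\<^sub>k (cocyc H ^^ i) t)"

definition hopf_up :: "('k::field, 'a) hopf \<Rightarrow> nat \<Rightarrow> ('k, 'a) tensor \<Rightarrow> ('k, 'a) tensor"
  where "hopf_up H n t = (\<Sum>i\<le>n + 1. (-1) ^ i *\<^sub>k coface H n i t)"

definition hopf_down :: "('k::field, 'a) hopf \<Rightarrow> nat \<Rightarrow> ('k, 'a) tensor \<Rightarrow> ('k, 'a) tensor"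
  where "hopf_down H n t =
    cocyc_norm H n (extra_codegen H n (t - (-1) ^ (n + 1) *\<^sub>k cocyc H t))"

definition hopf_normalized :: "('k::field, 'a) hopf \<Rightarrow> nat \<Rightarrow> ('k, 'a) tensor set"
  where "hopf_normalized H n = {t \<in> tpower H n. \<forall>i\<in>{1..n}. codegen H i t = 0}"

end

theory Submission imports Defs begin

text \<open>
  The forms of degree \<open>n\<close> are the tensors in \<open>H\<^sup>\<otimes>\<^sup>(\<^sup>n\<^sup>+\<^sup>1\<^sup>)\<close> that vanish when any two neighbouring factors are
  multiplied; \<open>d\<close> inserts \<open>1\<close> at every position with alternating signs, and \<open>b'\<close> multiplies the last
  factor by the first one.  The map
  \<open>(h\<^sub>1, \<dots>, h\<^sub>n) \<mapsto> \<Sum> h\<^sub>1\<^sub>,\<^sub>(\<^sub>1\<^sub>) \<otimes> S(h\<^sub>1\<^sub>,\<^sub>(\<^sub>2\<^sub>)) h\<^sub>2\<^sub>,\<^sub>(\<^sub>1\<^sub>) \<otimes> \<dots> \<otimes> S(h\<^sub>n\<^sub>,\<^sub>(\<^sub>2\<^sub>))\<close>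
  identifies \<open>H\<^sup>\<otimes>\<^sup>n\<close> with the right coinvariants of \<open>H\<^sup>\<otimes>\<^sup>(\<^sup>n\<^sup>+\<^sup>1\<^sup>)\<close>; here \<open>S\<^sup>2 = 1\<close> makes the cyclic operator
  correspond to the cyclic permutation of the factors.  So coinvariant forms correspond to normalized
  Hopf cochains, the Hopf differentials becoming \<open>d\<close> and \<open>N b'\<close> where \<open>N = \<Sum> \<kappa>'\<^sup>j\<close>, while the mixed complex
  of forms has \<open>b'\<close> and \<open>N d\<close>.  As \<open>(\<kappa>'\<^sup>n - 1)(\<kappa>'\<^sup>n\<^sup>+\<^sup>1 - 1) = 0\<close> on forms of degree \<open>n\<close>, the projection onto the
  generalized eigenspace of \<open>\<kappa>'\<close> for \<open>1\<close> is homotopic to the identity, and there \<open>N\<close> is multiplication by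
  \<open>n + 1\<close>, so that multiplication by \<open>1 / n!\<close> exchanges the two pairs of differentials.  For direct sums
  the normalized cochains have the same cohomology as all cochains.  Finally the antiautomorphism of the
  tensor algebra induced by \<open>S\<close> exchanges left with right coinvariants and \<open>b\<close> with \<open>b'\<close>.
\<close>

section \<open>Linear operators\<close>

text \<open>Apart from the grading, stability of the right coinvariants is never checked by
  computing a coaction of a value or of a product: they are exactly the image of the comparison map,
  and every operator in question is intertwined by that map with an operator on
  \<open>H\<close>-tensors, so its values lie in the image again. The homotopy behind the eigenspace
  projection comes from \<open>b' d + d b' = 1 - \<kappa>'\<close>. On the image of
  \<open>b'\<close> and on the image of \<open>d\<close> the operator \<open>\<kappa>'\<close> has
  finite order, so in characteristic 0 averaging splits off the fixed vectors, and on the rest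
  \<open>1 - \<kappa>'\<close> is inverted by an explicit polynomial in \<open>\<kappa>'\<close>.
  The obstacle on the formal side is that the operators of the calculus are known only on forms, and
  products only on carriers. Hence every operator is first defined on all functionals, where
  linearity (\<open>linop\<close>) has no side conditions and an identity needs to be checked on
  pure tensors only; identities in the algebra are stated after an arbitrary linear map into
  tensors.\<close>

definition linop :: "(('b \<Rightarrow> 'k::field) \<Rightarrow> ('c \<Rightarrow> 'k)) \<Rightarrow> bool"
  where "linop f \<longleftrightarrow> (\<forall>x y. f (x + y) = f x + f y) \<and> (\<forall>c x. f (c *\<^sub>k x) = c *\<^sub>k f x)"

named_theorems linop_intros

lemma linop_add: "linop f \<Longrightarrow> f (x + y) = f x + f y"
  and linop_scale: "linop f \<Longrightarrow> f (c *\<^sub>k x) = c *\<^sub>k f x"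
  by (auto simp: linop_def)

lemma linop_zero: "linop f \<Longrightarrow> f 0 = 0"
  using linop_scale[of f 0 0] by simp

lemma linop_minus: "linop f \<Longrightarrow> f (- x) = - f x"
  using linop_scale[of f "-1" x] by simp

lemma linop_diff: "linop f \<Longrightarrow> f (x - y) = f x - f y"
  using linop_add[of f x "- y"] linop_minus[of f y] by simp

lemma linop_sum: "linop f \<Longrightarrow> f (\<Sum>i\<in>A. g i) = (\<Sum>i\<in>A. f (g i))"
  by (induction A rule: infinite_finite_induct) (auto simp: linop_zero linop_add)

lemma linop_sum_list: "linop f \<Longrightarrow> f (\<Sum>i\<leftarrow>L. g i) = (\<Sum>i\<leftarrow>L. f (g i))"
  by (induction L) (auto simp: linop_zero linop_add)

lemmas linop_simps = linop_add linop_scale linop_zero linop_minus linop_diff linop_sum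

lemma linop_eq_on_span:
  assumes "linop f" "linop g" "\<And>x. x \<in> S \<Longrightarrow> f x = g x" "x \<in> fs.span S"
  shows "f x = g x"
  by (rule fs.span_induct_alt[where h = "\<lambda>x. f x = g x", OF assms(4)])
    (simp_all add: linop_simps[OF assms(1)] linop_simps[OF assms(2)] assms(3))

lemma linop_span_into:
  assumes "linop f" "fs.subspace W" "\<And>x. x \<in> S \<Longrightarrow> f x \<in> W" "x \<in> fs.span S"
  shows "f x \<in> W"
  by (rule fs.span_induct_alt[where h = "\<lambda>x. f x \<in> W", OF assms(4)])
    (simp_all add: linop_simps[OF assms(1)] assms fs.subspace_0 fs.subspace_add fs.subspace_scale)

lemma linop_tbind [linop_intros]: "linop F \<Longrightarrow> linop (\<lambda>t. tbind (F t) f)"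
  by (auto simp: linop_def tbind_def fscale_def)

lemma linop_id [linop_intros]: "linop (\<lambda>t. t)"
  by (auto simp: linop_def)

lemma linop_const0 [linop_intros]: "linop (\<lambda>t. 0)"
  by (auto simp: linop_def)

lemma linop_plus [linop_intros]: "linop F \<Longrightarrow> linop G \<Longrightarrow> linop (\<lambda>t. F t + G t)"
  by (auto simp: linop_def algebra_simps fs.scale_right_distrib)

lemma linop_sub [linop_intros]: "linop F \<Longrightarrow> linop G \<Longrightarrow> linop (\<lambda>t. F t - G t)"
  by (auto simp: linop_def algebra_simps fs.scale_right_diff_distrib)

lemma linop_uminus [linop_intros]: "linop F \<Longrightarrow> linop (\<lambda>t. - F t)"
  by (auto simp: linop_def)

lemma linop_fscale [linop_intros]: "linop F \<Longrightarrow> linop (\<lambda>t. c *\<^sub>k F t)"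
  by (auto simp: linop_def algebra_simps fs.scale_right_distrib)

lemma linop_sumI [linop_intros]: "(\<And>i. linop (F i)) \<Longrightarrow> linop (\<lambda>t. \<Sum>i\<in>A. F i t)"
  by (induction A rule: infinite_finite_induct) (auto intro: linop_intros)

lemma linop_sum_listI: "(\<And>i. linop (F i)) \<Longrightarrow> linop (\<lambda>t. \<Sum>i\<leftarrow>L. F i t)"
  by (induction L) (auto intro: linop_intros)

lemma linop_compose: "linop F \<Longrightarrow> linop G \<Longrightarrow> linop (\<lambda>t. F (G t))"
  by (auto simp: linop_def)

lemma linop_funpow [linop_intros]:
  fixes f :: "('b \<Rightarrow> 'k::field) \<Rightarrow> ('b \<Rightarrow> 'k)"
  shows "linop f \<Longrightarrow> linop G \<Longrightarrow> linop (\<lambda>t. (f ^^ n) (G t))"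
  by (induction n) (auto simp: linop_def)

lemma linop_linear_on: "linop f \<Longrightarrow> linear_on V f"
  by (auto simp: linop_def linear_on_def)

lemma linear_on_span_eq:
  assumes f: "linear_on (fs.span S) f" and g: "linear_on (fs.span S) g"
    and eq: "\<And>x. x \<in> S \<Longrightarrow> f x = g x" and x: "x \<in> fs.span S"
  shows "f x = g x"
proof -
  \<comment> \<open>Membership is carried through the induction, because \<open>linear_on\<close>
    gives additivity only inside the span.\<close>
  have "f x = g x \<and> x \<in> fs.span S"
  proof (rule fs.span_induct_alt[where h = "\<lambda>x. f x = g x \<and> x \<in> fs.span S", OF x])
    have "f (0 *\<^sub>k 0) = 0 *\<^sub>k f 0" "g (0 *\<^sub>k 0) = 0 *\<^sub>k g 0"
      using f g fs.span_zero[of S] unfolding linear_on_def by blast+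
    then show "f 0 = g 0 \<and> 0 \<in> fs.span S" by (simp add: fs.span_zero)
  next
    fix c x y assume step: "x \<in> S" "f y = g y \<and> y \<in> fs.span S"
    then have "c *\<^sub>k x \<in> fs.span S" "x \<in> fs.span S"
      by (auto intro: fs.span_base fs.span_scale)
    moreover have "f (c *\<^sub>k x) = c *\<^sub>k f x" "g (c *\<^sub>k x) = c *\<^sub>k g x"
      using f g \<open>x \<in> fs.span S\<close> unfolding linear_on_def by blast+
    ultimately show "f (c *\<^sub>k x + y) = g (c *\<^sub>k x + y) \<and> c *\<^sub>k x + y \<in> fs.span S"
      using f g step eq unfolding linear_on_def by (simp add: fs.span_add)
  qed
  then show ?thesis ..
qed

text \<open>The operators of the calculus are restrictions of operators on all tensors.\<close>

lemma the_linear_map_eq: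
  assumes f: "linop f" and S: "S \<subseteq> V" "V \<subseteq> fs.span S" and V: "fs.subspace V"
    and P: "P (restrict f V)"
    and uniq: "\<And>g x. linear_on V g \<Longrightarrow> P g \<Longrightarrow> x \<in> S \<Longrightarrow> g x = f x"
    and x: "x \<in> V"
  shows "the_linear_map V P x = f x"
proof -
  have span: "V = fs.span S"
    using S V by (simp add: fs.span_minimal subset_antisym)
  have lin: "linear_on V (restrict f V)"
    using V f unfolding linear_on_def linop_def
    by (simp add: fs.subspace_add fs.subspace_scale)
  have "(THE f. f \<in> extensional V \<and> linear_on V f \<and> P f) = restrict f V"
  proof (rule the_equality)
    fix g assume g: "g \<in> extensional V \<and> linear_on V g \<and> P g"
    show "g = restrict f V"
    proof (rule extensionalityI[of _ V])
      fix y assume "y \<in> V"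
      then show "g y = restrict f V y"
        using linear_on_span_eq[of S g f y] g uniq linop_linear_on[OF f] span by auto
    qed (use g in auto)
  qed (use lin P in auto)
  then show ?thesis using x by (simp add: the_linear_map_def)
qed

section \<open>Tensors and Sweedler sums\<close>

definition lin :: "('k::field, 'a, 'm) module_scheme \<Rightarrow> ('a \<Rightarrow> 'b \<Rightarrow> 'k) \<Rightarrow> bool"
  where "lin M f \<longleftrightarrow>
    (\<forall>x\<in>carrier M. \<forall>y\<in>carrier M. f (x \<oplus>\<^bsub>M\<^esub> y) = f x + f y) \<and>
    (\<forall>c. \<forall>x\<in>carrier M. f (c \<odot>\<^bsub>M\<^esub> x) = c *\<^sub>k f x)"

text \<open>Demanded for lists of all lengths at once, so that \<open>tbind\<close> evaluates on
  pure tensors of every degree. Maps meant for a single degree are extended by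
  \<open>0\<close>.\<close>

definition mlin :: "('k::field, 'a, 'm) module_scheme \<Rightarrow> ('a list \<Rightarrow> 'b \<Rightarrow> 'k) \<Rightarrow> bool"
  where "mlin M f \<longleftrightarrow>
    (\<forall>xs ys. set xs \<subseteq> carrier M \<and> set ys \<subseteq> carrier M \<longrightarrow> lin M (\<lambda>x. f (xs @ x # ys)))"

lemma mlin_multilinear: "mlin M f \<longleftrightarrow> (\<forall>n \<phi>. multilinear M n (\<lambda>xs. f xs \<phi>))"
proof
  show "mlin M f \<Longrightarrow> \<forall>n \<phi>. multilinear M n (\<lambda>xs. f xs \<phi>)"
    unfolding mlin_def lin_def multilinear_def by (simp add: fscale_def fun_eq_iff)
next
  assume *: "\<forall>n \<phi>. multilinear M n (\<lambda>xs. f xs \<phi>)"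
  show "mlin M f"
    unfolding mlin_def lin_def
  proof (intro allI impI conjI ballI ext; elim conjE)
    fix xs ys x y \<phi> assume "set xs \<subseteq> carrier M" "set ys \<subseteq> carrier M" "x \<in> carrier M" "y \<in> carrier M"
    then show "f (xs @ (x \<oplus>\<^bsub>M\<^esub> y) # ys) \<phi> = (f (xs @ x # ys) + f (xs @ y # ys)) \<phi>"
      using *[rule_format, of "length xs + 1 + length ys" \<phi>] unfolding multilinear_def by simp
  next
    fix xs ys x c \<phi> assume "set xs \<subseteq> carrier M" "set ys \<subseteq> carrier M" "x \<in> carrier M"
    then show "f (xs @ (c \<odot>\<^bsub>M\<^esub> x) # ys) \<phi> = (c *\<^sub>k f (xs @ x # ys)) \<phi>"
      using *[rule_format, of "length xs + 1 + length ys" \<phi>] unfolding multilinear_def fscale_def by metis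
  qed
qed

lemma mlinD:
  "mlin M f \<Longrightarrow> set xs \<subseteq> carrier M \<Longrightarrow> set ys \<subseteq> carrier M \<Longrightarrow> lin M (\<lambda>x. f (xs @ x # ys))"
  by (auto simp: mlin_def)

text \<open>A pure tensor takes the value \<open>0\<close> on functions that are not multilinear in
  its degree; \<open>mlin\<close> excludes this case at every argument of the resulting
  functional.\<close>

lemma tbind_tens: "mlin M f \<Longrightarrow> tbind (tens M xs) f = f xs"
  by (auto simp: tbind_def tens_def mlin_multilinear)

lemma mlin_tens: "mlin M (tens M)"
  by (auto simp: mlin_multilinear tens_def multilinear_def)

lemma linop_lin: "linop F \<Longrightarrow> lin M f \<Longrightarrow> lin M (\<lambda>x. F (f x))"
  by (auto simp: lin_def linop_def)

lemma linop_mlin: "linop F \<Longrightarrow> mlin M f \<Longrightarrow> mlin M (\<lambda>x. F (f x))"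
  unfolding mlin_def using linop_lin[of F M] by blast

lemma lin_0: "lin M (\<lambda>x. 0)"
  by (simp add: lin_def)

lemma lin_add: "lin M f \<Longrightarrow> lin M g \<Longrightarrow> lin M (\<lambda>x. f x + g x)"
  by (auto simp: lin_def fs.scale_right_distrib)

lemma lin_diff: "lin M f \<Longrightarrow> lin M g \<Longrightarrow> lin M (\<lambda>x. f x - g x)"
  by (auto simp: lin_def fs.scale_right_diff_distrib)

lemma lin_scale: "lin M f \<Longrightarrow> lin M (\<lambda>x. c *\<^sub>k f x)"
  by (auto simp: lin_def fs.scale_right_distrib mult.commute)

lemma lin_sum_list: "(\<And>i. i \<in> set L \<Longrightarrow> lin M (f i)) \<Longrightarrow> lin M (\<lambda>x. \<Sum>i\<leftarrow>L. f i x)"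
  by (induction L) (auto intro: lin_0 lin_add)

definition TT :: "('k::field, 'a, 'm) module_scheme \<Rightarrow> ('k, 'a) tensor set"
  where "TT M = fs.span {tens M xs | xs. set xs \<subseteq> carrier M}"

lemma TT_subspace: "fs.subspace (TT M)" by (simp add: TT_def)

lemma tpower_subspace: "fs.subspace (tpower M n)" by (simp add: tpower_def)

lemma tens_in_TT: "set xs \<subseteq> carrier M \<Longrightarrow> tens M xs \<in> TT M"
  unfolding TT_def by (rule fs.span_base) auto

lemma tens_in_tpower: "set xs \<subseteq> carrier M \<Longrightarrow> length xs = n \<Longrightarrow> tens M xs \<in> tpower M n"
  unfolding tpower_def by (rule fs.span_base) auto

lemma tpower_TT: "t \<in> tpower M n \<Longrightarrow> t \<in> TT M"
  unfolding tpower_def TT_def by (erule rev_subsetD, rule fs.span_mono) auto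

lemma TT_eqI:
  assumes "linop f" "linop g" "\<And>xs. set xs \<subseteq> carrier M \<Longrightarrow> f (tens M xs) = g (tens M xs)" "t \<in> TT M"
  shows "f t = g t"
  by (rule linop_eq_on_span[OF assms(1,2) _ assms(4)[unfolded TT_def]]) (use assms(3) in auto)

lemma tpower_eqI:
  assumes "linop f" "linop g"
    "\<And>xs. set xs \<subseteq> carrier M \<Longrightarrow> length xs = n \<Longrightarrow> f (tens M xs) = g (tens M xs)" "t \<in> tpower M n"
  shows "f t = g t"
  by (rule linop_eq_on_span[OF assms(1,2) _ assms(4)[unfolded tpower_def]]) (use assms(3) in auto)

lemma TT_into:
  assumes "linop f" "fs.subspace W" "\<And>xs. set xs \<subseteq> carrier M \<Longrightarrow> f (tens M xs) \<in> W" "t \<in> TT M"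
  shows "f t \<in> W"
  by (rule linop_span_into[OF assms(1,2) _ assms(4)[unfolded TT_def]]) (use assms(3) in auto)

lemma tpower_into:
  assumes "linop f" "fs.subspace W"
    "\<And>xs. set xs \<subseteq> carrier M \<Longrightarrow> length xs = n \<Longrightarrow> f (tens M xs) \<in> W" "t \<in> tpower M n"
  shows "f t \<in> W"
  by (rule linop_span_into[OF assms(1,2) _ assms(4)[unfolded tpower_def]]) (use assms(3) in auto)

text \<open>Each equation that expresses linearity in \<open>x\<close> compares two maps that are
  linear in \<open>t\<close>, so it passes from pure tensors to all of \<open>TT\<close>.\<close>

lemma mlin_lin_TT:
  assumes "\<And>xs. set xs \<subseteq> carrier M \<Longrightarrow> lin M (\<lambda>x. f x (tens M xs))"
    "\<And>x. linop (f x)" "t \<in> TT M" "\<And>x y. x \<in> carrier M \<Longrightarrow> y \<in> carrier M \<Longrightarrow> x \<oplus>\<^bsub>M\<^esub> y \<in> carrier M"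
  shows "lin M (\<lambda>x. f x t)"
  unfolding lin_def
proof (intro conjI ballI allI)
  fix x y assume xy: "x \<in> carrier M" "y \<in> carrier M"
  show "f (x \<oplus>\<^bsub>M\<^esub> y) t = f x t + f y t"
    by (rule TT_eqI[OF assms(2) linop_plus[OF assms(2) assms(2)] _ assms(3)]) (use assms(1) xy in \<open>auto simp: lin_def\<close>)
next
  fix x and c assume x: "x \<in> carrier M"
  show "f (c \<odot>\<^bsub>M\<^esub> x) t = c *\<^sub>k f x t"
    by (rule TT_eqI[OF assms(2) linop_fscale[OF assms(2)] _ assms(3)]) (use assms(1) x in \<open>auto simp: lin_def\<close>)
qed

text \<open>The decomposition is picked by choice. The empty list outside the carrier makes the
  congruence rule for Sweedler sums hold for every \<open>x\<close>.\<close>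

definition sweedler_list :: "('k::field, 'a) hopf \<Rightarrow> 'a \<Rightarrow> ('a \<times> 'a) list"
  where "sweedler_list H x = (if x \<in> carrier H then
    (SOME L. set L \<subseteq> carrier H \<times> carrier H \<and> comult H x = (\<Sum>p\<leftarrow>L. tens H [fst p, snd p])) else [])"

text \<open>A sum over a chosen list, independent of the choice only for bilinear \<open>g\<close>.\<close>

definition sw :: "('k::field, 'a) hopf \<Rightarrow> 'a \<Rightarrow> ('a \<Rightarrow> 'a \<Rightarrow> 'b::monoid_add) \<Rightarrow> 'b"
  where "sw H x g = (\<Sum>p\<leftarrow>sweedler_list H x. g (fst p) (snd p))"

lemma linop_sw [linop_intros]: "(\<And>a b. linop (F a b)) \<Longrightarrow> linop (\<lambda>t. sw H x (\<lambda>a b. F a b t))"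
  unfolding sw_def by (rule linop_sum_listI)

lemma linop_of_sw: "linop F \<Longrightarrow> F (sw H x g) = sw H x (\<lambda>a b. F (g a b))"
  by (simp add: sw_def linop_sum_list)

lemma sw_add: "sw H x (\<lambda>a b. f a b + g a b) = sw H x f + sw H x g"
  for f :: "_ \<Rightarrow> _ \<Rightarrow> 'b::ab_group_add"
  by (simp add: sw_def sum_list_addf)

lemma sw_diff: "sw H x (\<lambda>a b. f a b - g a b) = sw H x f - sw H x g"
  for f :: "_ \<Rightarrow> _ \<Rightarrow> 'b::ab_group_add"
  by (simp add: sw_def sum_list_subtractf)

lemma sw_scale: "sw H x (\<lambda>a b. c *\<^sub>k g a b) = c *\<^sub>k sw H x g"
  using linop_of_sw[OF linop_fscale[OF linop_id]] by metis

lemma sw_swap: "sw H x (\<lambda>a b. sw H y (\<lambda>c d. g a b c d)) = sw H y (\<lambda>c d. sw H x (\<lambda>a b. g a b c d))"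
  for g :: "_ \<Rightarrow> _ \<Rightarrow> _ \<Rightarrow> _ \<Rightarrow> 'b::ab_group_add"
proof -
  have "(\<Sum>p\<leftarrow>L. \<Sum>q\<leftarrow>L'. f p q) = (\<Sum>q\<leftarrow>L'. \<Sum>p\<leftarrow>L. f p q)"
    for L L' and f :: "_ \<Rightarrow> _ \<Rightarrow> 'b"
    by (induction L) (auto simp: sum_list_addf)
  then show ?thesis by (simp add: sw_def)
qed

definition lin2 :: "('k::field, 'a, 'm) module_scheme \<Rightarrow> ('a \<Rightarrow> 'a \<Rightarrow> 'b \<Rightarrow> 'k) \<Rightarrow> bool"
  where "lin2 M g \<longleftrightarrow> (\<forall>y\<in>carrier M. lin M (\<lambda>x. g x y) \<and> lin M (\<lambda>x. g y x))"

definition lin3 :: "('k::field, 'a, 'm) module_scheme \<Rightarrow> ('a \<Rightarrow> 'a \<Rightarrow> 'a \<Rightarrow> 'b \<Rightarrow> 'k) \<Rightarrow> bool"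
  where "lin3 M g \<longleftrightarrow> (\<forall>y\<in>carrier M. \<forall>z\<in>carrier M.
    lin M (\<lambda>x. g x y z) \<and> lin M (\<lambda>x. g y x z) \<and> lin M (\<lambda>x. g y z x))"

text \<open>The scalar of each term is absorbed into its first factor, so sums without coefficients
  suffice.\<close>

lemma ex_list_of_tpower_2:
  assumes add: "\<And>x y c. x \<in> carrier M \<Longrightarrow> (c \<odot>\<^bsub>M\<^esub> x) \<in> carrier M"
    and t: "t \<in> tpower M 2"
  shows "\<exists>L. set L \<subseteq> carrier M \<times> carrier M \<and> t = (\<Sum>p\<leftarrow>L. tens M [fst p, snd p])"
proof (rule fs.span_induct_alt[where h = "\<lambda>t. \<exists>L. set L \<subseteq> carrier M \<times> carrier M \<and> t = (\<Sum>p\<leftarrow>L. tens M [fst p, snd p])",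
      OF t[unfolded tpower_def]])
  show "\<exists>L. set L \<subseteq> carrier M \<times> carrier M \<and> 0 = (\<Sum>p\<leftarrow>L. tens M [fst p, snd p])"
    by (rule exI[of _ "[]"]) simp
next
  fix c x y assume step: "x \<in> {tens M xs |xs. length xs = 2 \<and> set xs \<subseteq> carrier M}"
    "\<exists>L. set L \<subseteq> carrier M \<times> carrier M \<and> y = (\<Sum>p\<leftarrow>L. tens M [fst p, snd p])"
  then obtain a b where ab: "x = tens M [a, b]" "a \<in> carrier M" "b \<in> carrier M"
    by (auto simp: numeral_2_eq_2 length_Suc_conv)
  obtain L where L: "set L \<subseteq> carrier M \<times> carrier M" "y = (\<Sum>p\<leftarrow>L. tens M [fst p, snd p])"
    using step by auto
  have "c *\<^sub>k tens M [a, b] = tens M [c \<odot>\<^bsub>M\<^esub> a, b]"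
    using mlinD[OF mlin_tens, of "[]" M "[b]"] ab by (auto simp: lin_def)
  then show "\<exists>L. set L \<subseteq> carrier M \<times> carrier M \<and> c *\<^sub>k x + y = (\<Sum>p\<leftarrow>L. tens M [fst p, snd p])"
    using L ab add by (intro exI[of _ "(c \<odot>\<^bsub>M\<^esub> a, b) # L"]) auto
qed

context hopf_algebra
begin

lemma smult_closed' [simp]: "x \<in> carrier H \<Longrightarrow> c \<odot> x \<in> carrier H"
  by (rule smult_closed) (auto simp: ring_of_type_algebra_def)

declare antipode_closed [simp]

lemma sweedler_list:
  assumes "x \<in> carrier H"
  shows "set (sweedler_list H x) \<subseteq> carrier H \<times> carrier H"
    and "comult H x = (\<Sum>p\<leftarrow>sweedler_list H x. tens H [fst p, snd p])"
  using someI_ex[OF ex_list_of_tpower_2[OF smult_closed' comult_closed[OF assms]]] assms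
  by (auto simp: sweedler_list_def)

lemma sw_cong:
  assumes "\<And>a b. a \<in> carrier H \<Longrightarrow> b \<in> carrier H \<Longrightarrow> f a b = g a b"
  shows "sw H x f = sw H x g"
proof (cases "x \<in> carrier H")
  case True
  then have "fst p \<in> carrier H" "snd p \<in> carrier H" if "p \<in> set (sweedler_list H x)" for p
    using sweedler_list(1) that by fastforce+
  then show ?thesis unfolding sw_def
    by (intro arg_cong[of _ _ sum_list] map_cong refl assms) auto
qed (simp add: sw_def sweedler_list_def)

lemma sw_into:
  assumes "fs.subspace W" "\<And>a b. a \<in> carrier H \<Longrightarrow> b \<in> carrier H \<Longrightarrow> g a b \<in> W"
  shows "sw H x g \<in> W"
proof -
  have "(\<Sum>p\<leftarrow>L. g (fst p) (snd p)) \<in> W" if "set L \<subseteq> carrier H \<times> carrier H" for L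
    using that by (induction L) (auto simp: assms fs.subspace_0 fs.subspace_add)
  moreover have "set (sweedler_list H x) \<subseteq> carrier H \<times> carrier H"
    using sweedler_list(1)[of x] by (cases "x \<in> carrier H") (auto simp: sweedler_list_def)
  ultimately show ?thesis unfolding sw_def by blast
qed

text \<open>Extension by \<open>0\<close> to lists of other lengths makes a bilinear map accessible
  to \<open>tbind_tens\<close>.\<close>

lemma lin2_mlin:
  assumes "lin2 H g"
  shows "mlin H (\<lambda>l. if length l = 2 then g (l ! 0) (l ! 1) else 0)"
proof -
  have "lin H (\<lambda>x. if length (xs @ x # ys) = 2 then g ((xs @ x # ys) ! 0) ((xs @ x # ys) ! 1) else 0)"
    if "set xs \<subseteq> carrier H" "set ys \<subseteq> carrier H" for xs ys
  proof (cases "length xs + length ys = 1")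
    case True
    then consider y where "xs = []" "ys = [y]" | y where "xs = [y]" "ys = []"
      by (cases xs; cases ys) auto
    then show ?thesis using assms that by cases (auto simp: lin2_def)
  next
    case False
    then show ?thesis by (auto simp: lin_0)
  qed
  then show ?thesis by (auto simp: mlin_def)
qed

lemma lin3_mlin:
  assumes "lin3 H g"
  shows "mlin H (\<lambda>l. if length l = 3 then g (l ! 0) (l ! 1) (l ! 2) else 0)"
proof -
  have "lin H (\<lambda>x. if length (xs @ x # ys) = 3 then g ((xs @ x # ys) ! 0) ((xs @ x # ys) ! 1) ((xs @ x # ys) ! 2) else 0)"
    if "set xs \<subseteq> carrier H" "set ys \<subseteq> carrier H" for xs ys
  proof (cases "length xs + length ys = 2")
    case True
    then consider y z where "xs = []" "ys = [y, z]" | y z where "xs = [y]" "ys = [z]"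
      | y z where "xs = [y, z]" "ys = []"
      by (cases xs; cases ys; cases "tl xs"; cases "tl ys") auto
    then show ?thesis using assms that
      by cases (auto simp: lin3_def)
  next
    case False
    then show ?thesis by (auto simp: lin_0)
  qed
  then show ?thesis by (auto simp: mlin_def)
qed

lemma lin1_mlin:
  assumes "lin H g"
  shows "mlin H (\<lambda>l. if length l = 1 then g (l ! 0) else 0)"
proof -
  have "lin H (\<lambda>x. if length (xs @ x # ys) = 1 then g ((xs @ x # ys) ! 0) else 0)" for xs ys
    using assms by (cases xs; cases ys) (auto simp: lin_0)
  then show ?thesis by (auto simp: mlin_def)
qed

text \<open>Only lists of length 2 matter here. The integrands in the Hopf axioms read off
  \<open>h ! 0\<close> and \<open>h ! 1\<close> and need not be multilinear on lists of other
  lengths, so \<open>tbind_tens\<close> does not apply to them.\<close>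

lemma tbind_tens_pair:
  assumes "a \<in> carrier H" "b \<in> carrier H"
    and "\<And>y. y \<in> carrier H \<Longrightarrow> lin H (\<lambda>x. f [x, y]) \<and> lin H (\<lambda>x. f [y, x])"
  shows "tbind (tens H [a, b]) f = f [a, b]"
proof -
  have "multilinear H 2 (\<lambda>xs. f xs \<phi>)" for \<phi>
    unfolding multilinear_def
  proof (intro allI impI)
    fix xs ys x y and c :: 'k
    assume *: "set xs \<subseteq> carrier H \<and> set ys \<subseteq> carrier H \<and> x \<in> carrier H \<and> y \<in> carrier H \<and>
      length xs + 1 + length ys = 2"
    then consider z where "xs = []" "ys = [z]" | z where "xs = [z]" "ys = []"
      by (cases xs; cases ys) auto
    then show "f (xs @ (x \<oplus> y) # ys) \<phi> = f (xs @ x # ys) \<phi> + f (xs @ y # ys) \<phi> \<and>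
       f (xs @ c \<odot> x # ys) \<phi> = c * f (xs @ x # ys) \<phi>"
      using * assms(3) by cases (auto simp: lin_def fscale_def)
  qed
  then show ?thesis by (auto simp: tbind_def tens_def numeral_2_eq_2)
qed

lemma tbind_comult:
  assumes "x \<in> carrier H"
    and "\<And>y. y \<in> carrier H \<Longrightarrow> lin H (\<lambda>x. f [x, y]) \<and> lin H (\<lambda>x. f [y, x])"
  shows "tbind (comult H x) f = sw H x (\<lambda>a b. f [a, b])"
proof -
  have "comult H x = sw H x (\<lambda>a b. tens H [a, b])"
    using sweedler_list(2)[OF assms(1)] by (simp add: sw_def)
  then have "tbind (comult H x) f = sw H x (\<lambda>a b. tbind (tens H [a, b]) f)"
    using linop_of_sw[OF linop_tbind[OF linop_id]] by metis
  also have "\<dots> = sw H x (\<lambda>a b. f [a, b])"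
    by (rule sw_cong) (use tbind_tens_pair assms(2) in blast)
  finally show ?thesis .
qed

lemma tbind_comult2:
  fixes g :: "'a \<Rightarrow> 'a \<Rightarrow> ('k, 'c) tensor"
  assumes "x \<in> carrier H" "lin2 H g"
  shows "tbind (comult H x) (\<lambda>h. g (h ! 0) (h ! 1)) = sw H x g"
  using tbind_comult[of x "\<lambda>h. g (h ! 0) (h ! 1)"] assms by (auto simp: lin2_def)

lemma comult_sw: "x \<in> carrier H \<Longrightarrow> comult H x = sw H x (\<lambda>a b. tens H [a, b])"
  using sweedler_list(2) by (simp add: sw_def)

text \<open>The decompositions chosen for \<open>x\<close>, \<open>y\<close> and
  \<open>x \<oplus> y\<close> are unrelated. Linearity holds because, for bilinear \<open>g\<close>,
  the sum equals \<open>tbind\<close> of the coproduct, which is linear in \<open>x\<close>.\<close>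

lemma sw_lin:
  fixes g :: "'a \<Rightarrow> 'a \<Rightarrow> ('k, 'c) tensor"
  assumes "lin2 H g"
  shows "lin H (\<lambda>x. sw H x g)"
proof -
  have eq: "sw H x g = tbind (comult H x) (\<lambda>h. g (h ! 0) (h ! 1))" if "x \<in> carrier H" for x
    using tbind_comult2[OF that assms] by (rule sym)
  have l: "linop (\<lambda>t. tbind t (\<lambda>h. g (h ! 0) (h ! 1) :: ('k, 'c) tensor))"
    by (intro linop_intros)
  show ?thesis
    unfolding lin_def
  proof (intro conjI ballI allI)
    fix x y assume xy: "x \<in> carrier H" "y \<in> carrier H"
    then have "x \<oplus> y \<in> carrier H" by auto
    with xy show "sw H (x \<oplus> y) g = sw H x g + sw H y g"
      by (simp only: eq comult_add linop_add[OF l])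
  next
    fix x c assume "x \<in> carrier H"
    then show "sw H (c \<odot> x) g = c *\<^sub>k sw H x g"
      by (simp only: eq smult_closed' comult_smult linop_scale[OF l])
  qed
qed

lemma lin_sw:
  assumes "\<And>a b. a \<in> carrier H \<Longrightarrow> b \<in> carrier H \<Longrightarrow> lin H (\<lambda>x. g a b x)"
  shows "lin H (\<lambda>x. sw H y (\<lambda>a b. g a b x))"
proof (cases "y \<in> carrier H")
  case True
  then have "fst p \<in> carrier H" "snd p \<in> carrier H" if "p \<in> set (sweedler_list H y)" for p
    using sweedler_list(1) that by fastforce+
  then show ?thesis unfolding sw_def
    by (intro lin_sum_list assms) auto
qed (simp add: sw_def sweedler_list_def lin_0)

end

section \<open>Elementary operators on the end factors of a tensor\<close>

definition tpre :: "('k::field, 'a) hopf \<Rightarrow> 'a \<Rightarrow> ('k, 'a) tensor \<Rightarrow> ('k, 'a) tensor"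
  where "tpre H x t = tbind t (\<lambda>ys. tens H (x # ys))"

definition tapp :: "('k::field, 'a) hopf \<Rightarrow> ('k, 'a) tensor \<Rightarrow> 'a \<Rightarrow> ('k, 'a) tensor"
  where "tapp H t x = tbind t (\<lambda>ys. tens H (ys @ [x]))"

definition modhd :: "('k::field, 'a) hopf \<Rightarrow> ('a \<Rightarrow> 'a) \<Rightarrow> ('k, 'a) tensor \<Rightarrow> ('k, 'a) tensor"
  where "modhd H h t = tbind t (\<lambda>ys. case ys of [] \<Rightarrow> 0 | y # ys \<Rightarrow> tens H (h y # ys))"

definition modlast :: "('k::field, 'a) hopf \<Rightarrow> ('a \<Rightarrow> 'a) \<Rightarrow> ('k, 'a) tensor \<Rightarrow> ('k, 'a) tensor"
  where "modlast H h t = tbind t (\<lambda>ys. if ys = [] then 0 else tens H (butlast ys @ [h (last ys)]))"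

definition tlm :: "('k::field, 'a) hopf \<Rightarrow> 'a \<Rightarrow> ('k, 'a) tensor \<Rightarrow> ('k, 'a) tensor"
  where "tlm H c = modhd H (\<lambda>y. c \<otimes>\<^bsub>H\<^esub> y)"

definition trm :: "('k::field, 'a) hopf \<Rightarrow> 'a \<Rightarrow> ('k, 'a) tensor \<Rightarrow> ('k, 'a) tensor"
  where "trm H c = modlast H (\<lambda>y. y \<otimes>\<^bsub>H\<^esub> c)"

definition tll :: "('k::field, 'a) hopf \<Rightarrow> 'a \<Rightarrow> ('k, 'a) tensor \<Rightarrow> ('k, 'a) tensor"
  where "tll H c = modlast H (\<lambda>y. c \<otimes>\<^bsub>H\<^esub> y)"

lemma linop_tpre [linop_intros]: "linop F \<Longrightarrow> linop (\<lambda>t. tpre H x (F t))"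
  and linop_tapp [linop_intros]: "linop F \<Longrightarrow> linop (\<lambda>t. tapp H (F t) x)"
  and linop_modhd [linop_intros]: "linop F \<Longrightarrow> linop (\<lambda>t. modhd H h (F t))"
  and linop_modlast [linop_intros]: "linop F \<Longrightarrow> linop (\<lambda>t. modlast H h (F t))"
  unfolding tpre_def tapp_def modhd_def modlast_def by (intro linop_intros; assumption)+

lemma linop_tlm [linop_intros]: "linop F \<Longrightarrow> linop (\<lambda>t. tlm H x (F t))"
  and linop_trm [linop_intros]: "linop F \<Longrightarrow> linop (\<lambda>t. trm H x (F t))"
  and linop_tll [linop_intros]: "linop F \<Longrightarrow> linop (\<lambda>t. tll H x (F t))"
  unfolding tlm_def trm_def tll_def by (intro linop_intros; assumption)+

lemmas op_lin_simps =
  linop_add[OF linop_tpre[OF linop_id]] linop_scale[OF linop_tpre[OF linop_id]]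
  linop_zero[OF linop_tpre[OF linop_id]] linop_diff[OF linop_tpre[OF linop_id]]
  linop_minus[OF linop_tpre[OF linop_id]]
  linop_add[OF linop_tapp[OF linop_id]] linop_scale[OF linop_tapp[OF linop_id]]
  linop_zero[OF linop_tapp[OF linop_id]] linop_diff[OF linop_tapp[OF linop_id]]
  linop_minus[OF linop_tapp[OF linop_id]]
  linop_add[OF linop_tlm[OF linop_id]] linop_scale[OF linop_tlm[OF linop_id]]
  linop_zero[OF linop_tlm[OF linop_id]] linop_diff[OF linop_tlm[OF linop_id]]
  linop_minus[OF linop_tlm[OF linop_id]]
  linop_add[OF linop_trm[OF linop_id]] linop_scale[OF linop_trm[OF linop_id]]
  linop_zero[OF linop_trm[OF linop_id]] linop_diff[OF linop_trm[OF linop_id]]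
  linop_minus[OF linop_trm[OF linop_id]]
  linop_add[OF linop_tll[OF linop_id]] linop_scale[OF linop_tll[OF linop_id]]
  linop_zero[OF linop_tll[OF linop_id]] linop_diff[OF linop_tll[OF linop_id]]
  linop_minus[OF linop_tll[OF linop_id]]

lemmas op_sw =
  linop_of_sw[OF linop_tpre[OF linop_id]] linop_of_sw[OF linop_tapp[OF linop_id]]
  linop_of_sw[OF linop_tlm[OF linop_id]] linop_of_sw[OF linop_trm[OF linop_id]]
  linop_of_sw[OF linop_tll[OF linop_id]]

definition hlin :: "('k::field, 'a) hopf \<Rightarrow> ('a \<Rightarrow> 'a) \<Rightarrow> bool"
  where "hlin H h \<longleftrightarrow> (\<forall>x\<in>carrier H. h x \<in> carrier H) \<and>
    (\<forall>x\<in>carrier H. \<forall>y\<in>carrier H. h (x \<oplus>\<^bsub>H\<^esub> y) = h x \<oplus>\<^bsub>H\<^esub> h y) \<and>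
    (\<forall>c. \<forall>x\<in>carrier H. h (c \<odot>\<^bsub>H\<^esub> x) = c \<odot>\<^bsub>H\<^esub> h x)"

context hopf_algebra
begin

text \<open>As a congruence rule it hands the simplifier the membership of both Sweedler factors in
  the carrier, on which almost all later rewriting under \<open>sw\<close> depends.\<close>

lemma sw_cong_arg [cong]:
  assumes "x = y" "\<And>a b. a \<in> carrier H \<Longrightarrow> b \<in> carrier H \<Longrightarrow> f a b = g a b"
  shows "sw H x f = sw H y g"
  using sw_cong[OF assms(2)] assms(1) by simp

lemma ring_H: "ring H"
  by (rule hopf_algebra.axioms(1)[OF hopf_algebra_axioms])

lemmas H_distrib = ring.ring_simprules(13)[OF ring_H] ring.ring_simprules(23)[OF ring_H]

lemma mlinI:
  assumes "\<And>xs ys. set xs \<subseteq> carrier H \<Longrightarrow> set ys \<subseteq> carrier H \<Longrightarrow> lin H (\<lambda>x. f (xs @ x # ys))"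
  shows "mlin H f"
  using assms by (auto simp: mlin_def)

lemma lin_cong:
  assumes "\<And>x. x \<in> carrier H \<Longrightarrow> f x = g x" "lin H g"
  shows "lin H f"
  using assms by (auto simp: lin_def)

lemma mlin_cong:
  assumes "\<And>xs. set xs \<subseteq> carrier H \<Longrightarrow> xs \<noteq> [] \<Longrightarrow> f xs = g xs" "mlin H g"
  shows "mlin H f"
proof (rule mlinI)
  fix xs ys assume "set xs \<subseteq> carrier H" "set ys \<subseteq> carrier H"
  then show "lin H (\<lambda>x. f (xs @ x # ys))"
    using assms by (intro lin_cong[where g = "\<lambda>x. g (xs @ x # ys)", OF _ mlinD[OF assms(2)]]) auto
qed

lemma lin_tens: "set xs \<subseteq> carrier H \<Longrightarrow> set ys \<subseteq> carrier H \<Longrightarrow> lin H (\<lambda>x. tens H (xs @ x # ys))"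
  by (rule mlinD[OF mlin_tens])

lemma lin_tens_hlin:
  "hlin H h \<Longrightarrow> set xs \<subseteq> carrier H \<Longrightarrow> set ys \<subseteq> carrier H \<Longrightarrow> lin H (\<lambda>x. tens H (xs @ h x # ys))"
  using lin_tens[of xs ys] by (simp add: lin_def hlin_def)

lemma hlin_id: "hlin H (\<lambda>x. x)"
  and hlin_mult: "c \<in> carrier H \<Longrightarrow> hlin H (\<lambda>x. c \<otimes> x)"
  and hlin_mult': "c \<in> carrier H \<Longrightarrow> hlin H (\<lambda>x. x \<otimes> c)"
  and hlin_antipode: "hlin H (antipode H)"
  by (auto simp: hlin_def H_distrib mult_smult_left mult_smult_right antipode_add antipode_smult)

lemma TT_induct_into:
  assumes "linop F" "t \<in> TT H" "\<And>xs. set xs \<subseteq> carrier H \<Longrightarrow> F (tens H xs) \<in> TT H"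
  shows "F t \<in> TT H"
  by (rule TT_into[OF assms(1) TT_subspace assms(3) assms(2)])

lemma tpre_tens [simp]: "x \<in> carrier H \<Longrightarrow> tpre H x (tens H xs) = tens H (x # xs)"
  unfolding tpre_def by (intro tbind_tens mlinI) (use lin_tens[of "x # _"] in auto)

lemma tapp_tens [simp]: "x \<in> carrier H \<Longrightarrow> tapp H (tens H xs) x = tens H (xs @ [x])"
  unfolding tapp_def by (intro tbind_tens mlinI) (use lin_tens[of _ "_ @ [x]"] in auto)

lemma modhd_tens:
  assumes "hlin H h"
  shows "modhd H h (tens H xs) = (case xs of [] \<Rightarrow> 0 | y # ys \<Rightarrow> tens H (h y # ys))"
  unfolding modhd_def
proof (intro tbind_tens mlinI)
  fix xs ys assume "set xs \<subseteq> carrier H" "set ys \<subseteq> carrier H"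
  then show "lin H (\<lambda>x. case xs @ x # ys of [] \<Rightarrow> 0 | y # ys \<Rightarrow> tens H (h y # ys))"
    using lin_tens_hlin[OF assms, of "[]" ys] lin_tens[of "h (hd xs) # tl xs" ys] assms
    by (cases xs) (auto simp: hlin_def)
qed

lemma modlast_tens:
  assumes "hlin H h"
  shows "modlast H h (tens H xs) = (if xs = [] then 0 else tens H (butlast xs @ [h (last xs)]))"
  unfolding modlast_def
proof (intro tbind_tens mlinI)
  fix xs ys assume *: "set xs \<subseteq> carrier H" "set ys \<subseteq> carrier H"
  show "lin H (\<lambda>x. if xs @ x # ys = [] then 0 else tens H (butlast (xs @ x # ys) @ [h (last (xs @ x # ys))]))"
  proof (cases ys rule: rev_cases)
    case Nil
    then show ?thesis using lin_tens_hlin[OF assms, of xs "[]"] * by (simp add: butlast_append)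
  next
    case (snoc zs z)
    then show ?thesis using lin_tens[of xs "zs @ [h z]"] * assms by (simp add: butlast_append hlin_def)
  qed
qed

lemma tlm_tens [simp]: "c \<in> carrier H \<Longrightarrow> tlm H c (tens H []) = 0"
    "c \<in> carrier H \<Longrightarrow> tlm H c (tens H (x # xs)) = tens H ((c \<otimes> x) # xs)"
  by (simp_all add: tlm_def modhd_tens[OF hlin_mult])

lemma trm_tens [simp]: "c \<in> carrier H \<Longrightarrow> trm H c (tens H []) = 0"
    "c \<in> carrier H \<Longrightarrow> trm H c (tens H (x # xs)) =
       (if xs = [] then tens H [x \<otimes> c] else tens H (x # butlast xs @ [last xs \<otimes> c]))"
    "c \<in> carrier H \<Longrightarrow> trm H c (tens H (xs @ [x])) = tens H (xs @ [x \<otimes> c])"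
  by (simp_all add: trm_def modlast_tens[OF hlin_mult'])

lemma tll_tens [simp]: "c \<in> carrier H \<Longrightarrow> tll H c (tens H []) = 0"
    "c \<in> carrier H \<Longrightarrow> tll H c (tens H (x # xs)) =
       (if xs = [] then tens H [c \<otimes> x] else tens H (x # butlast xs @ [c \<otimes> last xs]))"
    "c \<in> carrier H \<Longrightarrow> tll H c (tens H (xs @ [x])) = tens H (xs @ [c \<otimes> x])"
  by (simp_all add: tll_def modlast_tens[OF hlin_mult])

lemma tens_TT [simp]: "set xs \<subseteq> carrier H \<Longrightarrow> tens H xs \<in> TT H"
  by (rule tens_in_TT)

lemma last_in_carrier: "set xs \<subseteq> carrier H \<Longrightarrow> xs \<noteq> [] \<Longrightarrow> last xs \<in> carrier H"
  by (meson last_in_set subsetD)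

lemma set_butlast_carrier: "set xs \<subseteq> carrier H \<Longrightarrow> set (butlast xs) \<subseteq> carrier H"
  by (meson in_set_butlastD subset_code(1))

lemma TT_0 [simp]: "0 \<in> TT H" and TT_add [simp]: "s \<in> TT H \<Longrightarrow> t \<in> TT H \<Longrightarrow> s + t \<in> TT H"
  and TT_diff [simp]: "s \<in> TT H \<Longrightarrow> t \<in> TT H \<Longrightarrow> s - t \<in> TT H"
  and TT_neg [simp]: "s \<in> TT H \<Longrightarrow> - s \<in> TT H"
  and TT_scale [simp]: "s \<in> TT H \<Longrightarrow> c *\<^sub>k s \<in> TT H"
  and TT_sw [simp]: "(\<And>a b. a \<in> carrier H \<Longrightarrow> b \<in> carrier H \<Longrightarrow> g a b \<in> TT H) \<Longrightarrow> sw H x g \<in> TT H"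
  using TT_subspace[of H] by (auto simp: fs.subspace_0 fs.subspace_add fs.subspace_diff
    fs.subspace_scale fs.subspace_neg intro: sw_into[OF TT_subspace])

lemma op_TT [simp]:
  assumes "t \<in> TT H"
  shows "x \<in> carrier H \<Longrightarrow> tpre H x t \<in> TT H" "x \<in> carrier H \<Longrightarrow> tapp H t x \<in> TT H"
    "x \<in> carrier H \<Longrightarrow> tlm H x t \<in> TT H" "x \<in> carrier H \<Longrightarrow> trm H x t \<in> TT H"
    "x \<in> carrier H \<Longrightarrow> tll H x t \<in> TT H"
proof -
  assume x: "x \<in> carrier H"
  note [intro!] = linop_intros and [simp] = x last_in_carrier set_butlast_carrier
  show "tpre H x t \<in> TT H" "tapp H t x \<in> TT H"
    by (rule TT_induct_into[OF _ assms]; force)+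
  show "tlm H x t \<in> TT H" "trm H x t \<in> TT H" "tll H x t \<in> TT H"
  proof (rule_tac [!] TT_induct_into[OF _ assms])
    fix xs assume "set xs \<subseteq> carrier H"
    then show "tlm H x (tens H xs) \<in> TT H" "trm H x (tens H xs) \<in> TT H" "tll H x (tens H xs) \<in> TT H"
      by (cases xs; simp)+
  qed auto
qed

lemma op_lin:
  assumes "t \<in> TT H"
  shows "lin H (\<lambda>x. tpre H x t)" "lin H (\<lambda>x. tapp H t x)" "lin H (\<lambda>x. tlm H x t)"
    "lin H (\<lambda>x. trm H x t)" "lin H (\<lambda>x. tll H x t)"
proof -
  note [intro!] = linop_intros and [simp] = last_in_carrier set_butlast_carrier
  have 1: "lin H (\<lambda>x. tpre H x (tens H xs))" "lin H (\<lambda>x. tapp H (tens H xs) x)" if "set xs \<subseteq> carrier H" for xs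
    using lin_tens[of "[]" xs] lin_tens[of xs "[]"] that by (auto simp: lin_def)
  have 2: "lin H (\<lambda>x. tlm H x (tens H xs))" if "set xs \<subseteq> carrier H" for xs
    using lin_tens_hlin[OF hlin_mult'[of "hd xs"], of "[]" "tl xs"] that
    by (cases xs) (auto simp: lin_def)
  have 3: "lin H (\<lambda>x. trm H x (tens H xs))" "lin H (\<lambda>x. tll H x (tens H xs))" if "set xs \<subseteq> carrier H" for xs
    using lin_tens_hlin[OF hlin_mult[of "last xs"], of "butlast xs" "[]"]
      lin_tens_hlin[OF hlin_mult'[of "last xs"], of "butlast xs" "[]"] that
    by (cases xs rule: rev_cases; auto simp: lin_def)+
  show "lin H (\<lambda>x. tpre H x t)" "lin H (\<lambda>x. tapp H t x)" "lin H (\<lambda>x. tlm H x t)"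
    "lin H (\<lambda>x. trm H x t)" "lin H (\<lambda>x. tll H x t)"
    by (rule mlin_lin_TT[where f = "tpre H", OF 1(1) linop_tpre[OF linop_id] assms];
          simp add: ring.ring_simprules[OF ring_H])
      (rule mlin_lin_TT[where f = "\<lambda>x t. tapp H t x", OF 1(2) linop_tapp[OF linop_id] assms]
        mlin_lin_TT[where f = "tlm H", OF 2 linop_tlm[OF linop_id] assms]
        mlin_lin_TT[where f = "trm H", OF 3(1) linop_trm[OF linop_id] assms]
        mlin_lin_TT[where f = "tll H", OF 3(2) linop_tll[OF linop_id] assms];
          simp add: ring.ring_simprules[OF ring_H])+
qed

lemmas op_arg_simps [simp] = op_lin[unfolded lin_def, THEN conjunct1, rule_format]
  op_lin[unfolded lin_def, THEN conjunct2, rule_format]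

lemma sw_arg_simps [simp]:
  fixes g :: "'a \<Rightarrow> 'a \<Rightarrow> ('k, 'c) tensor"
  assumes "lin2 H g"
  shows "x \<in> carrier H \<Longrightarrow> y \<in> carrier H \<Longrightarrow> sw H (x \<oplus> y) g = sw H x g + sw H y g"
    "x \<in> carrier H \<Longrightarrow> sw H (c \<odot> x) g = c *\<^sub>k sw H x g"
  using sw_lin[OF assms] by (auto simp: lin_def)

lemmas lin_simps = lin_def lin2_def lin3_def H_distrib mult_smult_left mult_smult_right
  antipode_add antipode_smult op_lin_simps sw_add sw_scale fs.scale_right_distrib fs.scale_right_diff_distrib
  counit_add counit_smult fs.scale_left_distrib

lemma linD: "lin H g \<Longrightarrow> x \<in> carrier H \<Longrightarrow> y \<in> carrier H \<Longrightarrow> g (x \<oplus> y) = g x + g y"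
    "lin H g \<Longrightarrow> x \<in> carrier H \<Longrightarrow> g (c \<odot> x) = c *\<^sub>k g x"
  by (auto simp: lin_def)

lemma lin_tens_short:
  "lin H (\<lambda>x. tens H [x])"
  "a \<in> carrier H \<Longrightarrow> lin H (\<lambda>x. tens H [x, a])"
  "a \<in> carrier H \<Longrightarrow> lin H (\<lambda>x. tens H [a, x])"
  "a \<in> carrier H \<Longrightarrow> b \<in> carrier H \<Longrightarrow> lin H (\<lambda>x. tens H [x, a, b])"
  "a \<in> carrier H \<Longrightarrow> b \<in> carrier H \<Longrightarrow> lin H (\<lambda>x. tens H [a, x, b])"
  "a \<in> carrier H \<Longrightarrow> b \<in> carrier H \<Longrightarrow> lin H (\<lambda>x. tens H [a, b, x])"
  using lin_tens[of "[]" "[]"] lin_tens[of "[]" "[a]"] lin_tens[of "[a]" "[]"]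
    lin_tens[of "[]" "[a,b]"] lin_tens[of "[a]" "[b]"] lin_tens[of "[a,b]" "[]"] by auto

lemma tcat_tens:
  assumes "set xs \<subseteq> carrier H" "set ys \<subseteq> carrier H"
  shows "tcat H (tens H xs) (tens H ys) = tens H (xs @ ys)"
proof -
  have *: "tbind (tens H ys) (\<lambda>ys. tens H (zs @ ys)) = tens H (zs @ ys)" if "set zs \<subseteq> carrier H" for zs
    by (intro tbind_tens mlinI) (use lin_tens[of "zs @ _"] that in auto)
  have "mlin H (\<lambda>zs. tens H (zs @ ys))"
    by (rule mlinI) (use lin_tens[of _ "_ @ ys"] assms in auto)
  then have "mlin H (\<lambda>xs. tbind (tens H ys) (\<lambda>ys. tens H (xs @ ys)))"
    by (rule mlin_cong[rotated]) (use * in auto)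
  then show ?thesis
    unfolding tcat_def using *[OF assms(1)] by (subst tbind_tens) auto
qed

lemma linop_tcat: "linop (\<lambda>s. tcat H s t)"
  unfolding tcat_def by (intro linop_intros)

lemma linop_tcat_tens:
  assumes "set xs \<subseteq> carrier H" "t \<in> TT H"
  shows "tcat H (tens H xs) t = tbind t (\<lambda>ys. tens H (xs @ ys))"
proof -
  have l: "linop (\<lambda>t. tbind t (\<lambda>ys. tens H (zs @ ys)))" for zs by (intro linop_intros)
  have *: "tbind (tens H ys) (\<lambda>ys. tens H (zs @ ys)) = tens H (zs @ ys)"
    if "set zs \<subseteq> carrier H" "set ys \<subseteq> carrier H" for zs ys
    by (intro tbind_tens mlinI) (use lin_tens[of "zs @ _"] that in auto)
  have "mlin H (\<lambda>xs. tbind t (\<lambda>ys. tens H (xs @ ys)))"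
  proof (rule mlinI)
    fix xs zs assume xz: "set xs \<subseteq> carrier H" "set zs \<subseteq> carrier H"
    show "lin H (\<lambda>x. tbind t (\<lambda>ys. tens H ((xs @ x # zs) @ ys)))"
    proof (rule mlin_lin_TT[where f = "\<lambda>x t. tbind t (\<lambda>ys. tens H ((xs @ x # zs) @ ys))", OF _ l assms(2)])
      fix ys assume ys: "set ys \<subseteq> carrier H"
      show "lin H (\<lambda>x. tbind (tens H ys) (\<lambda>ys. tens H ((xs @ x # zs) @ ys)))"
      proof (rule lin_cong)
        fix x assume "x \<in> carrier H"
        then show "tbind (tens H ys) (\<lambda>ys. tens H ((xs @ x # zs) @ ys)) = tens H (xs @ x # (zs @ ys))"
          using *[of "xs @ x # zs" ys] ys xz by simp
      next
        show "lin H (\<lambda>x. tens H (xs @ x # (zs @ ys)))" by (rule lin_tens) (use xz ys in auto)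
      qed
    qed (simp add: ring.ring_simprules[OF ring_H])
  qed
  then show ?thesis unfolding tcat_def by (rule tbind_tens)
qed

lemma tcat_single_left: "x \<in> carrier H \<Longrightarrow> t \<in> TT H \<Longrightarrow> tcat H (tens H [x]) t = tpre H x t"
  by (simp add: linop_tcat_tens tpre_def)

lemma tcat_single_right:
  assumes "x \<in> carrier H" "t \<in> TT H" shows "tcat H t (tens H [x]) = tapp H t x"
  by (rule TT_eqI[OF linop_tcat linop_tapp[OF linop_id] _ assms(2)]) (use assms(1) in \<open>simp add: tcat_tens\<close>)

section \<open>The Hopf axioms as rules for Sweedler sums\<close>

lemma sw_coassoc:
  fixes g :: "'a \<Rightarrow> 'a \<Rightarrow> 'a \<Rightarrow> ('k, 'c) tensor"
  assumes x: "x \<in> carrier H" and g: "lin3 H g"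
  shows "sw H x (\<lambda>a b. sw H a (\<lambda>c d. g c d b)) = sw H x (\<lambda>a b. sw H b (\<lambda>c d. g a c d))"
proof -
  \<comment> \<open>Coassociativity is an identity of tensors of degree 3; the linear extension of
    \<open>g\<close> is applied to both of its sides.\<close>
  define G where "G = (\<lambda>l. if length l = 3 then g (l ! 0) (l ! 1) (l ! 2) else 0)"
  have G: "tbind (tens H l) G = G l" for l
    using tbind_tens[OF lin3_mlin[OF g]] by (simp add: G_def)
  have tG: "tbind (sw H x f) G = sw H x (\<lambda>a b. tbind (f a b) G)" for x f
    by (rule linop_of_sw) (intro linop_intros)
  have 1: "tcat H (comult H a) (tens H [b]) = sw H a (\<lambda>c d. tens H [c, d, b])"
    if "a \<in> carrier H" "b \<in> carrier H" for a b
    by (simp add: comult_sw that linop_of_sw[OF linop_tcat] tcat_tens)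
  have 2: "tcat H (tens H [a]) (comult H b) = sw H b (\<lambda>c d. tens H [a, c, d])"
    if "a \<in> carrier H" "b \<in> carrier H" for a b
    using that by (simp add: tcat_single_left comult_sw op_sw)
  have l: "lin2 H (\<lambda>a b. sw H a (\<lambda>c d. tens H [c, d, b]))" "lin2 H (\<lambda>a b. sw H b (\<lambda>c d. tens H [a, c, d]))"
    using lin_tens_short by (auto simp: lin2_def intro!: sw_lin lin_sw)
  have "tbind (comult H x) (\<lambda>h. tcat H (comult H (h ! 0)) (tens H [h ! 1])) =
      sw H x (\<lambda>a b. sw H a (\<lambda>c d. tens H [c, d, b]))"
    by (subst tbind_comult[OF x])
      (use l in \<open>auto simp: 1 lin2_def intro: lin_cong[where g = "\<lambda>a. sw H a (\<lambda>c d. tens H [c, d, _])"]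
        lin_cong[where g = "\<lambda>b. sw H _ (\<lambda>c d. tens H [c, d, b])"]\<close>)
  moreover have "tbind (comult H x) (\<lambda>h. tcat H (tens H [h ! 0]) (comult H (h ! 1))) =
      sw H x (\<lambda>a b. sw H b (\<lambda>c d. tens H [a, c, d]))"
    by (subst tbind_comult[OF x])
      (use l in \<open>auto simp: 2 lin2_def intro: lin_cong[where g = "\<lambda>a. sw H _ (\<lambda>c d. tens H [a, c, d])"]
        lin_cong[where g = "\<lambda>b. sw H b (\<lambda>c d. tens H [_, c, d])"]\<close>)
  ultimately have "tbind (sw H x (\<lambda>a b. sw H a (\<lambda>c d. tens H [c, d, b]))) G =
      tbind (sw H x (\<lambda>a b. sw H b (\<lambda>c d. tens H [a, c, d]))) G"
    using coassoc[OF x] by simp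
  then show ?thesis by (simp add: tG G) (simp add: G_def)
qed

lemma sw_counit_left:
  fixes g :: "'a \<Rightarrow> ('k, 'c) tensor"
  assumes x: "x \<in> carrier H" and g: "lin H g"
  shows "sw H x (\<lambda>a b. counit H a *\<^sub>k g b) = g x"
proof -
  define G where "G = (\<lambda>l. if length l = 1 then g (l ! 0) else 0)"
  have G: "tbind (tens H l) G = G l" for l
    using tbind_tens[OF lin1_mlin[OF g]] by (simp add: G_def)
  have tG: "tbind (sw H x f) G = sw H x (\<lambda>a b. tbind (f a b) G)" for x f
    by (rule linop_of_sw) (intro linop_intros)
  have tG': "tbind (c *\<^sub>k t) G = c *\<^sub>k tbind t G" for c t
    by (rule linop_scale) (intro linop_intros)
  have "sw H x (\<lambda>a b. counit H a *\<^sub>k tens H [b]) = tens H [x]"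
    using counit_left[OF x] tbind_comult2[OF x, of "\<lambda>a b. counit H a *\<^sub>k tens H [b]"] lin_tens_short(1)
    by (simp add: lin_simps mult.commute)
  then have "tbind (sw H x (\<lambda>a b. counit H a *\<^sub>k tens H [b])) G = tbind (tens H [x]) G" by simp
  then show ?thesis by (simp add: tG tG' G) (simp add: G_def)
qed

lemma sw_counit_right:
  fixes g :: "'a \<Rightarrow> ('k, 'c) tensor"
  assumes x: "x \<in> carrier H" and g: "lin H g"
  shows "sw H x (\<lambda>a b. counit H b *\<^sub>k g a) = g x"
proof -
  define G where "G = (\<lambda>l. if length l = 1 then g (l ! 0) else 0)"
  have G: "tbind (tens H l) G = G l" for l
    using tbind_tens[OF lin1_mlin[OF g]] by (simp add: G_def)
  have tG: "tbind (sw H x f) G = sw H x (\<lambda>a b. tbind (f a b) G)" for x f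
    by (rule linop_of_sw) (intro linop_intros)
  have tG': "tbind (c *\<^sub>k t) G = c *\<^sub>k tbind t G" for c t
    by (rule linop_scale) (intro linop_intros)
  have "sw H x (\<lambda>a b. counit H b *\<^sub>k tens H [a]) = tens H [x]"
    using counit_right[OF x] tbind_comult2[OF x, of "\<lambda>a b. counit H b *\<^sub>k tens H [a]"] lin_tens_short(1)
    by (simp add: lin_simps mult.commute)
  then have "tbind (sw H x (\<lambda>a b. counit H b *\<^sub>k tens H [a])) G = tbind (tens H [x]) G" by simp
  then show ?thesis by (simp add: tG tG' G) (simp add: G_def)
qed

lemma one_closed' [simp]: "\<one> \<in> carrier H" and mult_closed' [simp]: "x \<in> carrier H \<Longrightarrow> y \<in> carrier H \<Longrightarrow> x \<otimes> y \<in> carrier H"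
  and add_closed' [simp]: "x \<in> carrier H \<Longrightarrow> y \<in> carrier H \<Longrightarrow> x \<oplus> y \<in> carrier H"
  and mult_one' [simp]: "x \<in> carrier H \<Longrightarrow> \<one> \<otimes> x = x"  "x \<in> carrier H \<Longrightarrow> x \<otimes> \<one> = x"
  by (auto simp: ring.ring_simprules[OF ring_H] monoid.r_one[OF ring.is_monoid[OF ring_H]])

lemma mult_assoc': "x \<in> carrier H \<Longrightarrow> y \<in> carrier H \<Longrightarrow> z \<in> carrier H \<Longrightarrow> x \<otimes> y \<otimes> z = x \<otimes> (y \<otimes> z)"
  by (simp add: ring.ring_simprules[OF ring_H])

text \<open>Sums in the algebra are formed in a carrier, not in a type, so the contraction
  \<open>S(x_1) x_2 = \<epsilon>(x) 1\<close> is stated after an arbitrary linear map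
  \<open>g\<close> into tensors. The same holds for all identities about the antipode below.\<close>

lemma sw_antipode_left:
  fixes g :: "'a \<Rightarrow> ('k, 'c) tensor"
  assumes x: "x \<in> carrier H" and g: "lin H g"
  shows "sw H x (\<lambda>a b. g (antipode H a \<otimes> b)) = counit H x *\<^sub>k g \<one>"
proof -
  define G where "G = (\<lambda>l. if length l = 1 then g (l ! 0) else 0)"
  have G: "tbind (tens H l) G = G l" for l
    using tbind_tens[OF lin1_mlin[OF g]] by (simp add: G_def)
  have tG: "tbind (sw H x f) G = sw H x (\<lambda>a b. tbind (f a b) G)" for x f
    by (rule linop_of_sw) (intro linop_intros)
  have "sw H x (\<lambda>a b. tens H [antipode H a \<otimes> b]) = tens H [counit H x \<odot> \<one>]"
    using antipode_left[OF x] tbind_comult2[OF x, of "\<lambda>a b. tens H [antipode H a \<otimes> b]"] lin_tens_short(1)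
    by (simp add: lin_simps)
  then have "tbind (sw H x (\<lambda>a b. tens H [antipode H a \<otimes> b])) G = tbind (tens H [counit H x \<odot> \<one>]) G" by simp
  then show ?thesis using linD(2)[OF g] by (simp add: tG G) (simp add: G_def)
qed

lemma sw_antipode_right:
  fixes g :: "'a \<Rightarrow> ('k, 'c) tensor"
  assumes x: "x \<in> carrier H" and g: "lin H g"
  shows "sw H x (\<lambda>a b. g (a \<otimes> antipode H b)) = counit H x *\<^sub>k g \<one>"
proof -
  define G where "G = (\<lambda>l. if length l = 1 then g (l ! 0) else 0)"
  have G: "tbind (tens H l) G = G l" for l
    using tbind_tens[OF lin1_mlin[OF g]] by (simp add: G_def)
  have tG: "tbind (sw H x f) G = sw H x (\<lambda>a b. tbind (f a b) G)" for x f
    by (rule linop_of_sw) (intro linop_intros)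
  have "sw H x (\<lambda>a b. tens H [a \<otimes> antipode H b]) = tens H [counit H x \<odot> \<one>]"
    using antipode_right[OF x] tbind_comult2[OF x, of "\<lambda>a b. tens H [a \<otimes> antipode H b]"] lin_tens_short(1)
    by (simp add: lin_simps)
  then have "tbind (sw H x (\<lambda>a b. tens H [a \<otimes> antipode H b])) G = tbind (tens H [counit H x \<odot> \<one>]) G" by simp
  then show ?thesis using linD(2)[OF g] by (simp add: tG G) (simp add: G_def)
qed

lemma sw_of_tens_eq:
  fixes g :: "'a \<Rightarrow> 'a \<Rightarrow> ('k, 'c) tensor"
  assumes g: "lin2 H g"
  shows "tbind (tens H [a, b]) (\<lambda>l. if length l = 2 then g (l ! 0) (l ! 1) else 0) = g a b"
    "tbind (sw H x f) (\<lambda>l. if length l = 2 then g (l ! 0) (l ! 1) else 0) =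
       sw H x (\<lambda>a b. tbind (f a b) (\<lambda>l. if length l = 2 then g (l ! 0) (l ! 1) else 0))"
proof -
  show "tbind (tens H [a, b]) (\<lambda>l. if length l = 2 then g (l ! 0) (l ! 1) else 0) = g a b"
    using tbind_tens[OF lin2_mlin[OF g]] by simp
  show "tbind (sw H x f) (\<lambda>l. if length l = 2 then g (l ! 0) (l ! 1) else 0) =
       sw H x (\<lambda>a b. tbind (f a b) (\<lambda>l. if length l = 2 then g (l ! 0) (l ! 1) else 0))"
    by (rule linop_of_sw) (intro linop_intros)
qed

lemma sw_one:
  fixes g :: "'a \<Rightarrow> 'a \<Rightarrow> ('k, 'c) tensor"
  assumes g: "lin2 H g"
  shows "sw H \<one> g = g \<one> \<one>"
  using sw_of_tens_eq[OF g] comult_sw[OF one_closed'] comult_one by (metis (no_types, lifting) sw_cong)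

lemma sw_mult:
  fixes g :: "'a \<Rightarrow> 'a \<Rightarrow> ('k, 'c) tensor"
  assumes x: "x \<in> carrier H" and y: "y \<in> carrier H" and g: "lin2 H g"
  shows "sw H (x \<otimes> y) g = sw H x (\<lambda>a b. sw H y (\<lambda>c d. g (a \<otimes> c) (b \<otimes> d)))"
proof -
  have l: "lin2 H (\<lambda>a b. tens H [a, b])" using lin_tens_short by (simp add: lin2_def)
  have 2: "tbind (comult H y) (\<lambda>ys. tens H [a \<otimes> ys ! 0, b \<otimes> ys ! 1]) = sw H y (\<lambda>c d. tens H [a \<otimes> c, b \<otimes> d])"
    if "a \<in> carrier H" "b \<in> carrier H" for a b
    by (rule tbind_comult2[OF y, of "\<lambda>c d. tens H [a \<otimes> c, b \<otimes> d]"])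
      (use that l in \<open>auto simp: lin_simps\<close>)
  have "comult H (x \<otimes> y) = tbind (comult H x) (\<lambda>xs. tbind (comult H y) (\<lambda>ys. tens H [xs ! 0 \<otimes> ys ! 0, xs ! 1 \<otimes> ys ! 1]))"
    by (simp add: comult_mult x y tsquare_mult_def)
  also have "\<dots> = sw H x (\<lambda>a b. sw H y (\<lambda>c d. tens H [a \<otimes> c, b \<otimes> d]))"
    by (subst tbind_comult[OF x]) (use x y l in \<open>auto simp: 2[unfolded One_nat_def] lin_simps\<close>)
  finally have "sw H (x \<otimes> y) (\<lambda>a b. tens H [a, b]) = \<dots>"
    using x y by (simp add: comult_sw)
  then have "tbind (sw H (x \<otimes> y) (\<lambda>a b. tens H [a, b])) (\<lambda>l. if length l = 2 then g (l ! 0) (l ! 1) else 0) =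
     tbind (sw H x (\<lambda>a b. sw H y (\<lambda>c d. tens H [a \<otimes> c, b \<otimes> d]))) (\<lambda>l. if length l = 2 then g (l ! 0) (l ! 1) else 0)"
    by simp
  then show ?thesis by (simp only: sw_of_tens_eq[OF g])
qed

section \<open>The antipode as an antimorphism of algebras and coalgebras\<close>

lemma antipode_mult:
  fixes g :: "'a \<Rightarrow> ('k, 'c) tensor"
  assumes x: "x \<in> carrier H" and y: "y \<in> carrier H" and g: "lin H g"
  shows "g (antipode H (x \<otimes> y)) = g (antipode H y \<otimes> antipode H x)"
proof -
  let ?S = "antipode H"
  note gD = linD[OF g]
  \<comment> \<open>This is uniqueness of the convolution inverse of the multiplication. With
    \<open>a, p, q\<close> the parts of \<open>x\<close> and \<open>c, r, s\<close> those of
    \<open>y\<close>, the expression \<open>S(c) S(a) p r S(q s)\<close> is contracted in two ways: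
    cancelling \<open>p r S(q s)\<close> leaves \<open>S(y) S(x)\<close>, cancelling
    \<open>S(c) S(a) p r\<close> leaves \<open>S(x y)\<close>.\<close>
  define G where "G = (\<lambda>a p q c r s. g ((?S c \<otimes> ?S a) \<otimes> ((p \<otimes> r) \<otimes> ?S (q \<otimes> s))))"
  have 1: "counit H d *\<^sub>k counit H b *\<^sub>k g (?S c \<otimes> ?S a) = sw H b (\<lambda>p q. sw H d (\<lambda>r s. G a p q c r s))"
    if "a \<in> carrier H" "b \<in> carrier H" "c \<in> carrier H" "d \<in> carrier H" for a b c d
  proof -
    have "counit H (b \<otimes> d) *\<^sub>k g ((?S c \<otimes> ?S a) \<otimes> \<one>) = sw H (b \<otimes> d) (\<lambda>p q. g ((?S c \<otimes> ?S a) \<otimes> (p \<otimes> ?S q)))"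
      using that by (intro sw_antipode_right[symmetric, of "b \<otimes> d" "\<lambda>z. g ((?S c \<otimes> ?S a) \<otimes> z)"])
        (simp_all add: lin_simps gD)
    also have "\<dots> = sw H b (\<lambda>p q. sw H d (\<lambda>r s. G a p q c r s))"
      unfolding G_def using that by (intro sw_mult) (simp_all add: lin_simps gD)
    finally show ?thesis using that by (simp add: counit_mult mult.commute)
  qed
  have "g (?S y \<otimes> ?S x) = sw H x (\<lambda>a b. counit H b *\<^sub>k g (?S y \<otimes> ?S a))"
    by (rule sw_counit_right[symmetric]) (use x y in \<open>simp_all add: lin_simps gD\<close>)
  also have "\<dots> = sw H x (\<lambda>a b. sw H y (\<lambda>c d. counit H d *\<^sub>k counit H b *\<^sub>k g (?S c \<otimes> ?S a)))"
    by (intro sw_cong sw_counit_right[symmetric]) (use x y in \<open>simp_all add: lin_simps gD mult.commute\<close>)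
  also have "\<dots> = sw H x (\<lambda>a b. sw H y (\<lambda>c d. sw H b (\<lambda>p q. sw H d (\<lambda>r s. G a p q c r s))))"
    by (simp only: 1 cong: sw_cong)
  also have "\<dots> = sw H x (\<lambda>a b. sw H b (\<lambda>p q. sw H y (\<lambda>c d. sw H d (\<lambda>r s. G a p q c r s))))"
    by (rule sw_cong, rule sw_swap)
  also have "\<dots> = sw H x (\<lambda>w q. sw H w (\<lambda>a p. sw H y (\<lambda>c d. sw H d (\<lambda>r s. G a p q c r s))))"
    by (rule sw_coassoc[symmetric, OF x, of "\<lambda>a p q. sw H y (\<lambda>c d. sw H d (\<lambda>r s. G a p q c r s))"])
      (simp add: G_def lin_simps gD)
  also have "\<dots> = sw H x (\<lambda>w q. sw H w (\<lambda>a p. sw H y (\<lambda>v s. sw H v (\<lambda>c r. G a p q c r s))))"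
    by (rule sw_cong, rule sw_cong, rule sw_coassoc[symmetric, OF y])
      (simp add: G_def lin_simps gD)
  also have "\<dots> = sw H x (\<lambda>w q. sw H y (\<lambda>v s. sw H w (\<lambda>a p. sw H v (\<lambda>c r. G a p q c r s))))"
    by (rule sw_cong, rule sw_swap)
  also have "\<dots> = sw H x (\<lambda>w q. sw H y (\<lambda>v s. counit H w *\<^sub>k counit H v *\<^sub>k g (?S (q \<otimes> s))))"
  proof (rule sw_cong, rule sw_cong)
    fix w q v s assume *: "w \<in> carrier H" "q \<in> carrier H" "v \<in> carrier H" "s \<in> carrier H"
    have "sw H w (\<lambda>a p. sw H v (\<lambda>c r. G a p q c r s)) =
       sw H v (\<lambda>c r. sw H w (\<lambda>a p. g (?S c \<otimes> ((?S a \<otimes> p) \<otimes> (r \<otimes> ?S (q \<otimes> s))))))"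
      by (subst sw_swap) (use * in \<open>simp add: G_def mult_assoc'\<close>)
    also have "\<dots> = sw H v (\<lambda>c r. counit H w *\<^sub>k g (?S c \<otimes> (\<one> \<otimes> (r \<otimes> ?S (q \<otimes> s)))))"
      by (rule sw_cong, rule sw_antipode_left) (use * in \<open>simp_all add: lin_simps gD\<close>)
    also have "\<dots> = sw H v (\<lambda>c r. counit H w *\<^sub>k g ((?S c \<otimes> r) \<otimes> ?S (q \<otimes> s)))"
      using * by (simp add: mult_assoc')
    also have "\<dots> = counit H v *\<^sub>k (counit H w *\<^sub>k g (\<one> \<otimes> ?S (q \<otimes> s)))"
      by (rule sw_antipode_left) (use * in \<open>simp_all add: lin_simps gD mult.commute\<close>)
    finally show "sw H w (\<lambda>a p. sw H v (\<lambda>c r. G a p q c r s)) = counit H w *\<^sub>k counit H v *\<^sub>k g (?S (q \<otimes> s))"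
      using * by (simp add: mult.commute)
  qed
  also have "\<dots> = sw H x (\<lambda>w q. counit H w *\<^sub>k sw H y (\<lambda>v s. counit H v *\<^sub>k g (?S (q \<otimes> s))))"
    by (simp only: sw_scale)
  also have "\<dots> = sw H x (\<lambda>w q. counit H w *\<^sub>k g (?S (q \<otimes> y)))"
    by (intro sw_cong arg_cong[where f = "fscale _"] sw_counit_left)
      (use x y in \<open>simp_all add: lin_simps gD mult.commute\<close>)
  also have "\<dots> = g (?S (x \<otimes> y))"
    by (rule sw_counit_left) (use x y in \<open>simp_all add: lin_simps gD\<close>)
  finally show ?thesis ..
qed

lemma antipode_one:
  fixes g :: "'a \<Rightarrow> ('k, 'c) tensor"
  assumes g: "lin H g"
  shows "g (antipode H \<one>) = g \<one>"
proof -
  note gD = linD[OF g]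
  have "sw H \<one> (\<lambda>a b. g (antipode H a \<otimes> b)) = g (antipode H \<one> \<otimes> \<one>)"
    by (rule sw_one) (simp add: lin_simps gD)
  moreover have "sw H \<one> (\<lambda>a b. g (antipode H a \<otimes> b)) = counit H \<one> *\<^sub>k g \<one>"
    by (rule sw_antipode_left) (use g in auto)
  ultimately show ?thesis by (simp add: counit_one)
qed

lemma sw_antipode:
  fixes g :: "'a \<Rightarrow> 'a \<Rightarrow> ('k, 'c) tensor"
  assumes x: "x \<in> carrier H" and g: "lin2 H g"
  shows "sw H (antipode H x) g = sw H x (\<lambda>a b. g (antipode H b) (antipode H a))"
proof -
  let ?S = "antipode H"
  have gD: "g (a \<oplus> b) c = g a c + g b c" "g c (a \<oplus> b) = g c a + g c b"
    if "a \<in> carrier H" "b \<in> carrier H" "c \<in> carrier H" for a b c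
    using g that by (auto simp: lin2_def lin_def)
  have gD': "g (k \<odot> b) c = k *\<^sub>k g b c" "g c (k \<odot> b) = k *\<^sub>k g c b"
    if "b \<in> carrier H" "c \<in> carrier H" for k b c
    using g that by (auto simp: lin2_def lin_def)
  \<comment> \<open>Again a convolution inverse, now of the coproduct. The terms are
    \<open>S(b) c1 e1 \<otimes> S(a) c2 e2\<close>, where \<open>u, c, e\<close> are the three parts
    of \<open>x\<close>, \<open>a, b\<close> come from \<open>u\<close>, \<open>c1, c2\<close> from
    \<open>c\<close>, and \<open>e1, e2\<close> from \<open>S(e)\<close>. Contracting
    \<open>c S(e)\<close> leaves \<open>S(b) \<otimes> S(a)\<close>; contracting
    \<open>S(b) c1\<close> and then \<open>S(a) c2\<close> leaves the coproduct of
    \<open>S(e)\<close>.\<close>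
  define K where "K = (\<lambda>a b c1 c2 e1 e2. g ((?S b \<otimes> c1) \<otimes> e1) ((?S a \<otimes> c2) \<otimes> e2))"
  have "sw H x (\<lambda>a b. g (?S b) (?S a)) = sw H x (\<lambda>u v. counit H v *\<^sub>k sw H u (\<lambda>a b. g (?S b) (?S a)))"
    by (rule sw_counit_right[symmetric]) (use x in \<open>simp_all add: lin_simps gD gD'\<close>)
  also have "\<dots> = sw H x (\<lambda>u v. sw H v (\<lambda>c e. sw H u (\<lambda>a b. sw H c (\<lambda>c1 c2. sw H (?S e) (K a b c1 c2)))))"
  proof (rule sw_cong)
    fix u v assume *: "u \<in> carrier H" "v \<in> carrier H"
    have "counit H v *\<^sub>k sw H u (\<lambda>a b. g (?S b) (?S a)) =
       counit H v *\<^sub>k sw H \<one> (\<lambda>p q. sw H u (\<lambda>a b. g (?S b \<otimes> p) (?S a \<otimes> q)))"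
      using * by (subst sw_one) (simp_all add: lin_simps gD gD')
    also have "\<dots> = sw H v (\<lambda>c e. sw H (c \<otimes> ?S e) (\<lambda>p q. sw H u (\<lambda>a b. g (?S b \<otimes> p) (?S a \<otimes> q))))"
      using * by (intro sw_antipode_right[symmetric]) (simp_all add: lin_simps gD gD')
    also have "\<dots> = sw H v (\<lambda>c e. sw H c (\<lambda>c1 c2. sw H (?S e) (\<lambda>e1 e2. sw H u (\<lambda>a b. g (?S b \<otimes> (c1 \<otimes> e1)) (?S a \<otimes> (c2 \<otimes> e2))))))"
      using * by (intro sw_cong sw_mult) (simp_all add: lin_simps gD gD')
    also have "\<dots> = sw H v (\<lambda>c e. sw H c (\<lambda>c1 c2. sw H (?S e) (\<lambda>e1 e2. sw H u (\<lambda>a b. K a b c1 c2 e1 e2))))"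
      unfolding K_def using * by (intro sw_cong) (simp_all add: mult_assoc')
    also have "\<dots> = sw H v (\<lambda>c e. sw H c (\<lambda>c1 c2. sw H u (\<lambda>a b. sw H (?S e) (\<lambda>e1 e2. K a b c1 c2 e1 e2))))"
      by (rule sw_cong, rule sw_cong, rule sw_swap)
    also have "\<dots> = sw H v (\<lambda>c e. sw H u (\<lambda>a b. sw H c (\<lambda>c1 c2. sw H (?S e) (\<lambda>e1 e2. K a b c1 c2 e1 e2))))"
      by (rule sw_cong, rule sw_swap)
    finally show "counit H v *\<^sub>k sw H u (\<lambda>a b. g (?S b) (?S a)) =
        sw H v (\<lambda>c e. sw H u (\<lambda>a b. sw H c (\<lambda>c1 c2. sw H (?S e) (K a b c1 c2))))" .
  qed
  also have "\<dots> = sw H x (\<lambda>w e. sw H w (\<lambda>u c. sw H u (\<lambda>a b. sw H c (\<lambda>c1 c2. sw H (?S e) (K a b c1 c2)))))"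
    by (rule sw_coassoc[symmetric, OF x, of "\<lambda>u c e. sw H u (\<lambda>a b. sw H c (\<lambda>c1 c2. sw H (?S e) (K a b c1 c2)))"])
      (simp add: K_def lin_simps gD gD')
  also have "\<dots> = sw H x (\<lambda>w e. counit H w *\<^sub>k sw H (?S e) g)"
  proof (rule sw_cong)
    fix w e assume *: "w \<in> carrier H" "e \<in> carrier H"
    define L where "L = (\<lambda>a b c1 c2. sw H (?S e) (K a b c1 c2))"
    have "sw H w (\<lambda>u c. sw H u (\<lambda>a b. sw H c (\<lambda>c1 c2. L a b c1 c2))) =
        sw H w (\<lambda>a r. sw H r (\<lambda>b c. sw H c (\<lambda>c1 c2. L a b c1 c2)))"
      by (rule sw_coassoc[OF *(1), of "\<lambda>a b c. sw H c (\<lambda>c1 c2. L a b c1 c2)"])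
        (use * in \<open>simp add: L_def K_def lin_simps gD gD'\<close>)
    also have "\<dots> = sw H w (\<lambda>a r. sw H r (\<lambda>s c2. sw H s (\<lambda>b c1. L a b c1 c2)))"
      by (rule sw_cong, rule sw_coassoc[symmetric])
        (use * in \<open>simp_all add: L_def K_def lin_simps gD gD'\<close>)
    also have "\<dots> = sw H w (\<lambda>a r. sw H r (\<lambda>s c2. counit H s *\<^sub>k sw H (?S e) (\<lambda>e1 e2. g (\<one> \<otimes> e1) ((?S a \<otimes> c2) \<otimes> e2))))"
      unfolding L_def K_def
      by (rule sw_cong, rule sw_cong,
          rule sw_antipode_left[where g = "\<lambda>z. sw H (?S e) (\<lambda>e1 e2. g (z \<otimes> e1) ((?S _ \<otimes> _) \<otimes> e2))"])
        (use * in \<open>simp_all add: lin_simps gD gD'\<close>)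
    also have "\<dots> = sw H w (\<lambda>a r. sw H (?S e) (\<lambda>e1 e2. g (\<one> \<otimes> e1) ((?S a \<otimes> r) \<otimes> e2)))"
      by (rule sw_cong, rule sw_counit_left) (use * in \<open>simp_all add: lin_simps gD gD'\<close>)
    also have "\<dots> = counit H w *\<^sub>k sw H (?S e) (\<lambda>e1 e2. g (\<one> \<otimes> e1) (\<one> \<otimes> e2))"
      by (rule sw_antipode_left[where g = "\<lambda>z. sw H (?S e) (\<lambda>e1 e2. g (\<one> \<otimes> e1) (z \<otimes> e2))"])
        (use * in \<open>simp_all add: lin_simps gD gD'\<close>)
    finally show "sw H w (\<lambda>u c. sw H u (\<lambda>a b. sw H c (\<lambda>c1 c2. sw H (?S e) (K a b c1 c2)))) = counit H w *\<^sub>k sw H (?S e) g"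
      by (simp add: L_def)
  qed
  also have "\<dots> = sw H (?S x) g"
    by (rule sw_counit_left) (use x g in \<open>simp_all add: lin_simps gD gD'\<close>)
  finally show ?thesis ..
qed

end

section \<open>Operators on tensors\<close>

text \<open>On all tensors, \<open>tphi\<close> is the comparison map of the header, \<open>tpsi\<close> its inverse on coinvariants,
  \<open>tcor\<close> the right coaction, \<open>tins\<close> the differential \<open>d\<close>, \<open>tE\<close> the operator \<open>b'\<close>, \<open>trot\<close> the cyclic
  permutation and \<open>tsg i\<close> the codegeneracy that multiplies the factors \<open>i\<close> and \<open>i + 1\<close>.\<close>

definition tdiag :: "('k::field, 'a) hopf \<Rightarrow> 'a \<Rightarrow> ('k, 'a) tensor \<Rightarrow> ('k, 'a) tensor"
  where "tdiag H h t = tbind t (diag_act H h)"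

fun philist :: "('k::field, 'a) hopf \<Rightarrow> 'a list \<Rightarrow> ('k, 'a) tensor" where
  "philist H [] = tens H [\<one>\<^bsub>H\<^esub>]"
| "philist H (h # hs) = sw H h (\<lambda>a b. tpre H a (tlm H (antipode H b) (philist H hs)))"

definition tphi :: "('k::field, 'a) hopf \<Rightarrow> ('k, 'a) tensor \<Rightarrow> ('k, 'a) tensor"
  where "tphi H t = tbind t (philist H)"

fun psilist :: "('k::field, 'a) hopf \<Rightarrow> 'a list \<Rightarrow> ('k, 'a) tensor" where
  "psilist H [] = 0"
| "psilist H [x] = tdiag H x (tens H [])"
| "psilist H (x # y # ys) = tdiag H x (tpre H \<one>\<^bsub>H\<^esub> (psilist H (y # ys)))"

definition tpsi :: "('k::field, 'a) hopf \<Rightarrow> ('k, 'a) tensor \<Rightarrow> ('k, 'a) tensor"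
  where "tpsi H t = tbind t (psilist H)"

fun corlist :: "('k::field, 'a) hopf \<Rightarrow> 'a list \<Rightarrow> ('k, 'a) tensor" where
  "corlist H [] = tens H [\<one>\<^bsub>H\<^esub>]"
| "corlist H (x # xs) = sw H x (\<lambda>a b. tpre H a (tll H b (corlist H xs)))"

definition tcor :: "('k::field, 'a) hopf \<Rightarrow> ('k, 'a) tensor \<Rightarrow> ('k, 'a) tensor"
  where "tcor H t = tbind t (corlist H)"

fun inslist :: "('k::field, 'a) hopf \<Rightarrow> 'a list \<Rightarrow> ('k, 'a) tensor" where
  "inslist H [] = tens H [\<one>\<^bsub>H\<^esub>]"
| "inslist H (x # xs) = tens H (\<one>\<^bsub>H\<^esub> # x # xs) - tpre H x (inslist H xs)"

definition tins :: "('k::field, 'a) hopf \<Rightarrow> ('k, 'a) tensor \<Rightarrow> ('k, 'a) tensor"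
  where "tins H t = tbind t (inslist H)"

definition tE :: "('k::field, 'a) hopf \<Rightarrow> ('k, 'a) tensor \<Rightarrow> ('k, 'a) tensor"
  where "tE H t = tbind t (\<lambda>xs. case xs of [] \<Rightarrow> 0 | x # xs \<Rightarrow> trm H x (tens H xs))"

definition trot :: "('k::field, 'a) hopf \<Rightarrow> ('k, 'a) tensor \<Rightarrow> ('k, 'a) tensor"
  where "trot H t = tbind t (\<lambda>xs. case xs of [] \<Rightarrow> tens H [] | x # xs \<Rightarrow> tens H (xs @ [x]))"

fun sglist :: "('k::field, 'a) hopf \<Rightarrow> nat \<Rightarrow> 'a list \<Rightarrow> ('k, 'a) tensor" where
  "sglist H i [] = 0"
| "sglist H 0 (x # xs) = tlm H x (tens H xs)"
| "sglist H (Suc i) (x # xs) = tpre H x (sglist H i xs)"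

definition tsg :: "('k::field, 'a) hopf \<Rightarrow> nat \<Rightarrow> ('k, 'a) tensor \<Rightarrow> ('k, 'a) tensor"
  where "tsg H i t = tbind t (sglist H i)"

definition tmulS :: "('k::field, 'a) hopf \<Rightarrow> ('k, 'a) tensor \<Rightarrow> ('k, 'a) tensor"
  where "tmulS H t = tbind t (\<lambda>xs. if xs = [] then 0 else trm H (antipode H (last xs)) (tens H (butlast xs)))"

lemma linop_ops [linop_intros]:
  assumes "linop F"
  shows "linop (\<lambda>t. tdiag H h (F t))" "linop (\<lambda>t. tphi H (F t))" "linop (\<lambda>t. tpsi H (F t))"
    "linop (\<lambda>t. tcor H (F t))" "linop (\<lambda>t. tins H (F t))" "linop (\<lambda>t. tE H (F t))"
    "linop (\<lambda>t. trot H (F t))" "linop (\<lambda>t. tsg H i (F t))" "linop (\<lambda>t. tmulS H (F t))"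
  unfolding tdiag_def tphi_def tpsi_def tcor_def tins_def tE_def trot_def tsg_def tmulS_def
  by (intro linop_intros assms)+

lemmas linop_basic = linop_ops[OF linop_id]

lemmas op_lin_simps2 = linop_basic[THEN linop_add] linop_basic[THEN linop_scale]
  linop_basic[THEN linop_zero] linop_basic[THEN linop_diff] linop_basic[THEN linop_minus]

lemmas op_sw2 = linop_basic[THEN linop_of_sw]

text \<open>The tensors of positive degree. Multiplication into an end factor sends the empty tensor
  to \<open>0\<close>, so unit laws and the commutation of such operators with adding a factor at
  the other end hold here but fail on all of \<open>TT\<close>.\<close>

definition TN :: "('k::field, 'a, 'm) module_scheme \<Rightarrow> ('k, 'a) tensor set"
  where "TN M = fs.span {tens M xs | xs. set xs \<subseteq> carrier M \<and> xs \<noteq> []}"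

lemma TN_subspace: "fs.subspace (TN M)" by (simp add: TN_def)

lemma TN_TT: "t \<in> TN M \<Longrightarrow> t \<in> TT M"
  unfolding TN_def TT_def by (erule rev_subsetD, rule fs.span_mono) auto

lemma tpower_TN: "t \<in> tpower M n \<Longrightarrow> n > 0 \<Longrightarrow> t \<in> TN M"
  unfolding TN_def tpower_def by (erule rev_subsetD, rule fs.span_mono) auto

lemma tens_in_TN: "set xs \<subseteq> carrier M \<Longrightarrow> xs \<noteq> [] \<Longrightarrow> tens M xs \<in> TN M"
  unfolding TN_def by (rule fs.span_base) auto

lemma TN_eqI:
  assumes "linop f" "linop g"
    "\<And>x xs. x \<in> carrier M \<Longrightarrow> set xs \<subseteq> carrier M \<Longrightarrow> f (tens M (x # xs)) = g (tens M (x # xs))" "t \<in> TN M"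
  shows "f t = g t"
proof (rule linop_eq_on_span[OF assms(1,2) _ assms(4)[unfolded TN_def]])
  fix t assume "t \<in> {tens M xs |xs. set xs \<subseteq> carrier M \<and> xs \<noteq> []}"
  then show "f t = g t" by (auto simp: neq_Nil_conv assms(3))
qed

lemma TN_into:
  assumes "linop f" "fs.subspace W"
    "\<And>x xs. x \<in> carrier M \<Longrightarrow> set xs \<subseteq> carrier M \<Longrightarrow> f (tens M (x # xs)) \<in> W" "t \<in> TN M"
  shows "f t \<in> W"
proof (rule linop_span_into[OF assms(1,2) _ assms(4)[unfolded TN_def]])
  fix t assume "t \<in> {tens M xs |xs. set xs \<subseteq> carrier M \<and> xs \<noteq> []}"
  then show "f t \<in> W" by (auto simp: neq_Nil_conv assms(3))
qed

context hopf_algebra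
begin

lemma mlin_Cons:
  assumes f: "\<And>x xs. x \<in> carrier H \<Longrightarrow> set xs \<subseteq> carrier H \<Longrightarrow> f (x # xs) = A x (g xs)"
    and A: "\<And>x. linop (A x)" and l: "\<And>xs. set xs \<subseteq> carrier H \<Longrightarrow> lin H (\<lambda>x. A x (g xs))" and g: "mlin H g"
  shows "mlin H f"
proof (rule mlinI)
  fix xs ys assume *: "set xs \<subseteq> carrier H" "set ys \<subseteq> carrier H"
  show "lin H (\<lambda>x. f (xs @ x # ys))"
  proof (cases xs)
    case Nil
    then show ?thesis using * l[of ys] by (simp add: lin_def f)
  next
    case (Cons z zs)
    then show ?thesis using * linop_lin[OF A mlinD[OF g], of zs ys z] by (simp add: lin_def f)
  qed
qed

text \<open>For functions defined by recursion along the list, with \<open>B\<close> the part of the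
  value that does not recur. Linearity in the head is \<open>l\<close>; linearity in later entries
  is inherited since \<open>A x\<close> is linear in the recursive value.\<close>

lemma mlin_rec:
  assumes f: "\<And>x xs. x \<in> carrier H \<Longrightarrow> set xs \<subseteq> carrier H \<Longrightarrow> f (x # xs) = B (x # xs) + A x (f xs)"
    and A: "\<And>x. linop (A x)" and l: "\<And>xs. set xs \<subseteq> carrier H \<Longrightarrow> lin H (\<lambda>x. A x (f xs))" and B: "mlin H B"
  shows "mlin H f"
proof (rule mlinI)
  fix xs ys assume *: "set xs \<subseteq> carrier H" "set ys \<subseteq> carrier H"
  then show "lin H (\<lambda>x. f (xs @ x # ys))"
  proof (induction xs)
    case Nil
    then have "lin H (\<lambda>x. B ([] @ x # ys) + A x (f ys))"
      by (intro lin_add l mlinD[OF B]) auto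
    then show ?case using Nil by (simp add: lin_def f)
  next
    case (Cons z zs)
    then have "lin H (\<lambda>x. B ((z # zs) @ x # ys) + A z (f (zs @ x # ys)))"
      by (intro lin_add linop_lin[OF A] mlinD[OF B]) auto
    then show ?case using Cons.prems by (simp add: lin_def f)
  qed
qed

lemma mlin_0: "mlin H (\<lambda>x. 0)" by (simp add: mlin_def lin_0)

text \<open>The three claims depend on each other: rewriting \<open>tbind\<close> of the coproduct
  as a Sweedler sum uses linearity in \<open>h\<close> of the action on the tail, and replacing
  \<open>tcat\<close> by \<open>tpre\<close> uses that its values are tensors.\<close>

lemma diag_act_aux:
  assumes "set xs \<subseteq> carrier H"
  shows "lin H (\<lambda>h. diag_act H h xs) \<and> (\<forall>h\<in>carrier H. diag_act H h xs \<in> tpower H (length xs)) \<and>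
    (\<forall>h\<in>carrier H. \<forall>y ys. xs = y # ys \<longrightarrow> diag_act H h xs = sw H h (\<lambda>a b. tpre H (a \<otimes> y) (diag_act H b ys)))"
  using assms
proof (induction xs)
  case Nil
  have "tens H [] \<in> tpower H 0" by (rule tens_in_tpower) auto
  then show ?case using tpower_subspace[of H 0] by (auto simp: lin_simps fs.subspace_scale)
next
  case (Cons x xs)
  then have x: "x \<in> carrier H" and IH: "lin H (\<lambda>h. diag_act H h xs)"
    "\<And>h. h \<in> carrier H \<Longrightarrow> diag_act H h xs \<in> tpower H (length xs)" by auto
  note T = tpower_TT[OF IH(2)]
  have l: "lin2 H (\<lambda>a b. tpre H (a \<otimes> x) (diag_act H b xs))"
    unfolding lin2_def
    using x op_lin(1)[OF T] linop_lin[OF linop_tpre[OF linop_id] IH(1)] T by (auto simp: lin_simps)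
  have eq: "diag_act H h (x # xs) = sw H h (\<lambda>a b. tpre H (a \<otimes> x) (diag_act H b xs))" if h: "h \<in> carrier H" for h
  proof -
    have eq: "tcat H (tens H [a \<otimes> x]) (diag_act H b xs) = tpre H (a \<otimes> x) (diag_act H b xs)"
      if "a \<in> carrier H" "b \<in> carrier H" for a b
      by (rule tcat_single_left) (use x that T in auto)
    show ?thesis
      unfolding diag_act.simps
      by (subst tbind_comult[OF h])
        (use l x in \<open>auto simp: eq lin2_def intro: lin_cong[where g = "\<lambda>a. tpre H (a \<otimes> x) (diag_act H _ xs)"]
          lin_cong[where g = "\<lambda>b. tpre H (_ \<otimes> x) (diag_act H b xs)"]\<close>)
  qed
  have "diag_act H h (x # xs) \<in> tpower H (length (x # xs))" if h: "h \<in> carrier H" for h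
    unfolding eq[OF h]
  proof (intro sw_into tpower_subspace)
    fix a b assume "a \<in> carrier H" "b \<in> carrier H"
    then show "tpre H (a \<otimes> x) (diag_act H b xs) \<in> tpower H (length (x # xs))"
      using x by (intro tpower_into[OF linop_tpre[OF linop_id] tpower_subspace _ IH(2)])
        (auto intro!: tens_in_tpower)
  qed
  moreover have "lin H (\<lambda>h. diag_act H h (x # xs))"
    by (rule lin_cong[OF eq sw_lin[OF l]])
  ultimately show ?case using eq by auto
qed

lemma diag_act_Cons: "h \<in> carrier H \<Longrightarrow> x \<in> carrier H \<Longrightarrow> set xs \<subseteq> carrier H \<Longrightarrow>
    diag_act H h (x # xs) = sw H h (\<lambda>a b. tpre H (a \<otimes> x) (diag_act H b xs))"
  using diag_act_aux[of "x # xs"] by auto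

lemma diag_act_lin: "set xs \<subseteq> carrier H \<Longrightarrow> lin H (\<lambda>h. diag_act H h xs)"
  using diag_act_aux by blast

lemma mlin_diag_act: "h \<in> carrier H \<Longrightarrow> mlin H (diag_act H h)"
proof (rule mlinI)
  fix xs ys assume "set xs \<subseteq> carrier H" "set ys \<subseteq> carrier H" "h \<in> carrier H"
  then show "lin H (\<lambda>x. diag_act H h (xs @ x # ys))"
  proof (induction xs arbitrary: h)
    case Nil
    then have T: "diag_act H b ys \<in> TT H" if "b \<in> carrier H" for b
      using diag_act_aux that tpower_TT by blast
    have "lin H (\<lambda>x. sw H h (\<lambda>a b. tpre H (a \<otimes> x) (diag_act H b ys)))"
      by (rule lin_sw) (use T in \<open>simp add: lin_simps\<close>)
    then show ?case using Nil by (simp del: diag_act.simps add: lin_def diag_act_Cons)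
  next
    case (Cons z zs)
    have "lin H (\<lambda>x. sw H h (\<lambda>a b. tpre H (a \<otimes> z) (diag_act H b (zs @ x # ys))))"
      by (intro lin_sw linop_lin[OF linop_tpre[OF linop_id]]) (use Cons in auto)
    then show ?case using Cons by (simp del: diag_act.simps add: lin_def diag_act_Cons)
  qed
qed

lemma tdiag_tens: "h \<in> carrier H \<Longrightarrow> tdiag H h (tens H xs) = diag_act H h xs"
  unfolding tdiag_def by (rule tbind_tens[OF mlin_diag_act])

lemma tdiag_Nil [simp]: "h \<in> carrier H \<Longrightarrow> tdiag H h (tens H []) = counit H h *\<^sub>k tens H []"
  by (simp add: tdiag_tens)

lemma tdiag_tpre [simp]:
  assumes "h \<in> carrier H" "x \<in> carrier H" "t \<in> TT H"
  shows "tdiag H h (tpre H x t) = sw H h (\<lambda>a b. tpre H (a \<otimes> x) (tdiag H b t))"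
  by (rule TT_eqI[OF _ _ _ assms(3)])
    (use assms(1,2) in \<open>auto intro!: linop_intros simp del: diag_act.simps simp: tdiag_tens diag_act_Cons\<close>)

lemma tens_Cons: "x \<in> carrier H \<Longrightarrow> tens H (x # xs) = tpre H x (tens H xs)"
  by simp

lemma tpower_ops [simp]:
  assumes "t \<in> tpower H n"
  shows "x \<in> carrier H \<Longrightarrow> tpre H x t \<in> tpower H (Suc n)"
    "x \<in> carrier H \<Longrightarrow> tapp H t x \<in> tpower H (Suc n)"
    "x \<in> carrier H \<Longrightarrow> tlm H x t \<in> tpower H n"
    "x \<in> carrier H \<Longrightarrow> trm H x t \<in> tpower H n"
    "x \<in> carrier H \<Longrightarrow> tll H x t \<in> tpower H n"
    "x \<in> carrier H \<Longrightarrow> tdiag H x t \<in> tpower H n"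
proof -
  assume x: "x \<in> carrier H"
  note [simp] = x last_in_carrier set_butlast_carrier
  note [intro!] = linop_intros tens_in_tpower
  show "tpre H x t \<in> tpower H (Suc n)" "tapp H t x \<in> tpower H (Suc n)"
    by (rule tpower_into[OF _ tpower_subspace _ assms]; auto)+
  show "tdiag H x t \<in> tpower H n"
  proof (rule tpower_into[OF _ tpower_subspace _ assms])
    fix xs assume "set xs \<subseteq> carrier H" "length xs = n"
    then show "tdiag H x (tens H xs) \<in> tpower H n"
      using diag_act_aux[of xs] x by (auto simp: tdiag_tens simp del: diag_act.simps)
  qed auto
  have 0: "0 \<in> tpower H n" by (rule fs.subspace_0[OF tpower_subspace])
  have tl: "tlm H x (tens H xs) \<in> tpower H n" "trm H x (tens H xs) \<in> tpower H n" "tll H x (tens H xs) \<in> tpower H n"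
    if xs: "set xs \<subseteq> carrier H" "length xs = n" for xs
  proof -
    have "tlm H x (tens H xs) \<in> tpower H n \<and> trm H x (tens H xs) \<in> tpower H n \<and> tll H x (tens H xs) \<in> tpower H n"
    proof (cases xs)
      case Nil
      then show ?thesis using 0 by simp
    next
      case (Cons y ys)
      have "tens H ((x \<otimes> y) # ys) \<in> tpower H n"
        "tens H (butlast xs @ [last xs \<otimes> x]) \<in> tpower H n" "tens H (butlast xs @ [x \<otimes> last xs]) \<in> tpower H n"
        by (rule tens_in_tpower; use xs Cons in \<open>auto split: if_splits\<close>)+
      then show ?thesis using Cons by (auto split: if_splits)
    qed
    then show "tlm H x (tens H xs) \<in> tpower H n" "trm H x (tens H xs) \<in> tpower H n" "tll H x (tens H xs) \<in> tpower H n"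
      by blast+
  qed
  show "tlm H x t \<in> tpower H n"
    by (rule tpower_into[OF linop_tlm[OF linop_id] tpower_subspace tl(1) assms])
  show "trm H x t \<in> tpower H n"
    by (rule tpower_into[OF linop_trm[OF linop_id] tpower_subspace tl(2) assms])
  show "tll H x t \<in> tpower H n"
    by (rule tpower_into[OF linop_tll[OF linop_id] tpower_subspace tl(3) assms])
qed

lemma tdiag_TT [simp]:
  assumes "x \<in> carrier H" "t \<in> TT H"
  shows "tdiag H x t \<in> TT H"
proof (rule TT_induct_into[OF linop_basic(1) assms(2)])
  fix xs assume "set xs \<subseteq> carrier H"
  from tpower_TT[OF tpower_ops(6)[OF tens_in_tpower[OF this refl] assms(1)]]
  show "tdiag H x (tens H xs) \<in> TT H" .
qed

lemma tdiag_lin: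
  assumes t: "t \<in> TT H"
  shows " lin H (\<lambda>h. tdiag H h t)"
  by (rule mlin_lin_TT[where f = "tdiag H", OF _ linop_basic(1) t])
    (use tdiag_tens diag_act_lin in \<open>auto simp: lin_def simp del: diag_act.simps\<close>)

lemmas tdiag_arg [simp] = tdiag_lin[unfolded lin_def, THEN conjunct1, rule_format]
  tdiag_lin[unfolded lin_def, THEN conjunct2, rule_format]

lemma TT_list_induct [consumes 1, case_names Nil Cons]:
  assumes "set xs \<subseteq> carrier H" "P []"
    "\<And>x xs. x \<in> carrier H \<Longrightarrow> set xs \<subseteq> carrier H \<Longrightarrow> P xs \<Longrightarrow> P (x # xs)"
  shows "P xs"
  using assms(1) by (induction xs) (auto intro: assms)

text \<open>This is multiplicativity of the coproduct, applied once for each factor;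
  \<open>sw_swap\<close> sorts the parts of \<open>x\<close> and of \<open>y\<close>.\<close>

lemma tdiag_mult:
  assumes x: "x \<in> carrier H" and y: "y \<in> carrier H" and t: "t \<in> TT H"
  shows "tdiag H (x \<otimes> y) t = tdiag H x (tdiag H y t)"
proof -
  have "tdiag H (x \<otimes> y) (tens H xs) = tdiag H x (tdiag H y (tens H xs))" if "set xs \<subseteq> carrier H" for xs
    using that x y
  proof (induction arbitrary: x y rule: TT_list_induct)
    case Nil
    then show ?case by (simp add: counit_mult op_lin_simps2 mult.commute)
  next
    case (Cons z zs)
    have "tdiag H (x \<otimes> y) (tens H (z # zs)) =
        sw H (x \<otimes> y) (\<lambda>a b. tpre H (a \<otimes> z) (tdiag H b (tens H zs)))"
      using Cons by (simp add: tens_Cons del: tpre_tens)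
    also have "\<dots> = sw H x (\<lambda>a b. sw H y (\<lambda>c d. tpre H (a \<otimes> (c \<otimes> z)) (tdiag H b (tdiag H d (tens H zs)))))"
      using Cons by (subst sw_mult) (auto simp: lin_simps mult_assoc')
    also have "\<dots> = tdiag H x (tdiag H y (tens H (z # zs)))"
      using Cons by (subst sw_swap) (simp add: tens_Cons op_sw2 del: tpre_tens)
    finally show ?case .
  qed
  then show ?thesis
    by (intro TT_eqI[OF linop_basic(1) linop_ops(1)[OF linop_basic(1)] _ t]) auto
qed

lemma tdiag_one:
  assumes t: "t \<in> TT H"
  shows "tdiag H \<one> t = t"
proof -
  have "tdiag H \<one> (tens H xs) = tens H xs" if "set xs \<subseteq> carrier H" for xs
    using that
  proof (induction rule: TT_list_induct)
    case (Cons z zs)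
    have "tdiag H \<one> (tens H (z # zs)) = tpre H (\<one> \<otimes> z) (tdiag H \<one> (tens H zs))"
      using Cons by (simp add: tens_Cons del: tpre_tens) (subst sw_one, auto simp: lin_simps)
    then show ?case using Cons by simp
  qed (simp add: counit_one)
  then show ?thesis
    by (intro TT_eqI[OF linop_basic(1) linop_id _ t]) auto
qed

declare diag_act.simps(2) [simp del]

declare last_in_carrier [simp] set_butlast_carrier [simp]

lemma op_comm_TT:
  assumes "t \<in> TT H" "c \<in> carrier H" "d \<in> carrier H"
  shows "tlm H c (tpre H d t) = tpre H (c \<otimes> d) t"
    "tlm H c (tlm H d t) = tlm H (c \<otimes> d) t"
    "trm H c (trm H d t) = trm H (d \<otimes> c) t"
    "tll H c (tll H d t) = tll H (c \<otimes> d) t"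
    "tlm H c (trm H d t) = trm H d (tlm H c t)"
    "tapp H (tpre H c t) d = tpre H c (tapp H t d)"
    "trm H c (tapp H t d) = tapp H t (d \<otimes> c)"
    "tll H c (tapp H t d) = tapp H t (c \<otimes> d)"
proof -
  note [simp] = assms(2,3) mult_assoc'
  note eq = TT_eqI[OF _ _ _ assms(1)]
  show "tlm H c (tpre H d t) = tpre H (c \<otimes> d) t" by (rule eq) (auto intro!: linop_intros)
  show "tapp H (tpre H c t) d = tpre H c (tapp H t d)" by (rule eq) (auto intro!: linop_intros)
  show "trm H c (tapp H t d) = tapp H t (d \<otimes> c)" by (rule eq) (auto intro!: linop_intros)
  show "tll H c (tapp H t d) = tapp H t (c \<otimes> d)" by (rule eq) (auto intro!: linop_intros)
  show "tlm H c (tlm H d t) = tlm H (c \<otimes> d) t"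
  proof (rule eq)
    fix xs assume "set xs \<subseteq> carrier H"
    then show "tlm H c (tlm H d (tens H xs)) = tlm H (c \<otimes> d) (tens H xs)"
      by (cases xs) (auto simp: op_lin_simps)
  qed (intro linop_intros)+
  show "trm H c (trm H d t) = trm H (d \<otimes> c) t"
  proof (rule eq)
    fix xs assume "set xs \<subseteq> carrier H"
    then show "trm H c (trm H d (tens H xs)) = trm H (d \<otimes> c) (tens H xs)"
      by (cases xs rule: rev_cases) (auto simp: op_lin_simps)
  qed (intro linop_intros)+
  show "tll H c (tll H d t) = tll H (c \<otimes> d) t"
  proof (rule eq)
    fix xs assume "set xs \<subseteq> carrier H"
    then show "tll H c (tll H d (tens H xs)) = tll H (c \<otimes> d) (tens H xs)"
      by (cases xs rule: rev_cases) (auto simp: op_lin_simps)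
  qed (intro linop_intros)+
  show "tlm H c (trm H d t) = trm H d (tlm H c t)"
  proof (rule eq)
    fix xs assume "set xs \<subseteq> carrier H"
    then show "tlm H c (trm H d (tens H xs)) = trm H d (tlm H c (tens H xs))"
      by (cases xs) (auto simp: op_lin_simps)
  qed (intro linop_intros)+
qed

lemma op_comm_TN:
  assumes "t \<in> TN H" "c \<in> carrier H" "d \<in> carrier H"
  shows "trm H c (tpre H d t) = tpre H d (trm H c t)"
    "tll H c (tpre H d t) = tpre H d (tll H c t)"
    "tlm H c (tapp H t d) = tapp H (tlm H c t) d"
proof -
  note [simp] = assms(2,3)
  note eq = TN_eqI[OF _ _ _ assms(1)]
  show "trm H c (tpre H d t) = tpre H d (trm H c t)" by (rule eq) (auto intro!: linop_intros)
  show "tll H c (tpre H d t) = tpre H d (tll H c t)" by (rule eq) (auto intro!: linop_intros)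
  show "tlm H c (tapp H t d) = tapp H (tlm H c t) d" by (rule eq) (auto intro!: linop_intros)
qed

lemma op_one:
  assumes "t \<in> TN H"
  shows "tlm H \<one> t = t" "trm H \<one> t = t" "tll H \<one> t = t"
proof -
  note eq = TN_eqI[OF _ _ _ assms(1)]
  have *: "y # butlast ys @ [last ys] = y # ys" if "ys \<noteq> []" for y and ys :: "'a list"
    using that by simp
  show "tlm H \<one> t = t" by (rule eq) (auto intro!: linop_intros)
  show "trm H \<one> t = t" by (rule eq) (auto intro!: linop_intros)
  show "tll H \<one> t = t" by (rule eq) (auto intro!: linop_intros)
qed

lemma TN_0 [simp]: "0 \<in> TN H" and TN_add [simp]: "s \<in> TN H \<Longrightarrow> t \<in> TN H \<Longrightarrow> s + t \<in> TN H"
  and TN_diff [simp]: "s \<in> TN H \<Longrightarrow> t \<in> TN H \<Longrightarrow> s - t \<in> TN H"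
  and TN_neg [simp]: "s \<in> TN H \<Longrightarrow> - s \<in> TN H"
  and TN_scale [simp]: "s \<in> TN H \<Longrightarrow> c *\<^sub>k s \<in> TN H"
  and TN_sw [simp]: "(\<And>a b. a \<in> carrier H \<Longrightarrow> b \<in> carrier H \<Longrightarrow> g a b \<in> TN H) \<Longrightarrow> sw H x g \<in> TN H"
  and TN_TT' [simp]: "t \<in> TN H \<Longrightarrow> t \<in> TT H"
  and tens_TN [simp]: "set xs \<subseteq> carrier H \<Longrightarrow> xs \<noteq> [] \<Longrightarrow> tens H xs \<in> TN H"
  using TN_subspace[of H] by (auto simp: fs.subspace_0 fs.subspace_add fs.subspace_diff
    fs.subspace_scale fs.subspace_neg tens_in_TN intro: sw_into[OF TN_subspace] TN_TT)

lemma tpre_TN [simp]: "t \<in> TT H \<Longrightarrow> x \<in> carrier H \<Longrightarrow> tpre H x t \<in> TN H"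
  by (rule TT_into[OF linop_tpre[OF linop_id] TN_subspace]) (auto intro!: tens_in_TN)

lemma tapp_TN [simp]: "t \<in> TT H \<Longrightarrow> x \<in> carrier H \<Longrightarrow> tapp H t x \<in> TN H"
  by (rule TT_into[OF linop_tapp[OF linop_id] TN_subspace]) (auto intro!: tens_in_TN)

lemma op_TN [simp]:
  assumes "t \<in> TN H" "x \<in> carrier H"
  shows "tlm H x t \<in> TN H" "trm H x t \<in> TN H" "tll H x t \<in> TN H"
proof -
  show "tlm H x t \<in> TN H"
    by (rule TN_into[OF linop_tlm[OF linop_id] TN_subspace _ assms(1)]) (use assms(2) in auto)
  show "trm H x t \<in> TN H"
    by (rule TN_into[OF linop_trm[OF linop_id] TN_subspace _ assms(1)]) (use assms(2) in auto)
  show "tll H x t \<in> TN H"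
    by (rule TN_into[OF linop_tll[OF linop_id] TN_subspace _ assms(1)]) (use assms(2) in auto)
qed

section \<open>The comparison map and its left inverse\<close>

lemma philist_TN: "set xs \<subseteq> carrier H \<Longrightarrow> philist H xs \<in> TN H"
  by (induction xs) auto

lemma philist_tpower: "set xs \<subseteq> carrier H \<Longrightarrow> philist H xs \<in> tpower H (Suc (length xs))"
proof (induction xs)
  case Nil
  show ?case by (auto intro!: tens_in_tpower)
next
  case (Cons x xs)
  then show ?case by (auto intro!: sw_into[OF tpower_subspace])
qed

lemma mlin_philist: "mlin H (philist H)"
proof (rule mlin_rec[where A = "\<lambda>x t. sw H x (\<lambda>a b. tpre H a (tlm H (antipode H b) t))" and B = "\<lambda>_. 0"])
  fix xs assume "set xs \<subseteq> carrier H"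
  from philist_TN[OF this]
  show "lin H (\<lambda>x. sw H x (\<lambda>a b. tpre H a (tlm H (antipode H b) (philist H xs))))"
    by (intro sw_lin) (simp add: lin_simps)
qed (auto intro!: linop_intros mlin_0)

lemma tphi_tens [simp]: "tphi H (tens H xs) = philist H xs"
  unfolding tphi_def by (rule tbind_tens[OF mlin_philist])

lemma tphi_TN [simp]: "t \<in> TT H \<Longrightarrow> tphi H t \<in> TN H"
  by (rule TT_into[OF linop_basic(2) TN_subspace]) (auto simp: philist_TN)

lemma tphi_tpower [simp]: "t \<in> tpower H n \<Longrightarrow> tphi H t \<in> tpower H (Suc n)"
  by (rule tpower_into[OF linop_basic(2) tpower_subspace]) (use philist_tpower in auto)

lemma tphi_tpre [simp]:
  "t \<in> TT H \<Longrightarrow> x \<in> carrier H \<Longrightarrow> tphi H (tpre H x t) = sw H x (\<lambda>a b. tpre H a (tlm H (antipode H b) (tphi H t)))"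
  by (rule TT_eqI[where t = t]) (auto intro!: linop_intros)

lemma tphi_tpre_one:
  assumes "t \<in> TT H"
  shows "tphi H (tpre H \<one> t) = tpre H \<one> (tphi H t)"
proof -
  have "tphi H (tpre H \<one> t) = tpre H \<one> (tlm H (antipode H \<one>) (tphi H t))"
    using assms by simp (subst sw_one, auto simp: lin_simps)
  also have "\<dots> = tpre H \<one> (tlm H \<one> (tphi H t))"
    by (rule antipode_one[where g = "\<lambda>z. tpre H \<one> (tlm H z (tphi H t))"]) (use assms in \<open>simp add: lin_simps\<close>)
  finally show ?thesis using assms by (simp add: op_one)
qed

text \<open>The diagonal action becomes a conjugation. At each junction of neighbouring factors two
  inner parts of \<open>c\<close> meet as \<open>S(p2) q1\<close> and cancel, so only the outermost
  ones survive: one multiplies the first factor on the left, the antipode of the other multiplies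
  the last factor on the right.\<close>

lemma tphi_tdiag:
  assumes "t \<in> TT H" "c \<in> carrier H"
  shows "tphi H (tdiag H c t) = sw H c (\<lambda>a b. tlm H a (trm H (antipode H b) (tphi H t)))"
proof -
  let ?S = "antipode H"
  have "tphi H (tdiag H c (tens H xs)) = sw H c (\<lambda>a b. tlm H a (trm H (?S b) (tphi H (tens H xs))))"
    if "set xs \<subseteq> carrier H" for xs
    using that assms(2)
  proof (induction arbitrary: c rule: TT_list_induct)
    case Nil
    have "sw H c (\<lambda>a b. tens H [a \<otimes> ?S b]) = counit H c *\<^sub>k tens H [\<one>]"
      by (rule sw_antipode_right) (use Nil lin_tens_short in auto)
    then show ?case using Nil by (simp add: op_lin_simps2)
  next
    case (Cons h hs)
    define U where "U = tphi H (tens H hs)"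
    have U [simp]: "U \<in> TN H" using Cons by (simp add: U_def philist_TN)
    define F where "F = (\<lambda>p1 p2 q1 q2. sw H h (\<lambda>h1 h2. tpre H (p1 \<otimes> h1) (tlm H (?S h2 \<otimes> (?S p2 \<otimes> q1)) (trm H (?S q2) U))))"
    have "tphi H (tdiag H c (tens H (h # hs))) =
      sw H c (\<lambda>p q. sw H (p \<otimes> h) (\<lambda>a b. tpre H a (tlm H (?S b) (sw H q (\<lambda>q1 q2. tlm H q1 (trm H (?S q2) U))))))"
      using Cons by (simp add: tens_Cons op_sw2 Cons.IH[symmetric] U_def del: tpre_tens tphi_tens)
    also have "\<dots> = sw H c (\<lambda>p q. sw H p (\<lambda>p1 p2. sw H h (\<lambda>h1 h2. tpre H (p1 \<otimes> h1) (tlm H (?S (p2 \<otimes> h2)) (sw H q (\<lambda>q1 q2. tlm H q1 (trm H (?S q2) U)))))))"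
      by (intro sw_cong sw_mult) (use Cons in \<open>simp_all add: lin_simps\<close>)
    also have "\<dots> = sw H c (\<lambda>p q. sw H p (\<lambda>p1 p2. sw H h (\<lambda>h1 h2. tpre H (p1 \<otimes> h1) (tlm H (?S h2 \<otimes> ?S p2) (sw H q (\<lambda>q1 q2. tlm H q1 (trm H (?S q2) U)))))))"
      by (intro sw_cong, rule antipode_mult[where g = "\<lambda>z. tpre H _ (tlm H z _)"]) (use Cons in \<open>simp_all add: lin_simps\<close>)
    also have "\<dots> = sw H c (\<lambda>p q. sw H p (\<lambda>p1 p2. sw H h (\<lambda>h1 h2. sw H q (\<lambda>q1 q2. tpre H (p1 \<otimes> h1) (tlm H (?S h2 \<otimes> (?S p2 \<otimes> q1)) (trm H (?S q2) U))))))"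
      by (intro sw_cong) (use Cons in \<open>simp add: op_sw op_comm_TT mult_assoc'\<close>)
    also have "\<dots> = sw H c (\<lambda>p q. sw H p (\<lambda>p1 p2. sw H q (\<lambda>q1 q2. F p1 p2 q1 q2)))"
      unfolding F_def by (rule sw_cong, rule sw_cong, rule sw_swap)
    also have "\<dots> = sw H c (\<lambda>p1 r. sw H r (\<lambda>p2 q. sw H q (\<lambda>q1 q2. F p1 p2 q1 q2)))"
      by (rule sw_coassoc[where g = "\<lambda>p1 p2 q. sw H q (\<lambda>q1 q2. F p1 p2 q1 q2)"])
        (use Cons in \<open>simp_all add: F_def lin_simps\<close>)
    also have "\<dots> = sw H c (\<lambda>p1 r. sw H r (\<lambda>s q2. sw H s (\<lambda>p2 q1. F p1 p2 q1 q2)))"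
      by (rule sw_cong, rule sw_coassoc[symmetric]) (use Cons in \<open>simp_all add: F_def lin_simps\<close>)
    also have "\<dots> = sw H c (\<lambda>p1 r. sw H r (\<lambda>s q2. counit H s *\<^sub>k sw H h (\<lambda>h1 h2. tpre H (p1 \<otimes> h1) (tlm H (?S h2 \<otimes> \<one>) (trm H (?S q2) U)))))"
      unfolding F_def
      by (rule sw_cong, rule sw_cong, rule sw_antipode_left[where g = "\<lambda>z. sw H h (\<lambda>h1 h2. tpre H (_ \<otimes> h1) (tlm H (?S h2 \<otimes> z) (trm H (?S _) U)))"])
        (use Cons in \<open>simp_all add: lin_simps\<close>)
    also have "\<dots> = sw H c (\<lambda>p1 r. sw H h (\<lambda>h1 h2. tpre H (p1 \<otimes> h1) (tlm H (?S h2 \<otimes> \<one>) (trm H (?S r) U))))"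
      by (rule sw_cong, rule sw_counit_left) (use Cons in \<open>simp_all add: lin_simps\<close>)
    also have "\<dots> = sw H c (\<lambda>a b. tlm H a (trm H (?S b) (tphi H (tens H (h # hs)))))"
      using Cons by (simp add: tens_Cons op_sw op_comm_TN op_comm_TT U_def[symmetric] del: tpre_tens tphi_tens)
    finally show ?case .
  qed
  then show ?thesis
    by (intro TT_eqI[OF linop_ops(2)[OF linop_basic(1)] _ _ assms(1)]) (auto intro!: linop_intros)
qed

lemma psilist_aux: "set xs \<subseteq> carrier H \<Longrightarrow> psilist H xs \<in> TT H \<and> psilist H xs \<in> tpower H (length xs - 1)"
proof (induction xs)
  case Nil show ?case
    using fs.subspace_0[OF tpower_subspace[of H 0]] TT_0 by (simp add: zero_fun_def)
next
  case (Cons x xs)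
  have 0: "tens H [] \<in> tpower H 0" by (rule tens_in_tpower) auto
  then show ?case using Cons tpower_ops(6)[OF 0, of x] tpower_ops(6)[OF tpower_ops(1), of "psilist H xs" "length xs - 1" "\<one>" x]
    by (cases xs) (auto simp del: psilist.simps(2) tdiag_Nil simp: psilist.simps(2)[of H x])
qed

lemma mlin_psilist: "mlin H (psilist H)"
proof (rule mlinI)
  fix xs ys assume "set xs \<subseteq> carrier H" "set ys \<subseteq> carrier H"
  then show "lin H (\<lambda>x. psilist H (xs @ x # ys))"
  proof (induction xs)
    case Nil
    then show ?case using psilist_aux[of ys] tdiag_lin[of "tens H []"] tdiag_lin[of "tpre H \<one> (psilist H ys)"]
      by (cases ys) auto
  next
    case (Cons z zs)
    have "lin H (\<lambda>x. tdiag H z (tpre H \<one> (psilist H (zs @ x # ys))))"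
      by (intro linop_lin[where F = "\<lambda>t. tdiag H z (tpre H \<one> t)"] linop_intros) (use Cons in auto)
    then show ?case by (cases zs) auto
  qed
qed

lemma tpsi_tens: "tpsi H (tens H xs) = psilist H xs"
  unfolding tpsi_def by (rule tbind_tens[OF mlin_psilist])

lemma tpsi_tpower:
  assumes "t \<in> tpower H (Suc n)"
  shows "tpsi H t \<in> tpower H n"
proof (rule tpower_into[OF linop_basic(3) tpower_subspace _ assms])
  fix xs assume "set xs \<subseteq> carrier H" "length xs = Suc n"
  then show "tpsi H (tens H xs) \<in> tpower H n"
    using psilist_aux[of xs] by (simp add: tpsi_tens)
qed

lemma tpsi_TT [simp]:
  assumes "t \<in> TT H"
  shows "tpsi H t \<in> TT H"
proof (rule TT_into[OF linop_basic(3) TT_subspace _ assms])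
  fix xs assume "set xs \<subseteq> carrier H"
  then show "tpsi H (tens H xs) \<in> TT H"
    using psilist_aux[of xs] by (simp add: tpsi_tens)
qed

lemma tpsi_tpre [simp]:
  assumes "t \<in> TN H" "x \<in> carrier H"
  shows "tpsi H (tpre H x t) = tdiag H x (tpre H \<one> (tpsi H t))"
  by (rule TN_eqI[OF _ _ _ assms(1)]) (use assms(2) in \<open>auto intro!: linop_intros simp: tpsi_tens\<close>)

lemma tpsi_tlm:
  assumes "t \<in> TN H" "c \<in> carrier H"
  shows "tpsi H (tlm H c t) = tdiag H c (tpsi H t)"
proof (rule TN_eqI[OF _ _ _ assms(1)])
  fix x xs assume "x \<in> carrier H" "set xs \<subseteq> carrier H"
  then show "tpsi H (tlm H c (tens H (x # xs))) = tdiag H c (tpsi H (tens H (x # xs)))"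
    using assms(2) psilist_aux[of xs] tdiag_mult[of c x "tens H []"] tdiag_mult[of c x "tpre H \<one> (psilist H xs)"]
    by (cases xs) (auto simp: tpsi_tens simp del: tdiag_Nil tdiag_tpre)
qed (intro linop_intros)+

text \<open>The remaining tensor is acted on by \<open>S(b)\<close> from the comparison map and then
  by \<open>q\<close> from the inverse; together they act by \<open>q S(b)\<close>, which
  contracts.\<close>

lemma tpsi_tphi [simp]:
  assumes "t \<in> TT H"
  shows "tpsi H (tphi H t) = t"
proof -
  have "tpsi H (tphi H (tens H xs)) = tens H xs" if "set xs \<subseteq> carrier H" for xs
    using that
  proof (induction rule: TT_list_induct)
    case Nil
    show ?case by (simp add: tpsi_tens counit_one)
  next
    case (Cons h hs)
    have P [simp]: "philist H hs \<in> TN H" using Cons by (simp add: philist_TN)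
    have "tpsi H (tphi H (tens H (h # hs))) =
        sw H h (\<lambda>a b. tdiag H a (tpre H \<one> (tdiag H (antipode H b) (tens H hs))))"
      using Cons by (simp add: op_sw2 tpsi_tlm del: tdiag_tpre)
    also have "\<dots> = sw H h (\<lambda>a b. sw H a (\<lambda>p q. tpre H p (tdiag H (q \<otimes> antipode H b) (tens H hs))))"
      using Cons by (simp add: tdiag_mult)
    also have "\<dots> = sw H h (\<lambda>p r. sw H r (\<lambda>q b. tpre H p (tdiag H (q \<otimes> antipode H b) (tens H hs))))"
      by (rule sw_coassoc) (use Cons in \<open>simp_all add: lin_simps op_lin_simps2\<close>)
    also have "\<dots> = sw H h (\<lambda>p r. counit H r *\<^sub>k tpre H p (tdiag H \<one> (tens H hs)))"
      by (rule sw_cong, rule sw_antipode_right[where g = "\<lambda>z. tpre H _ (tdiag H z (tens H hs))"])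
        (use Cons in \<open>simp_all add: lin_simps op_lin_simps2\<close>)
    also have "\<dots> = tpre H h (tdiag H \<one> (tens H hs))"
      by (rule sw_counit_right) (use Cons in \<open>simp_all add: lin_simps op_lin_simps2\<close>)
    finally show ?case using Cons by (simp add: tdiag_one)
  qed
  then show ?thesis
    by (intro TT_eqI[OF linop_ops(3)[OF linop_basic(2)] linop_id _ assms]) auto
qed

section \<open>Right coinvariants as the image of the comparison map\<close>

lemma corlist_tpower: "set xs \<subseteq> carrier H \<Longrightarrow> corlist H xs \<in> tpower H (Suc (length xs))"
proof (induction xs)
  case Nil
  show ?case by (auto intro!: tens_in_tpower)
next
  case (Cons x xs)
  then show ?case by (auto intro!: sw_into[OF tpower_subspace])
qed

lemma corlist_TN: "set xs \<subseteq> carrier H \<Longrightarrow> corlist H xs \<in> TN H"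
  by (rule tpower_TN[OF corlist_tpower]) auto

lemma mlin_corlist: "mlin H (corlist H)"
proof (rule mlin_rec[where A = "\<lambda>x t. sw H x (\<lambda>a b. tpre H a (tll H b t))" and B = "\<lambda>_. 0"])
  fix xs assume "set xs \<subseteq> carrier H"
  from corlist_TN[OF this]
  show "lin H (\<lambda>x. sw H x (\<lambda>a b. tpre H a (tll H b (corlist H xs))))"
    by (intro sw_lin) (simp add: lin_simps)
qed (auto intro!: linop_intros mlin_0)

lemma tcor_tens [simp]: "tcor H (tens H xs) = corlist H xs"
  unfolding tcor_def by (rule tbind_tens[OF mlin_corlist])

lemma tcor_TN [simp]: "t \<in> TT H \<Longrightarrow> tcor H t \<in> TN H"
  by (rule TT_into[OF linop_basic(4) TN_subspace]) (auto simp: corlist_TN)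

lemma tcor_tpre [simp]:
  "t \<in> TT H \<Longrightarrow> x \<in> carrier H \<Longrightarrow> tcor H (tpre H x t) = sw H x (\<lambda>a b. tpre H a (tll H b (tcor H t)))"
  by (rule TT_eqI[where t = t]) (auto intro!: linop_intros)

lemma tcor_tlm:
  assumes t: "t \<in> TN H" and c: "c \<in> carrier H"
  shows "tcor H (tlm H c t) = sw H c (\<lambda>a b. tlm H a (tll H b (tcor H t)))"
proof (rule TN_eqI[OF _ _ _ t])
  fix x xs assume x: "x \<in> carrier H" "set xs \<subseteq> carrier H"
  note [simp] = corlist_TN[OF x(2)]
  have "tcor H (tlm H c (tens H (x # xs))) = sw H (c \<otimes> x) (\<lambda>a b. tpre H a (tll H b (corlist H xs)))"
    using x c by simp
  also have "\<dots> = sw H c (\<lambda>a b. sw H x (\<lambda>p q. tpre H (a \<otimes> p) (tll H (b \<otimes> q) (corlist H xs))))"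
    by (rule sw_mult) (use x c in \<open>simp_all add: lin_simps\<close>)
  also have "\<dots> = sw H c (\<lambda>a b. tlm H a (tll H b (tcor H (tens H (x # xs)))))"
    using x c by (simp add: op_sw op_comm_TN op_comm_TT)
  finally show "tcor H (tlm H c (tens H (x # xs))) = sw H c (\<lambda>a b. tlm H a (tll H b (tcor H (tens H (x # xs)))))" .
qed (intro linop_intros)+

text \<open>With \<open>h_1, ..., h_4\<close> the iterated coproduct of the first entry, the factors
  that the coaction sends to the end meet as \<open>h_2 S(h_3)\<close> and contract to
  \<open>1\<close>. They are neighbours because the coproduct of the antipode exchanges its two
  legs.\<close>

lemma tcor_tphi:
  assumes "t \<in> TT H"
  shows "tcor H (tphi H t) = tapp H (tphi H t) \<one>"
proof -
  let ?S = "antipode H"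
  have "tcor H (tphi H (tens H xs)) = tapp H (tphi H (tens H xs)) \<one>" if "set xs \<subseteq> carrier H" for xs
    using that
  proof (induction rule: TT_list_induct)
    case Nil
    have "tcor H (tens H [\<one>]) = tens H [\<one>, \<one>]"
      using sw_one[of "\<lambda>a b. tens H [a, b]"] lin_tens_short by (simp add: lin2_def)
    then show ?case by simp
  next
    case (Cons h hs)
    define U where "U = philist H hs"
    have [simp]: "U \<in> TN H" using Cons by (simp add: U_def philist_TN)
    have U: "tcor H U = tapp H U \<one>" using Cons by (simp add: U_def)
    define F where "F = (\<lambda>a1 a2 b1 b2. tpre H a1 (tapp H (tlm H (?S b2) U) (a2 \<otimes> ?S b1)))"
    have "tcor H (tphi H (tens H (h # hs))) =
      sw H h (\<lambda>a b. sw H a (\<lambda>a1 a2. sw H (?S b) (\<lambda>p q. tpre H a1 (tapp H (tlm H p U) (a2 \<otimes> q)))))"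
      using Cons by (simp add: U_def[symmetric] U op_sw2 tcor_tlm op_comm_TT op_comm_TN op_sw)
    also have "\<dots> = sw H h (\<lambda>a b. sw H a (\<lambda>a1 a2. sw H b (\<lambda>b1 b2. F a1 a2 b1 b2)))"
      unfolding F_def by (intro sw_cong sw_antipode) (use Cons in \<open>simp_all add: lin_simps\<close>)
    also have "\<dots> = sw H h (\<lambda>a1 r. sw H r (\<lambda>a2 b. sw H b (\<lambda>b1 b2. F a1 a2 b1 b2)))"
      by (rule sw_coassoc[where g = "\<lambda>a1 a2 b. sw H b (\<lambda>b1 b2. F a1 a2 b1 b2)"])
        (use Cons in \<open>simp_all add: F_def lin_simps\<close>)
    also have "\<dots> = sw H h (\<lambda>a1 r. sw H r (\<lambda>s b2. sw H s (\<lambda>a2 b1. F a1 a2 b1 b2)))"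
      by (rule sw_cong, rule sw_coassoc[symmetric]) (use Cons in \<open>simp_all add: F_def lin_simps\<close>)
    also have "\<dots> = sw H h (\<lambda>a1 r. sw H r (\<lambda>s b2. counit H s *\<^sub>k tpre H a1 (tapp H (tlm H (?S b2) U) \<one>)))"
      unfolding F_def
      by (rule sw_cong, rule sw_cong, rule sw_antipode_right[where g = "\<lambda>z. tpre H _ (tapp H (tlm H (?S _) U) z)"])
        (use Cons in \<open>simp_all add: lin_simps\<close>)
    also have "\<dots> = sw H h (\<lambda>a1 r. tpre H a1 (tapp H (tlm H (?S r) U) \<one>))"
      by (rule sw_cong, rule sw_counit_left) (use Cons in \<open>simp_all add: lin_simps\<close>)
    also have "\<dots> = tapp H (tphi H (tens H (h # hs))) \<one>"
      using Cons by (simp add: op_sw U_def[symmetric] op_comm_TT)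
    finally show ?case .
  qed
  then show ?thesis
    by (intro TT_eqI[OF linop_ops(4)[OF linop_basic(2)] linop_tapp[OF linop_basic(2)] _ assms]) auto
qed

lemma tmulS_tens:
  "tmulS H (tens H xs) = (if xs = [] then 0 else trm H (antipode H (last xs)) (tens H (butlast xs)))"
  unfolding tmulS_def
proof (rule tbind_tens, rule mlinI)
  fix xs ys assume *: "set xs \<subseteq> carrier H" "set ys \<subseteq> carrier H"
  let ?f = "\<lambda>xs. if xs = [] then 0 else trm H (antipode H (last xs)) (tens H (butlast xs))"
  show "lin H (\<lambda>x. ?f (xs @ x # ys))"
  proof (cases ys rule: rev_cases)
    case Nil
    have "lin H (\<lambda>x. trm H (antipode H x) (tens H xs))" using * by (simp add: lin_simps)
    then show ?thesis using Nil by simp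
  next
    case (snoc zs z)
    have "lin H (\<lambda>x. trm H (antipode H z) (tens H (xs @ x # zs)))"
      by (intro linop_lin[OF linop_trm[OF linop_id]] lin_tens) (use * snoc in auto)
    then show ?thesis using snoc by (simp add: butlast_append)
  qed
qed

text \<open>At least two factors have to follow \<open>x\<close>: with a single one, the antipode
  would be multiplied into \<open>x\<close> itself.\<close>

lemma tmulS_tpre:
  assumes "t \<in> tpower H (Suc (Suc n))" "x \<in> carrier H"
  shows "tmulS H (tpre H x t) = tpre H x (tmulS H t)"
proof (rule tpower_eqI[OF _ _ _ assms(1)])
  fix xs assume xs: "set xs \<subseteq> carrier H" "length xs = Suc (Suc n)"
  then have "butlast xs \<noteq> []" by (cases xs) auto
  with xs show "tmulS H (tpre H x (tens H xs)) = tpre H x (tmulS H (tens H xs))"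
    using assms(2) op_comm_TN(1)[of "tens H (butlast xs)" "antipode H (last xs)" x]
    by (auto simp: tmulS_tens)
qed (intro linop_intros)+

lemma tmulS_tll:
  assumes "t \<in> TN H" "b \<in> carrier H"
  shows "tmulS H (tll H b t) = trm H (antipode H b) (tmulS H t)"
proof (rule TN_eqI[OF _ _ _ assms(1)])
  fix x xs assume x: "x \<in> carrier H" "set xs \<subseteq> carrier H"
  obtain ys y where xy: "x # xs = ys @ [y]" by (cases "x # xs" rule: rev_cases) auto
  have "set (x # xs) \<subseteq> carrier H" using x by simp
  then have y: "y \<in> carrier H" "set ys \<subseteq> carrier H"
    unfolding xy by auto
  have "trm H (antipode H (b \<otimes> y)) (tens H ys) = trm H (antipode H y \<otimes> antipode H b) (tens H ys)"
    by (rule antipode_mult[where g = "\<lambda>z. trm H z (tens H ys)"]) (use y assms in \<open>simp_all add: lin_simps\<close>)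
  then show "tmulS H (tll H b (tens H (x # xs))) = trm H (antipode H b) (tmulS H (tens H (x # xs)))"
    unfolding xy using y assms(2) by (simp add: tmulS_tens op_comm_TT)
qed (intro linop_intros)+

text \<open>Stated for all nonempty tensors, since coinvariance says nothing about pure tensors and
  would be lost in an induction along their entries. For a coinvariant the coaction only appends
  \<open>1\<close>, and the right hand side returns \<open>t\<close>.\<close>

lemma tphi_tpsi_tcor:
  assumes "t \<in> TN H"
  shows "tphi H (tpsi H t) = tmulS H (tcor H t)"
proof -
  let ?S = "antipode H"
  have "tphi H (tpsi H (tens H xs)) = tmulS H (tcor H (tens H xs))" if "set xs \<subseteq> carrier H" "xs \<noteq> []" for xs
    using that
  proof (induction rule: TT_list_induct)
    case (Cons x xs)
    show ?case
    proof (cases "xs = []")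
      case True
      have "sw H x (\<lambda>a b. tens H [a \<otimes> ?S b]) = counit H x *\<^sub>k tens H [\<one>]"
        by (rule sw_antipode_right) (use Cons lin_tens_short in auto)
      then show ?thesis using True Cons(1) by (simp add: tpsi_tens op_sw2 tmulS_tens op_lin_simps2)
    next
      case False
      then obtain n where n: "length xs = Suc n" by (cases xs) auto
      have T: "tens H xs \<in> TN H" and c: "corlist H xs \<in> tpower H (Suc (Suc n))"
        using Cons False corlist_tpower[of xs] by (simp_all add: n)
      note [simp] = TN_TT'[OF T]
      have "tphi H (tpsi H (tens H (x # xs))) = tphi H (tdiag H x (tpre H \<one> (tpsi H (tens H xs))))"
        using Cons T by (simp add: tens_Cons del: tpre_tens tdiag_tpre)
      also have "\<dots> = sw H x (\<lambda>a b. tlm H a (trm H (?S b) (tpre H \<one> (tmulS H (tcor H (tens H xs))))))"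
        using Cons T by (subst tphi_tdiag) (simp_all add: tphi_tpre_one False del: tcor_tens tphi_tpre)
      also have "\<dots> = sw H x (\<lambda>a b. tpre H a (trm H (?S b) (tmulS H (corlist H xs))))"
      proof -
        have [simp]: "tmulS H (corlist H xs) \<in> TN H"
          using Cons False T by (metis tphi_TN tpsi_TT TN_TT' tcor_tens)
        show ?thesis using Cons by (simp add: op_comm_TT op_comm_TN)
      qed
      also have "\<dots> = tmulS H (tcor H (tens H (x # xs)))"
        using Cons corlist_TN[of xs] by (simp add: op_sw2 tmulS_tpre[OF tpower_ops(5)[OF c]] tmulS_tll)
      finally show ?thesis .
    qed
  qed simp
  then show ?thesis
    by (intro TN_eqI[OF linop_ops(2)[OF linop_basic(3)] linop_ops(9)[OF linop_basic(4)] _ assms]) auto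
qed

lemma tphi_tpsi:
  assumes t: "t \<in> TN H" and co: "tcor H t = tapp H t \<one>"
  shows "tphi H (tpsi H t) = t"
proof -
  have "tmulS H (tapp H t \<one>) = trm H (antipode H \<one>) t"
    by (rule TN_eqI[OF _ _ _ t]) (auto intro!: linop_intros simp: tmulS_tens simp del: trm_tens)
  also have "\<dots> = trm H \<one> t"
    by (rule antipode_one[where g = "\<lambda>z. trm H z t"]) (use t in \<open>simp add: lin_simps\<close>)
  finally show ?thesis using tphi_tpsi_tcor[OF t] co op_one[OF t] by simp
qed

end

text \<open>Otherwise the simplifier evaluates equations between sums of tensors pointwise.\<close>

declare plus_fun_apply [simp del] zero_fun_apply [simp del] minus_apply [simp del] uminus_apply [simp del]

text \<open>\<open>codegen_list H i\<close> stands for the codegeneracy with index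
  \<open>i + 1\<close>. Recursion along the list makes it multilinear in every degree, whereas
  \<open>codegen\<close> picks entries by position and is meaningful only on lists that are long
  enough.\<close>

fun codegen_list :: "('k::field, 'a) hopf \<Rightarrow> nat \<Rightarrow> 'a list \<Rightarrow> ('k, 'a) tensor" where
  "codegen_list H i [] = 0"
| "codegen_list H 0 (h # hs) = counit H h *\<^sub>k tens H hs"
| "codegen_list H (Suc i) (h # hs) = tpre H h (codegen_list H i hs)"

text \<open>Only the inner cofaces: \<open>coface_list H i\<close> comultiplies entry
  \<open>i\<close>, counted from 0, and is the coface with index \<open>i + 1\<close>.\<close>

fun coface_list :: "('k::field, 'a) hopf \<Rightarrow> nat \<Rightarrow> 'a list \<Rightarrow> ('k, 'a) tensor" where
  "coface_list H i [] = 0"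
| "coface_list H 0 (h # hs) = sw H h (\<lambda>a b. tpre H a (tpre H b (tens H hs)))"
| "coface_list H (Suc i) (h # hs) = tpre H h (coface_list H i hs)"

context hopf_algebra
begin

section \<open>Insertion of units, rotation, and multiplication of neighbours\<close>

lemma inslist_TN: "set xs \<subseteq> carrier H \<Longrightarrow> inslist H xs \<in> TN H"
  by (induction xs) auto

lemma inslist_tpower: "set xs \<subseteq> carrier H \<Longrightarrow> inslist H xs \<in> tpower H (Suc (length xs))"
proof (induction xs)
  case Nil
  show ?case by (auto intro!: tens_in_tpower)
next
  case (Cons x xs)
  then show ?case
    by (auto intro!: fs.subspace_diff[OF tpower_subspace] tens_in_tpower)
qed

lemma mlin_inslist: "mlin H (inslist H)"
proof (rule mlin_rec[where A = "\<lambda>x t. - tpre H x t" and B = "\<lambda>xs. tpre H \<one> (tens H xs)"])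
  fix xs assume "set xs \<subseteq> carrier H"
  from inslist_TN[OF this] show "lin H (\<lambda>x. - tpre H x (inslist H xs))"
    by (simp add: lin_simps)
next
  show "mlin H (\<lambda>xs. tpre H \<one> (tens H xs))"
    by (rule linop_mlin[OF linop_tpre[OF linop_id] mlin_tens])
qed (auto intro!: linop_intros)

lemma tins_tens [simp]: "tins H (tens H xs) = inslist H xs"
  unfolding tins_def by (rule tbind_tens[OF mlin_inslist])

lemma tins_TN [simp]: "t \<in> TT H \<Longrightarrow> tins H t \<in> TN H"
  by (rule TT_into[OF linop_basic(5) TN_subspace]) (auto simp: inslist_TN)

lemma tins_tpower [simp]: "t \<in> tpower H n \<Longrightarrow> tins H t \<in> tpower H (Suc n)"
  by (rule tpower_into[OF linop_basic(5) tpower_subspace]) (use inslist_tpower in auto)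

lemma tins_tpre [simp]:
  "t \<in> TT H \<Longrightarrow> x \<in> carrier H \<Longrightarrow> tins H (tpre H x t) = tpre H \<one> (tpre H x t) - tpre H x (tins H t)"
  by (rule TT_eqI[where t = t]) (auto intro!: linop_intros)

lemma tins_tlm:
  assumes "t \<in> TN H" "c \<in> carrier H"
  shows "tins H (tlm H c t) = tlm H c (tins H t) - tpre H c t + tpre H \<one> (tlm H c t)"
  by (rule TN_eqI[OF _ _ _ assms(1)])
    (use assms(2) in \<open>auto intro!: linop_intros simp: op_lin_simps op_comm_TT inslist_TN\<close>)

text \<open>Right multiplication of the last factor commutes with every insertion except the one at
  the right end, which has the sign \<open>(-1) ^ n\<close>; the correction is the difference of the
  two end terms.\<close>

lemma tins_trm:
  assumes "t \<in> tpower H n" "x \<in> carrier H"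
  shows "tins H (trm H x t) = trm H x (tins H t) + (-1) ^ n *\<^sub>k (tapp H (trm H x t) \<one> - tapp H t x)"
proof -
  have *: "tins H (trm H x (tens H xs)) = trm H x (tins H (tens H xs)) +
      (-1) ^ length xs *\<^sub>k (tapp H (trm H x (tens H xs)) \<one> - tapp H (tens H xs) x)"
    if "set xs \<subseteq> carrier H" for xs
    using that
  proof (induction rule: TT_list_induct)
    case Nil
    then show ?case using assms(2) by (simp add: op_lin_simps op_lin_simps2)
  next
    case (Cons y ys)
    show ?case
    proof (cases "ys = []")
      case True
      then show ?thesis using Cons(1) assms(2) by (simp add: op_lin_simps op_lin_simps2)
    next
      case False
      then have [simp]: "tens H ys \<in> TN H" using Cons by simp
      show ?thesis
        using Cons assms(2)
        by (simp add: tens_Cons op_comm_TN op_comm_TT op_lin_simps op_lin_simps2 fs.scale_right_diff_distrib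
            del: tpre_tens tins_tens trm_tens tapp_tens)
    qed
  qed
  show ?thesis
  proof (rule tpower_eqI[OF _ _ _ assms(1)])
    fix xs assume "set xs \<subseteq> carrier H" "length xs = n"
    from *[OF this(1), unfolded this(2)]
    show "tins H (trm H x (tens H xs)) = trm H x (tins H (tens H xs)) +
        (-1) ^ n *\<^sub>k (tapp H (trm H x (tens H xs)) \<one> - tapp H (tens H xs) x)" .
  qed (intro linop_intros)+
qed

lemma trot_tens: "trot H (tens H xs) = (case xs of [] \<Rightarrow> tens H [] | x # xs \<Rightarrow> tens H (xs @ [x]))"
  unfolding trot_def
proof (rule tbind_tens, rule mlinI)
  fix xs ys assume "set xs \<subseteq> carrier H" "set ys \<subseteq> carrier H"
  then show "lin H (\<lambda>x. case xs @ x # ys of [] \<Rightarrow> tens H [] | x # xs \<Rightarrow> tens H (xs @ [x]))"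
    using lin_tens[of ys "[]"] lin_tens[of "tl xs" "ys @ [hd xs]"] by (cases xs) auto
qed

lemma trot_tens_Cons [simp]: "trot H (tens H []) = tens H []" "trot H (tens H (x # xs)) = tens H (xs @ [x])"
  by (simp_all add: trot_tens)

lemma trot_tpre [simp]: "t \<in> TT H \<Longrightarrow> x \<in> carrier H \<Longrightarrow> trot H (tpre H x t) = tapp H t x"
  by (rule TT_eqI[where t = t]) (auto intro!: linop_intros)

lemma trot_tpower [simp]:
  assumes "t \<in> tpower H n" shows "trot H t \<in> tpower H n"
proof (rule tpower_into[OF linop_basic(7) tpower_subspace _ assms])
  fix xs assume xs: "set xs \<subseteq> carrier H" "length xs = n"
  then show "trot H (tens H xs) \<in> tpower H n"
    by (cases xs) (auto intro!: tens_in_tpower)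
qed

lemma tE_tens: "tE H (tens H xs) = (case xs of [] \<Rightarrow> 0 | x # xs \<Rightarrow> trm H x (tens H xs))"
  unfolding tE_def
proof (rule tbind_tens, rule mlin_Cons[where g = "tens H" and A = "trm H"])
  fix xs assume "set xs \<subseteq> carrier H"
  then show "lin H (\<lambda>x. trm H x (tens H xs))" by (intro op_lin) auto
qed (auto intro!: linop_intros mlin_tens)

lemma tE_tens_Cons [simp]: "tE H (tens H []) = 0" "tE H (tens H (x # xs)) = trm H x (tens H xs)"
  by (simp_all add: tE_tens)

lemma tE_tpre [simp]: "t \<in> TT H \<Longrightarrow> x \<in> carrier H \<Longrightarrow> tE H (tpre H x t) = trm H x t"
  by (rule TT_eqI[where t = t]) (auto intro!: linop_intros)

lemma tE_tpower [simp]: "t \<in> tpower H (Suc n) \<Longrightarrow> tE H t \<in> tpower H n"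
proof (rule tpower_into[OF linop_basic(6) tpower_subspace])
  fix xs assume xs: "set xs \<subseteq> carrier H" "length xs = Suc n"
  then show "tE H (tens H xs) \<in> tpower H n"
    by (cases xs) (auto intro!: tpower_ops tens_in_tpower simp del: trm_tens)
qed

lemma mlin_sglist: "mlin H (sglist H i)"
proof (induction i)
  case 0
  show ?case
  proof (rule mlin_Cons[where g = "tens H" and A = "tlm H"])
    fix xs assume "set xs \<subseteq> carrier H"
    then show "lin H (\<lambda>x. tlm H x (tens H xs))" by (intro op_lin) auto
  qed (auto intro!: linop_intros mlin_tens)
next
  case (Suc i)
  have T: "sglist H i xs \<in> TT H" if "set xs \<subseteq> carrier H" for xs
    using that
  proof (induction xs arbitrary: i)
    case (Cons x xs)
    then show ?case by (cases i) auto
  qed simp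
  show ?case
    by (rule mlin_Cons[where g = "sglist H i" and A = "tpre H"])
      (use Suc in \<open>auto intro!: linop_intros op_lin T\<close>)
qed

lemma tsg_tens: "tsg H i (tens H xs) = sglist H i xs"
  unfolding tsg_def by (rule tbind_tens[OF mlin_sglist])

lemma sglist_tpower: "set xs \<subseteq> carrier H \<Longrightarrow> sglist H i xs \<in> tpower H (length xs - 1)"
proof (induction xs arbitrary: i)
  case Nil
  then show ?case by (simp add: fs.subspace_0[OF tpower_subspace])
next
  case (Cons x xs)
  have t: "tens H xs \<in> tpower H (length xs)" using Cons by (auto intro!: tens_in_tpower)
  have 0: "0 \<in> tpower H 0" by (rule fs.subspace_0[OF tpower_subspace])
  show ?case
  proof (cases i)
    case 0
    then show ?thesis using Cons t by simp
  next
    case (Suc j)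
    show ?thesis
    proof (cases "xs = []")
      case True
      then show ?thesis using Suc 0 by (simp add: op_lin_simps)
    next
      case False
      then have "Suc (length xs - 1) = length xs" by (cases xs) auto
      then show ?thesis using Suc Cons tpower_ops(1)[OF Cons.IH[of j], of x] by simp
    qed
  qed
qed

lemma tsg_tpower [simp]: "t \<in> tpower H (Suc n) \<Longrightarrow> tsg H i t \<in> tpower H n"
proof (rule tpower_into[OF linop_basic(8) tpower_subspace])
  fix xs assume xs: "set xs \<subseteq> carrier H" "length xs = Suc n"
  then show "tsg H i (tens H xs) \<in> tpower H n"
    using sglist_tpower[of xs i] by (simp add: tsg_tens)
qed

lemma tsg_TT [simp]: "t \<in> TT H \<Longrightarrow> tsg H i t \<in> TT H"
proof (rule TT_into[OF linop_basic(8) TT_subspace])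
  fix xs assume xs: "set xs \<subseteq> carrier H"
  then show "tsg H i (tens H xs) \<in> TT H"
    using tpower_TT[OF sglist_tpower[of xs i]] by (simp add: tsg_tens)
qed

lemma tsg_Nil [simp]: "tsg H i (tens H []) = 0" by (simp add: tsg_tens)

lemma tsg_0_tpre [simp]: "t \<in> TT H \<Longrightarrow> x \<in> carrier H \<Longrightarrow> tsg H 0 (tpre H x t) = tlm H x t"
  by (rule TT_eqI[where t = t]) (auto intro!: linop_intros simp: tsg_tens)

lemma tsg_Suc_tpre [simp]: "t \<in> TT H \<Longrightarrow> x \<in> carrier H \<Longrightarrow> tsg H (Suc i) (tpre H x t) = tpre H x (tsg H i t)"
  by (rule TT_eqI[where t = t]) (auto intro!: linop_intros simp: tsg_tens)

lemma tsg_tlm: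
  assumes "t \<in> TN H" "c \<in> carrier H"
  shows "tsg H i (tlm H c t) = tlm H c (tsg H i t)"
proof (rule TN_eqI[OF _ _ _ assms(1)])
  fix x xs assume x: "x \<in> carrier H" "set xs \<subseteq> carrier H"
  then have [simp]: "sglist H j xs \<in> TT H" for j using tpower_TT[OF sglist_tpower] by blast
  show "tsg H i (tlm H c (tens H (x # xs))) = tlm H c (tsg H i (tens H (x # xs)))"
    using x assms(2) by (cases i) (auto simp: tsg_tens op_comm_TT)
qed (intro linop_intros)+

text \<open>A pure tensor sees only the values of \<open>f\<close> on lists of its own length, so a
  definition by position may be replaced there by a recursive, multilinear one.\<close>

lemma tbind_tens_length:
  assumes eq: "\<And>xs. set xs \<subseteq> carrier H \<Longrightarrow> length xs = n \<Longrightarrow> f xs = g xs" and g: "mlin H g"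
    and hs: "set hs \<subseteq> carrier H" "length hs = n"
  shows "tbind (tens H hs) f = g hs"
proof -
  have "multilinear H n (\<lambda>xs. f xs \<phi>)" for \<phi>
    using g[unfolded mlin_multilinear, rule_format, of n \<phi>] unfolding multilinear_def
    by (auto simp: eq)
  then show ?thesis using hs by (auto simp: tbind_def tens_def eq)
qed

section \<open>Codegeneracies, cofaces and cyclic operator under the comparison map\<close>

lemma codegen_list_TT: "set xs \<subseteq> carrier H \<Longrightarrow> codegen_list H i xs \<in> TT H"
proof (induction xs arbitrary: i)
  case Nil show ?case by simp
next
  case (Cons x xs)
  then show ?case by (cases i) auto
qed

lemma mlin_codegen_list: "mlin H (codegen_list H i)"
proof (induction i)
  case 0
  show ?case
    by (rule mlin_Cons[where g = "tens H" and A = "\<lambda>x t. counit H x *\<^sub>k t"])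
      (auto intro!: linop_intros mlin_tens simp: lin_simps)
next
  case (Suc i)
  show ?case
    by (rule mlin_Cons[where g = "codegen_list H i" and A = "tpre H"])
      (use Suc in \<open>auto intro!: linop_intros op_lin codegen_list_TT\<close>)
qed

lemma linop_codegen: "linop (codegen H i)"
  unfolding codegen_def by (intro linop_intros)

lemma codegen_tens:
  assumes "set xs \<subseteq> carrier H" "i < length xs"
  shows "codegen H (Suc i) (tens H xs) = codegen_list H i xs"
  unfolding codegen_def
proof (rule tbind_tens_length[OF _ mlin_codegen_list assms(1) refl])
  have "counit H (ys ! i) *\<^sub>k tens H (take i ys @ drop (Suc i) ys) = codegen_list H i ys"
    if "set ys \<subseteq> carrier H" "i < length ys" for ys i
    using that
  proof (induction ys arbitrary: i)
    case (Cons y ys)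
    show ?case
    proof (cases i)
      case (Suc j)
      then show ?thesis using Cons.prems by (simp add: op_lin_simps Cons.IH[of j, symmetric])
    qed simp
  qed simp
  then show "counit H (ys ! (Suc i - 1)) *\<^sub>k tens H (take (Suc i - 1) ys @ drop (Suc i) ys) = codegen_list H i ys"
    if "set ys \<subseteq> carrier H" "length ys = length xs" for ys
    using that assms(2) by simp
qed

text \<open>Multiplying the two factors that share the parts of an entry \<open>h\<close> produces
  \<open>h_1 S(h_2) = \<epsilon>(h) 1\<close>, which is the codegeneracy at
  \<open>h\<close>.\<close>

lemma tsg_tphi:
  assumes "t \<in> tpower H n" "i < n"
  shows "tsg H i (tphi H t) = tphi H (codegen H (Suc i) t)"
proof (rule tpower_eqI[OF _ _ _ assms(1)])
  have "tsg H i (philist H xs) = tphi H (codegen_list H i xs)" if "set xs \<subseteq> carrier H" "i < length xs" for xs i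
    using that
  proof (induction xs arbitrary: i)
    case (Cons h hs)
    then have [simp]: "philist H hs \<in> TN H" by (simp add: philist_TN)
    show ?case
    proof (cases i)
      case 0
      have "tsg H 0 (philist H (h # hs)) = sw H h (\<lambda>a b. tlm H (a \<otimes> antipode H b) (philist H hs))"
        using Cons by (simp add: op_sw2 op_comm_TT)
      also have "\<dots> = counit H h *\<^sub>k tlm H \<one> (philist H hs)"
        by (rule sw_antipode_right[where g = "\<lambda>z. tlm H z (philist H hs)"]) (use Cons in \<open>simp_all add: lin_simps\<close>)
      finally show ?thesis using 0 by (simp add: op_one op_lin_simps2)
    next
      case (Suc j)
      then show ?thesis using Cons by (simp add: op_sw2 tsg_tlm codegen_list_TT)
    qed
  qed simp
  then show "tsg H i (tphi H (tens H xs)) = tphi H (codegen H (Suc i) (tens H xs))"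
    if "set xs \<subseteq> carrier H" "length xs = n" for xs
    using that assms(2) by (simp add: codegen_tens)
qed (intro linop_intros linop_compose[OF linop_basic(2) linop_codegen])+

lemma coface_list_TT: "set xs \<subseteq> carrier H \<Longrightarrow> coface_list H i xs \<in> TT H"
proof (induction xs arbitrary: i)
  case Nil show ?case by simp
next
  case (Cons x xs)
  then show ?case by (cases i) auto
qed

lemma mlin_coface_list: "mlin H (coface_list H i)"
proof (induction i)
  case 0
  show ?case
    by (rule mlin_Cons[where g = "tens H" and A = "\<lambda>x t. sw H x (\<lambda>a b. tpre H a (tpre H b t))"])
      (auto intro!: linop_intros mlin_tens sw_lin simp: lin_simps simp del: tpre_tens)
next
  case (Suc i)
  show ?case
    by (rule mlin_Cons[where g = "coface_list H i" and A = "tpre H"])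
      (use Suc in \<open>auto intro!: linop_intros op_lin coface_list_TT\<close>)
qed

lemma tcat_Nil_left: "t \<in> TT H \<Longrightarrow> tcat H (tens H []) t = t"
  by (simp add: linop_tcat_tens) (rule TT_eqI[where t = t], auto intro!: linop_intros tbind_tens mlin_tens)

lemma tbind_append_tens: "set zs \<subseteq> carrier H \<Longrightarrow> tbind (tens H xs) (\<lambda>ys. tens H (zs @ ys)) = tens H (zs @ xs)"
  by (intro tbind_tens mlinI) (use lin_tens[of "zs @ _"] in auto)

lemma tcat_Cons_left:
  assumes "t \<in> TT H" "x \<in> carrier H" "set xs \<subseteq> carrier H"
  shows "tcat H (tens H (x # xs)) t = tpre H x (tcat H (tens H xs) t)"
proof -
  have "tbind t (\<lambda>ys. tens H ((x # xs) @ ys)) = tpre H x (tbind t (\<lambda>ys. tens H (xs @ ys)))"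
    by (rule TT_eqI[OF _ _ _ assms(1)])
      (use assms in \<open>auto intro!: linop_intros simp: tbind_append_tens[of xs] tbind_append_tens[of "x # xs", simplified]\<close>)
  then show ?thesis using assms by (simp add: linop_tcat_tens)
qed

lemma coface_list_eq:
  assumes "set hs \<subseteq> carrier H" "i < length hs"
  shows "tcat H (tens H (take i hs)) (tcat H (comult H (hs ! i)) (tens H (drop (Suc i) hs))) = coface_list H i hs"
  using assms
proof (induction hs arbitrary: i)
  case (Cons h hs)
  have T: "tcat H (comult H h) (tens H ys) = sw H h (\<lambda>a b. tens H (a # b # ys))"
    if "h \<in> carrier H" "set ys \<subseteq> carrier H" for h ys
    using that by (simp add: comult_sw linop_of_sw[OF linop_tcat] tcat_tens)
  show ?case
  proof (cases i)
    case 0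
    then show ?thesis using Cons by (simp add: T tcat_Nil_left)
  next
    case (Suc j)
    then have j: "j < length hs" "hs ! j \<in> carrier H" "set (drop (Suc j) hs) \<subseteq> carrier H" "set (take j hs) \<subseteq> carrier H"
      using Cons.prems by (auto dest: in_set_takeD in_set_dropD)
    then have "tcat H (comult H (hs ! j)) (tens H (drop (Suc j) hs)) \<in> TT H"
      by (simp add: T)
    then show ?thesis using Suc Cons j by (simp add: tcat_Cons_left)
  qed
qed simp

text \<open>The Hopf differential without its first coface. Leaving that one out gives a recursion
  along the list, \<open>upc_Cons\<close>, that runs parallel to the recursion of
  \<open>inslist\<close>.\<close>

definition "upc hs = (\<Sum>i<length hs. (-1) ^ Suc i *\<^sub>k coface_list H i hs) + (-1) ^ Suc (length hs) *\<^sub>k tens H (hs @ [\<one>])"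

lemma upc_Cons: "h \<in> carrier H \<Longrightarrow> upc (h # hs) = - coface_list H 0 (h # hs) - tpre H h (upc hs)"
  unfolding upc_def
  by (simp add: sum.lessThan_Suc_shift op_lin_simps linop_sum[OF linop_tpre[OF linop_id]] sum_negf del: sum.lessThan_Suc)

lemma linop_coface: "linop (coface H n i)"
  unfolding coface_def by (intro linop_intros)

lemma linop_hopf_up: "linop (hopf_up H n)"
  unfolding hopf_up_def by (intro linop_intros linop_compose[OF linop_coface])

lemma hopf_up_tens:
  assumes hs: "set hs \<subseteq> carrier H" "length hs = n"
  shows "hopf_up H n (tens H hs) = tens H (\<one> # hs) + upc hs"
proof -
  have 0: "coface H n 0 (tens H hs) = tens H (\<one> # hs)"
    unfolding coface_def by (rule tbind_tens_length[OF _ _ hs, of _ "\<lambda>hs. tens H (\<one> # hs)"])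
      (use lin_tens[of "\<one> # _"] in \<open>auto intro!: mlinI\<close>)
  have l: "coface H n (Suc n) (tens H hs) = tens H (hs @ [\<one>])"
    unfolding coface_def by (rule tbind_tens_length[OF _ _ hs, of _ "\<lambda>hs. tens H (hs @ [\<one>])"])
      (use lin_tens[of _ "_ @ [\<one>]"] in \<open>auto intro!: mlinI\<close>)
  have m: "coface H n (Suc i) (tens H hs) = coface_list H i hs" if "i < n" for i
    unfolding coface_def
    by (rule tbind_tens_length[OF _ mlin_coface_list hs]) (use that coface_list_eq in auto)
  have "hopf_up H n (tens H hs) = (\<Sum>i<Suc (Suc n). (-1) ^ i *\<^sub>k coface H n i (tens H hs))"
    unfolding hopf_up_def by (simp add: lessThan_Suc_atMost)
  also have "\<dots> = coface H n 0 (tens H hs) + (\<Sum>i<n. (-1) ^ Suc i *\<^sub>k coface H n (Suc i) (tens H hs)) +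
      (-1) ^ Suc n *\<^sub>k coface H n (Suc n) (tens H hs)"
    by (subst sum.lessThan_Suc_shift) (simp add: add.assoc)
  also have "(\<Sum>i<n. (-1) ^ Suc i *\<^sub>k coface H n (Suc i) (tens H hs)) = (\<Sum>i<n. (-1) ^ Suc i *\<^sub>k coface_list H i hs)"
    by (rule sum.cong) (auto simp: m)
  finally show ?thesis by (simp add: 0 l upc_def hs add.assoc)
qed

lemma upc_TT: "set hs \<subseteq> carrier H \<Longrightarrow> upc hs \<in> TT H"
  unfolding upc_def
  by (intro TT_add TT_scale fs.subspace_sum[OF TT_subspace] coface_list_TT) auto

text \<open>Comultiplying an entry \<open>h\<close> before the comparison map gives
  \<open>h_1 \<otimes> S(h_2) h_3 \<otimes> S(h_4) ...\<close>; the middle factor contracts, so an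
  inner coface becomes the insertion of \<open>1\<close> between the two parts of
  \<open>h\<close>.\<close>

lemma tins_tphi:
  assumes "t \<in> tpower H n"
  shows "tins H (tphi H t) = tphi H (hopf_up H n t)"
proof (rule tpower_eqI[OF _ _ _ assms])
  have "tins H (philist H hs) = tpre H \<one> (philist H hs) + tphi H (upc hs)" if "set hs \<subseteq> carrier H" for hs
    using that
  proof (induction hs)
    case Nil
    show ?case using tphi_tpre_one[of "tens H []"] by (simp add: upc_def op_lin_simps2)
  next
    case (Cons h hs)
    let ?S = "antipode H"
    define U where "U = philist H hs"
    have U [simp]: "U \<in> TN H" using Cons by (simp add: U_def philist_TN)
    have IH: "tins H U = tpre H \<one> U + tphi H (upc hs)" using Cons by (simp add: U_def)
    have T [simp]: "upc hs \<in> TT H" using Cons by (simp add: upc_TT)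
    have "tphi H (coface_list H 0 (h # hs)) =
       sw H h (\<lambda>a b. sw H a (\<lambda>p q. sw H b (\<lambda>r s. tpre H p (tpre H (?S q \<otimes> r) (tlm H (?S s) U)))))"
      using Cons by (simp add: op_sw2 op_sw op_comm_TT U_def[symmetric] tens_Cons del: tpre_tens)
    also have "\<dots> = sw H h (\<lambda>p b. sw H b (\<lambda>q b. sw H b (\<lambda>r s. tpre H p (tpre H (?S q \<otimes> r) (tlm H (?S s) U)))))"
      by (rule sw_coassoc[where g = "\<lambda>p q b. sw H b (\<lambda>r s. tpre H p (tpre H (?S q \<otimes> r) (tlm H (?S s) U)))"])
        (use Cons in \<open>simp_all add: lin_simps\<close>)
    also have "\<dots> = sw H h (\<lambda>p b. sw H b (\<lambda>z s. sw H z (\<lambda>q r. tpre H p (tpre H (?S q \<otimes> r) (tlm H (?S s) U)))))"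
      by (rule sw_cong, rule sw_coassoc[symmetric]) (use Cons in \<open>simp_all add: lin_simps\<close>)
    also have "\<dots> = sw H h (\<lambda>p b. sw H b (\<lambda>z s. counit H z *\<^sub>k tpre H p (tpre H \<one> (tlm H (?S s) U))))"
      by (rule sw_cong, rule sw_cong, rule sw_antipode_left[where g = "\<lambda>z. tpre H _ (tpre H z (tlm H (?S _) U))"])
        (use Cons in \<open>simp_all add: lin_simps\<close>)
    also have "\<dots> = sw H h (\<lambda>p b. tpre H p (tpre H \<one> (tlm H (?S b) U)))"
      by (rule sw_cong, rule sw_counit_left) (use Cons in \<open>simp_all add: lin_simps\<close>)
    finally have c: "tphi H (coface_list H 0 (h # hs)) = sw H h (\<lambda>p b. tpre H p (tpre H \<one> (tlm H (?S b) U)))" .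
    show ?case
      using Cons.prems
      by (simp add: op_sw2 U_def[symmetric] IH tins_tlm op_lin_simps op_lin_simps2 upc_Cons c op_sw op_comm_TT
          sw_diff sw_add del: coface_list.simps)
  qed
  then show "tins H (tphi H (tens H hs)) = tphi H (hopf_up H n (tens H hs))"
    if "set hs \<subseteq> carrier H" "length hs = n" for hs
    using that tphi_tpre_one[of "tens H hs"] by (simp add: hopf_up_tens op_lin_simps2 del: philist.simps(2))
qed (intro linop_intros linop_compose[OF linop_basic(2) linop_hopf_up])+

lemma mlin_cocyc: "mlin H (\<lambda>hs. case hs of [] \<Rightarrow> tens H [] | h # hs' \<Rightarrow> diag_act H (antipode H h) (hs' @ [\<one>]))"
proof (rule mlin_Cons[where g = "tens H" and A = "\<lambda>x t. tdiag H (antipode H x) (tapp H t \<one>)"])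
  fix xs assume "set xs \<subseteq> carrier H"
  then show "lin H (\<lambda>x. tdiag H (antipode H x) (tapp H (tens H xs) \<one>))"
    by (simp add: lin_simps del: tapp_tens)
qed (auto intro!: linop_intros mlin_tens simp: tdiag_tens)

lemma linop_cocyc: "linop (cocyc H)"
  unfolding cocyc_def by (intro linop_intros)

lemma cocyc_Nil [simp]: "cocyc H (tens H []) = tens H []"
  unfolding cocyc_def by (subst tbind_tens[OF mlin_cocyc]) simp

lemma cocyc_tpre:
  assumes "t \<in> TT H" "h \<in> carrier H"
  shows "cocyc H (tpre H h t) = tdiag H (antipode H h) (tapp H t \<one>)"
proof (rule TT_eqI[OF _ _ _ assms(1)])
  fix xs assume "set xs \<subseteq> carrier H"
  then show "cocyc H (tpre H h (tens H xs)) = tdiag H (antipode H h) (tapp H (tens H xs) \<one>)"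
    unfolding cocyc_def using assms(2) by (simp add: tbind_tens[OF mlin_cocyc] tdiag_tens)
qed (intro linop_intros linop_compose[OF linop_cocyc])+

lemma tphi_tapp_one:
  assumes "t \<in> TT H"
  shows "tphi H (tapp H t \<one>) = tapp H (tphi H t) \<one>"
proof -
  have "tphi H (tapp H (tens H xs) \<one>) = tapp H (tphi H (tens H xs)) \<one>" if "set xs \<subseteq> carrier H" for xs
    using that
  proof (induction rule: TT_list_induct)
    case Nil
    then show ?case using tphi_tpre_one[of "tens H []"] by simp
  next
    case (Cons x xs)
    have "tphi H (tapp H (tens H (x # xs)) \<one>) = tphi H (tpre H x (tapp H (tens H xs) \<one>))"
      using Cons by simp
    also have "\<dots> = sw H x (\<lambda>a b. tpre H a (tlm H (antipode H b) (tapp H (tphi H (tens H xs)) \<one>)))"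
      using Cons by (subst tphi_tpre) (simp_all del: tapp_tens tphi_tens)
    also have "\<dots> = tapp H (tphi H (tens H (x # xs))) \<one>"
      using Cons philist_TN[of xs] by (simp add: op_sw op_comm_TT op_comm_TN)
    finally show ?case .
  qed
  then show ?thesis
    by (rule TT_eqI[OF linop_ops(2)[OF linop_tapp[OF linop_id]] linop_tapp[OF linop_basic(2)] _ assms])
qed

end

lemma (in involutive_hopf_algebra) trot_tphi:
  assumes "t \<in> TT H"
  shows "trot H (tphi H t) = tphi H (cocyc H t)"
proof -
  let ?S = "antipode H"
  have "trot H (tphi H (tens H xs)) = tphi H (cocyc H (tens H xs))" if "set xs \<subseteq> carrier H" for xs
    using that
  proof (cases xs)
    case Nil
    then show ?thesis by simp
  next
    case (Cons h hs)
    define U where "U = philist H hs"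
    have h: "h \<in> carrier H" "set hs \<subseteq> carrier H" using Cons that by auto
    have U [simp]: "U \<in> TN H" using h by (simp add: U_def philist_TN)
    have "tphi H (cocyc H (tens H xs)) = tphi H (tdiag H (?S h) (tapp H (tens H hs) \<one>))"
      using Cons h by (simp add: tens_Cons cocyc_tpre del: tpre_tens)
    also have "\<dots> = sw H (?S h) (\<lambda>a b. tlm H a (trm H (?S b) (tapp H U \<one>)))"
      using h by (simp add: tphi_tdiag tphi_tapp_one U_def del: tapp_tens)
    also have "\<dots> = sw H (?S h) (\<lambda>a b. tapp H (tlm H a U) (?S b))"
      using h by (simp add: op_comm_TT op_comm_TN)
    \<comment> \<open>The coproduct of \<open>S(h)\<close> exchanges the parts of \<open>h\<close>,
      and conjugation applies the antipode to one of them once more, so the new last factor is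
      \<open>S(S(h_1))\<close>. This is the place where \<open>S\<close> has to be an
      involution.\<close>
    also have "\<dots> = sw H h (\<lambda>a b. tapp H (tlm H (?S b) U) (?S (?S a)))"
      by (rule sw_antipode) (use h in \<open>simp_all add: lin_simps\<close>)
    also have "\<dots> = sw H h (\<lambda>a b. tapp H (tlm H (?S b) U) a)"
      by (simp add: antipode_involutive)
    also have "\<dots> = trot H (tphi H (tens H xs))"
      using Cons h by (simp add: op_sw2 U_def[symmetric])
    finally show ?thesis ..
  qed
  then show ?thesis
    by (rule TT_eqI[OF linop_ops(7)[OF linop_basic(2)] linop_compose[OF linop_basic(2) linop_cocyc] _ assms])
qed

section \<open>Forms\<close>

context hopf_algebra
begin

lemma TN_list_induct [consumes 2, case_names single Cons]:
  assumes "set xs \<subseteq> carrier H" "xs \<noteq> []" "\<And>x. x \<in> carrier H \<Longrightarrow> P [x]"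
    "\<And>x xs. x \<in> carrier H \<Longrightarrow> set xs \<subseteq> carrier H \<Longrightarrow> xs \<noteq> [] \<Longrightarrow> P xs \<Longrightarrow> P (x # xs)"
  shows "P xs"
  using assms(1,2)
proof (induction xs)
  case (Cons x xs)
  then show ?case using assms(3,4) by (cases "xs = []") auto
qed simp

lemma TN_eq_listI:
  assumes "linop f" "linop g"
    "\<And>xs. set xs \<subseteq> carrier H \<Longrightarrow> xs \<noteq> [] \<Longrightarrow> f (tens H xs) = g (tens H xs)" "t \<in> TN H"
  shows "f t = g t"
  by (rule TN_eqI[OF assms(1,2) _ assms(4)]) (use assms(3) in auto)

section \<open>The product of the tensor algebra\<close>

definition "olist xs ys = tens H (butlast xs @ (last xs \<otimes> hd ys) # tl ys)"

lemma mlin_olist_right: "set xs \<subseteq> carrier H \<Longrightarrow> xs \<noteq> [] \<Longrightarrow> mlin H (olist xs)"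
proof (rule mlinI)
  fix us vs assume xs: "set xs \<subseteq> carrier H" "xs \<noteq> []" and uv: "set us \<subseteq> carrier H" "set vs \<subseteq> carrier H"
  show "lin H (\<lambda>x. olist xs (us @ x # vs))"
  proof (cases us)
    case Nil
    show ?thesis
      using lin_tens_hlin[OF hlin_mult[of "last xs"], of "butlast xs" vs] xs uv Nil by (simp add: olist_def)
  next
    case (Cons u us')
    show ?thesis
      using lin_tens[of "butlast xs @ (last xs \<otimes> u) # us'" vs] xs uv Cons by (simp add: olist_def)
  qed
qed

lemma mlin_olist_left: "set ys \<subseteq> carrier H \<Longrightarrow> ys \<noteq> [] \<Longrightarrow> mlin H (\<lambda>xs. olist xs ys)"
proof (rule mlinI)
  fix us vs assume ys: "set ys \<subseteq> carrier H" "ys \<noteq> []" and uv: "set us \<subseteq> carrier H" "set vs \<subseteq> carrier H"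
  have t: "set (tl ys) \<subseteq> carrier H" using ys by (cases ys) auto
  have h: "hd ys \<in> carrier H" using ys by (cases ys) auto
  show "lin H (\<lambda>x. olist (us @ x # vs) ys)"
  proof (cases vs rule: rev_cases)
    case Nil
    show ?thesis
      using lin_tens_hlin[OF hlin_mult'[OF h], of us "tl ys"] t uv Nil by (simp add: olist_def butlast_append)
  next
    case (snoc vs' v)
    show ?thesis
      using lin_tens[of us "vs' @ (v \<otimes> hd ys) # tl ys"] t h uv snoc by (simp add: olist_def butlast_append)
  qed
qed

lemma linop_olist: "linop (\<lambda>t. tbind t (olist xs))" by (intro linop_intros)

lemma tbind_olist: "set xs \<subseteq> carrier H \<Longrightarrow> xs \<noteq> [] \<Longrightarrow> tbind (tens H ys) (olist xs) = olist xs ys"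
  by (rule tbind_tens[OF mlin_olist_right])

lemma mlin_lin_TN:
  assumes "\<And>xs. set xs \<subseteq> carrier H \<Longrightarrow> xs \<noteq> [] \<Longrightarrow> lin H (\<lambda>x. f x (tens H xs))" "\<And>x. linop (f x)" "t \<in> TN H"
  shows "lin H (\<lambda>x. f x t)"
  unfolding lin_def
proof (intro conjI ballI allI)
  fix x y assume xy: "x \<in> carrier H" "y \<in> carrier H"
  show "f (x \<oplus> y) t = f x t + f y t"
    by (rule TN_eq_listI[OF assms(2) linop_plus[OF assms(2) assms(2)] _ assms(3)]) (use assms(1) xy in \<open>auto simp: lin_def\<close>)
next
  fix x and c assume x: "x \<in> carrier H"
  show "f (c \<odot> x) t = c *\<^sub>k f x t"
    by (rule TN_eq_listI[OF assms(2) linop_fscale[OF assms(2)] _ assms(3)]) (use assms(1) x in \<open>auto simp: lin_def\<close>)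
qed

lemma odot_tens:
  assumes xs: "set xs \<subseteq> carrier H" "xs \<noteq> []" and t: "t \<in> TN H"
  shows "odot H (tens H xs) t = tbind t (olist xs)"
proof -
  have "mlin H (\<lambda>xs. tbind t (olist xs))"
  proof (rule mlinI)
    fix us vs assume uv: "set us \<subseteq> carrier H" "set vs \<subseteq> carrier H"
    show "lin H (\<lambda>x. tbind t (olist (us @ x # vs)))"
    proof (rule mlin_lin_TN[where f = "\<lambda>x t. tbind t (olist (us @ x # vs))", OF _ linop_olist t])
      fix ys assume ys: "set ys \<subseteq> carrier H" "ys \<noteq> []"
      have l: "lin H (\<lambda>x. olist (us @ x # vs) ys)"
        using mlinD[OF mlin_olist_left[OF ys] uv] .
      show "lin H (\<lambda>x. tbind (tens H ys) (olist (us @ x # vs)))"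
        by (rule lin_cong[OF tbind_olist l]) (use uv in auto)
    qed
  qed
  then have "tbind (tens H xs) (\<lambda>xs. tbind t (olist xs)) = tbind t (olist xs)" by (rule tbind_tens)
  then show ?thesis by (simp add: odot_def olist_def[abs_def])
qed

lemma linop_odot [linop_intros]: "linop F \<Longrightarrow> linop (\<lambda>s. odot H (F s) t)"
  unfolding odot_def by (intro linop_intros; assumption)

lemma odot_single: "t \<in> TN H \<Longrightarrow> x \<in> carrier H \<Longrightarrow> odot H (tens H [x]) t = tlm H x t"
  by (subst odot_tens, simp_all, rule TN_eqI[OF linop_olist linop_tlm[OF linop_id]])
    (auto simp: tbind_olist, simp add: olist_def)

lemma odot_tpre:
  assumes s: "s \<in> TN H" and t: "t \<in> TN H" and x: "x \<in> carrier H"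
  shows "odot H (tpre H x s) t = tpre H x (odot H s t)"
proof (rule TN_eq_listI[OF _ _ _ s])
  fix xs assume xs: "set xs \<subseteq> carrier H" "xs \<noteq> []"
  have "tbind t (olist (x # xs)) = tpre H x (tbind t (olist xs))"
    by (rule TN_eq_listI[OF linop_olist linop_tpre[OF linop_olist] _ t])
      (use xs x in \<open>simp add: tbind_olist, simp add: olist_def\<close>)
  then show "odot H (tpre H x (tens H xs)) t = tpre H x (odot H (tens H xs) t)"
    using xs x t by (simp add: odot_tens)
qed (intro linop_intros)+

lemma odot_add_right:
  assumes s: "s \<in> TN H" and t: "t \<in> TN H" "t' \<in> TN H"
  shows "odot H s (t + t') = odot H s t + odot H s t'"
  by (rule TN_eq_listI[OF _ _ _ s])
    (use t in \<open>auto intro!: linop_intros simp: odot_tens linop_add[OF linop_olist]\<close>)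

lemma odot_scale_right:
  assumes s: "s \<in> TN H" and t: "t \<in> TN H"
  shows "odot H s (c *\<^sub>k t) = c *\<^sub>k odot H s t"
  by (rule TN_eq_listI[OF _ _ _ s])
    (use t in \<open>auto intro!: linop_intros simp: odot_tens linop_scale[OF linop_olist]\<close>)

lemma odot_zero_right: "s \<in> TN H \<Longrightarrow> odot H s 0 = 0"
  using odot_scale_right[of s 0 0] by simp

lemmas odot_left_simps = linop_add[OF linop_odot[OF linop_id]] linop_scale[OF linop_odot[OF linop_id]]
  linop_diff[OF linop_odot[OF linop_id]] linop_zero[OF linop_odot[OF linop_id]]
  linop_minus[OF linop_odot[OF linop_id]]

lemmas odot_sw = linop_of_sw[OF linop_odot[OF linop_id]]

lemma odot_TN [simp]:
  assumes s: "s \<in> TN H" and t: "t \<in> TN H"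
  shows "odot H s t \<in> TN H"
proof (rule TN_into[OF linop_odot[OF linop_id] TN_subspace _ s])
  have "odot H (tens H xs) t \<in> TN H" if "set xs \<subseteq> carrier H" "xs \<noteq> []" for xs
    using that
  proof (induction rule: TN_list_induct)
    case (Cons x xs)
    then show ?case using t odot_tpre[of "tens H xs" t x] by simp
  qed (simp add: odot_single t)
  then show "odot H (tens H (x # xs)) t \<in> TN H" if "x \<in> carrier H" "set xs \<subseteq> carrier H" for x xs
    using that by simp
qed

lemma odot_tpower:
  assumes s: "s \<in> tpower H (Suc m)" and t: "t \<in> tpower H (Suc n)"
  shows "odot H s t \<in> tpower H (Suc (m + n))"
proof (rule tpower_into[OF linop_odot[OF linop_id] tpower_subspace _ s])
  have t': "t \<in> TN H" by (rule tpower_TN[OF t]) simp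
  have "odot H (tens H xs) t \<in> tpower H (length xs + n)" if "set xs \<subseteq> carrier H" "xs \<noteq> []" for xs
    using that
  proof (induction rule: TN_list_induct)
    case (Cons x xs)
    then show ?case using t' odot_tpre[of "tens H xs" t x] by simp
  qed (use t t' in \<open>simp add: odot_single\<close>)
  then show "odot H (tens H xs) t \<in> tpower H (Suc (m + n))" if "set xs \<subseteq> carrier H" "length xs = Suc m" for xs
    using that by (metis add_Suc list.size(3) nat.distinct(1))
qed

lemma odot_tlm:
  assumes s: "s \<in> TN H" and t: "t \<in> TN H" and x: "x \<in> carrier H"
  shows "odot H (tlm H x s) t = tlm H x (odot H s t)"
proof (rule TN_eqI[OF _ _ _ s])
  fix y ys assume y: "y \<in> carrier H" "set ys \<subseteq> carrier H"
  show "odot H (tlm H x (tens H (y # ys))) t = tlm H x (odot H (tens H (y # ys)) t)"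
  proof (cases "ys = []")
    case True
    then show ?thesis using y x t by (simp add: odot_single op_comm_TT)
  next
    case False
    then have "odot H (tens H ((x \<otimes> y) # ys)) t = tpre H (x \<otimes> y) (odot H (tens H ys) t)"
      "odot H (tens H (y # ys)) t = tpre H y (odot H (tens H ys) t)"
      using odot_tpre[of "tens H ys" t "x \<otimes> y"] odot_tpre[of "tens H ys" t y] y x t by simp_all
    then show ?thesis using y x t False by (simp add: op_comm_TT)
  qed
qed (intro linop_intros)+

lemma odot_assoc:
  assumes r: "r \<in> TN H" and s: "s \<in> TN H" and t: "t \<in> TN H"
  shows "odot H (odot H r s) t = odot H r (odot H s t)"
proof (rule TN_eq_listI[OF _ _ _ r])
  fix xs assume "set xs \<subseteq> carrier H" "xs \<noteq> []"
  then show "odot H (odot H (tens H xs) s) t = odot H (tens H xs) (odot H s t)"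
  proof (induction rule: TN_list_induct)
    case (Cons x xs)
    then show ?case using s t by (simp add: tens_Cons odot_tpre del: tpre_tens)
  qed (use s t in \<open>simp add: odot_single odot_tlm\<close>)
qed (intro linop_intros)+

lemma odot_single_right:
  assumes s: "s \<in> TN H" and x: "x \<in> carrier H"
  shows "odot H s (tens H [x]) = trm H x s"
proof (rule TN_eq_listI[OF _ _ _ s])
  fix xs assume "set xs \<subseteq> carrier H" "xs \<noteq> []"
  then show "odot H (tens H xs) (tens H [x]) = trm H x (tens H xs)"
  proof (induction rule: TN_list_induct)
    case (Cons y ys)
    then show ?case using x by (simp add: tens_Cons odot_tpre op_comm_TN del: tpre_tens trm_tens)
  qed (use x in \<open>simp add: odot_single\<close>)
qed (intro linop_intros)+

lemma diff1_eq: "a \<in> carrier H \<Longrightarrow> diff1 H a = tpre H \<one> (tens H [a]) - tpre H a (tens H [\<one>])"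
  by (simp add: diff1_def)

lemma diff1_TN [simp]: "a \<in> carrier H \<Longrightarrow> diff1 H a \<in> TN H"
  by (simp add: diff1_def)

lemma diff1_tpower: "a \<in> carrier H \<Longrightarrow> diff1 H a \<in> tpower H 2"
  unfolding diff1_def by (intro fs.subspace_diff[OF tpower_subspace] tens_in_tpower) auto

lemma odot_diff1_left:
  "a \<in> carrier H \<Longrightarrow> t \<in> TN H \<Longrightarrow> odot H (diff1 H a) t = tpre H \<one> (tlm H a t) - tpre H a t"
  by (simp add: diff1_eq odot_left_simps odot_tpre odot_single op_one del: tpre_tens)

lemma odot_diff1_right:
  assumes s: "s \<in> TN H" and a: "a \<in> carrier H"
  shows "odot H s (diff1 H a) = tapp H s a - tapp H (trm H a s) \<one>"
proof (rule TN_eq_listI[OF _ _ _ s])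
  fix xs assume "set xs \<subseteq> carrier H" "xs \<noteq> []"
  then show "odot H (tens H xs) (diff1 H a) = tapp H (tens H xs) a - tapp H (trm H a (tens H xs)) \<one>"
  proof (induction rule: TN_list_induct)
    case (single x)
    have "odot H (tens H [x]) (diff1 H a) = tlm H x (diff1 H a)" using single a by (simp add: odot_single)
    then show ?case using single a by (simp add: diff1_def op_lin_simps)
  next
    case (Cons y ys)
    then show ?case using a
      by (simp add: tens_Cons odot_tpre op_comm_TN op_comm_TT op_lin_simps del: tpre_tens trm_tens tapp_tens)
  qed
qed (intro linop_intros)+

section \<open>Forms as tensors\<close>

definition fstep where "fstep = (\<lambda>\<omega> a. odot H \<omega> (diff1 H a))"

lemma foldl_fstep_TN: "set as \<subseteq> carrier H \<Longrightarrow> \<omega> \<in> TN H \<Longrightarrow> foldl fstep \<omega> as \<in> TN H"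
  by (induction as arbitrary: \<omega>) (auto simp: fstep_def)

lemma foldl_fstep_tpre: "set as \<subseteq> carrier H \<Longrightarrow> \<omega> \<in> TN H \<Longrightarrow> x \<in> carrier H \<Longrightarrow>
   foldl fstep (tpre H x \<omega>) as = tpre H x (foldl fstep \<omega> as)"
  by (induction as arbitrary: \<omega>) (auto simp: fstep_def odot_tpre)

lemma foldl_fstep_diff: "foldl fstep (s - t) as = foldl fstep s as - foldl fstep t as"
  by (induction as arbitrary: s t) (auto simp: fstep_def odot_left_simps)

lemma form_foldl: "form H (a # as) = foldl fstep (tens H [a]) as"
  by (simp add: form_def fstep_def)

lemma form_single [simp]: "form H [a] = tens H [a]"
  by (simp add: form_foldl)

text \<open>The product \<open>a db\<close> is \<open>a \<otimes> b - a b \<otimes> 1\<close>. Both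
  forms on the right have a new head, so inductions over forms keep the head arbitrary, as in
  \<open>form_list_induct\<close>.\<close>

lemma form_Cons:
  assumes "a \<in> carrier H" "b \<in> carrier H" "set as \<subseteq> carrier H"
  shows "form H (a # b # as) = tpre H a (form H (b # as)) - tpre H (a \<otimes> b) (form H (\<one> # as))"
proof -
  have "fstep (tens H [a]) b = tpre H a (tens H [b]) - tpre H (a \<otimes> b) (tens H [\<one>])"
    using assms by (simp add: fstep_def odot_single) (simp add: diff1_def op_lin_simps)
  then show ?thesis using assms by (simp add: form_foldl foldl_fstep_diff foldl_fstep_tpre del: tpre_tens)
qed

lemma form_snoc: "as \<noteq> [] \<Longrightarrow> form H (as @ [a]) = odot H (form H as) (diff1 H a)"
  by (cases as) (simp_all add: form_foldl fstep_def)

lemma form_TN [simp]: "a \<in> carrier H \<Longrightarrow> set as \<subseteq> carrier H \<Longrightarrow> form H (a # as) \<in> TN H"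
  by (simp add: form_foldl foldl_fstep_TN)

lemma form_list_induct [consumes 2, case_names single Cons]:
  assumes "a \<in> carrier H" "set as \<subseteq> carrier H"
    "\<And>a. a \<in> carrier H \<Longrightarrow> P a []"
    "\<And>a b as. a \<in> carrier H \<Longrightarrow> b \<in> carrier H \<Longrightarrow> set as \<subseteq> carrier H \<Longrightarrow>
       (\<And>c. c \<in> carrier H \<Longrightarrow> P c as) \<Longrightarrow> P a (b # as)"
  shows "P a as"
  using assms(1,2) by (induction as arbitrary: a) (auto intro: assms(3,4))

lemma form_tpower: "a \<in> carrier H \<Longrightarrow> set as \<subseteq> carrier H \<Longrightarrow> form H (a # as) \<in> tpower H (Suc (length as))"
proof (induction rule: form_list_induct)
  case (single a)
  then show ?case by (auto intro!: tens_in_tpower)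
next
  case (Cons a b as)
  then show ?case by (auto simp: form_Cons intro!: fs.subspace_diff[OF tpower_subspace])
qed

lemma tlm_form:
  "a \<in> carrier H \<Longrightarrow> set as \<subseteq> carrier H \<Longrightarrow> c \<in> carrier H \<Longrightarrow> tlm H c (form H (a # as)) = form H ((c \<otimes> a) # as)"
  by (cases as) (auto simp: form_Cons op_lin_simps op_comm_TT mult_assoc')

lemma tsg_form: "a \<in> carrier H \<Longrightarrow> set as \<subseteq> carrier H \<Longrightarrow> tsg H i (form H (a # as)) = 0"
proof (induction arbitrary: i rule: form_list_induct)
  case (single a)
  then show ?case by (cases i) (simp_all add: tsg_tens op_lin_simps)
next
  case (Cons a b as)
  show ?case
  proof (cases i)
    case 0
    then show ?thesis using Cons by (simp add: form_Cons op_lin_simps2 tlm_form)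
  next
    case (Suc j)
    then show ?thesis using Cons by (simp add: form_Cons op_lin_simps2 op_lin_simps)
  qed
qed

lemma form_one_one: "set as \<subseteq> carrier H \<Longrightarrow> form H (\<one> # \<one> # as) = 0"
  by (simp add: form_Cons)

lemma tins_form: "a \<in> carrier H \<Longrightarrow> set as \<subseteq> carrier H \<Longrightarrow> tins H (form H (a # as)) = form H (\<one> # a # as)"
proof (induction rule: form_list_induct)
  case (single a)
  then show ?case by (simp add: form_Cons)
next
  case (Cons a b as)
  then show ?case
    by (simp add: form_Cons[of a b as] form_Cons[of \<one> a "b # as"] op_lin_simps2 op_lin_simps form_one_one)
qed

text \<open>\<open>tnrm i\<close> is the projection \<open>1 - \<delta>\<^sub>i \<sigma>\<^sub>i\<close> onto the kernel of \<open>\<sigma>\<^sub>i\<close>; the composition of all of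
  them sends \<open>a\<^sub>0 \<otimes> \<dots> \<otimes> a\<^sub>n\<close> to \<open>a\<^sub>0 da\<^sub>1 \<dots> da\<^sub>n\<close>.\<close>

end

fun unlist :: "('k::field, 'a) hopf \<Rightarrow> nat \<Rightarrow> 'a list \<Rightarrow> ('k, 'a) tensor" where
  "unlist H i [] = 0"
| "unlist H 0 (x # xs) = tpre H x (tpre H \<one>\<^bsub>H\<^esub> (tens H xs))"
| "unlist H (Suc i) (x # xs) = tpre H x (unlist H i xs)"

definition tnrm :: "('k::field, 'a) hopf \<Rightarrow> nat \<Rightarrow> ('k, 'a) tensor \<Rightarrow> ('k, 'a) tensor"
  where "tnrm H i t = t - tbind (tsg H i t) (unlist H i)"

primrec tform :: "('k::field, 'a) hopf \<Rightarrow> nat \<Rightarrow> nat \<Rightarrow> ('k, 'a) tensor \<Rightarrow> ('k, 'a) tensor" where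
  "tform H i 0 t = t"
| "tform H i (Suc m) t = tform H (Suc i) m (tnrm H i t)"

lemma linop_tnrm [linop_intros]: "linop F \<Longrightarrow> linop (\<lambda>t. tnrm H i (F t))"
  unfolding tnrm_def by (intro linop_intros; assumption)

lemma linop_tform: "linop F \<Longrightarrow> linop (\<lambda>t. tform H i m (F t))"
proof (induction m arbitrary: F i)
  case (Suc m)
  show ?case using Suc.IH[OF linop_tnrm[OF Suc.prems]] by simp
qed simp

context hopf_algebra
begin

lemma unlist_TT: "set xs \<subseteq> carrier H \<Longrightarrow> unlist H i xs \<in> TT H"
proof (induction xs arbitrary: i)
  case (Cons x xs)
  then show ?case by (cases i) auto
qed simp

lemma mlin_unlist: "mlin H (unlist H i)"
proof (induction i)
  case 0
  show ?case
    by (rule mlin_Cons[where g = "tens H" and A = "\<lambda>x t. tpre H x (tpre H \<one> t)"])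
      (auto intro!: linop_intros op_lin mlin_tens simp del: tpre_tens)
next
  case (Suc i)
  show ?case
    by (rule mlin_Cons[where g = "unlist H i" and A = "tpre H"])
      (use Suc in \<open>auto intro!: linop_intros op_lin unlist_TT\<close>)
qed

lemma tbind_unlist_tpre:
  assumes "t \<in> TT H" "x \<in> carrier H"
  shows "tbind (tpre H x t) (unlist H 0) = tpre H x (tpre H \<one> t)"
    "tbind (tpre H x t) (unlist H (Suc i)) = tpre H x (tbind t (unlist H i))"
  by (rule TT_eqI[OF _ _ _ assms(1)];
      use assms(2) in \<open>auto intro!: linop_intros simp: tbind_tens[OF mlin_unlist]\<close>)+

lemma tnrm_tpre: "t \<in> TT H \<Longrightarrow> x \<in> carrier H \<Longrightarrow> tnrm H (Suc i) (tpre H x t) = tpre H x (tnrm H i t)"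
  by (simp add: tnrm_def op_lin_simps tbind_unlist_tpre)

lemma tnrm_TT: "t \<in> TT H \<Longrightarrow> tnrm H i t \<in> TT H"
proof (rule TT_into[OF linop_tnrm[OF linop_id] TT_subspace])
  have "tbind t (unlist H i) \<in> TT H" if "t \<in> TT H" for t
    by (rule TT_into[OF _ TT_subspace _ that]) (auto intro!: linop_intros simp: tbind_tens[OF mlin_unlist] unlist_TT)
  then show "tnrm H i (tens H xs) \<in> TT H" if "set xs \<subseteq> carrier H" for xs
    using that by (simp add: tnrm_def)
qed

lemma tform_tpre:
  "t \<in> TT H \<Longrightarrow> x \<in> carrier H \<Longrightarrow> tform H (Suc i) m (tpre H x t) = tpre H x (tform H i m t)"
  by (induction m arbitrary: i t) (auto simp: tnrm_tpre tnrm_TT)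

text \<open>\<open>tnrm H 0\<close> replaces \<open>a \<otimes> b \<otimes> ...\<close> by
  \<open>a \<otimes> b \<otimes> ... - a b \<otimes> 1 \<otimes> ...\<close>, and the remaining
  projections act behind the first factor; this is the recursion \<open>form_Cons\<close>.\<close>

lemma tform_tens:
  "a \<in> carrier H \<Longrightarrow> set as \<subseteq> carrier H \<Longrightarrow> tform H 0 (length as) (tens H (a # as)) = form H (a # as)"
proof (induction rule: form_list_induct)
  case (single a)
  then show ?case by simp
next
  case (Cons a b as)
  have "tnrm H 0 (tens H (a # b # as)) = tpre H a (tens H (b # as)) - tpre H (a \<otimes> b) (tens H (\<one> # as))"
    using Cons by (simp add: tnrm_def tsg_tens tbind_tens[OF mlin_unlist])
  then show ?case
    using Cons by (simp add: linop_diff[OF linop_tform[OF linop_id]] tform_tpre form_Cons del: tpre_tens)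
qed

lemma tform_fixed: "(\<And>i. tsg H i t = 0) \<Longrightarrow> tform H i m t = t"
proof (induction m arbitrary: i)
  case (Suc m)
  have "tnrm H i t = t"
    using Suc.prems linop_zero[OF linop_tbind[OF linop_id]] by (simp add: tnrm_def)
  then show ?case using Suc by simp
qed simp

section \<open>The graded pieces of the universal calculus\<close>

definition "formspan n = fs.span {form H (a # as) | a as. a \<in> carrier H \<and> set as \<subseteq> carrier H \<and> length as = n}"

lemma formspan_subspace: "fs.subspace (formspan n)" by (simp add: formspan_def)

lemma form_in_formspan: "a \<in> carrier H \<Longrightarrow> set as \<subseteq> carrier H \<Longrightarrow> length as = n \<Longrightarrow> form H (a # as) \<in> formspan n"
  unfolding formspan_def by (rule fs.span_base) blast

lemma formspan_into:
  assumes "linop f" "fs.subspace W"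
    "\<And>a as. a \<in> carrier H \<Longrightarrow> set as \<subseteq> carrier H \<Longrightarrow> length as = n \<Longrightarrow> f (form H (a # as)) \<in> W" "t \<in> formspan n"
  shows "f t \<in> W"
  by (rule linop_span_into[OF assms(1,2) _ assms(4)[unfolded formspan_def]]) (use assms(3) in auto)

lemma formspan_eqI:
  assumes "linop f" "linop g"
    "\<And>a as. a \<in> carrier H \<Longrightarrow> set as \<subseteq> carrier H \<Longrightarrow> length as = n \<Longrightarrow> f (form H (a # as)) = g (form H (a # as))"
    "t \<in> formspan n"
  shows "f t = g t"
  by (rule linop_eq_on_span[OF assms(1,2) _ assms(4)[unfolded formspan_def]]) (use assms(3) in auto)

text \<open>A tensor annihilated by all multiplications of neighbours is fixed by the projections
  that make up \<open>tform\<close>, and on pure tensors \<open>tform\<close> takes forms as values.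
  With this description, an operator preserves forms as soon as its commutation with
  \<open>tsg\<close> is known.\<close>

lemma formspan_eq: "formspan n = {t \<in> tpower H (Suc n). \<forall>i. tsg H i t = 0}"
proof (intro equalityI subsetI)
  fix t assume t: "t \<in> formspan n"
  have "t \<in> tpower H (Suc n)"
    by (rule formspan_into[OF linop_id tpower_subspace _ t]) (use form_tpower in auto)
  moreover have "tsg H i t = 0" for i
    by (rule formspan_eqI[OF linop_basic(8) linop_const0 _ t]) (use tsg_form in auto)
  ultimately show "t \<in> {t \<in> tpower H (Suc n). \<forall>i. tsg H i t = 0}" by simp
next
  fix t assume t: "t \<in> {t \<in> tpower H (Suc n). \<forall>i. tsg H i t = 0}"
  have "tform H 0 n t \<in> formspan n"
  proof (rule tpower_into[OF linop_tform[OF linop_id] formspan_subspace])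
    show "t \<in> tpower H (Suc n)" using t by simp
    fix xs assume xs: "set xs \<subseteq> carrier H" "length xs = Suc n"
    then obtain a as where "xs = a # as" "length as = n" by (cases xs) auto
    then show "tform H 0 n (tens H xs) \<in> formspan n"
      using xs tform_tens[of a as] form_in_formspan[of a as] by simp
  qed
  then show "t \<in> formspan n" using t by (simp add: tform_fixed)
qed

lemma formspan_TN: "t \<in> formspan n \<Longrightarrow> t \<in> TN H"
  by (simp add: formspan_eq tpower_TN[of t H "Suc n"])

lemma formspan_tpower: "t \<in> formspan n \<Longrightarrow> t \<in> tpower H (Suc n)"
  using formspan_eq by auto

lemma Omega1_eq: "Omega1 H = formspan 1"
proof -
  have "tbind t (\<lambda>xs. tens H [xs ! 0 \<otimes> xs ! 1]) = tsg H 0 t \<and> (\<forall>i. tsg H (Suc i) t = 0)" if t: "t \<in> tpower H 2" for t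
  proof (intro conjI allI)
    show "tbind t (\<lambda>xs. tens H [xs ! 0 \<otimes> xs ! 1]) = tsg H 0 t"
    proof (rule tpower_eqI[OF linop_tbind[OF linop_id] linop_basic(8) _ t])
      fix xs assume xs: "set xs \<subseteq> carrier H" "length xs = 2"
      then obtain x y where "xs = [x, y]" "x \<in> carrier H" "y \<in> carrier H"
        by (auto simp: numeral_2_eq_2 length_Suc_conv)
      then show "tbind (tens H xs) (\<lambda>xs. tens H [xs ! 0 \<otimes> xs ! 1]) = tsg H 0 (tens H xs)"
        using lin_tens_short(1) by (simp add: tsg_tens) (subst tbind_tens_pair, auto simp: lin_simps)
    qed
    show "tsg H (Suc i) t = 0" for i
    proof (rule tpower_eqI[OF linop_basic(8) linop_const0 _ t])
      fix xs assume xs: "set xs \<subseteq> carrier H" "length xs = 2"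
      then obtain x y where "xs = [x, y]" "x \<in> carrier H" "y \<in> carrier H"
        by (auto simp: numeral_2_eq_2 length_Suc_conv)
      then show "tsg H (Suc i) (tens H xs) = 0" by (cases i) (simp_all add: tsg_tens op_lin_simps)
    qed
  qed
  then show ?thesis unfolding Omega1_def formspan_eq
    by (auto simp: numeral_2_eq_2) (metis not0_implies_Suc)
qed

text \<open>\<open>odot\<close> is a \<open>linop\<close> in its left argument only. In the right
  argument linearity is available on \<open>TN\<close>, so the inner induction carries membership in
  \<open>TN\<close> along.\<close>

lemma odot_into:
  assumes W: "fs.subspace W" and s: "s \<in> fs.span A" and t: "t \<in> fs.span B"
    and AB: "A \<subseteq> TN H" "B \<subseteq> TN H" and "\<And>a b. a \<in> A \<Longrightarrow> b \<in> B \<Longrightarrow> odot H a b \<in> W"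
  shows "odot H s t \<in> W"
proof (rule linop_span_into[OF linop_odot[OF linop_id] W _ s])
  fix a assume a: "a \<in> A"
  have "odot H a t \<in> W \<and> t \<in> TN H"
  proof (rule fs.span_induct_alt[where h = "\<lambda>t. odot H a t \<in> W \<and> t \<in> TN H", OF t])
    show "odot H a 0 \<in> W \<and> 0 \<in> TN H"
      using a AB W by (auto simp: odot_zero_right fs.subspace_0)
    show "odot H a (c *\<^sub>k x + y) \<in> W \<and> c *\<^sub>k x + y \<in> TN H" if "x \<in> B" "odot H a y \<in> W \<and> y \<in> TN H" for c x y
      using a AB W that assms(6)[OF a that(1)]
      by (auto simp: odot_add_right odot_scale_right subset_iff fs.subspace_add fs.subspace_scale)
  qed
  then show "odot H a t \<in> W" ..
qed

text \<open>The Leibniz rule in the shape \<open>a db c = a d(b c) - a b dc\<close>.\<close>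

lemma odot_form2:
  assumes "a \<in> carrier H" "b \<in> carrier H" "c \<in> carrier H" "set cs \<subseteq> carrier H"
  shows "odot H (form H [a, b]) (form H (c # cs)) = form H (a # (b \<otimes> c) # cs) - form H ((a \<otimes> b) # c # cs)"
proof -
  have "odot H (form H [a, b]) (form H (c # cs)) =
      tpre H a (form H ((b \<otimes> c) # cs)) - tpre H (a \<otimes> b) (form H (c # cs))"
    using assms by (simp add: form_Cons odot_left_simps odot_tpre odot_single tlm_form del: tpre_tens)
  then show ?thesis using assms by (simp add: form_Cons mult_assoc')
qed

lemma Omega_deg_eq: "Omega_deg H n = formspan n"
proof (induction n)
  case 0
  have 1: "{tens H xs |xs. length xs = 1 \<and> set xs \<subseteq> carrier H} = (\<lambda>a. tens H [a]) ` carrier H"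
  proof (intro equalityI subsetI)
    fix x assume "x \<in> {tens H xs |xs. length xs = 1 \<and> set xs \<subseteq> carrier H}"
    then obtain xs where "x = tens H xs" "length xs = 1" "set xs \<subseteq> carrier H" by blast
    then show "x \<in> (\<lambda>a. tens H [a]) ` carrier H" by (cases xs) auto
  next
    fix x assume "x \<in> (\<lambda>a. tens H [a]) ` carrier H"
    then obtain a where "x = tens H [a]" "a \<in> carrier H" by blast
    then show "x \<in> {tens H xs |xs. length xs = 1 \<and> set xs \<subseteq> carrier H}"
      by (intro CollectI exI[of _ "[a]"]) auto
  qed
  have 2: "{form H (a # as) |a as. a \<in> carrier H \<and> set as \<subseteq> carrier H \<and> length as = 0} = (\<lambda>a. tens H [a]) ` carrier H"
  proof (intro equalityI subsetI)
    fix x assume "x \<in> (\<lambda>a. tens H [a]) ` carrier H"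
    then obtain a where "x = form H [a]" "a \<in> carrier H" by auto
    then show "x \<in> {form H (a # as) |a as. a \<in> carrier H \<and> set as \<subseteq> carrier H \<and> length as = 0}"
      by (intro CollectI exI[of _ a] exI[of _ "[]"]) auto
  qed auto
  show ?case unfolding formspan_def Omega_deg.simps tpower_def 1 2 ..
next
  case (Suc n)
  show ?case
  proof (intro equalityI)
    have "odot H \<omega> \<eta> \<in> formspan (Suc n)" if \<omega>: "\<omega> \<in> formspan 1" and \<eta>: "\<eta> \<in> formspan n" for \<omega> \<eta>
    proof (rule odot_into[OF formspan_subspace \<omega>[unfolded formspan_def] \<eta>[unfolded formspan_def]])
      fix x y assume "x \<in> {form H (a # as) |a as. a \<in> carrier H \<and> set as \<subseteq> carrier H \<and> length as = 1}"
        "y \<in> {form H (a # as) |a as. a \<in> carrier H \<and> set as \<subseteq> carrier H \<and> length as = n}"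
      then obtain a b c cs where *: "x = form H [a, b]" "y = form H (c # cs)" "a \<in> carrier H" "b \<in> carrier H"
        "c \<in> carrier H" "set cs \<subseteq> carrier H" "length cs = n"
        by (auto simp: length_Suc_conv)
      then have "form H (a # (b \<otimes> c) # cs) \<in> formspan (Suc n)" "form H ((a \<otimes> b) # c # cs) \<in> formspan (Suc n)"
        by (auto intro!: form_in_formspan simp del: subset_iff)
      then show "odot H x y \<in> formspan (Suc n)"
        using * by (simp add: odot_form2 fs.subspace_diff[OF formspan_subspace])
    qed auto
    then show "Omega_deg H (Suc n) \<subseteq> formspan (Suc n)"
      unfolding Omega_deg.simps by (intro fs.span_minimal formspan_subspace) (auto simp: Suc Omega1_eq)
    show "formspan (Suc n) \<subseteq> Omega_deg H (Suc n)"
      unfolding formspan_def[of "Suc n"] Omega_deg.simps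
    proof (intro fs.span_mono subsetI)
      fix x assume "x \<in> {form H (a # as) |a as. a \<in> carrier H \<and> set as \<subseteq> carrier H \<and> length as = Suc n}"
      then obtain a b as where x: "x = form H (a # b # as)" "a \<in> carrier H" "b \<in> carrier H" "set as \<subseteq> carrier H" "length as = n"
        by (auto simp: length_Suc_conv)
      \<comment> \<open>Leibniz with middle element \<open>1\<close>: the second term of
        \<open>odot_form2\<close> contains \<open>d1 = 0\<close>.\<close>
      then have "x = odot H (form H [a, b]) (form H (\<one> # as))"
        using form_one_one[of as] by (simp add: odot_form2) (simp add: form_Cons)
      moreover have "form H [a, b] \<in> formspan 1" "form H (\<one> # as) \<in> formspan n"
        using x by (auto intro!: form_in_formspan)
      ultimately show "x \<in> {odot H \<omega> \<eta> |\<omega> \<eta>. \<omega> \<in> Omega1 H \<and> \<eta> \<in> Omega_deg H n}"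
        unfolding Suc Omega1_eq by blast
    qed
  qed
qed

end

definition tdeg :: "('k::field, 'a) hopf \<Rightarrow> nat \<Rightarrow> ('k, 'a) tensor \<Rightarrow> ('k, 'a) tensor"
  where "tdeg H n t = tbind t (\<lambda>xs. if length xs = Suc n then tens H xs else 0)"

definition tkar :: "('k::field, 'a) hopf \<Rightarrow> ('k, 'a) tensor \<Rightarrow> ('k, 'a) tensor"
  where "tkar H t = t - tE H (tins H t) - tins H (tE H t)"

lemma linop_tkar [linop_intros]: "linop F \<Longrightarrow> linop (\<lambda>t. tkar H (F t))"
  unfolding tkar_def by (intro linop_intros; assumption)

lemmas tkar_simps = linop_add[OF linop_tkar[OF linop_id]] linop_scale[OF linop_tkar[OF linop_id]]
  linop_diff[OF linop_tkar[OF linop_id]] linop_zero[OF linop_tkar[OF linop_id]]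

lemma linop_tdeg [linop_intros]: "linop F \<Longrightarrow> linop (\<lambda>t. tdeg H n (F t))"
  unfolding tdeg_def by (intro linop_intros; assumption)

context hopf_algebra
begin

lemma tdeg_tens: "tdeg H n (tens H xs) = (if length xs = Suc n then tens H xs else 0)"
  unfolding tdeg_def
proof (rule tbind_tens, rule mlinI)
  fix xs ys assume *: "set xs \<subseteq> carrier H" "set ys \<subseteq> carrier H"
  show "lin H (\<lambda>x. if length (xs @ x # ys) = Suc n then tens H (xs @ x # ys) else 0)"
    using lin_tens[OF *] by (cases "length xs + length ys = n") (auto simp: lin_0)
qed

lemma tdeg_tpower: "t \<in> tpower H (Suc m) \<Longrightarrow> tdeg H n t = (if m = n then t else 0)"
  by (cases "m = n"; simp;
      rule tpower_eqI[where t = t and n = "Suc m"]; auto intro!: linop_intros simp: tdeg_tens)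

text \<open>The equation is claimed for every \<open>M\<close> beyond the bound, so that two tensors
  can be added under a common bound.\<close>

lemma tdeg_sum:
  assumes "t \<in> TN H"
  shows "\<exists>N. \<forall>M\<ge>N. t = (\<Sum>n<M. tdeg H n t)"
proof (rule fs.span_induct_alt[where h = "\<lambda>t. \<exists>N. \<forall>M\<ge>N. t = (\<Sum>n<M. tdeg H n t)", OF assms[unfolded TN_def]])
  have l: "linop (tdeg H n)" for n by (rule linop_tdeg[OF linop_id])
  show "\<exists>N. \<forall>M\<ge>N. 0 = (\<Sum>n<M. tdeg H n 0)"
    by (simp add: linop_zero[OF l])
  fix c x y assume "x \<in> {tens H xs |xs. set xs \<subseteq> carrier H \<and> xs \<noteq> []}" and y: "\<exists>N. \<forall>M\<ge>N. y = (\<Sum>n<M. tdeg H n y)"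
  then obtain xs where xs: "x = tens H xs" "set xs \<subseteq> carrier H" "xs \<noteq> []" by blast
  obtain N where N: "y = (\<Sum>n<M. tdeg H n y)" if "M \<ge> N" for M using y by blast
  have x: "x = (\<Sum>n<M. tdeg H n x)" if "M \<ge> length xs" for M
  proof -
    obtain k where k: "length xs = Suc k" using xs(3) by (cases xs) auto
    have "(\<Sum>n<M. tdeg H n x) = (\<Sum>n<M. if n = k then x else 0)"
      using xs k by (intro sum.cong) (auto simp: tdeg_tens)
    also have "\<dots> = x" using that k by simp
    finally show ?thesis ..
  qed
  have "c *\<^sub>k x + y = (\<Sum>n<M. tdeg H n (c *\<^sub>k x + y))" if "M \<ge> max N (length xs)" for M
  proof -
    have "(\<Sum>n<M. tdeg H n (c *\<^sub>k x + y)) = c *\<^sub>k (\<Sum>n<M. tdeg H n x) + (\<Sum>n<M. tdeg H n y)"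
      by (simp add: linop_add[OF l] linop_scale[OF l] sum.distrib fs.scale_sum_right)
    then show ?thesis using N[of M] x[of M] that by simp
  qed
  then show "\<exists>N. \<forall>M\<ge>N. c *\<^sub>k x + y = (\<Sum>n<M. tdeg H n (c *\<^sub>k x + y))" by blast
qed

lemma Omega_subspace: "fs.subspace (Omega H)" by (simp add: Omega_def)

lemma formspan_Omega: "t \<in> formspan n \<Longrightarrow> t \<in> Omega H"
  unfolding Omega_def Omega_deg_eq by (rule fs.span_base) blast

lemma Omega_span: "Omega H = fs.span {form H (a # as) |a as. a \<in> carrier H \<and> set as \<subseteq> carrier H}"
proof (intro equalityI)
  have "formspan n \<subseteq> fs.span {form H (a # as) |a as. a \<in> carrier H \<and> set as \<subseteq> carrier H}" for n
    unfolding formspan_def by (rule fs.span_mono) blast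
  then show "Omega H \<subseteq> fs.span {form H (a # as) |a as. a \<in> carrier H \<and> set as \<subseteq> carrier H}"
    unfolding Omega_def Omega_deg_eq by (intro fs.span_minimal fs.subspace_span) blast
  show "fs.span {form H (a # as) |a as. a \<in> carrier H \<and> set as \<subseteq> carrier H} \<subseteq> Omega H"
    using formspan_Omega form_in_formspan by (intro fs.span_minimal Omega_subspace) blast
qed

lemma Omega_TN [simp]: "t \<in> Omega H \<Longrightarrow> t \<in> TN H"
  unfolding Omega_span by (erule rev_subsetD, rule fs.span_minimal[OF _ TN_subspace]) auto

lemma Omega_into:
  assumes "linop f" "fs.subspace W"
    "\<And>a as. a \<in> carrier H \<Longrightarrow> set as \<subseteq> carrier H \<Longrightarrow> f (form H (a # as)) \<in> W" "t \<in> Omega H"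
  shows "f t \<in> W"
  by (rule linop_span_into[OF assms(1,2) _ assms(4)[unfolded Omega_span]]) (use assms(3) in auto)

lemma tdeg_Omega:
  assumes "t \<in> Omega H" shows "tdeg H n t \<in> formspan n"
proof (rule Omega_into[OF linop_tdeg[OF linop_id] formspan_subspace _ assms])
  fix a as assume a: "a \<in> carrier H" "set as \<subseteq> carrier H"
  then show "tdeg H n (form H (a # as)) \<in> formspan n"
    by (auto simp: tdeg_tpower[OF form_tpower] fs.subspace_0[OF formspan_subspace] form_in_formspan)
qed

section \<open>The operators \<open>b'\<close> and \<open>d\<close> on forms\<close>

lemma tsg_trm:
  assumes "t \<in> TT H" "c \<in> carrier H"
  shows "tsg H i (trm H c t) = trm H c (tsg H i t)"
proof -
  have "tsg H i (trm H c (tens H xs)) = trm H c (tsg H i (tens H xs))" if "set xs \<subseteq> carrier H" for xs i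
    using that
  proof (induction arbitrary: i rule: TT_list_induct)
    case Nil
    then show ?case using assms by (simp add: op_lin_simps2 op_lin_simps)
  next
    case (Cons x xs)
    show ?case
    proof (cases "xs = []")
      case True
      then show ?thesis using Cons assms by (cases i) (simp_all add: tsg_tens op_lin_simps)
    next
      case False
      note [simp] = tens_TN[OF Cons(2) False]
      \<comment> \<open>Commuting \<open>trm\<close> with \<open>tpre\<close> requires a nonempty
        tensor. The only doubtful case is a single factor, all of whose degeneracies vanish.\<close>
      have T: "tsg H j (tens H xs) \<in> TN H \<or> tsg H j (tens H xs) = 0" for j
      proof (cases "length xs = 1")
        case True
        then obtain y where "xs = [y]" by (auto simp: length_Suc_conv)
        then show ?thesis using Cons by (cases j) (auto simp: tsg_tens op_lin_simps)
      next
        case False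
        then obtain n where "length xs = Suc (Suc n)" using \<open>xs \<noteq> []\<close> by (cases xs; cases "tl xs") auto
        then have "tsg H j (tens H xs) \<in> tpower H (Suc n)" using Cons by (intro tsg_tpower tens_in_tpower)
        then show ?thesis using tpower_TN by blast
      qed
      show ?thesis
      proof (cases i)
        case 0
        then show ?thesis using Cons assms
          by (simp add: tens_Cons op_comm_TN op_comm_TT del: tpre_tens trm_tens)
      next
        case (Suc j)
        then show ?thesis using Cons assms T[of j]
          by (auto simp: tens_Cons op_comm_TN op_lin_simps simp del: tpre_tens trm_tens)
      qed
    qed
  qed
  then show ?thesis
    by (rule TT_eqI[OF linop_ops(8)[OF linop_trm[OF linop_id]] linop_trm[OF linop_basic(8)] _ assms(1)])
qed

lemma tsg_tE:
  assumes "t \<in> TT H" shows "tsg H i (tE H t) = tE H (tsg H (Suc i) t)"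
proof (rule TT_eqI[OF linop_ops(8)[OF linop_basic(6)] linop_ops(6)[OF linop_basic(8)] _ assms])
  fix xs assume "set xs \<subseteq> carrier H"
  then show "tsg H i (tE H (tens H xs)) = tE H (tsg H (Suc i) (tens H xs))"
    by (cases xs) (auto simp: tens_Cons tsg_trm op_lin_simps2 simp del: tpre_tens trm_tens)
qed

text \<open>Moving the first two factors one after the other to the end has the same effect as
  moving their product. Hence \<open>b'\<close> squares to zero on forms, where that product
  vanishes.\<close>

lemma tE_tE:
  assumes "t \<in> TT H" shows "tE H (tE H t) = tE H (tsg H 0 t)"
proof (rule TT_eqI[OF linop_ops(6)[OF linop_basic(6)] linop_ops(6)[OF linop_basic(8)] _ assms])
  fix xs assume "set xs \<subseteq> carrier H"
  then show "tE H (tE H (tens H xs)) = tE H (tsg H 0 (tens H xs))"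
    by (cases xs; cases "tl xs"; cases "tl (tl xs)")
      (auto simp: op_lin_simps2 tsg_tens mult_assoc')
qed

lemma tE_degree_0: "t \<in> tpower H 1 \<Longrightarrow> tE H t = 0"
  by (rule tpower_eqI[OF linop_basic(6) linop_const0]) (auto simp: length_Suc_conv)

lemma tins_tins:
  assumes "t \<in> TT H" shows "tins H (tins H t) = 0"
proof -
  have "tins H (tins H (tens H xs)) = 0" if "set xs \<subseteq> carrier H" for xs
    using that
  proof (induction rule: TT_list_induct)
    case (Cons x xs)
    then show ?case using inslist_TN[of xs] by (simp add: op_lin_simps2 op_lin_simps)
  qed simp
  then show ?thesis
    by (rule TT_eqI[OF linop_ops(5)[OF linop_basic(5)] linop_const0 _ assms])
qed

lemma tE_formspan: "t \<in> formspan (Suc n) \<Longrightarrow> tE H t \<in> formspan n"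
  by (simp add: formspan_eq tsg_tE[OF tpower_TT[of t H "Suc (Suc n)"]] op_lin_simps2)

lemma tE_formspan_0: "t \<in> formspan 0 \<Longrightarrow> tE H t = 0"
  by (simp add: formspan_eq tE_degree_0)

lemma tE_tE_formspan: "t \<in> formspan n \<Longrightarrow> tE H (tE H t) = 0"
  by (simp add: formspan_eq tE_tE[OF tpower_TT[of t H "Suc n"]] op_lin_simps2)

lemma tins_formspan:
  assumes "t \<in> formspan n" shows "tins H t \<in> formspan (Suc n)"
  by (rule formspan_into[OF linop_basic(5) formspan_subspace _ assms]) (auto simp: tins_form form_in_formspan)

lemma odot_formspan_0: "a \<in> carrier H \<Longrightarrow> t \<in> formspan n \<Longrightarrow> odot H (tens H [a]) t \<in> formspan n"
  by (simp add: odot_single formspan_TN)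
    (rule formspan_into[OF linop_tlm[OF linop_id] formspan_subspace], auto simp: tlm_form form_in_formspan)

lemma odot_formspan:
  "s \<in> formspan m \<Longrightarrow> t \<in> formspan n \<Longrightarrow> odot H s t \<in> formspan (m + n)"
proof (induction m arbitrary: s)
  case 0
  show ?case
  proof (rule formspan_into[OF linop_odot[OF linop_id] formspan_subspace _ 0(1)])
    fix a and as :: "'a list" assume "a \<in> carrier H" "length as = 0"
    then show "odot H (form H (a # as)) t \<in> formspan (0 + n)" using odot_formspan_0[of a t n] 0(2) by simp
  qed
next
  case (Suc m)
  show ?case
  proof (rule linop_span_into[OF linop_odot[OF linop_id] formspan_subspace])
    show "s \<in> fs.span {odot H \<omega> \<eta> |\<omega> \<eta>. \<omega> \<in> Omega1 H \<and> \<eta> \<in> Omega_deg H m}"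
      using Suc.prems(1) Omega_deg_eq[of "Suc m"] by simp
    fix x assume "x \<in> {odot H \<omega> \<eta> |\<omega> \<eta>. \<omega> \<in> Omega1 H \<and> \<eta> \<in> Omega_deg H m}"
    then obtain \<omega> \<eta> where x: "x = odot H \<omega> \<eta>" "\<omega> \<in> formspan 1" "\<eta> \<in> formspan m"
      by (auto simp: Omega1_eq Omega_deg_eq)
    have "odot H x t = odot H \<omega> (odot H \<eta> t)"
      unfolding x by (rule odot_assoc) (use x Suc.prems formspan_TN in auto)
    also have "\<dots> \<in> fs.span {odot H \<omega> \<eta> |\<omega> \<eta>. \<omega> \<in> Omega1 H \<and> \<eta> \<in> Omega_deg H (m + n)}"
      by (rule fs.span_base) (use x Suc in \<open>auto simp: Omega1_eq Omega_deg_eq\<close>)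
    also have "\<dots> = formspan (Suc m + n)" using Omega_deg_eq[of "Suc (m + n)"] by simp
    finally show "odot H x t \<in> formspan (Suc m + n)" .
  qed
qed

lemma diff1_formspan: "a \<in> carrier H \<Longrightarrow> diff1 H a \<in> formspan 1"
  using form_in_formspan[of \<one> "[a]" 1] by (simp add: form_Cons diff1_def)

text \<open>As \<open>a db = d(a b) - da b\<close>, forms are spanned by products that begin with a
  differential, the elements on which \<open>b'\<close> is prescribed.\<close>

lemma form_Cons_diff1:
  assumes "a \<in> carrier H" "b \<in> carrier H" "set as \<subseteq> carrier H"
  shows "form H (a # b # as) = odot H (diff1 H (a \<otimes> b)) (form H (\<one> # as)) - odot H (diff1 H a) (form H (b # as))"
  using assms by (simp add: odot_diff1_left tlm_form form_Cons)

text \<open>The formula \<open>\<kappa>'(da w) = (-1)^n w da\<close>, for every tensor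
  \<open>w\<close> with \<open>n + 1\<close> factors and not only for forms: all terms that contain
  \<open>tins H w\<close> cancel, and the terms at the right end remain.\<close>

lemma tkar_diff1:
  assumes w: "w \<in> tpower H (Suc n)" and a: "a \<in> carrier H"
  shows "tkar H (odot H (diff1 H a) w) = (-1) ^ n *\<^sub>k odot H w (diff1 H a)"
proof -
  have [simp]: "w \<in> TN H" by (rule tpower_TN[OF w]) simp
  have 1: "tE H (odot H (diff1 H a) w) = tlm H a w - trm H a w"
    using a by (simp add: odot_diff1_left op_lin_simps2 op_one)
  have 2: "tins H (odot H (diff1 H a) w) = tpre H a (tins H w) - tpre H \<one> (tlm H a (tins H w))"
    using a by (simp add: odot_diff1_left op_lin_simps2 tins_tlm op_lin_simps)
  have 3: "tE H (tins H (odot H (diff1 H a) w)) = trm H a (tins H w) - tlm H a (tins H w)"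
    unfolding 2 using a by (simp add: op_lin_simps2 op_one)
  have 4: "tins H (tE H (odot H (diff1 H a) w)) = (tlm H a (tins H w) - tpre H a w + tpre H \<one> (tlm H a w)) -
      (trm H a (tins H w) + (-1) ^ Suc n *\<^sub>k (tapp H (trm H a w) \<one> - tapp H w a))"
    unfolding 1 using a by (simp add: op_lin_simps2 tins_tlm tins_trm[OF w])
  show ?thesis
    unfolding tkar_def 3 4 using a
    by (simp add: odot_diff1_left odot_diff1_right fs.scale_right_diff_distrib)
qed

lemma form_one_Cons:
  "a \<in> carrier H \<Longrightarrow> set as \<subseteq> carrier H \<Longrightarrow> form H (\<one> # a # as) = odot H (diff1 H a) (form H (\<one> # as))"
  by (simp add: odot_diff1_left tlm_form form_Cons)

lemma linop_tkar_pow: "linop (tkar H ^^ k)"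
  by (rule linop_funpow[OF linop_tkar[OF linop_id] linop_id])

text \<open>Each of the \<open>length as\<close> differentials is carried past the other ones and
  past \<open>w\<close>, that is past degree \<open>m + (length as - 1)\<close>, which explains the
  exponent.\<close>

lemma tkar_pow_form:
  assumes "set as \<subseteq> carrier H" "w \<in> tpower H (Suc m)"
  shows "(tkar H ^^ length as) (odot H (form H (\<one> # as)) w) =
    (-1) ^ (length as * (m + (length as - 1))) *\<^sub>k odot H w (form H (\<one> # as))"
  using assms
proof (induction as arbitrary: m w)
  case Nil
  have "w \<in> TN H" by (rule tpower_TN[OF Nil(2)]) simp
  then show ?case by (simp add: odot_single odot_single_right op_one)
next
  case (Cons a as)
  define k where "k = length as"
  define F where "F = form H (\<one> # as)"
  have w [simp]: "w \<in> TN H" by (rule tpower_TN[OF Cons(3)]) simp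
  have F [simp]: "F \<in> TN H" using Cons by (simp add: F_def)
  have Fp: "F \<in> tpower H (Suc k)" unfolding F_def k_def using Cons by (intro form_tpower) auto
  have a: "a \<in> carrier H" "set as \<subseteq> carrier H" using Cons by auto
  have wa: "odot H w (diff1 H a) \<in> tpower H (Suc (Suc m))"
    using odot_tpower[OF Cons(3), of "diff1 H a" 1] diff1_tpower[OF a(1)] by (simp add: numeral_2_eq_2)
  have "(tkar H ^^ length (a # as)) (odot H (form H (\<one> # a # as)) w) =
      (tkar H ^^ k) (tkar H (odot H (diff1 H a) (odot H F w)))"
    using a by (simp add: form_one_Cons odot_assoc F_def k_def funpow_swap1)
  also have "\<dots> = (-1) ^ (k + m) *\<^sub>k (tkar H ^^ k) (odot H F (odot H w (diff1 H a)))"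
    using a by (subst tkar_diff1[OF odot_tpower[OF Fp Cons(3)]])
      (simp_all add: linop_scale[OF linop_tkar_pow] odot_assoc)
  also have "\<dots> = (-1) ^ (k + m) *\<^sub>k (-1) ^ (k * (Suc m + (k - 1))) *\<^sub>k odot H (odot H w (diff1 H a)) F"
    using Cons.IH[OF a(2) wa] by (simp add: k_def F_def)
  also have "odot H (odot H w (diff1 H a)) F = odot H w (form H (\<one> # a # as))"
    using a by (simp add: form_one_Cons odot_assoc F_def)
  also have "(-1) ^ (k + m) *\<^sub>k (-1) ^ (k * (Suc m + (k - 1))) *\<^sub>k odot H w (form H (\<one> # a # as)) =
      (-1) ^ (Suc k * (m + k)) *\<^sub>k odot H w (form H (\<one> # a # as))"
  proof (cases k)
    case (Suc j)
    then have "k + m + k * (Suc m + (k - 1)) = Suc k * (m + k)" by simp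
    then show ?thesis by (simp only: fs.scale_scale power_add[symmetric])
  qed simp
  finally show ?case by (simp add: k_def)
qed

lemma tkar_formspan: "t \<in> formspan n \<Longrightarrow> tkar H t \<in> formspan n"
  unfolding tkar_def
  by (cases n) (auto intro!: fs.subspace_diff[OF formspan_subspace] tE_formspan tins_formspan
    simp: tE_formspan_0 op_lin_simps2 fs.subspace_0[OF formspan_subspace])

lemma tkar_pow_formspan: "t \<in> formspan n \<Longrightarrow> (tkar H ^^ k) t \<in> formspan n"
  by (induction k) (auto intro: tkar_formspan)

lemma tkar_tE:
  assumes "z \<in> formspan n" shows "tkar H (tE H z) = tE H (tkar H z)"
  using tE_tE_formspan[OF assms] tE_tE_formspan[OF tins_formspan[OF assms]]
  by (simp add: tkar_def op_lin_simps2)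

lemma tkar_pow_tE:
  "z \<in> formspan n \<Longrightarrow> (tkar H ^^ k) (tE H z) = tE H ((tkar H ^^ k) z)"
  by (induction k) (auto simp: tkar_tE[OF tkar_pow_formspan])

text \<open>The form \<open>x = a da\<^sub>1 \<dots> da\<^sub>n\<close> is \<open>\<kappa>'\<^sup>n y\<close> for \<open>y = da\<^sub>1 \<dots> da\<^sub>n a\<close>, and \<open>b' d x = x - y\<close>.\<close>

lemma tkar_star:
  assumes "x \<in> formspan n"
  shows "(tkar H ^^ n) x = x + tE H ((tkar H ^^ n) (tins H x))"
proof (rule formspan_eqI[OF linop_tkar_pow _ _ assms])
  fix a as assume a: "a \<in> carrier H" "set as \<subseteq> carrier H" "length as = n"
  define F where "F = form H (\<one> # as)"
  have F [simp]: "F \<in> TN H" using a by (simp add: F_def)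
  define x where "x = form H (a # as)"
  define y where "y = odot H F (tens H [a])"
  have x: "x \<in> formspan n" unfolding x_def using a by (intro form_in_formspan)
  note [simp] = formspan_TN[OF x]
  have xF: "odot H (tens H [a]) F = x" using a by (simp add: x_def F_def odot_single tlm_form)
  \<comment> \<open>All differentials are moved past an element of degree 0, so the total sign is
    \<open>(-1) ^ (n * (n - 1)) = 1\<close>.\<close>
  have even: "even (n * (0 + (n - 1)))" by (cases n) auto
  have 1: "(tkar H ^^ n) y = x"
    using tkar_pow_form[OF a(2), of "tens H [a]" 0] tens_in_tpower[of "[a]" H 1] a even
    by (simp add: y_def F_def[symmetric] xF)
  have 2: "tins H x = odot H (diff1 H a) F"
    using a by (simp add: x_def F_def tins_form form_one_Cons)
  have "tE H (tins H x) = x - y"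
    unfolding 2 using a xF by (simp add: odot_diff1_left op_lin_simps2 op_one odot_single y_def odot_single_right)
  then have "(tkar H ^^ n) x - (tkar H ^^ n) y = (tkar H ^^ n) (tE H (tins H x))"
    by (simp add: linop_diff[OF linop_tkar_pow])
  also have "\<dots> = tE H ((tkar H ^^ n) (tins H x))"
    by (rule tkar_pow_tE[OF tins_formspan[OF x]])
  finally show "(tkar H ^^ n) (form H (a # as)) = form H (a # as) + tE H ((tkar H ^^ n) (tins H (form H (a # as))))"
    unfolding 1 x_def[symmetric] by (simp add: algebra_simps)
qed (rule linop_plus[OF linop_id linop_ops(6)[OF linop_funpow[OF linop_tkar[OF linop_id] linop_basic(5)]]])

section \<open>Identification with the prescribed operators of the calculus\<close>

lemma Omega_uniq:
  assumes "linop f" "P (restrict f (Omega H))" "fs.span S = Omega H"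
    "\<And>g x. linear_on (Omega H) g \<Longrightarrow> P g \<Longrightarrow> x \<in> S \<Longrightarrow> g x = f x" "x \<in> Omega H"
  shows "the_linear_map (Omega H) P x = f x"
proof (rule the_linear_map_eq[where f = f and P = P and V = "Omega H" and S = S])
  show "S \<subseteq> Omega H" "Omega H \<subseteq> fs.span S"
    using assms(3) fs.span_superset[of S] by auto
qed (fact assms Omega_subspace)+

lemma form_Omega: "a \<in> carrier H \<Longrightarrow> set as \<subseteq> carrier H \<Longrightarrow> form H (a # as) \<in> Omega H"
  by (rule formspan_Omega[OF form_in_formspan]) auto

lemma forms_span: "fs.span {form H as |as. as \<noteq> [] \<and> set as \<subseteq> carrier H} = Omega H"
proof -
  have "{form H as |as. as \<noteq> [] \<and> set as \<subseteq> carrier H} = {form H (a # as) |a as. a \<in> carrier H \<and> set as \<subseteq> carrier H}"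
  proof (intro equalityI subsetI)
    fix x assume "x \<in> {form H as |as. as \<noteq> [] \<and> set as \<subseteq> carrier H}"
    then obtain as where "x = form H as" "as \<noteq> []" "set as \<subseteq> carrier H" by blast
    then show "x \<in> {form H (a # as) |a as. a \<in> carrier H \<and> set as \<subseteq> carrier H}"
      by (cases as) auto
  next
    fix x assume "x \<in> {form H (a # as) |a as. a \<in> carrier H \<and> set as \<subseteq> carrier H}"
    then obtain a as where "x = form H (a # as)" "a \<in> carrier H" "set as \<subseteq> carrier H" by blast
    then show "x \<in> {form H as |as. as \<noteq> [] \<and> set as \<subseteq> carrier H}"
      by (intro CollectI exI[of _ "a # as"]) auto
  qed
  then show ?thesis by (simp add: Omega_span)
qed

lemma dO_eq: assumes "t \<in> Omega H" shows "dO H t = tins H t"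
  unfolding dO_def
proof (rule Omega_uniq[OF linop_basic(5) _ forms_span _ assms])
  have *: "tins H (form H as) = form H (\<one> # as)" "form H as \<in> Omega H" if "as \<noteq> []" "set as \<subseteq> carrier H" for as
    using that tins_form[of "hd as" "tl as"] form_Omega[of "hd as" "tl as"] by (cases as; auto)+
  show "\<forall>as. as \<noteq> [] \<and> set as \<subseteq> carrier H \<longrightarrow> restrict (tins H) (Omega H) (form H as) = form H (\<one> # as)"
    using * by auto
  show "g x = tins H x" if "\<forall>as. as \<noteq> [] \<and> set as \<subseteq> carrier H \<longrightarrow> g (form H as) = form H (\<one> # as)"
    "x \<in> {form H as |as. as \<noteq> [] \<and> set as \<subseteq> carrier H}" for g :: "('k, 'a) tensor \<Rightarrow> ('k, 'a) tensor" and x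
    using that * by auto
qed

lemma bO'_eq: assumes "t \<in> Omega H" shows "bO' H t = tE H t"
  unfolding bO'_def
proof (rule Omega_uniq[OF linop_basic(6) _ _ _ assms])
  \<comment> \<open>These are the elements on which the defining property of \<open>b'\<close> gives
    the values; they span by \<open>form_Cons_diff1\<close>.\<close>
  let ?S = "Omega_deg H 0 \<union> {odot H (diff1 H a) \<omega> |a \<omega> n. a \<in> carrier H \<and> \<omega> \<in> Omega_deg H n}"
  have O: "odot H (diff1 H a) \<omega> \<in> Omega H" if "a \<in> carrier H" "\<omega> \<in> Omega_deg H n" for a \<omega> n
    using odot_formspan[OF diff1_formspan[OF that(1)]] that(2) formspan_Omega by (metis Omega_deg_eq)
  have O0: "\<omega> \<in> Omega H" if "\<omega> \<in> Omega_deg H n" for \<omega> n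
    using that formspan_Omega by (metis Omega_deg_eq)
  have e: "tE H (odot H (diff1 H a) \<omega>) = odot H (tens H [a]) \<omega> - odot H \<omega> (tens H [a])"
    if "a \<in> carrier H" "\<omega> \<in> Omega_deg H n" for a \<omega> n
  proof -
    have "\<omega> \<in> TN H" using O0 that by auto
    then show ?thesis using that
      by (simp add: odot_diff1_left op_lin_simps2 op_one odot_single odot_single_right)
  qed
  have e0: "tE H \<omega> = 0" if "\<omega> \<in> Omega_deg H 0" for \<omega>
    using that tE_formspan_0 by (metis Omega_deg_eq)
  show "fs.span ?S = Omega H"
  proof
    show "fs.span ?S \<subseteq> Omega H" using O O0 by (intro fs.span_minimal Omega_subspace) blast
    show "Omega H \<subseteq> fs.span ?S"
      unfolding Omega_span
    proof (intro fs.span_minimal fs.subspace_span subsetI)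
      fix x assume "x \<in> {form H (a # as) |a as. a \<in> carrier H \<and> set as \<subseteq> carrier H}"
      then obtain a as where x: "x = form H (a # as)" "a \<in> carrier H" "set as \<subseteq> carrier H" by blast
      show "x \<in> fs.span ?S"
      proof (cases as)
        case Nil
        then show ?thesis using x form_in_formspan[of a "[]" 0] by (intro fs.span_base) (simp add: Omega_deg_eq del: Omega_deg.simps)
      next
        case (Cons b bs)
        have ab: "a \<otimes> b \<in> carrier H" using x Cons by simp
        have "form H (\<one> # bs) \<in> Omega_deg H (length bs)" "form H (b # bs) \<in> Omega_deg H (length bs)"
          using x Cons by (auto simp: Omega_deg_eq intro!: form_in_formspan)
        then have "odot H (diff1 H (a \<otimes> b)) (form H (\<one> # bs)) \<in> ?S" "odot H (diff1 H a) (form H (b # bs)) \<in> ?S"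
          using x(2) ab by blast+
        then show ?thesis using x Cons
          by (simp add: form_Cons_diff1 fs.span_diff fs.span_base)
      qed
    qed
  qed
  show "(\<forall>\<omega>\<in>Omega_deg H 0. restrict (tE H) (Omega H) \<omega> = 0) \<and>
    (\<forall>n. \<forall>\<omega>\<in>Omega_deg H n. \<forall>a\<in>carrier H. restrict (tE H) (Omega H) (odot H (diff1 H a) \<omega>) =
       odot H (tens H [a]) \<omega> - odot H \<omega> (tens H [a]))"
    using O O0 e e0 by (auto simp del: Omega_deg.simps)
  show "g x = tE H x" if "(\<forall>\<omega>\<in>Omega_deg H 0. g \<omega> = 0) \<and>
    (\<forall>n. \<forall>\<omega>\<in>Omega_deg H n. \<forall>a\<in>carrier H. g (odot H (diff1 H a) \<omega>) =
       odot H (tens H [a]) \<omega> - odot H \<omega> (tens H [a]))" "x \<in> ?S"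
    for g :: "('k, 'a) tensor \<Rightarrow> ('k, 'a) tensor" and x
    using that e e0 by (auto simp del: Omega_deg.simps)
qed

lemma karoubi'_eq: assumes "t \<in> formspan n" shows "karoubi' H t = tkar H t"
proof -
  have "tE H t \<in> Omega H"
    using assms by (cases n)
      (simp_all add: tE_formspan_0 fs.subspace_0[OF Omega_subspace] formspan_Omega[OF tE_formspan])
  then show ?thesis
    using formspan_Omega[OF assms] formspan_Omega[OF tins_formspan[OF assms]]
    by (simp add: karoubi'_def tkar_def dO_eq bO'_eq)
qed

lemma karoubi'_pow_eq: "t \<in> formspan n \<Longrightarrow> (karoubi' H ^^ k) t = (tkar H ^^ k) t"
  by (induction k) (auto simp: karoubi'_eq[OF tkar_pow_formspan])

end

section \<open>Coactions and the antipode\<close>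

text \<open>\<open>sweedler\<close> with \<open>tbind\<close> of each coproduct replaced by the
  chosen sum. Congruence, differences and linear images can then be taken without multilinearity of
  the integrand.\<close>

primrec swl :: "('k::field, 'a) hopf \<Rightarrow> 'a list \<Rightarrow> ('a list \<Rightarrow> 'a list \<Rightarrow> ('k, 'a) tensor) \<Rightarrow> ('k, 'a) tensor" where
  "swl H [] g = g [] []"
| "swl H (a # as) g = sw H a (\<lambda>p q. swl H as (\<lambda>us vs. g (p # us) (q # vs)))"

text \<open>The contribution of a Sweedler pair of the first factor to the left coaction:
  \<open>p\<close> joins the product accumulated in front, \<open>q\<close> stays behind it as a
  factor.\<close>

definition tql :: "('k::field, 'a) hopf \<Rightarrow> 'a \<Rightarrow> 'a \<Rightarrow> ('k, 'a) tensor \<Rightarrow> ('k, 'a) tensor"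
  where "tql H p q t = tbind t (\<lambda>ys. case ys of [] \<Rightarrow> 0 | y # ys \<Rightarrow> tens H ((p \<otimes>\<^bsub>H\<^esub> y) # q # ys))"

definition trh :: "('k::field, 'a) hopf \<Rightarrow> 'a \<Rightarrow> ('k, 'a) tensor \<Rightarrow> ('k, 'a) tensor"
  where "trh H c = modhd H (\<lambda>y. y \<otimes>\<^bsub>H\<^esub> c)"

fun collist :: "('k::field, 'a) hopf \<Rightarrow> 'a list \<Rightarrow> ('k, 'a) tensor" where
  "collist H [] = tens H [\<one>\<^bsub>H\<^esub>]"
| "collist H (x # xs) = sw H x (\<lambda>a b. tql H a b (collist H xs))"

definition tcol :: "('k::field, 'a) hopf \<Rightarrow> ('k, 'a) tensor \<Rightarrow> ('k, 'a) tensor"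
  where "tcol H t = tbind t (collist H)"

text \<open>The antipode extends to an involutive antiautomorphism of the tensor algebra that exchanges the
  two coactions, and \<open>b\<close> with \<open>b'\<close>.\<close>

definition tJ :: "('k::field, 'a) hopf \<Rightarrow> ('k, 'a) tensor \<Rightarrow> ('k, 'a) tensor"
  where "tJ H t = tbind t (\<lambda>xs. tens H (rev (map (antipode H) xs)))"

definition tsgn :: "('k::field, 'a) hopf \<Rightarrow> ('k, 'a) tensor \<Rightarrow> ('k, 'a) tensor"
  where "tsgn H t = tbind t (\<lambda>xs. (-1) ^ length xs *\<^sub>k tens H xs)"

text \<open>The operator \<open>b\<close> on forms. Its sign depends on the degree and enters
  through \<open>tsgn\<close>, which keeps the definition linear on all tensors. Degree
  \<open>n\<close> has \<open>n + 1\<close> factors, hence the minus sign in front.\<close>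

definition tF :: "('k::field, 'a) hopf \<Rightarrow> ('k, 'a) tensor \<Rightarrow> ('k, 'a) tensor"
  where "tF H t = - tJ H (tE H (tJ H (tsgn H t)))"

lemma linop_ops2 [linop_intros]:
  assumes "linop F"
  shows "linop (\<lambda>t. tql H a b (F t))" "linop (\<lambda>t. trh H a (F t))" "linop (\<lambda>t. tcol H (F t))"
    "linop (\<lambda>t. tJ H (F t))" "linop (\<lambda>t. tsgn H (F t))" "linop (\<lambda>t. tF H (F t))"
  unfolding tql_def trh_def tcol_def tJ_def tsgn_def tF_def
  by (intro linop_intros assms)+

lemmas linop_basic2 = linop_ops2[OF linop_id]

lemmas op_lin_simps3 = linop_basic2[THEN linop_add] linop_basic2[THEN linop_scale]
  linop_basic2[THEN linop_zero] linop_basic2[THEN linop_diff] linop_basic2[THEN linop_minus]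

lemmas op_sw3 = linop_basic2[THEN linop_of_sw]

context hopf_algebra
begin

section \<open>The coactions on forms\<close>

definition bimlin :: "('a list \<Rightarrow> 'a list \<Rightarrow> ('k, 'a) tensor) \<Rightarrow> bool"
  where "bimlin g \<longleftrightarrow> (\<forall>vs. set vs \<subseteq> carrier H \<longrightarrow> mlin H (\<lambda>us. g us vs)) \<and> (\<forall>us. set us \<subseteq> carrier H \<longrightarrow> mlin H (g us))"

lemma bimlinD:
  assumes "bimlin g" "set us \<subseteq> carrier H" "set us' \<subseteq> carrier H" "set vs \<subseteq> carrier H"
  shows "lin H (\<lambda>x. g (us @ x # us') vs)" "lin H (\<lambda>x. g vs (us @ x # us'))"
  using assms mlinD[of H "\<lambda>us. g us vs" us us'] mlinD[of H "g vs" us us'] unfolding bimlin_def by auto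

lemma bimlin_cong:
  assumes eq: "\<And>us vs. set us \<subseteq> carrier H \<Longrightarrow> set vs \<subseteq> carrier H \<Longrightarrow> g' us vs = g us vs" and g: "bimlin g"
  shows "bimlin g'"
  unfolding bimlin_def
proof (intro conjI allI impI)
  fix us assume us: "set us \<subseteq> carrier H"
  show "mlin H (\<lambda>vs. g' vs us)"
    by (rule mlin_cong[where g = "\<lambda>vs. g vs us"]) (use us eq g in \<open>auto simp: bimlin_def\<close>)
  show "mlin H (g' us)"
    by (rule mlin_cong[where g = "g us"]) (use us eq g in \<open>auto simp: bimlin_def\<close>)
qed

lemma bimlin_Cons:
  assumes "bimlin g" "p \<in> carrier H" "q \<in> carrier H"
  shows "bimlin (\<lambda>us vs. g (p # us) (q # vs))"
  unfolding bimlin_def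
proof (intro conjI allI impI mlinI)
  fix vs us us' assume "set vs \<subseteq> carrier H" "set us \<subseteq> carrier H" "set us' \<subseteq> carrier H"
  then show "lin H (\<lambda>x. g (p # us @ x # us') (q # vs))" "lin H (\<lambda>x. g (p # vs) (q # us @ x # us'))"
    using bimlinD(1)[OF assms(1), of "p # us" us' "q # vs"] bimlinD(2)[OF assms(1), of "q # us" us' "p # vs"] assms(2,3)
    by auto
qed

lemma lin_swl:
  "(\<And>us vs. set us \<subseteq> carrier H \<Longrightarrow> set vs \<subseteq> carrier H \<Longrightarrow> lin H (\<lambda>x. G x us vs)) \<Longrightarrow> lin H (\<lambda>x. swl H as (G x))"
proof (induction as arbitrary: G)
  case (Cons a as)
  show ?case unfolding swl.simps
    by (intro lin_sw Cons.IH Cons.prems) auto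
qed simp

lemma swl_cong:
  "(\<And>us vs. set us \<subseteq> carrier H \<Longrightarrow> set vs \<subseteq> carrier H \<Longrightarrow> length us = length as \<Longrightarrow> length vs = length as \<Longrightarrow> g us vs = g' us vs) \<Longrightarrow>
    swl H as g = swl H as g'"
proof (induction as arbitrary: g g')
  case (Cons a as)
  show ?case unfolding swl.simps
    by (intro sw_cong Cons.IH Cons.prems) auto
qed simp

lemma linop_of_swl: "linop F \<Longrightarrow> F (swl H as g) = swl H as (\<lambda>us vs. F (g us vs))"
  by (induction as arbitrary: g) (auto simp: linop_of_sw)

lemma swl_diff: "swl H as (\<lambda>us vs. g us vs - g' us vs) = swl H as g - swl H as g'"
  by (induction as arbitrary: g g') (auto simp: sw_diff)

lemma swl_lin2:
  assumes "bimlin g"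
  shows "lin2 H (\<lambda>p q. swl H as (\<lambda>us vs. g (p # us) (q # vs)))"
  unfolding lin2_def
proof (intro ballI conjI lin_swl)
  fix y us vs assume "y \<in> carrier H" "set us \<subseteq> carrier H" "set vs \<subseteq> carrier H"
  then show "lin H (\<lambda>x. g (x # us) (y # vs))" "lin H (\<lambda>x. g (y # us) (x # vs))"
    using bimlinD(1)[OF assms, of "[]" us "y # vs"] bimlinD(2)[OF assms, of "[]" vs "y # us"] by auto
qed

lemma sweedler_swl: "bimlin g \<Longrightarrow> set as \<subseteq> carrier H \<Longrightarrow> sweedler H as g = swl H as g"
proof (induction as arbitrary: g)
  case (Cons a as)
  have eq: "sweedler H as (\<lambda>us vs. g (p # us) (q # vs)) = swl H as (\<lambda>us vs. g (p # us) (q # vs))"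
    if "p \<in> carrier H" "q \<in> carrier H" for p q
    by (intro Cons.IH bimlin_Cons Cons.prems that) (use Cons.prems in auto)
  have l: "lin H (\<lambda>x. swl H as (\<lambda>us vs. g (x # us) (y # vs)))" "lin H (\<lambda>x. swl H as (\<lambda>us vs. g (y # us) (x # vs)))"
    if "y \<in> carrier H" for y
    using swl_lin2[OF Cons.prems(1), of as] that unfolding lin2_def by blast+
  have l': "lin H (\<lambda>x. sweedler H as (\<lambda>us vs. g (x # us) (y # vs)))" "lin H (\<lambda>x. sweedler H as (\<lambda>us vs. g (y # us) (x # vs)))"
    if "y \<in> carrier H" for y
    using lin_cong[OF eq[OF _ that] l(1)[OF that]] lin_cong[OF eq[OF that] l(2)[OF that]] by simp_all
  have "sweedler H (a # as) g = sw H a (\<lambda>p q. sweedler H as (\<lambda>us vs. g (p # us) (q # vs)))"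
    unfolding sweedler.simps
    by (subst tbind_comult) (use Cons.prems l' in auto)
  also have "\<dots> = swl H (a # as) g"
    unfolding swl.simps by (intro sw_cong eq)
  finally show ?case .
qed simp

lemma mlin_form: "mlin H (form H)"
proof (rule mlinI)
  have head: "lin H (\<lambda>x. form H (x # ys))" if "set ys \<subseteq> carrier H" for ys
    by (rule lin_cong[OF _ op_lin(3)[of "form H (\<one> # ys)"]]) (use that in \<open>simp_all add: tlm_form\<close>)
  have "lin H (\<lambda>x. form H (z # zs @ x # ys))" if "z \<in> carrier H" "set zs \<subseteq> carrier H" "set ys \<subseteq> carrier H" for z zs ys
    using that
  proof (induction zs arbitrary: z)
    case Nil
    have "lin H (\<lambda>x. tpre H z (form H (x # ys)) - tpre H (z \<otimes> x) (form H (\<one> # ys)))"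
      by (intro lin_diff linop_lin[OF linop_tpre[OF linop_id]] head) (use Nil in \<open>simp_all add: lin_simps\<close>)
    then show ?case using Nil by (simp add: lin_def form_Cons)
  next
    case (Cons a as)
    have "lin H (\<lambda>x. tpre H z (form H (a # as @ x # ys)) - tpre H (z \<otimes> a) (form H (\<one> # as @ x # ys)))"
      by (intro lin_diff linop_lin[OF linop_tpre[OF linop_id]] Cons.IH) (use Cons.prems in auto)
    then show ?case using Cons.prems by (simp add: lin_def form_Cons)
  qed
  then show "lin H (\<lambda>x. form H (xs @ x # ys))" if "set xs \<subseteq> carrier H" "set ys \<subseteq> carrier H" for xs ys
    using that head by (cases xs) auto
qed

lemma lprod_Nil [simp]: "lprod H [] = \<one>" and lprod_Cons [simp]: "lprod H (x # xs) = x \<otimes> lprod H xs"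
  by (simp_all add: lprod_def)

lemma lprod_closed [simp]: "set xs \<subseteq> carrier H \<Longrightarrow> lprod H xs \<in> carrier H"
  by (induction xs) auto

lemma hlin_lprod: "set vs \<subseteq> carrier H \<Longrightarrow> set vs' \<subseteq> carrier H \<Longrightarrow> hlin H (\<lambda>x. lprod H (vs @ x # vs'))"
proof (induction vs)
  case Nil
  then show ?case by (simp add: hlin_mult')
next
  case (Cons v vs)
  then show ?case by (auto simp: hlin_def H_distrib mult_smult_right)
qed

lemma lin_hlin: "lin H f \<Longrightarrow> hlin H h \<Longrightarrow> lin H (\<lambda>x. f (h x))"
  by (simp add: lin_def hlin_def)

text \<open>One argument for both coactions. \<open>Q p q\<close> is what a Sweedler pair of the
  first factor does to the coaction of the rest, and \<open>g\<close> is the integrand in the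
  definition. Both sides follow the recursion \<open>form_Cons\<close>; for the term with head
  \<open>a \<otimes> b\<close> this uses multiplicativity of the coproduct.\<close>

lemma coact_form:
  assumes Q: "\<And>p q. linop (Q p q)" and Qlin: "\<And>t. t \<in> TN H \<Longrightarrow> lin2 H (\<lambda>p q. Q p q t)"
    and C: "linop C" and C_tpre: "\<And>a t. a \<in> carrier H \<Longrightarrow> t \<in> TN H \<Longrightarrow> C (tpre H a t) = sw H a (\<lambda>p q. Q p q (C t))"
    and C_TN: "\<And>t. t \<in> TN H \<Longrightarrow> C t \<in> TN H"
    and g1: "\<And>a. a \<in> carrier H \<Longrightarrow> C (tens H [a]) = sw H a (\<lambda>p q. g [p] [q])"
    and g2: "\<And>p q r s us vs. p \<in> carrier H \<Longrightarrow> q \<in> carrier H \<Longrightarrow> r \<in> carrier H \<Longrightarrow> s \<in> carrier H \<Longrightarrow>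
      set us \<subseteq> carrier H \<Longrightarrow> set vs \<subseteq> carrier H \<Longrightarrow>
      g (p # r # us) (q # s # vs) = Q p q (g (r # us) (s # vs)) - Q (p \<otimes> r) (q \<otimes> s) (g (\<one> # us) (\<one> # vs))"
    and bi: "bimlin g"
    and a: "a \<in> carrier H" "set as \<subseteq> carrier H"
  shows "C (form H (a # as)) = swl H (a # as) g"
  using a
proof (induction rule: form_list_induct)
  case (single a)
  then show ?case by (simp add: g1)
next
  case (Cons a b as)
  define Z where "Z = swl H as (\<lambda>us vs. g (\<one> # us) (\<one> # vs))"
  have Z: "C (form H (\<one> # as)) = Z"
    using Cons.IH[of \<one>] by (simp add: Z_def sw_one[OF swl_lin2[OF bi]])
  have Z': "Z \<in> TN H" using C_TN[of "form H (\<one> # as)"] Cons by (simp add: Z)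
  have "C (form H (a # b # as)) = sw H a (\<lambda>p q. Q p q (swl H (b # as) g)) - sw H (a \<otimes> b) (\<lambda>p q. Q p q Z)"
    using Cons by (simp add: form_Cons linop_diff[OF C] C_tpre Z)
  also have "sw H (a \<otimes> b) (\<lambda>p q. Q p q Z) = sw H a (\<lambda>p q. sw H b (\<lambda>r s. Q (p \<otimes> r) (q \<otimes> s) Z))"
    by (rule sw_mult) (use Cons Qlin[OF Z'] in auto)
  also have "sw H a (\<lambda>p q. Q p q (swl H (b # as) g)) - sw H a (\<lambda>p q. sw H b (\<lambda>r s. Q (p \<otimes> r) (q \<otimes> s) Z)) =
      sw H a (\<lambda>p q. sw H b (\<lambda>r s. swl H as (\<lambda>us vs. Q p q (g (r # us) (s # vs)) - Q (p \<otimes> r) (q \<otimes> s) (g (\<one> # us) (\<one> # vs)))))"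
    by (simp add: Z_def linop_of_sw[OF Q] linop_of_swl[OF Q] swl_diff sw_diff)
  also have "\<dots> = swl H (a # b # as) g"
    unfolding swl.simps by (intro sw_cong swl_cong g2[symmetric])
  finally show ?case .
qed

lemma coactR_eq:
  assumes "t \<in> Omega H" shows "coactR H t = tcor H t"
  unfolding coactR_def
proof (rule Omega_uniq[OF linop_basic(4) _ forms_span _ assms])
  \<comment> \<open>\<open>form H []\<close> involves \<open>hd []\<close>. The value
    \<open>0\<close> in that case makes the integrand multilinear on lists of all lengths.\<close>
  define g where "g us vs = (if us = [] then 0 else tapp H (form H us) (lprod H vs))" for us vs
  define g' where "g' us vs = (if us = [] then 0 else tcat H (form H us) (tens H [lprod H vs]))" for us vs
  have F: "form H us \<in> TN H" if "us \<noteq> []" "set us \<subseteq> carrier H" for us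
    using that by (cases us) auto
  have gg: "g' us vs = g us vs" if "set us \<subseteq> carrier H" "set vs \<subseteq> carrier H" for us vs
    using that by (simp add: g_def g'_def tcat_single_right F)
  have bi: "bimlin g"
    unfolding bimlin_def
  proof (intro conjI allI impI mlinI)
    fix vs us us' assume *: "set vs \<subseteq> carrier H" "set us \<subseteq> carrier H" "set us' \<subseteq> carrier H"
    have "lin H (\<lambda>x. tapp H (form H (us @ x # us')) (lprod H vs))"
      by (rule linop_lin[OF linop_tapp[OF linop_id] mlinD[OF mlin_form *(2,3)]])
    then show "lin H (\<lambda>x. g (us @ x # us') vs)" by (simp add: g_def)
    show "lin H (\<lambda>x. g vs (us @ x # us'))"
    proof (cases "vs = []")
      case False
      have "lin H (\<lambda>x. tapp H (form H vs) (lprod H (us @ x # us')))"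
        by (rule lin_hlin[OF op_lin(2) hlin_lprod]) (use * F[OF False] in auto)
      then show ?thesis using False by (simp add: g_def)
    qed (simp add: g_def lin_0)
  qed
  have bi': "bimlin g'"
    by (rule bimlin_cong[OF gg bi])
  have *: "sweedler H as (\<lambda>us vs. tcat H (form H us) (tens H [lprod H vs])) = tcor H (form H as)"
    if nz: "as \<noteq> []" "set as \<subseteq> carrier H" for as
  proof -
    obtain b bs where as: "as = b # bs" "b \<in> carrier H" "set bs \<subseteq> carrier H" using nz by (cases as) auto
    have "sweedler H as (\<lambda>us vs. tcat H (form H us) (tens H [lprod H vs])) = sweedler H as g'"
      by (simp add: as g'_def)
    also have "\<dots> = swl H as g'" by (rule sweedler_swl[OF bi' nz(2)])
    also have "\<dots> = swl H as g" by (rule swl_cong) (simp add: gg)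
    also have "\<dots> = tcor H (form H as)"
      unfolding as(1)
      by (rule coact_form[symmetric, where Q = "\<lambda>p q t. tpre H p (tll H q t)", OF _ _ _ _ _ _ _ bi])
        (use as in \<open>simp_all add: linop_intros linop_basic lin_simps g_def form_Cons op_lin_simps op_comm_TT op_comm_TN mult_assoc'\<close>)
    finally show ?thesis .
  qed
  have O: "form H as \<in> Omega H" if "as \<noteq> []" "set as \<subseteq> carrier H" for as
    using that form_Omega[of "hd as" "tl as"] by (cases as) auto
  show "\<forall>as. as \<noteq> [] \<and> set as \<subseteq> carrier H \<longrightarrow> restrict (tcor H) (Omega H) (form H as) =
      sweedler H as (\<lambda>us vs. tcat H (form H us) (tens H [lprod H vs]))"
    using * O by auto
  show "h x = tcor H x" if "\<forall>as. as \<noteq> [] \<and> set as \<subseteq> carrier H \<longrightarrow> h (form H as) =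
      sweedler H as (\<lambda>us vs. tcat H (form H us) (tens H [lprod H vs]))"
    "x \<in> {form H as |as. as \<noteq> [] \<and> set as \<subseteq> carrier H}" for h :: "('k, 'a) tensor \<Rightarrow> ('k, 'a) tensor" and x
    using that * by auto
qed

lemma tql_tens [simp]:
  assumes "p \<in> carrier H" "q \<in> carrier H"
  shows "tql H p q (tens H []) = 0" "tql H p q (tens H (x # xs)) = tens H ((p \<otimes> x) # q # xs)"
proof -
  have "mlin H (\<lambda>ys. case ys of [] \<Rightarrow> 0 | y # ys \<Rightarrow> tens H ((p \<otimes> y) # q # ys))"
  proof (rule mlin_Cons[where g = "tens H" and A = "\<lambda>x t. tpre H (p \<otimes> x) (tpre H q t)"])
    fix xs assume "set xs \<subseteq> carrier H"
    then show "lin H (\<lambda>x. tpre H (p \<otimes> x) (tpre H q (tens H xs)))"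
      using assms by (simp add: lin_simps del: tpre_tens)
  qed (use assms in \<open>auto intro!: linop_intros mlin_tens\<close>)
  from tbind_tens[OF this] show "tql H p q (tens H []) = 0" "tql H p q (tens H (x # xs)) = tens H ((p \<otimes> x) # q # xs)"
    by (simp_all add: tql_def)
qed

lemma tql_tpre: "t \<in> TT H \<Longrightarrow> p \<in> carrier H \<Longrightarrow> q \<in> carrier H \<Longrightarrow> x \<in> carrier H \<Longrightarrow>
    tql H p q (tpre H x t) = tpre H (p \<otimes> x) (tpre H q t)"
  by (rule TT_eqI[where t = t]) (auto intro!: linop_intros)

lemma tql_TN [simp]: "t \<in> TN H \<Longrightarrow> p \<in> carrier H \<Longrightarrow> q \<in> carrier H \<Longrightarrow> tql H p q t \<in> TN H"
  by (rule TN_into[OF linop_basic2(1) TN_subspace]) auto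

lemma tql_lin2:
  assumes "t \<in> TN H" shows "lin2 H (\<lambda>p q. tql H p q t)"
  unfolding lin2_def
proof (intro ballI conjI)
  fix y assume y: "y \<in> carrier H"
  show "lin H (\<lambda>x. tql H x y t)"
  proof (rule mlin_lin_TN[where f = "\<lambda>x. tql H x y", OF _ linop_basic2(1) assms])
    fix xs assume xs: "set xs \<subseteq> carrier H" "xs \<noteq> []"
    then obtain z zs where "xs = z # zs" "z \<in> carrier H" "set zs \<subseteq> carrier H" by (cases xs) auto
    then show "lin H (\<lambda>x. tql H x y (tens H xs))"
      using lin_tens_hlin[OF hlin_mult'[of z], of "[]" "y # zs"] y by (simp add: lin_def)
  qed
  show "lin H (\<lambda>x. tql H y x t)"
  proof (rule mlin_lin_TN[where f = "\<lambda>x. tql H y x", OF _ linop_basic2(1) assms])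
    fix xs assume xs: "set xs \<subseteq> carrier H" "xs \<noteq> []"
    then obtain z zs where "xs = z # zs" "z \<in> carrier H" "set zs \<subseteq> carrier H" by (cases xs) auto
    then show "lin H (\<lambda>x. tql H y x (tens H xs))"
      using lin_tens[of "[y \<otimes> z]" zs] y by (simp add: lin_def)
  qed
qed

lemma collist_TN: "set xs \<subseteq> carrier H \<Longrightarrow> collist H xs \<in> TN H"
  by (induction xs) auto

lemma mlin_collist: "mlin H (collist H)"
  by (rule mlin_rec[where A = "\<lambda>x t. sw H x (\<lambda>a b. tql H a b t)" and B = "\<lambda>_. 0"])
    (auto intro!: linop_intros mlin_0 sw_lin tql_lin2 collist_TN)

lemma tcol_tens [simp]: "tcol H (tens H xs) = collist H xs"
  unfolding tcol_def by (rule tbind_tens[OF mlin_collist])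

lemma tcol_TN [simp]: "t \<in> TT H \<Longrightarrow> tcol H t \<in> TN H"
  by (rule TT_into[OF linop_basic2(3) TN_subspace]) (auto simp: collist_TN)

lemma tcol_tpre [simp]:
  "t \<in> TT H \<Longrightarrow> x \<in> carrier H \<Longrightarrow> tcol H (tpre H x t) = sw H x (\<lambda>a b. tql H a b (tcol H t))"
  by (rule TT_eqI[where t = t]) (auto intro!: linop_intros)

lemma coactL_eq:
  assumes "t \<in> Omega H" shows "coactL H t = tcol H t"
  unfolding coactL_def
proof (rule Omega_uniq[OF linop_basic2(3) _ forms_span _ assms])
  define g where "g us vs = (if vs = [] then 0 else tpre H (lprod H us) (form H vs))" for us vs
  define g' where "g' us vs = (if vs = [] then 0 else tcat H (tens H [lprod H us]) (form H vs))" for us vs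
  have F: "form H us \<in> TN H" if "us \<noteq> []" "set us \<subseteq> carrier H" for us
    using that by (cases us) auto
  have gg: "g' us vs = g us vs" if "set us \<subseteq> carrier H" "set vs \<subseteq> carrier H" for us vs
    using that by (simp add: g_def g'_def tcat_single_left F)
  have bi: "bimlin g"
    unfolding bimlin_def
  proof (intro conjI allI impI mlinI)
    fix vs us us' assume *: "set vs \<subseteq> carrier H" "set us \<subseteq> carrier H" "set us' \<subseteq> carrier H"
    have "lin H (\<lambda>x. tpre H (lprod H vs) (form H (us @ x # us')))"
      by (rule linop_lin[OF linop_tpre[OF linop_id] mlinD[OF mlin_form *(2,3)]])
    then show "lin H (\<lambda>x. g vs (us @ x # us'))" by (simp add: g_def)
    show "lin H (\<lambda>x. g (us @ x # us') vs)"
    proof (cases "vs = []")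
      case False
      have "lin H (\<lambda>x. tpre H (lprod H (us @ x # us')) (form H vs))"
        by (rule lin_hlin[OF op_lin(1) hlin_lprod]) (use * F[OF False] in auto)
      then show ?thesis using False by (simp add: g_def)
    qed (simp add: g_def lin_0)
  qed
  have bi': "bimlin g'"
    by (rule bimlin_cong[OF gg bi])
  have *: "sweedler H as (\<lambda>us vs. tcat H (tens H [lprod H us]) (form H vs)) = tcol H (form H as)"
    if nz: "as \<noteq> []" "set as \<subseteq> carrier H" for as
  proof -
    obtain b bs where as: "as = b # bs" "b \<in> carrier H" "set bs \<subseteq> carrier H" using nz by (cases as) auto
    have "sweedler H as (\<lambda>us vs. tcat H (tens H [lprod H us]) (form H vs)) = sweedler H as g'"
      by (simp add: as g'_def)
    also have "\<dots> = swl H as g'" by (rule sweedler_swl[OF bi' nz(2)])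
    also have "\<dots> = swl H as g" by (rule swl_cong) (simp add: gg)
    also have "\<dots> = tcol H (form H as)"
      unfolding as(1)
      by (rule coact_form[symmetric, where Q = "tql H", OF _ _ _ _ _ _ _ bi])
        (use as in \<open>simp_all add: linop_basic2 tql_lin2 g_def form_Cons op_lin_simps op_lin_simps3 tql_tpre mult_assoc'\<close>)
    finally show ?thesis .
  qed
  have O: "form H as \<in> Omega H" if "as \<noteq> []" "set as \<subseteq> carrier H" for as
    using that form_Omega[of "hd as" "tl as"] by (cases as) auto
  show "\<forall>as. as \<noteq> [] \<and> set as \<subseteq> carrier H \<longrightarrow> restrict (tcol H) (Omega H) (form H as) =
      sweedler H as (\<lambda>us vs. tcat H (tens H [lprod H us]) (form H vs))"
    using * O by auto
  show "h x = tcol H x" if "\<forall>as. as \<noteq> [] \<and> set as \<subseteq> carrier H \<longrightarrow> h (form H as) =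
      sweedler H as (\<lambda>us vs. tcat H (tens H [lprod H us]) (form H vs))"
    "x \<in> {form H as |as. as \<noteq> [] \<and> set as \<subseteq> carrier H}" for h :: "('k, 'a) tensor \<Rightarrow> ('k, 'a) tensor" and x
    using that * by auto
qed

lemma trh_tens [simp]: "c \<in> carrier H \<Longrightarrow> trh H c (tens H []) = 0"
    "c \<in> carrier H \<Longrightarrow> trh H c (tens H (x # xs)) = tens H ((x \<otimes> c) # xs)"
  by (simp_all add: trh_def modhd_tens[OF hlin_mult'])

lemma trh_lin: assumes "t \<in> TN H" shows "lin H (\<lambda>c. trh H c t)"
proof (rule mlin_lin_TN[where f = "trh H", OF _ linop_basic2(2) assms])
  fix xs assume "set xs \<subseteq> carrier H" "xs \<noteq> []"
  then obtain z zs where "xs = z # zs" "z \<in> carrier H" "set zs \<subseteq> carrier H" by (cases xs) auto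
  then show "lin H (\<lambda>c. trh H c (tens H xs))"
    using lin_tens_hlin[OF hlin_mult[of z], of "[]" zs] by (simp add: lin_def)
qed

lemmas trh_arg [simp] = trh_lin[unfolded lin_def, THEN conjunct1, rule_format]
  trh_lin[unfolded lin_def, THEN conjunct2, rule_format]

lemma trh_TN [simp]: "t \<in> TN H \<Longrightarrow> c \<in> carrier H \<Longrightarrow> trh H c t \<in> TN H"
  by (rule TN_into[OF linop_basic2(2) TN_subspace]) auto

lemma tql_comm:
  assumes t: "t \<in> TN H" and c: "p \<in> carrier H" "q \<in> carrier H" "a \<in> carrier H"
  shows "tql H p q (tapp H t a) = tapp H (tql H p q t) a" "tql H p q (trh H a t) = trh H a (tql H p q t)"
proof -
  show "tql H p q (tapp H t a) = tapp H (tql H p q t) a"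
    by (rule TN_eqI[OF _ _ _ t]) (use c in \<open>auto intro!: linop_intros\<close>)
  show "tql H p q (trh H a t) = trh H a (tql H p q t)"
    by (rule TN_eqI[OF _ _ _ t]) (use c in \<open>auto intro!: linop_intros simp: mult_assoc'\<close>)
qed

lemma tcol_tapp:
  assumes t: "t \<in> TT H" and x: "x \<in> carrier H"
  shows "tcol H (tapp H t x) = sw H x (\<lambda>a b. tapp H (trh H a (tcol H t)) b)"
proof -
  have "tcol H (tapp H (tens H xs) x) = sw H x (\<lambda>a b. tapp H (trh H a (tcol H (tens H xs))) b)"
    if "set xs \<subseteq> carrier H" for xs
    using that
  proof (induction rule: TT_list_induct)
    case Nil
    then show ?case using x by simp
  next
    case (Cons y ys)
    have "tcol H (tapp H (tens H (y # ys)) x) = tcol H (tpre H y (tapp H (tens H ys) x))"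
      using Cons x by simp
    also have "\<dots> = sw H y (\<lambda>p q. sw H x (\<lambda>a b. tql H p q (tapp H (trh H a (tcol H (tens H ys))) b)))"
      using Cons x by (simp add: op_sw3 del: tapp_tens)
    also have "\<dots> = sw H x (\<lambda>a b. sw H y (\<lambda>p q. tql H p q (tapp H (trh H a (tcol H (tens H ys))) b)))"
      by (rule sw_swap)
    also have "\<dots> = sw H x (\<lambda>a b. tapp H (trh H a (tcol H (tens H (y # ys)))) b)"
      using Cons collist_TN[of ys] by (simp add: op_sw3 op_sw tql_comm)
    finally show ?case .
  qed
  then show ?thesis
    by (rule TT_eqI[OF linop_ops2(3)[OF linop_tapp[OF linop_id]]
        linop_sw[OF linop_tapp[OF linop_ops2(2)[OF linop_basic2(3)]]] _ t])
qed

section \<open>The antiautomorphism induced by the antipode\<close>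

lemma map_antipode_carrier [simp]: "set xs \<subseteq> carrier H \<Longrightarrow> antipode H ` set xs \<subseteq> carrier H"
  by auto

lemma tJ_tens [simp]: "tJ H (tens H xs) = tens H (rev (map (antipode H) xs))"
  unfolding tJ_def
proof (rule tbind_tens, rule mlinI)
  fix xs ys assume "set xs \<subseteq> carrier H" "set ys \<subseteq> carrier H"
  then show "lin H (\<lambda>x. tens H (rev (map (antipode H) (xs @ x # ys))))"
    using lin_tens_hlin[OF hlin_antipode, of "rev (map (antipode H) ys)" "rev (map (antipode H) xs)"]
    by simp
qed

lemma tJ_TT [simp]: "t \<in> TT H \<Longrightarrow> tJ H t \<in> TT H"
  by (rule TT_into[OF linop_basic2(4) TT_subspace]) auto

lemma tJ_TN [simp]: "t \<in> TN H \<Longrightarrow> tJ H t \<in> TN H"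
  by (rule TN_into[OF linop_basic2(4) TN_subspace]) auto

lemma tJ_tpower [simp]: "t \<in> tpower H n \<Longrightarrow> tJ H t \<in> tpower H n"
  by (rule tpower_into[OF linop_basic2(4) tpower_subspace]) (simp_all add: tens_in_tpower)

lemma tJ_tpre [simp]: "t \<in> TT H \<Longrightarrow> x \<in> carrier H \<Longrightarrow> tJ H (tpre H x t) = tapp H (tJ H t) (antipode H x)"
  by (rule TT_eqI[where t = t]) (auto intro!: linop_intros)

lemma tJ_tapp [simp]: "t \<in> TT H \<Longrightarrow> x \<in> carrier H \<Longrightarrow> tJ H (tapp H t x) = tpre H (antipode H x) (tJ H t)"
  by (rule TT_eqI[where t = t]) (auto intro!: linop_intros)

lemma tens_antipode_mult:
  assumes "set xs \<subseteq> carrier H" "set ys \<subseteq> carrier H" "x \<in> carrier H" "y \<in> carrier H"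
  shows "tens H (xs @ antipode H (x \<otimes> y) # ys) = tens H (xs @ (antipode H y \<otimes> antipode H x) # ys)"
  by (rule antipode_mult[where g = "\<lambda>z. tens H (xs @ z # ys)"]) (use assms lin_tens in auto)

lemma tJ_tlm: "t \<in> TT H \<Longrightarrow> c \<in> carrier H \<Longrightarrow> tJ H (tlm H c t) = trm H (antipode H c) (tJ H t)"
proof (rule TT_eqI[where t = t])
  fix xs assume "c \<in> carrier H" "set xs \<subseteq> carrier H"
  then show "tJ H (tlm H c (tens H xs)) = trm H (antipode H c) (tJ H (tens H xs))"
    using tens_antipode_mult[of "rev (map (antipode H) (tl xs))" "[]" c "hd xs"]
    by (cases xs) (auto simp: op_lin_simps3)
qed (auto intro!: linop_intros)

lemma tJ_tll: "t \<in> TT H \<Longrightarrow> c \<in> carrier H \<Longrightarrow> tJ H (tll H c t) = trh H (antipode H c) (tJ H t)"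
proof (rule TT_eqI[where t = t])
  fix xs assume "c \<in> carrier H" "set xs \<subseteq> carrier H"
  then show "tJ H (tll H c (tens H xs)) = trh H (antipode H c) (tJ H (tens H xs))"
    using tens_antipode_mult[of "[]" "rev (map (antipode H) (butlast xs))" c "last xs"]
    by (cases xs rule: rev_cases) (auto simp: op_lin_simps3)
qed (auto intro!: linop_intros)

lemma tens_antipode_one:
  "set xs \<subseteq> carrier H \<Longrightarrow> set ys \<subseteq> carrier H \<Longrightarrow> tens H (xs @ antipode H \<one> # ys) = tens H (xs @ \<one> # ys)"
  by (rule antipode_one[where g = "\<lambda>z. tens H (xs @ z # ys)"]) (use lin_tens in auto)

lemma tapp_antipode_one: "t \<in> TT H \<Longrightarrow> tapp H t (antipode H \<one>) = tapp H t \<one>"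
  by (rule antipode_one[where g = "tapp H t"]) (rule op_lin)

lemma tpre_antipode_one: "t \<in> TT H \<Longrightarrow> tpre H (antipode H \<one>) t = tpre H \<one> t"
  by (rule antipode_one[where g = "\<lambda>z. tpre H z t"]) (rule op_lin)

text \<open>The antipode exchanges the legs of each coproduct, and the reversal moves the product of
  the second legs from the end to the front.\<close>

lemma tJ_tcor:
  assumes t: "t \<in> TT H"
  shows "tJ H (tcor H t) = tcol H (tJ H t)"
proof -
  have "tJ H (tcor H (tens H xs)) = tcol H (tJ H (tens H xs))" if "set xs \<subseteq> carrier H" for xs
    using that
  proof (induction rule: TT_list_induct)
    case Nil
    then show ?case using tens_antipode_one[of "[]" "[]"] by simp
  next
    case (Cons x xs)
    note [simp] = corlist_TN[OF Cons(2)]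
    have U: "tcol H (tJ H (tens H xs)) \<in> TN H" using Cons by (simp add: collist_TN)
    have "tJ H (tcor H (tens H (x # xs))) =
        sw H x (\<lambda>a b. tapp H (trh H (antipode H b) (tJ H (tcor H (tens H xs)))) (antipode H a))"
      using Cons by (simp add: op_sw3 tJ_tll)
    also have "\<dots> = sw H (antipode H x) (\<lambda>a b. tapp H (trh H a (tcol H (tJ H (tens H xs)))) b)"
      unfolding Cons.IH using Cons U by (subst sw_antipode) (simp_all add: lin_simps del: tJ_tens)
    also have "\<dots> = tcol H (tapp H (tJ H (tens H xs)) (antipode H x))"
      using Cons by (intro tcol_tapp[symmetric]) auto
    also have "\<dots> = tcol H (tJ H (tens H (x # xs)))" using Cons by simp
    finally show ?case .
  qed
  then show ?thesis
    by (rule TT_eqI[OF linop_ops2(4)[OF linop_basic(4)] linop_ops2(3)[OF linop_basic2(4)] _ t])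
qed

lemma tins_tapp:
  assumes t: "t \<in> tpower H n" and x: "x \<in> carrier H"
  shows "tins H (tapp H t x) = tapp H (tins H t) x + (-1) ^ Suc n *\<^sub>k tapp H (tapp H t x) \<one>"
proof -
  have *: "tins H (tapp H (tens H xs) x) = tapp H (tins H (tens H xs)) x + (-1) ^ Suc (length xs) *\<^sub>k tapp H (tapp H (tens H xs) x) \<one>"
    if "set xs \<subseteq> carrier H" for xs
    using that
  proof (induction rule: TT_list_induct)
    case Nil
    then show ?case using x by simp
  next
    case (Cons y ys)
    then show ?case using x
      by (simp add: tens_Cons op_comm_TT op_lin_simps op_lin_simps2 del: tpre_tens tins_tens tapp_tens)
  qed
  show ?thesis
  proof (rule tpower_eqI[OF _ _ _ t])
    fix xs assume "set xs \<subseteq> carrier H" "length xs = n"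
    from *[OF this(1), unfolded this(2)]
    show "tins H (tapp H (tens H xs) x) = tapp H (tins H (tens H xs)) x + (-1) ^ Suc n *\<^sub>k tapp H (tapp H (tens H xs) x) \<one>" .
  qed (intro linop_intros)+
qed

text \<open>Reversal sends the insertion at position \<open>i\<close> to the one at position
  \<open>n - i\<close>, which accounts for the sign, and \<open>S(1) = 1\<close>.\<close>

lemma tJ_tins:
  assumes t: "t \<in> tpower H n"
  shows "tJ H (tins H t) = (-1) ^ n *\<^sub>k tins H (tJ H t)"
proof -
  have *: "tJ H (tins H (tens H xs)) = (-1) ^ length xs *\<^sub>k tins H (tJ H (tens H xs))"
    if "set xs \<subseteq> carrier H" for xs
    using that
  proof (induction rule: TT_list_induct)
    case Nil
    then show ?case using tens_antipode_one[of "[]" "[]"] by simp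
  next
    case (Cons x xs)
    have t: "tJ H (tens H xs) \<in> tpower H (length xs)" using Cons by (intro tJ_tpower tens_in_tpower) auto
    show ?case using Cons
      by (simp add: tens_Cons op_lin_simps op_lin_simps3 tins_tapp[OF t] tapp_antipode_one fs.scale_right_distrib fs.scale_right_diff_distrib
          del: tpre_tens tins_tens tapp_tens tJ_tens)
  qed
  show ?thesis
  proof (rule tpower_eqI[OF _ _ _ t])
    fix xs assume "set xs \<subseteq> carrier H" "length xs = n"
    from *[OF this(1), unfolded this(2)]
    show "tJ H (tins H (tens H xs)) = (-1) ^ n *\<^sub>k tins H (tJ H (tens H xs))" .
  qed (intro linop_intros)+
qed

lemma odot_tapp:
  assumes s: "s \<in> TN H" and t: "t \<in> TN H" and x: "x \<in> carrier H"
  shows "odot H s (tapp H t x) = tapp H (odot H s t) x"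
proof (rule TN_eq_listI[OF _ _ _ s])
  fix xs assume "set xs \<subseteq> carrier H" "xs \<noteq> []"
  then show "odot H (tens H xs) (tapp H t x) = tapp H (odot H (tens H xs) t) x"
  proof (induction rule: TN_list_induct)
    case (Cons y ys)
    then show ?case using x t by (simp add: tens_Cons odot_tpre op_comm_TT del: tpre_tens)
  qed (use x t in \<open>simp add: odot_single op_comm_TN\<close>)
qed (intro linop_intros)+

lemma tJ_odot:
  assumes s: "s \<in> TN H" and t: "t \<in> TN H"
  shows "tJ H (odot H s t) = odot H (tJ H t) (tJ H s)"
proof -
  have "tJ H (odot H (tens H xs) t) = odot H (tJ H t) (tJ H (tens H xs))" if "set xs \<subseteq> carrier H" "xs \<noteq> []" for xs
    using that
  proof (induction rule: TN_list_induct)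
    case (single x)
    then show ?case using t by (simp add: odot_single odot_single_right tJ_tlm)
  next
    case (Cons y ys)
    then show ?case using t by (simp add: tens_Cons odot_tpre odot_tapp del: tpre_tens tJ_tens)
  qed
  then have "tJ H (odot H s t) = odot H (tJ H t) (tJ H s) \<and> s \<in> TN H"
    using t
    by (intro fs.span_induct_alt[where h = "\<lambda>s. tJ H (odot H s t) = odot H (tJ H t) (tJ H s) \<and> s \<in> TN H", OF s[unfolded TN_def]])
      (auto simp: op_lin_simps3 odot_left_simps odot_zero_right odot_add_right odot_scale_right simp del: tJ_tens)
  then show ?thesis ..
qed

lemma tJ_diff1: "a \<in> carrier H \<Longrightarrow> tJ H (diff1 H a) = - diff1 H (antipode H a)"
  using tens_antipode_one[of "[antipode H a]" "[]"] tens_antipode_one[of "[]" "[antipode H a]"]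
  by (simp add: diff1_def op_lin_simps3)

text \<open>A form is built up by right multiplication with differentials. Reversing the product and
  using \<open>tJ(da) = - d(S a)\<close> gives a product of forms again.\<close>

lemma tJ_formspan:
  assumes "t \<in> formspan n" shows "tJ H t \<in> formspan n"
proof (rule formspan_into[OF linop_basic2(4) formspan_subspace _ assms])
  have "tJ H (form H (a # as)) \<in> formspan (length as)" if "a \<in> carrier H" "set as \<subseteq> carrier H" for a as
    using that(2)
  proof (induction as rule: rev_induct)
    case Nil
    then show ?case using form_in_formspan[of "antipode H a" "[]" 0] that by simp
  next
    case (snoc b bs)
    have "tJ H (form H (a # bs @ [b])) = - odot H (diff1 H (antipode H b)) (tJ H (form H (a # bs)))"
      using form_snoc[of "a # bs" b] snoc that by (simp add: tJ_odot tJ_diff1 odot_left_simps)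
    moreover have "odot H (diff1 H (antipode H b)) (tJ H (form H (a # bs))) \<in> formspan (1 + length bs)"
      using snoc by (intro odot_formspan diff1_formspan) auto
    ultimately show ?case by (simp add: fs.subspace_neg[OF formspan_subspace])
  qed
  then show "tJ H (form H (a # as)) \<in> formspan n" if "a \<in> carrier H" "set as \<subseteq> carrier H" "length as = n" for a as
    using that by blast
qed

lemma tsgn_tens: "tsgn H (tens H xs) = (-1) ^ length xs *\<^sub>k tens H xs"
  unfolding tsgn_def
proof (rule tbind_tens, rule mlinI)
  fix xs ys assume "set xs \<subseteq> carrier H" "set ys \<subseteq> carrier H"
  from lin_scale[OF lin_tens[OF this], of "(-1) ^ (length xs + Suc (length ys))"]
  show "lin H (\<lambda>x. (-1) ^ length (xs @ x # ys) *\<^sub>k tens H (xs @ x # ys))" by simp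
qed

lemma tsgn_tpower: "t \<in> tpower H n \<Longrightarrow> tsgn H t = (-1) ^ n *\<^sub>k t"
  by (rule tpower_eqI[where t = t and n = n]) (auto intro!: linop_intros simp: tsgn_tens)

lemma tF_eq: "t \<in> tpower H (Suc n) \<Longrightarrow> tF H t = (-1) ^ n *\<^sub>k tJ H (tE H (tJ H t))"
  by (simp add: tF_def tsgn_tpower op_lin_simps2 op_lin_simps3)

end

lemma (in involutive_hopf_algebra) tJ_tJ:
  assumes "t \<in> TT H" shows "tJ H (tJ H t) = t"
proof (rule TT_eqI[OF linop_ops2(4)[OF linop_basic2(4)] linop_id _ assms])
  fix xs assume "set xs \<subseteq> carrier H"
  then have "map (antipode H \<circ> antipode H) xs = xs"
    by (intro map_idI) (auto simp: antipode_involutive)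
  then show "tJ H (tJ H (tens H xs)) = tens H xs" by (simp add: rev_map)
qed

context involutive_hopf_algebra
begin

text \<open>The rule \<open>b'(da w) = a w - w a\<close> conjugated by \<open>tJ\<close>; the
  antipode is applied twice to \<open>a\<close>, and involutivity gives \<open>a\<close>
  back.\<close>

lemma tF_odot_diff1:
  assumes "w \<in> tpower H (Suc n)" "a \<in> carrier H"
  shows "tF H (odot H w (diff1 H a)) = (-1) ^ n *\<^sub>k (odot H w (tens H [a]) - odot H (tens H [a]) w)"
proof -
  have w [simp]: "w \<in> TN H" by (rule tpower_TN[OF assms(1)]) simp
  have p: "odot H w (diff1 H a) \<in> tpower H (Suc (Suc n))"
    using odot_tpower[OF assms(1), of "diff1 H a" 1] diff1_tpower[OF assms(2)] by (simp add: numeral_2_eq_2)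
  have "tE H (tJ H (odot H w (diff1 H a))) = trm H (antipode H a) (tJ H w) - tlm H (antipode H a) (tJ H w)"
    using assms by (simp add: tJ_odot tJ_diff1 odot_left_simps odot_diff1_left op_lin_simps2 op_one)
  moreover have "tJ H (tlm H (antipode H a) (tJ H w)) = trm H a w"
    using assms by (simp add: tJ_tlm antipode_involutive tJ_tJ)
  moreover have "tJ H (trm H (antipode H a) (tJ H w)) = tlm H a w"
  proof -
    have "trm H (antipode H a) (tJ H w) = tJ H (tlm H a w)" using assms by (simp add: tJ_tlm)
    then show ?thesis using assms by (simp add: tJ_tJ)
  qed
  ultimately show ?thesis
    using assms by (simp add: tF_eq[OF p] op_lin_simps3 odot_single odot_single_right fs.scale_right_diff_distrib)
qed

lemma tF_formspan: "t \<in> formspan (Suc n) \<Longrightarrow> tF H t \<in> formspan n"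
  using formspan_tpower[of t "Suc n"]
  by (simp add: tF_eq fs.subspace_scale[OF formspan_subspace] fs.subspace_neg[OF formspan_subspace] tJ_formspan tE_formspan)

lemma tF_formspan_0: "t \<in> formspan 0 \<Longrightarrow> tF H t = 0"
  using formspan_tpower[of t 0]
  by (simp add: tF_eq tE_formspan_0 tJ_formspan op_lin_simps3)

lemma bO_eq: assumes "t \<in> Omega H" shows "bO H t = tF H t"
  unfolding bO_def
proof (rule Omega_uniq[OF linop_basic2(6) _ _ _ assms])
  let ?S = "Omega_deg H 0 \<union> {odot H \<omega> (diff1 H a) |a \<omega> n. a \<in> carrier H \<and> \<omega> \<in> Omega_deg H n}"
  have O: "odot H \<omega> (diff1 H a) \<in> Omega H" if "a \<in> carrier H" "\<omega> \<in> Omega_deg H n" for a \<omega> n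
    using odot_formspan[OF _ diff1_formspan[OF that(1)]] that(2) formspan_Omega by (metis Omega_deg_eq)
  have O0: "\<omega> \<in> Omega H" if "\<omega> \<in> Omega_deg H n" for \<omega> n
    using that formspan_Omega by (metis Omega_deg_eq)
  have e: "tF H (odot H \<omega> (diff1 H a)) = (-1) ^ n *\<^sub>k (odot H \<omega> (tens H [a]) - odot H (tens H [a]) \<omega>)"
    if "a \<in> carrier H" "\<omega> \<in> Omega_deg H n" for a \<omega> n
    using that formspan_tpower by (intro tF_odot_diff1) (auto simp: Omega_deg_eq)
  have e0: "tF H \<omega> = 0" if "\<omega> \<in> Omega_deg H 0" for \<omega>
    using that tF_formspan_0 by (metis Omega_deg_eq)
  show "fs.span ?S = Omega H"
  proof
    show "fs.span ?S \<subseteq> Omega H" using O O0 by (intro fs.span_minimal Omega_subspace) blast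
    show "Omega H \<subseteq> fs.span ?S"
      unfolding Omega_span
    proof (intro fs.span_minimal fs.subspace_span subsetI)
      fix x assume "x \<in> {form H (a # as) |a as. a \<in> carrier H \<and> set as \<subseteq> carrier H}"
      then obtain a as where x: "x = form H (a # as)" "a \<in> carrier H" "set as \<subseteq> carrier H" by blast
      have "x \<in> ?S"
      proof (cases as rule: rev_cases)
        case Nil
        then show ?thesis using x form_in_formspan[of a "[]" 0] by (simp add: Omega_deg_eq del: Omega_deg.simps)
      next
        case (snoc bs b)
        have "form H (a # bs) \<in> Omega_deg H (length bs)"
          using x snoc by (auto simp: Omega_deg_eq intro!: form_in_formspan)
        moreover have "x = odot H (form H (a # bs)) (diff1 H b)"
          using form_snoc[of "a # bs" b] x snoc by simp
        ultimately show ?thesis using x snoc by auto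
      qed
      then show "x \<in> fs.span ?S" by (rule fs.span_base)
    qed
  qed
  show "(\<forall>\<omega>\<in>Omega_deg H 0. restrict (tF H) (Omega H) \<omega> = 0) \<and>
    (\<forall>n. \<forall>\<omega>\<in>Omega_deg H n. \<forall>a\<in>carrier H. restrict (tF H) (Omega H) (odot H \<omega> (diff1 H a)) =
       (-1) ^ n *\<^sub>k (odot H \<omega> (tens H [a]) - odot H (tens H [a]) \<omega>))"
    using O O0 e e0 by (auto simp del: Omega_deg.simps)
  show "g x = tF H x" if "(\<forall>\<omega>\<in>Omega_deg H 0. g \<omega> = 0) \<and>
    (\<forall>n. \<forall>\<omega>\<in>Omega_deg H n. \<forall>a\<in>carrier H. g (odot H \<omega> (diff1 H a)) =
       (-1) ^ n *\<^sub>k (odot H \<omega> (tens H [a]) - odot H (tens H [a]) \<omega>))" "x \<in> ?S"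
    for g x
    using that e e0 by (auto simp del: Omega_deg.simps)
qed

end

section \<open>Quasi-isomorphisms of super-complexes\<close>

definition cscale :: "'k::field \<Rightarrow> ('b, 'k) cochain \<Rightarrow> ('b, 'k) cochain"
  where "cscale c x = (\<lambda>n. c *\<^sub>k x n)"

definition clin :: "(('b, 'k::field) cochain \<Rightarrow> ('c, 'k) cochain) \<Rightarrow> bool"
  where "clin F \<longleftrightarrow> (\<forall>x y. F (x + y) = F x + F y) \<and> (\<forall>c x. F (cscale c x) = cscale c (F x))"

definition csub :: "('b, 'k::field) cochain set \<Rightarrow> bool"
  where "csub V \<longleftrightarrow> 0 \<in> V \<and> (\<forall>x\<in>V. \<forall>y\<in>V. x + y \<in> V) \<and> (\<forall>c. \<forall>x\<in>V. cscale c x \<in> V)"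

definition is_supercomplex :: "('b, 'k::field) supercomplex \<Rightarrow> bool"
  where "is_supercomplex K \<longleftrightarrow> clin (snd K) \<and> (\<forall>i\<in>{0, 1}. csub (fst K i) \<and>
    (\<forall>x\<in>fst K i. snd K x \<in> fst K (1 - i) \<and> snd K (snd K x) = 0))"

text \<open>Bijectivity on cohomology, spelled out on representatives: a chain map that reflects
  coboundaries among cocycles and meets every class.\<close>

definition quasi_iso ::
  "('b, 'k::field) supercomplex \<Rightarrow> ('c, 'k) supercomplex \<Rightarrow> (('b, 'k) cochain \<Rightarrow> ('c, 'k) cochain) \<Rightarrow> bool"
  where "quasi_iso K L F \<longleftrightarrow> clin F \<and> (\<forall>i\<in>{0, 1}.
    (\<forall>x\<in>fst K i. F x \<in> fst L i \<and> snd L (F x) = F (snd K x)) \<and>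
    (\<forall>x\<in>cocycles K i. F x \<in> coboundaries L i \<longrightarrow> x \<in> coboundaries K i) \<and>
    (\<forall>y\<in>cocycles L i. \<exists>x\<in>cocycles K i. F x - y \<in> coboundaries L i))"

lemma cscale_simps [simp]: "cscale c 0 = 0" "cscale c (x + y) = cscale c x + cscale c y"
  "cscale c (x - y) = cscale c x - cscale c y" "cscale (-1) x = - x" "cscale 0 x = 0"
  "cscale c (- x) = - cscale c x"
  by (auto simp: cscale_def fun_eq_iff fscale_def algebra_simps plus_fun_apply zero_fun_apply minus_apply uminus_apply)

lemma cochain_plus: "(x + y) n = x n + y n" for x y :: "('b, 'k::field) cochain"
  by (simp add: plus_fun_apply)

lemma cochain_minus: "(x - y) n = x n - y n" for x y :: "('b, 'k::field) cochain"
  by (simp add: minus_apply)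

lemma clinD: "clin F \<Longrightarrow> F (x + y) = F x + F y" "clin F \<Longrightarrow> F (cscale c x) = cscale c (F x)"
  by (auto simp: clin_def)

lemma clin_0: "clin F \<Longrightarrow> F 0 = 0"
  using clinD(2)[of F 0 0] by simp

lemma clin_diff: "clin F \<Longrightarrow> F (x - y) = F x - F y"
  using clinD(1)[of F x "- y"] clinD(2)[of F "-1" y] by simp

lemma csubD: "csub V \<Longrightarrow> 0 \<in> V" "csub V \<Longrightarrow> x \<in> V \<Longrightarrow> y \<in> V \<Longrightarrow> x + y \<in> V"
  "csub V \<Longrightarrow> x \<in> V \<Longrightarrow> cscale c x \<in> V"
  by (auto simp: csub_def)

lemma csub_diff: "csub V \<Longrightarrow> x \<in> V \<Longrightarrow> y \<in> V \<Longrightarrow> x - y \<in> V"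
  using csubD(2)[of V x "- y"] csubD(3)[of V y "-1"] by simp

lemma csub_uminus: "csub V \<Longrightarrow> x \<in> V \<Longrightarrow> - x \<in> V"
  using csubD(3)[of V x "-1"] by simp

lemma parity_cases: "i \<in> {0, 1} \<Longrightarrow> (1 - i :: nat) \<in> {0, 1}" "i \<in> {0, 1} \<Longrightarrow> 1 - (1 - i :: nat) = i"
  by auto

lemma csub_coboundaries:
  assumes K: "is_supercomplex K" and i: "i \<in> {0, 1}"
  shows "csub (coboundaries K i)"
proof -
  have V: "csub (fst K (1 - i))" and D: "clin (snd K)"
    using K parity_cases(1)[OF i] by (auto simp: is_supercomplex_def)
  show ?thesis
    unfolding csub_def coboundaries_def
  proof (intro conjI ballI allI)
    show "0 \<in> snd K ` fst K (1 - i)"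
      by (rule image_eqI[OF _ csubD(1)[OF V]]) (simp add: clin_0[OF D])
  next
    fix x y assume "x \<in> snd K ` fst K (1 - i)" "y \<in> snd K ` fst K (1 - i)"
    then obtain v w where "x = snd K v" "y = snd K w" "v \<in> fst K (1 - i)" "w \<in> fst K (1 - i)" by blast
    then show "x + y \<in> snd K ` fst K (1 - i)"
      by (intro image_eqI[of _ _ "v + w"] csubD(2)[OF V]) (simp_all add: clinD(1)[OF D])
  next
    fix c x assume "x \<in> snd K ` fst K (1 - i)"
    then obtain v where "x = snd K v" "v \<in> fst K (1 - i)" by blast
    then show "cscale c x \<in> snd K ` fst K (1 - i)"
      by (intro image_eqI[of _ _ "cscale c v"] csubD(3)[OF V]) (simp_all add: clinD(2)[OF D])
  qed
qed

lemma csub_cocycles: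
  assumes K: "is_supercomplex K" and i: "i \<in> {0, 1}"
  shows "csub (cocycles K i)"
  using assms unfolding csub_def cocycles_def is_supercomplex_def by (auto simp: clinD clin_0)

lemma coset_eq_iff:
  assumes "csub U"
  shows "x +o U = y +o U \<longleftrightarrow> x - y \<in> U"
proof
  assume "x +o U = y +o U"
  moreover have "x \<in> x +o U" using csubD(1)[OF assms] by (force simp: elt_set_plus_def)
  ultimately obtain u where "u \<in> U" "x = y + u" by (auto simp: elt_set_plus_def)
  then show "x - y \<in> U" by simp
next
  assume *: "x - y \<in> U"
  have sub: "x +o U \<subseteq> y +o U" if "x - y \<in> U" for x y
  proof
    fix z assume "z \<in> x +o U"
    then obtain u where "u \<in> U" "z = x + u" by (auto simp: elt_set_plus_def)
    then have "z = y + ((x - y) + u)" "(x - y) + u \<in> U" using that csubD(2)[OF assms] by auto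
    then show "z \<in> y +o U" unfolding elt_set_plus_def by blast
  qed
  from csub_uminus[OF assms *] have "y - x \<in> U" by simp
  with sub[OF *] sub[of y x] show "x +o U = y +o U" by blast
qed

lemma coset_add:
  assumes "csub U"
  shows "(x +o U) + (y +o U) = (x + y) +o U"
proof (intro equalityI subsetI)
  fix z assume "z \<in> (x +o U) + (y +o U)"
  then obtain u v where "z = (x + u) + (y + v)" "u \<in> U" "v \<in> U" by (auto simp: set_plus_def elt_set_plus_def)
  then have "z = (x + y) + (u + v)" "u + v \<in> U" using csubD(2)[OF assms] by (auto simp: algebra_simps)
  then show "z \<in> (x + y) +o U" by (auto simp: elt_set_plus_def)
next
  fix z assume "z \<in> (x + y) +o U"
  then obtain u where "z = (x + u) + (y + 0)" "u \<in> U" by (auto simp: elt_set_plus_def algebra_simps)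
  then show "z \<in> (x +o U) + (y +o U)" using csubD(1)[OF assms] by (auto simp: set_plus_def elt_set_plus_def)
qed

lemma class_image_coset:
  fixes F :: "('b, 'k::field) cochain \<Rightarrow> ('c, 'k) cochain"
  assumes F: "\<And>x y. F (x + y) = F x + F y" and U: "csub U" and B: "0 \<in> B" "F ` B \<subseteq> U"
  shows "class_image U F (x +o B) = F x +o U"
  unfolding class_image_def
proof (intro equalityI subsetI)
  fix z assume "z \<in> F ` (x +o B) + U"
  then obtain b u where z: "z = F (x + b) + u" "b \<in> B" "u \<in> U" by (auto simp: set_plus_def elt_set_plus_def)
  then have "z = F x + (F b + u)" "F b + u \<in> U" using F B csubD(2)[OF U, of "F b" u] by (auto simp: add.assoc)
  then show "z \<in> F x +o U" by (auto simp: elt_set_plus_def)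
next
  fix z assume "z \<in> F x +o U"
  then obtain u where u: "u \<in> U" "z = F x + u" by (auto simp: elt_set_plus_def)
  have "x = x + 0" by simp
  then have "x \<in> x +o B" unfolding elt_set_plus_def using B(1) by blast
  then show "z \<in> F ` (x +o B) + U" unfolding set_plus_def using u by blast
qed

lemma quasi_isoD:
  assumes "quasi_iso K L F"
  shows "clin F" and "\<And>i x. i \<in> {0, 1} \<Longrightarrow> x \<in> fst K i \<Longrightarrow> F x \<in> fst L i"
    "\<And>i x. i \<in> {0, 1} \<Longrightarrow> x \<in> fst K i \<Longrightarrow> snd L (F x) = F (snd K x)"
    "\<And>i x. i \<in> {0, 1} \<Longrightarrow> x \<in> cocycles K i \<Longrightarrow> F x \<in> coboundaries L i \<Longrightarrow> x \<in> coboundaries K i"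
    "\<And>i y. i \<in> {0, 1} \<Longrightarrow> y \<in> cocycles L i \<Longrightarrow> \<exists>x\<in>cocycles K i. F x - y \<in> coboundaries L i"
  using assms unfolding quasi_iso_def by blast+

lemma chain_map_cocycles:
  assumes "quasi_iso K L F" "i \<in> {0, 1}" "x \<in> cocycles K i"
  shows "F x \<in> cocycles L i"
  using assms(3) quasi_isoD[OF assms(1)] assms(2) clin_0[OF quasi_isoD(1)[OF assms(1)]] by (auto simp: cocycles_def)

lemma chain_map_coboundaries:
  assumes "quasi_iso K L F" "i \<in> {0, 1}" "x \<in> coboundaries K i"
  shows "F x \<in> coboundaries L i"
proof -
  obtain w where w: "w \<in> fst K (1 - i)" "x = snd K w" using assms(3) by (auto simp: coboundaries_def)
  then have "F x = snd L (F w)" "F w \<in> fst L (1 - i)"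
    using quasi_isoD(2,3)[OF assms(1) parity_cases(1)[OF assms(2)]] by auto
  then show ?thesis by (auto simp: coboundaries_def)
qed

lemma quasi_iso_cohomology_iso:
  assumes K: "is_supercomplex K" and L: "is_supercomplex L" and F: "quasi_iso K L F" and i: "i \<in> {0, 1}"
  shows "cohomology_iso K L i (class_image (coboundaries L i) F)"
proof -
  let ?BK = "coboundaries K i" and ?BL = "coboundaries L i"
  have BK: "csub ?BK" and BL: "csub ?BL" using csub_coboundaries[OF K i] csub_coboundaries[OF L i] .
  note FD = clinD[OF quasi_isoD(1)[OF F]]
  have im: "class_image ?BL F (x +o ?BK) = F x +o ?BL" for x
    by (rule class_image_coset[OF FD(1) BL csubD(1)[OF BK]]) (use chain_map_coboundaries[OF F i] in auto)
  have sc: "class_scale K i c (x +o ?BK) = cscale c x +o ?BK" for c x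
    unfolding class_scale_def cscale_def[symmetric]
    by (rule class_image_coset) (use BK csubD in auto)
  have sc': "class_scale L i c (x +o ?BL) = cscale c x +o ?BL" for c x
    unfolding class_scale_def cscale_def[symmetric]
    by (rule class_image_coset) (use BL csubD in auto)
  show ?thesis
    unfolding cohomology_iso_def
  proof (intro conjI ballI allI)
    show "bij_betw (class_image ?BL F) (cohomology K i) (cohomology L i)"
      unfolding bij_betw_def
    proof
      show "inj_on (class_image ?BL F) (cohomology K i)"
      proof (rule inj_onI)
        fix Z W assume "Z \<in> cohomology K i" "W \<in> cohomology K i" and eq: "class_image ?BL F Z = class_image ?BL F W"
        then obtain x y where xy: "Z = x +o ?BK" "W = y +o ?BK" "x \<in> cocycles K i" "y \<in> cocycles K i"
          by (auto simp: cohomology_def)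
        have "F x - F y \<in> ?BL" using eq by (simp add: xy im coset_eq_iff[OF BL])
        then have "F (x - y) \<in> ?BL" by (simp add: clin_diff[OF quasi_isoD(1)[OF F]])
        then have "x - y \<in> ?BK"
          using quasi_isoD(4)[OF F i] csub_diff[OF csub_cocycles[OF K i] xy(3,4)] by blast
        then show "Z = W" by (simp add: xy coset_eq_iff[OF BK])
      qed
      show "class_image ?BL F ` cohomology K i = cohomology L i"
      proof (intro equalityI subsetI)
        fix Z assume "Z \<in> class_image ?BL F ` cohomology K i"
        then show "Z \<in> cohomology L i"
          using chain_map_cocycles[OF F i] by (auto simp: cohomology_def im)
      next
        fix Z assume "Z \<in> cohomology L i"
        then obtain y where y: "Z = y +o ?BL" "y \<in> cocycles L i" by (auto simp: cohomology_def)
        then obtain x where x: "x \<in> cocycles K i" "F x - y \<in> ?BL" using quasi_isoD(5)[OF F i] by blast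
        then have "Z = class_image ?BL F (x +o ?BK)" by (simp add: im y coset_eq_iff[OF BL, symmetric])
        then show "Z \<in> class_image ?BL F ` cohomology K i" using x by (auto simp: cohomology_def)
      qed
    qed
  next
    fix Z W assume "Z \<in> cohomology K i" "W \<in> cohomology K i"
    then obtain x y where "Z = x +o ?BK" "W = y +o ?BK" by (auto simp: cohomology_def)
    then show "class_image ?BL F (Z + W) = class_image ?BL F Z + class_image ?BL F W"
      by (simp add: im coset_add[OF BK] coset_add[OF BL] FD)
  next
    fix c Z assume "Z \<in> cohomology K i"
    then obtain x where "Z = x +o ?BK" by (auto simp: cohomology_def)
    then show "class_image ?BL F (class_scale K i c Z) = class_scale L i c (class_image ?BL F Z)"
      by (simp add: im sc sc' FD)
  qed
qed

lemma quasi_iso_compose: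
  assumes K: "is_supercomplex K" and L: "is_supercomplex L" and M: "is_supercomplex M"
    and F: "quasi_iso K L F" and G: "quasi_iso L M G"
  shows "quasi_iso K M (\<lambda>x. G (F x))"
  unfolding quasi_iso_def
proof (intro conjI ballI impI)
  note FD = quasi_isoD[OF F] and GD = quasi_isoD[OF G]
  show "clin (\<lambda>x. G (F x))" using FD(1) GD(1) by (simp add: clin_def)
  fix i :: nat assume i: "i \<in> {0, 1}"
  show "G (F x) \<in> fst M i" "snd M (G (F x)) = G (F (snd K x))" if "x \<in> fst K i" for x
    using that FD(2,3)[OF i] GD(2,3)[OF i] by simp_all
  show "x \<in> coboundaries K i" if "x \<in> cocycles K i" "G (F x) \<in> coboundaries M i" for x
    using that FD(4)[OF i] GD(4)[OF i] chain_map_cocycles[OF F i] by blast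
  fix z assume "z \<in> cocycles M i"
  then obtain y where y: "y \<in> cocycles L i" "G y - z \<in> coboundaries M i" using GD(5)[OF i] by blast
  then obtain x where x: "x \<in> cocycles K i" "F x - y \<in> coboundaries L i" using FD(5)[OF i] by blast
  have "G (F x) - z = G (F x - y) + (G y - z)" by (simp add: clin_diff[OF GD(1)])
  also have "\<dots> \<in> coboundaries M i"
    by (intro csubD(2)[OF csub_coboundaries[OF M i]] chain_map_coboundaries[OF G i] x y)
  finally show "\<exists>x\<in>cocycles K i. G (F x) - z \<in> coboundaries M i" using x by blast
qed

text \<open>The two maps are asked to be inverse up to coboundaries on cocycles only. This suits the
  Karoubi projection, whose homotopies take a simple form there.\<close>

lemma quasi_iso_homotopy:
  assumes K: "is_supercomplex K" and L: "is_supercomplex L" and F: "clin F" and G: "clin G"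
    and FK: "\<And>i x. i \<in> {0, 1} \<Longrightarrow> x \<in> fst K i \<Longrightarrow> F x \<in> fst L i \<and> snd L (F x) = F (snd K x)"
    and GL: "\<And>i x. i \<in> {0, 1} \<Longrightarrow> x \<in> fst L i \<Longrightarrow> G x \<in> fst K i \<and> snd K (G x) = G (snd L x)"
    and GF: "\<And>i x. i \<in> {0, 1} \<Longrightarrow> x \<in> cocycles K i \<Longrightarrow> G (F x) - x \<in> coboundaries K i"
    and FG: "\<And>i x. i \<in> {0, 1} \<Longrightarrow> x \<in> cocycles L i \<Longrightarrow> F (G x) - x \<in> coboundaries L i"
  shows "quasi_iso K L F"
  unfolding quasi_iso_def
proof (intro conjI ballI impI F)
  fix i :: nat assume i: "i \<in> {0, 1}"
  show "F x \<in> fst L i" "snd L (F x) = F (snd K x)" if "x \<in> fst K i" for x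
    using that FK[OF i] by simp_all
  show "x \<in> coboundaries K i" if x: "x \<in> cocycles K i" "F x \<in> coboundaries L i" for x
  proof -
    obtain w where w: "w \<in> fst L (1 - i)" "F x = snd L w" using x(2) by (auto simp: coboundaries_def)
    then have "G (F x) \<in> coboundaries K i"
      using GL[OF parity_cases(1)[OF i] w(1)] by (auto simp: coboundaries_def) (metis image_eqI)
    then have "G (F x) - (G (F x) - x) \<in> coboundaries K i"
      by (rule csub_diff[OF csub_coboundaries[OF K i] _ GF[OF i x(1)]])
    then show ?thesis by simp
  qed
  fix y assume y: "y \<in> cocycles L i"
  then have "G y \<in> cocycles K i" using GL[OF i, of y] clin_0[OF G] by (auto simp: cocycles_def)
  then show "\<exists>x\<in>cocycles K i. F x - y \<in> coboundaries L i" using FG[OF i y] by blast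
qed

text \<open>The operators of the calculus are linear only on forms; \<open>K'\<close> replaces them by operators that are
  linear on all tensors.\<close>

lemma naturally_isomorphic_cohomologyI:
  fixes K L K' :: "('k::field, 'a) hopf \<Rightarrow> ('a list \<Rightarrow> 'k, 'k) supercomplex"
  assumes K: "\<And>H. involutive_hopf_algebra H \<Longrightarrow> is_supercomplex (K' H)"
    and KK': "\<And>H i. involutive_hopf_algebra H \<Longrightarrow> i \<in> {0, 1} \<Longrightarrow> cocycles (K H) i = cocycles (K' H) i \<and> coboundaries (K H) i = coboundaries (K' H) i"
    and L: "\<And>H. involutive_hopf_algebra H \<Longrightarrow> is_supercomplex (L H)"
    and F: "\<And>H. involutive_hopf_algebra H \<Longrightarrow> quasi_iso (K' H) (L H) (F H)"
    and nat: "\<And>H H' f i x. involutive_hopf_algebra H \<Longrightarrow> involutive_hopf_algebra H' \<Longrightarrow> f \<in> hopf_hom H H' \<Longrightarrow> i \<in> {0, 1} \<Longrightarrow>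
      x \<in> fst (K' H) i \<Longrightarrow> F H' (\<lambda>n. tmap H' f (x n)) = (\<lambda>n. tmap H' f (F H x n)) \<and>
        (\<lambda>n. tmap H' f (x n)) \<in> fst (K' H') i \<and> snd (K' H') (\<lambda>n. tmap H' f (x n)) = (\<lambda>n. tmap H' f (snd (K' H) x n))"
    and natL: "\<And>H H' f i x. involutive_hopf_algebra H \<Longrightarrow> involutive_hopf_algebra H' \<Longrightarrow> f \<in> hopf_hom H H' \<Longrightarrow> i \<in> {0, 1} \<Longrightarrow>
      x \<in> fst (L H) i \<Longrightarrow> (\<lambda>n. tmap H' f (x n)) \<in> fst (L H') i \<and> snd (L H') (\<lambda>n. tmap H' f (x n)) = (\<lambda>n. tmap H' f (snd (L H) x n))"
  shows "naturally_isomorphic_cohomology K L"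
  unfolding naturally_isomorphic_cohomology_def
proof (intro exI[of _ "\<lambda>H i. class_image (coboundaries (L H) i) (F H)"] conjI allI impI ballI)
  fix H :: "('k, 'a) hopf" and i :: nat assume H: "involutive_hopf_algebra H" and i: "i \<in> {0, 1}"
  have "cohomology (K H) i = cohomology (K' H) i" "class_scale (K H) i = class_scale (K' H) i"
    using KK'[OF H i] by (simp_all add: cohomology_def class_scale_def fun_eq_iff)
  then show "cohomology_iso (K H) (L H) i (class_image (coboundaries (L H) i) (F H))"
    using quasi_iso_cohomology_iso[OF K[OF H] L[OF H] F[OF H] i] unfolding cohomology_iso_def by simp
next
  fix H H' :: "('k, 'a) hopf" and f i Z
  assume "involutive_hopf_algebra H \<and> involutive_hopf_algebra H' \<and> f \<in> hopf_hom H H'" and i: "i \<in> {0 :: nat, 1}"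
    and Z: "Z \<in> cohomology (K H) i"
  then have H: "involutive_hopf_algebra H" "involutive_hopf_algebra H'" "f \<in> hopf_hom H H'" by auto
  let ?t = "\<lambda>x n. tmap H' f (x n)"
  note KK = KK'[OF H(1) i] and KK2 = KK'[OF H(2) i]
  obtain x where x: "x \<in> cocycles (K' H) i" "Z = x +o coboundaries (K' H) i"
    using Z KK by (auto simp: cohomology_def)
  have add: "?t (x + y) = ?t x + ?t y" for x y
    unfolding tmap_def using linop_add[OF linop_tbind[OF linop_id]]
    by (auto simp: fun_eq_iff plus_fun_apply tbind_def)
  note BK = csub_coboundaries[OF K[OF H(1)] i] and BK' = csub_coboundaries[OF K[OF H(2)] i]
    and BL = csub_coboundaries[OF L[OF H(1)] i] and BL' = csub_coboundaries[OF L[OF H(2)] i]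
  have tK: "?t ` coboundaries (K' H) i \<subseteq> coboundaries (K' H') i"
    using nat[OF H parity_cases(1)[OF i]] by (force simp: coboundaries_def)
  have tL: "?t ` coboundaries (L H) i \<subseteq> coboundaries (L H') i"
    using natL[OF H parity_cases(1)[OF i]] by (force simp: coboundaries_def)
  have imF: "class_image (coboundaries (L G) i) (F G) (y +o coboundaries (K' G) i) = F G y +o coboundaries (L G) i"
    if G: "involutive_hopf_algebra G" for G y
    by (rule class_image_coset[OF clinD(1)[OF quasi_isoD(1)[OF F[OF G]]] csub_coboundaries[OF L[OF G] i]
        csubD(1)[OF csub_coboundaries[OF K[OF G] i]]])
      (use chain_map_coboundaries[OF F[OF G] i] in auto)
  have "class_image (coboundaries (K H') i) ?t Z = ?t x +o coboundaries (K' H') i"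
    unfolding x(2) using class_image_coset[OF add BK' csubD(1)[OF BK] tK] KK2 by simp
  moreover have "F H' (?t x) = ?t (F H x)" using nat[OF H i] x(1) by (auto simp: cocycles_def)
  moreover have "class_image (coboundaries (L H') i) ?t (class_image (coboundaries (L H) i) (F H) Z) =
      ?t (F H x) +o coboundaries (L H') i"
    unfolding x(2) imF[OF H(1)] using class_image_coset[OF add BL' csubD(1)[OF BL] tL] by simp
  ultimately show "class_image (coboundaries (L H') i) (F H') (class_image (coboundaries (K H') i) ?t Z) =
      class_image (coboundaries (L H') i) ?t (class_image (coboundaries (L H) i) (F H) Z)"
    using imF[OF H(2)] by simp
qed

section \<open>Direct product and direct sum super-complexes\<close>

text \<open>The flag selects finite support, so that the arguments common to direct sums and direct
  products are carried out once.\<close>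

definition cp_space :: "bool \<Rightarrow> (nat \<Rightarrow> ('b \<Rightarrow> 'k::field) set) \<Rightarrow> nat \<Rightarrow> ('b, 'k) cochain set"
  where "cp_space fin C i = {x \<in> parity_prod C i. fin \<longrightarrow> finite {n. x n \<noteq> 0}}"

definition cp where "cp fin C l u = (cp_space fin C, total_diff l u)"

lemma cp_prod_eq: "cp_prod C l u = cp False C l u"
  by (simp add: cp_prod_def cp_def cp_space_def fun_eq_iff)

lemma cp_sum_eq: "cp_sum C l u = cp True C l u"
  by (simp add: cp_sum_def cp_def cp_space_def parity_sum_def fun_eq_iff)

lemma cp_spaceD: "x \<in> cp_space fin C i \<Longrightarrow> x n \<in> C n"
  "x \<in> cp_space fin C i \<Longrightarrow> n mod 2 \<noteq> i \<Longrightarrow> x n = 0"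
  by (auto simp: cp_space_def parity_prod_def)

lemma csub_cp_space:
  fixes C :: "nat \<Rightarrow> ('b \<Rightarrow> 'k::field) set"
  assumes "\<And>n. fs.subspace (C n)" shows "csub (cp_space fin C i)"
proof -
  have "finite {n. (x + y) n \<noteq> 0}" if "finite {n. x n \<noteq> 0}" "finite {n. y n \<noteq> 0}" for x y :: "('b, 'k) cochain"
    by (rule finite_subset[OF _ finite_UnI[OF that]]) (auto simp: plus_fun_apply)
  moreover have "finite {n. c *\<^sub>k x n \<noteq> 0}" if "finite {n. x n \<noteq> 0}" for c and x :: "('b, 'k) cochain"
    by (rule finite_subset[OF _ that]) auto
  ultimately show ?thesis
    using assms unfolding csub_def cp_space_def parity_prod_def cscale_def
    by (auto simp: fs.subspace_0 fs.subspace_add fs.subspace_scale plus_fun_apply zero_fun_apply)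
qed

lemma total_diff_Suc: "total_diff l u x (Suc n) = l (Suc n) (x (Suc (Suc n))) + u n (x n)"
  and total_diff_0: "total_diff l u x 0 = l 0 (x 1)"
  by (simp_all add: total_diff_def)

lemma total_diff_in:
  assumes C: "\<And>n. fs.subspace (C n)" and l: "\<And>n x. x \<in> C (Suc n) \<Longrightarrow> l n x \<in> C n" and u: "\<And>n x. x \<in> C n \<Longrightarrow> u n x \<in> C (Suc n)"
    and l0: "\<And>n. l n 0 = 0" and u0: "\<And>n. u n 0 = 0" and i: "i \<in> {0, 1}" and x: "x \<in> cp_space fin C i"
  shows "total_diff l u x \<in> cp_space fin C (1 - i)"
proof -
  note xD = cp_spaceD[OF x]
  have 1: "total_diff l u x n \<in> C n" for n
    by (cases n) (auto simp: total_diff_Suc total_diff_0 xD l u C fs.subspace_add)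
  have 2: "total_diff l u x n = 0" if "n mod 2 \<noteq> 1 - i" for n
  proof (cases n)
    case 0
    then have "x 1 = 0" using that i by (intro xD) auto
    then show ?thesis using 0 by (simp add: total_diff_0 l0)
  next
    case (Suc m)
    have "m mod 2 \<noteq> i" using that i Suc by (auto simp: mod_Suc split: if_splits)
    then have "x m = 0" "x (Suc (Suc m)) = 0" by (auto intro!: xD)
    then show ?thesis using Suc by (simp add: total_diff_Suc l0 u0)
  qed
  have 3: "finite {n. total_diff l u x n \<noteq> 0}" if "finite {n. x n \<noteq> 0}"
  proof (rule finite_subset)
    show "{n. total_diff l u x n \<noteq> 0} \<subseteq> (\<lambda>n. n - 1) ` {n. x n \<noteq> 0} \<union> Suc ` {n. x n \<noteq> 0}"
    proof
      fix n assume "n \<in> {n. total_diff l u x n \<noteq> 0}"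
      then have "x (Suc n) \<noteq> 0 \<or> (\<exists>m. n = Suc m \<and> x m \<noteq> 0)"
        by (cases n) (auto simp: total_diff_Suc total_diff_0 l0 u0)
      then show "n \<in> (\<lambda>n. n - 1) ` {n. x n \<noteq> 0} \<union> Suc ` {n. x n \<noteq> 0}"
      proof
        assume "x (Suc n) \<noteq> 0"
        then show ?thesis by (intro UnI1 image_eqI[of n _ "Suc n"]) auto
      qed blast
    qed
  qed (use that in auto)
  show ?thesis using 1 2 3 x unfolding cp_space_def parity_prod_def by blast
qed

lemma degreewise_in:
  assumes T: "\<And>n x. x \<in> C n \<Longrightarrow> T n x \<in> C' n" and T0: "\<And>n. T n 0 = 0" and x: "x \<in> cp_space fin C i"
  shows "(\<lambda>n. T n (x n)) \<in> cp_space fin C' i"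
proof -
  have "finite {n. T n (x n) \<noteq> 0}" if "finite {n. x n \<noteq> 0}"
    by (rule finite_subset[OF _ that]) (auto simp: T0)
  then show ?thesis using x T by (auto simp: cp_space_def parity_prod_def T0)
qed

lemma clin_degreewise: "(\<And>n. linop (T n)) \<Longrightarrow> clin (\<lambda>x n. T n (x n))"
  by (auto simp: clin_def cscale_def fun_eq_iff plus_fun_apply linop_def)

lemma clin_total_diff:
  assumes "\<And>n. linop (l n)" "\<And>n. linop (u n)"
  shows "clin (total_diff l u)"
proof -
  have "total_diff l u (x + y) n = (total_diff l u x + total_diff l u y) n" for x y n
    by (cases n) (simp_all add: total_diff_Suc total_diff_0 cochain_plus linop_add[OF assms(1)] linop_add[OF assms(2)] add_ac)
  moreover have "total_diff l u (cscale c x) n = cscale c (total_diff l u x) n" for c x n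
    by (cases n) (simp_all add: total_diff_Suc total_diff_0 cscale_def linop_scale[OF assms(1)] linop_scale[OF assms(2)] fs.scale_right_distrib)
  ultimately show ?thesis
    unfolding clin_def by (intro conjI allI; intro ext[where 'a = nat]; blast)
qed

lemma is_supercomplex_cp:
  assumes m: "mixed_complex C l u" and l: "\<And>n. linop (l n)" and u: "\<And>n. linop (u n)"
  shows "is_supercomplex (cp fin C l u)"
  unfolding is_supercomplex_def
proof (intro conjI ballI)
  note mD = m[unfolded mixed_complex_def]
  have C: "fs.subspace (C n)" for n using mD by blast
  show "clin (snd (cp fin C l u))" by (simp add: cp_def clin_total_diff[OF l u])
  fix i :: nat assume i: "i \<in> {0, 1}"
  show "csub (fst (cp fin C l u) i)" by (simp add: cp_def csub_cp_space[OF C])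
  fix x assume "x \<in> fst (cp fin C l u) i"
  then have x: "x \<in> cp_space fin C i" by (simp add: cp_def)
  have "total_diff l u x \<in> cp_space fin C (1 - i)"
    by (rule total_diff_in[where C = C and l = l and u = u, OF C _ _ linop_zero[OF l] linop_zero[OF u] i x]) (use mD in blast)+
  then show "snd (cp fin C l u) x \<in> fst (cp fin C l u) (1 - i)" by (simp add: cp_def)
  have xC: "x n \<in> C n" for n by (rule cp_spaceD(1)[OF x])
  have "total_diff l u (total_diff l u x) n = 0" for n
  proof (cases n)
    \<comment> \<open>Nothing is lowered from degree 0, so here anticommutation is replaced by the
      separate condition \<open>l 0 (u 0 x) = 0\<close>.\<close>
    case 0
    have "l 0 (l 1 (x 2)) = 0" "l 0 (u 0 (x 0)) = 0"
      using mD xC[of 2] xC[of 0] by (simp_all add: numeral_2_eq_2)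
    then show ?thesis using 0 by (simp add: total_diff_Suc total_diff_0 linop_add[OF l] numeral_2_eq_2)
  next
    case (Suc m)
    have 1: "l (Suc m) (l (Suc (Suc m)) (x (Suc (Suc (Suc m))))) = 0" using mD xC by blast
    have 2: "l (Suc m) (u (Suc m) (x (Suc m))) + u m (l m (x (Suc m))) = 0" using mD xC by blast
    show ?thesis
    proof (cases m)
      case 0
      then show ?thesis using Suc 1 2 by (simp add: total_diff_Suc total_diff_0 linop_add[OF l] linop_add[OF u])
    next
      case (Suc k)
      have 3: "u (Suc k) (u k (x k)) = 0" using mD xC by blast
      show ?thesis using \<open>n = Suc m\<close> Suc 1 2 3
        by (simp add: total_diff_Suc linop_add[OF l] linop_add[OF u])
    qed
  qed
  then show "snd (cp fin C l u) (snd (cp fin C l u) x) = 0" by (auto simp: cp_def fun_eq_iff zero_fun_apply)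
qed

lemma cp_cong:
  assumes "\<And>n x. x \<in> C (Suc n) \<Longrightarrow> l n x = l' n x" "\<And>n x. x \<in> C n \<Longrightarrow> u n x = u' n x"
  shows "cocycles (cp fin C l u) i = cocycles (cp fin C l' u') i \<and> coboundaries (cp fin C l u) i = coboundaries (cp fin C l' u') i"
proof -
  have "total_diff l u x = total_diff l' u' x" if "x \<in> cp_space fin C j" for x j
  proof
    fix n show "total_diff l u x n = total_diff l' u' x n"
      using cp_spaceD(1)[OF that] by (cases n) (auto simp: total_diff_Suc total_diff_0 assms)
  qed
  then show ?thesis by (auto simp: cocycles_def coboundaries_def cp_def)
qed

lemma quasi_iso_degreewise_iso:
  assumes K: "is_supercomplex (cp fin C l u)" and L: "is_supercomplex (cp fin C' l' u')"
    and T: "\<And>n. linop (T n)" "\<And>n x. x \<in> C n \<Longrightarrow> T n x \<in> C' n"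
    and S: "\<And>n. linop (S n)" "\<And>n x. x \<in> C' n \<Longrightarrow> S n x \<in> C n"
    and ST: "\<And>n x. x \<in> C n \<Longrightarrow> S n (T n x) = x" and TS: "\<And>n x. x \<in> C' n \<Longrightarrow> T n (S n x) = x"
    and l: "\<And>n x. x \<in> C (Suc n) \<Longrightarrow> l n x \<in> C n \<and> T n (l n x) = l' n (T (Suc n) x)"
    and u: "\<And>n x. x \<in> C n \<Longrightarrow> u n x \<in> C (Suc n) \<and> T (Suc n) (u n x) = u' n (T n x)"
  shows "quasi_iso (cp fin C l u) (cp fin C' l' u') (\<lambda>x n. T n (x n))"
proof (rule quasi_iso_homotopy[OF K L clin_degreewise[OF T(1)] clin_degreewise[OF S(1)]])
  have Sl: "S n (l' n y) = l n (S (Suc n) y)" if "y \<in> C' (Suc n)" for n y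
    using l[OF S(2)[OF that]] TS[OF that] ST by (metis)
  have Su: "S (Suc n) (u' n y) = u n (S n y)" if "y \<in> C' n" for n y
    using u[OF S(2)[OF that]] TS[OF that] ST by (metis)
  fix i :: nat assume i: "i \<in> {0, 1}"
  show "(\<lambda>n. T n (x n)) \<in> fst (cp fin C' l' u') i \<and> snd (cp fin C' l' u') (\<lambda>n. T n (x n)) = (\<lambda>n. T n (snd (cp fin C l u) x n))"
    if "x \<in> fst (cp fin C l u) i" for x
  proof
    have x: "x \<in> cp_space fin C i" using that by (simp add: cp_def)
    show "(\<lambda>n. T n (x n)) \<in> fst (cp fin C' l' u') i"
      using degreewise_in[where T = T and C = C and C' = C', OF T(2) linop_zero[OF T(1)] x] by (simp add: cp_def)
    show "snd (cp fin C' l' u') (\<lambda>n. T n (x n)) = (\<lambda>n. T n (snd (cp fin C l u) x n))"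
    proof
      fix n show "snd (cp fin C' l' u') (\<lambda>n. T n (x n)) n = T n (snd (cp fin C l u) x n)"
        using l u cp_spaceD(1)[OF x] by (cases n) (auto simp: cp_def total_diff_Suc total_diff_0 linop_add[OF T(1)])
    qed
  qed
  show "(\<lambda>n. S n (x n)) \<in> fst (cp fin C l u) i \<and> snd (cp fin C l u) (\<lambda>n. S n (x n)) = (\<lambda>n. S n (snd (cp fin C' l' u') x n))"
    if "x \<in> fst (cp fin C' l' u') i" for x
  proof
    have x: "x \<in> cp_space fin C' i" using that by (simp add: cp_def)
    show "(\<lambda>n. S n (x n)) \<in> fst (cp fin C l u) i"
      using degreewise_in[where T = S and C = C' and C' = C, OF S(2) linop_zero[OF S(1)] x] by (simp add: cp_def)
    show "snd (cp fin C l u) (\<lambda>n. S n (x n)) = (\<lambda>n. S n (snd (cp fin C' l' u') x n))"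
    proof
      fix n show "snd (cp fin C l u) (\<lambda>n. S n (x n)) n = S n (snd (cp fin C' l' u') x n)"
        using Sl Su cp_spaceD(1)[OF x] by (cases n) (auto simp: cp_def total_diff_Suc total_diff_0 linop_add[OF S(1)])
    qed
  qed
  show "(\<lambda>n. S n (T n (x n))) - x \<in> coboundaries (cp fin C l u) i" if "x \<in> cocycles (cp fin C l u) i" for x
  proof -
    have "(\<lambda>n. S n (T n (x n))) = x" using that ST by (auto simp: cocycles_def cp_def fun_eq_iff dest: cp_spaceD(1))
    then show ?thesis using csubD(1)[OF csub_coboundaries[OF K i]] by simp
  qed
  show "(\<lambda>n. T n (S n (x n))) - x \<in> coboundaries (cp fin C' l' u') i" if "x \<in> cocycles (cp fin C' l' u') i" for x
  proof -
    have "(\<lambda>n. T n (S n (x n))) = x" using that TS by (auto simp: cocycles_def cp_def fun_eq_iff dest: cp_spaceD(1))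
    then show ?thesis using csubD(1)[OF csub_coboundaries[OF L i]] by simp
  qed
qed

lemma total_diff_degreewise:
  assumes l: "\<And>n x. x \<in> C (Suc n) \<Longrightarrow> T n (l n x) = l' n (T (Suc n) x)"
    and u: "\<And>n x. x \<in> C n \<Longrightarrow> T (Suc n) (u n x) = u' n (T n x)"
    and T: "\<And>n. linop (T n)" and x: "x \<in> cp_space fin C i"
  shows "total_diff l' u' (\<lambda>n. T n (x n)) = (\<lambda>n. T n (total_diff l u x n))"
proof
  fix n show "total_diff l' u' (\<lambda>n. T n (x n)) n = T n (total_diff l u x n)"
    using l u cp_spaceD(1)[OF x] by (cases n) (auto simp: total_diff_Suc total_diff_0 linop_add[OF T])
qed

section \<open>The Karoubi operator\<close>

definition kar :: "(('b \<Rightarrow> 'k::field) \<Rightarrow> ('b \<Rightarrow> 'k)) \<Rightarrow> (('b \<Rightarrow> 'k) \<Rightarrow> ('b \<Rightarrow> 'k)) \<Rightarrow> ('b \<Rightarrow> 'k) \<Rightarrow> ('b \<Rightarrow> 'k)"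
  where "kar b d x = x - b (d x) - d (b x)"

definition ksum where "ksum b d n x = (\<Sum>j\<le>n. (kar b d ^^ j) x)"

text \<open>Collects what is used about \<open>b'\<close>, \<open>d\<close> and
  \<open>\<kappa>'\<close>. It is instantiated by all forms, by the coinvariant forms, and by all
  forms with \<open>b\<close> in place of \<open>b'\<close>. The relation \<open>star\<close> is
  what distinguishes it from two arbitrary square-zero operators of opposite degree.\<close>

locale karoubi_complex =
  fixes C :: "nat \<Rightarrow> ('b \<Rightarrow> 'k::field_char_0) set" and b d :: "('b \<Rightarrow> 'k) \<Rightarrow> ('b \<Rightarrow> 'k)"
  assumes C: "fs.subspace (C n)" and lb: "linop b" and ld: "linop d"
    and b_in: "x \<in> C (Suc n) \<Longrightarrow> b x \<in> C n" and b_0: "x \<in> C 0 \<Longrightarrow> b x = 0"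
    and d_in: "x \<in> C n \<Longrightarrow> d x \<in> C (Suc n)"
    and bb: "x \<in> C n \<Longrightarrow> b (b x) = 0" and dd: "x \<in> C n \<Longrightarrow> d (d x) = 0"
    and star: "x \<in> C n \<Longrightarrow> (kar b d ^^ n) x = x + b ((kar b d ^^ n) (d x))"
begin

abbreviation "K \<equiv> kar b d"
abbreviation "N \<equiv> ksum b d"

lemma lK: "linop K"
proof -
  have "linop (\<lambda>x. x - b (d x) - d (b x))"
    by (intro linop_intros linop_compose[OF lb ld] linop_compose[OF ld lb])
  then show ?thesis by (simp add: kar_def[abs_def])
qed

lemma lKp: "linop (K ^^ j)"
  using linop_funpow[OF lK linop_id] .

lemma lN: "linop (N n)"
proof -
  have "linop (\<lambda>x. \<Sum>j\<le>n. (K ^^ j) x)" by (rule linop_sumI) (rule lKp)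
  then show ?thesis by (simp add: ksum_def[abs_def])
qed

lemmas l_simps = linop_simps[OF lb] linop_simps[OF ld] linop_simps[OF lK] linop_simps[OF lKp] linop_simps[OF lN]

lemma C0: "0 \<in> C n" using fs.subspace_0[OF C] .

lemma db_in: "x \<in> C n \<Longrightarrow> d (b x) \<in> C n"
  by (cases n) (auto simp: b_0 l_simps C0 intro: b_in d_in)

lemma bd_in: "x \<in> C n \<Longrightarrow> b (d x) \<in> C n"
  by (intro b_in d_in)

lemma K_in: "x \<in> C n \<Longrightarrow> K x \<in> C n"
  unfolding kar_def by (intro fs.subspace_diff[OF C] db_in bd_in)

lemma Kp_in: "x \<in> C n \<Longrightarrow> (K ^^ j) x \<in> C n"
  by (induction j) (auto intro: K_in)

lemma N_in: "x \<in> C n \<Longrightarrow> N m x \<in> C n"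
  unfolding ksum_def by (intro fs.subspace_sum[OF C] Kp_in)

lemma b_K: "x \<in> C n \<Longrightarrow> b (K x) = K (b x)"
  using bb[of x n] bb[OF d_in, of x n] by (simp add: kar_def l_simps)

lemma d_K: "x \<in> C n \<Longrightarrow> d (K x) = K (d x)"
proof (cases n)
  case 0
  then show "x \<in> C n \<Longrightarrow> d (K x) = K (d x)" using dd[of x n] by (simp add: kar_def l_simps b_0)
next
  case (Suc m)
  then show "x \<in> C n \<Longrightarrow> d (K x) = K (d x)"
    using dd[of x n] dd[OF b_in, of x m] by (simp add: kar_def l_simps)
qed

lemma b_Kp: "x \<in> C n \<Longrightarrow> b ((K ^^ j) x) = (K ^^ j) (b x)"
  by (induction j) (auto simp: b_K[OF Kp_in])

lemma d_Kp: "x \<in> C n \<Longrightarrow> d ((K ^^ j) x) = (K ^^ j) (d x)"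
  by (induction j) (auto simp: d_K[OF Kp_in])

lemma b_N: "x \<in> C n \<Longrightarrow> b (N m x) = N m (b x)"
  by (simp add: ksum_def linop_sum[OF lb] b_Kp)

lemma d_N: "x \<in> C n \<Longrightarrow> d (N m x) = N m (d x)"
  by (simp add: ksum_def linop_sum[OF ld] d_Kp)

text \<open>Applying \<open>b\<close> to \<open>star\<close> kills the correction term. In
  \<open>per_d\<close> the correction term of \<open>star\<close>, taken one degree higher, vanishes
  because of \<open>d d = 0\<close>.\<close>

lemma per_b: "x \<in> C (Suc n) \<Longrightarrow> (K ^^ Suc n) (b x) = b x"
proof -
  assume x: "x \<in> C (Suc n)"
  have "(K ^^ Suc n) (b x) = b ((K ^^ Suc n) x)" by (rule b_Kp[OF x, symmetric])
  also have "\<dots> = b x + b (b ((K ^^ Suc n) (d x)))" by (simp only: star[OF x] linop_add[OF lb])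
  finally show ?thesis using bb[OF Kp_in[OF d_in[OF x], of "Suc n"]] by simp
qed

lemma per_d: "x \<in> C n \<Longrightarrow> (K ^^ Suc n) (d x) = d x"
  by (simp only: star[OF d_in] dd l_simps add_0_right)

text \<open>Since \<open>b d + d b = 1 - \<kappa>\<close>, the common summands telescope to
  \<open>1 - \<kappa>^(n + 1)\<close>. The additional summand \<open>\<kappa>^(n + 1) b d\<close> of
  \<open>N (Suc n)\<close> is exactly the correction term of \<open>star\<close> in degree
  \<open>n + 1\<close>.\<close>

lemma N_anticommute:
  assumes "x \<in> C (Suc n)" shows "N (Suc n) (b (d x)) + N n (d (b x)) = 0"
proof -
  have tel: "(\<Sum>j\<le>m. (K ^^ j) (x - K x)) = x - (K ^^ Suc m) x" for m
    by (induction m) (simp_all add: l_simps funpow_swap1)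
  have "N (Suc n) (b (d x)) + N n (d (b x)) = (\<Sum>j\<le>n. (K ^^ j) (x - K x)) + (K ^^ Suc n) (b (d x))"
    by (simp add: ksum_def kar_def[of b d x] sum.distrib l_simps del: funpow.simps)
  also have "\<dots> = x - (K ^^ Suc n) x + b ((K ^^ Suc n) (d x))"
    by (simp only: tel b_Kp[OF d_in[OF assms]])
  finally show ?thesis by (simp only: star[OF assms]) simp
qed

lemma bd_0: "x \<in> C 0 \<Longrightarrow> b (d x) = 0"
  using star[of x 0] by simp

lemma mixed_b: "mixed_complex C (\<lambda>_. b) (\<lambda>n x. N n (d x))"
  unfolding mixed_complex_def
proof (intro conjI allI ballI image_subsetI)
  fix n
  show "fs.subspace (C n)" by (rule C)
  show "linear_on (C (Suc n)) b" by (rule linop_linear_on[OF lb])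
  show "linear_on (C n) (\<lambda>x. N n (d x))" by (rule linop_linear_on[OF linop_compose[OF lN ld]])
  show "b x \<in> C n" if "x \<in> C (Suc n)" for x using b_in[OF that] .
  show "N n (d x) \<in> C (Suc n)" if "x \<in> C n" for x using N_in[OF d_in[OF that]] .
  show "b (b x) = 0" if "x \<in> C (Suc (Suc n))" for x using bb[OF that] .
  show "N (Suc n) (d (N n (d x))) = 0" if "x \<in> C n" for x
    using that by (simp add: d_N[OF d_in] dd l_simps)
  show "b (N (Suc n) (d x)) + N n (d (b x)) = 0" if "x \<in> C (Suc n)" for x
    using N_anticommute[OF that] b_N[OF d_in[OF that]] by simp
next
  show "b (N 0 (d x)) = 0" if "x \<in> C 0" for x
    using bd_0[OF that] by (simp add: ksum_def)
qed

lemma mixed_d: "mixed_complex C (\<lambda>n x. N n (b x)) (\<lambda>_. d)"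
  unfolding mixed_complex_def
proof (intro conjI allI ballI image_subsetI)
  fix n
  show "fs.subspace (C n)" by (rule C)
  show "linear_on (C n) d" by (rule linop_linear_on[OF ld])
  show "linear_on (C (Suc n)) (\<lambda>x. N n (b x))" by (rule linop_linear_on[OF linop_compose[OF lN lb]])
  show "d x \<in> C (Suc n)" if "x \<in> C n" for x using d_in[OF that] .
  show "N n (b x) \<in> C n" if "x \<in> C (Suc n)" for x using N_in[OF b_in[OF that]] .
  show "d (d x) = 0" if "x \<in> C n" for x using dd[OF that] .
  show "N n (b (N (Suc n) (b x))) = 0" if "x \<in> C (Suc (Suc n))" for x
    using that by (simp add: b_N[OF b_in] bb l_simps)
  show "N (Suc n) (b (d x)) + d (N n (b x)) = 0" if "x \<in> C (Suc n)" for x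
    using N_anticommute[OF that] d_N[OF b_in[OF that]] by simp
next
  show "N 0 (b (d x)) = 0" if "x \<in> C 0" for x
    using bd_0[OF that] by (simp add: l_simps)
qed

text \<open>On a vector \<open>y\<close> with \<open>\<kappa>\<^sup>n\<^sup>+\<^sup>1 y = y\<close>, the operator \<open>avg n\<close> is the projection onto the invariants and
  \<open>green n\<close> inverts \<open>1 - \<kappa>\<close> on its kernel.\<close>

definition "avg n x = (1 / of_nat (Suc n)) *\<^sub>k N n x"

definition "green n x = (- (1 / of_nat (Suc n))) *\<^sub>k (\<Sum>j\<le>n. of_nat j *\<^sub>k (K ^^ j) x)"

lemma l_avg: "linop (avg n)" and l_green: "linop (green n)"
proof -
  have "linop (\<lambda>x. (1 / of_nat (Suc n)) *\<^sub>k N n x)"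
    "linop (\<lambda>x. (- (1 / of_nat (Suc n))) *\<^sub>k (\<Sum>j\<le>n. of_nat j *\<^sub>k (K ^^ j) x))"
    by (intro linop_fscale linop_sumI lN lKp)+
  then show "linop (avg n)" "linop (green n)" by (simp_all add: avg_def[abs_def] green_def[abs_def])
qed

lemma green_in: "x \<in> C n \<Longrightarrow> green m x \<in> C n"
  unfolding green_def by (intro fs.subspace_scale[OF C] fs.subspace_sum[OF C] Kp_in)

lemma b_green: "x \<in> C n \<Longrightarrow> b (green m x) = green m (b x)"
  by (simp add: green_def linop_sum[OF lb] linop_scale[OF lb] linop_minus[OF lb] b_Kp)

lemma d_green: "x \<in> C n \<Longrightarrow> d (green m x) = green m (d x)"
  by (simp add: green_def linop_sum[OF ld] linop_scale[OF ld] linop_minus[OF ld] d_Kp)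

lemma K_N: "(K ^^ Suc n) y = y \<Longrightarrow> K (N n y) = N n y"
proof -
  assume y: "(K ^^ Suc n) y = y"
  have 1: "K (N n y) = (\<Sum>j\<le>n. (K ^^ Suc j) y)" by (simp add: ksum_def linop_sum[OF lK])
  have "(\<Sum>j\<le>n. (K ^^ Suc j) y) + y = (\<Sum>j\<le>Suc n. (K ^^ j) y)"
    by (subst sum.atMost_Suc_shift) simp
  also have "\<dots> = N n y + y" using y by (simp add: ksum_def)
  finally show ?thesis unfolding 1 by simp
qed

lemma N_fixed: "K y = y \<Longrightarrow> N n y = of_nat (Suc n) *\<^sub>k y"
proof -
  assume "K y = y"
  then have "(K ^^ j) y = y" for j by (induction j) auto
  moreover have "(\<Sum>j\<le>n. y) = of_nat (Suc n) *\<^sub>k y"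
    by (induction n) (simp_all only: atMost_0 sum.atMost_Suc of_nat_Suc fs.scale_left_distrib, simp_all)
  ultimately show ?thesis unfolding ksum_def by simp
qed

lemma N_avg: "(K ^^ Suc n) y = y \<Longrightarrow> N n (avg n y) = N n y"
  using N_fixed[of "avg n y" n] K_N[of n y] by (simp add: avg_def l_simps del: of_nat_Suc)

lemma avg_avg: "(K ^^ Suc n) y = y \<Longrightarrow> avg n (avg n y) = avg n y"
  by (simp add: avg_def[of n "avg n y"] N_avg del: funpow.simps) (simp add: avg_def)

text \<open>Summation by parts: the sum of \<open>j \<kappa>^j (1 - \<kappa>)\<close> over
  \<open>j \<le> n\<close> is \<open>N - 1 - n \<kappa>^(n + 1)\<close>, which is
  \<open>N - (n + 1)\<close> on vectors of period \<open>n + 1\<close>. Division by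
  \<open>- (n + 1)\<close> yields \<open>1 - avg\<close>, whence the constant in
  \<open>green\<close>.\<close>

lemma green: "(K ^^ Suc n) y = y \<Longrightarrow> green n (y - K y) = y - avg n y"
proof -
  assume y: "(K ^^ Suc n) y = y"
  have "(\<Sum>j\<le>m. of_nat j *\<^sub>k (K ^^ j) (y - K y)) = N m y - of_nat m *\<^sub>k (K ^^ Suc m) y - y" for m
  proof (induction m)
    case 0
    show ?case by (simp add: ksum_def)
  next
    case (Suc m)
    have "(K ^^ Suc m) (y - K y) = (K ^^ Suc m) y - (K ^^ Suc (Suc m)) y"
      by (simp only: linop_diff[OF lKp]) (simp add: funpow_swap1)
    moreover have "N (Suc m) y = N m y + (K ^^ Suc m) y" by (simp add: ksum_def)
    ultimately show ?case unfolding sum.atMost_Suc Suc.IH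
      by (simp add: fs.scale_right_diff_distrib fs.scale_left_distrib del: funpow.simps)
  qed
  from this[of n] y have "(\<Sum>j\<le>n. of_nat j *\<^sub>k (K ^^ j) (y - K y)) = N n y - of_nat (Suc n) *\<^sub>k y"
    by (simp add: fs.scale_left_distrib del: funpow.simps)
  then show ?thesis unfolding green_def avg_def
    by (simp add: fs.scale_right_diff_distrib del: of_nat_Suc)
qed

text \<open>In view of \<open>1 - \<kappa> = b d + d b\<close> this is
  \<open>1 - G (1 - \<kappa>)\<close> with a Green operator \<open>G\<close> for the right period:
  \<open>b d x\<close> has period \<open>n + 1\<close>, while \<open>d b x\<close> comes from degree
  \<open>n - 1\<close> and has period \<open>n\<close>. In degree 0 the last term vanishes, so
  truncated subtraction does no harm.\<close>

definition "P n x = x - green n (b (d x)) - green (n - 1) (d (b x))"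

lemma l_P: "linop (P n)"
proof -
  have "linop (\<lambda>x. x - green n (b (d x)) - green (n - 1) (d (b x)))"
    by (intro linop_sub linop_id linop_compose[OF l_green] linop_compose[OF lb ld] linop_compose[OF ld lb])
  then show ?thesis by (simp add: P_def[abs_def])
qed

lemma P_in: "x \<in> C n \<Longrightarrow> P n x \<in> C n"
  unfolding P_def by (intro fs.subspace_diff[OF C] green_in db_in bd_in)

text \<open>On the image of \<open>b\<close> the operator \<open>1 - \<kappa>\<close> reduces to
  \<open>b d\<close>, so \<open>green\<close> turns \<open>P\<close> into averaging there. Commuting
  \<open>b\<close> past \<open>green\<close> gives the same value for \<open>b\<close> after
  \<open>P\<close>. The case of \<open>d\<close> is dual.\<close>

lemma P_b:
  assumes z: "z \<in> C (Suc n)" shows "P n (b z) = avg n (b z)" "b (P (Suc n) z) = avg n (b z)"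
proof -
  have 1: "b z - K (b z) = b (d (b z))" using bb[OF z] by (simp add: kar_def l_simps)
  note g = green[OF per_b[OF z], unfolded 1]
  show "P n (b z) = avg n (b z)"
    using g bb[OF z] by (simp add: P_def l_simps linop_zero[OF l_green])
  show "b (P (Suc n) z) = avg n (b z)"
    using g bb[OF d_in[OF z]] by (simp add: P_def l_simps linop_zero[OF l_green] b_green[OF bd_in[OF z]] b_green[OF db_in[OF z]])
qed

lemma P_d:
  assumes x: "x \<in> C n" shows "P (Suc n) (d x) = avg n (d x)" "d (P n x) = avg n (d x)"
proof -
  have 1: "d x - K (d x) = d (b (d x))" using dd[OF x] by (simp add: kar_def l_simps)
  note g = green[OF per_d[OF x], unfolded 1]
  show "P (Suc n) (d x) = avg n (d x)"
    using g dd[OF x] by (simp add: P_def l_simps linop_zero[OF l_green])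
  have "d (d (b x)) = 0" by (cases n) (use x b_0 dd[OF b_in] in \<open>auto simp: l_simps\<close>)
  then show "d (P n x) = avg n (d x)"
    using g by (simp add: P_def l_simps linop_zero[OF l_green] d_green[OF bd_in[OF x]] d_green[OF db_in[OF x]])
qed

text \<open>On vectors fixed by \<open>\<kappa>\<close> the operator \<open>N n\<close> is
  multiplication by \<open>n + 1\<close>. A coefficient \<open>c_n\<close> in degree
  \<open>n\<close> carries \<open>b\<close> to \<open>N b\<close>, and also \<open>N d\<close> to
  \<open>d\<close>, when \<open>c_n = (n + 1) c_(n+1)\<close>; the solution with
  \<open>c_0 = 1\<close> is \<open>1 / fact n\<close>.\<close>

definition "rescale n x = (1 / fact n) *\<^sub>k P n x"

definition "unscale n x = fact n *\<^sub>k P n x"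

lemma l_rescale: "linop (rescale n)" and l_unscale: "linop (unscale n)"
  using linop_fscale[OF l_P] by (simp_all add: rescale_def[abs_def] unscale_def[abs_def])

lemma fact_scale: "(1 / fact (Suc n)) *\<^sub>k (of_nat (Suc n) *\<^sub>k x) = (1 / fact n) *\<^sub>k (x :: 'b \<Rightarrow> 'k)"
  "of_nat (Suc n) *\<^sub>k (1 / fact (Suc n)) *\<^sub>k x = (1 / fact n) *\<^sub>k x"
  "fact n *\<^sub>k (of_nat (Suc n) *\<^sub>k x) = fact (Suc n) *\<^sub>k x"
  "of_nat (Suc n) *\<^sub>k (fact n *\<^sub>k x) = fact (Suc n) *\<^sub>k x"
  by (simp_all add: fact_Suc mult.commute del: of_nat_Suc)

lemma N_as_avg: "N n y = of_nat (Suc n) *\<^sub>k avg n y"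
  by (simp add: avg_def del: of_nat_Suc)

lemma rescale_b:
  assumes x: "x \<in> C (Suc n)" shows "rescale n (b x) = N n (b (rescale (Suc n) x))"
proof -
  have "N n (b (rescale (Suc n) x)) = (1 / fact (Suc n)) *\<^sub>k N n (avg n (b x))"
    unfolding rescale_def using P_b[OF x] by (simp only: linop_scale[OF lb] linop_scale[OF lN])
  also have "\<dots> = (1 / fact n) *\<^sub>k avg n (b x)"
    unfolding N_avg[OF per_b[OF x]] by (simp only: N_as_avg fact_scale)
  finally show ?thesis unfolding rescale_def using P_b[OF x] by simp
qed

lemma rescale_d:
  assumes x: "x \<in> C n" shows "rescale (Suc n) (N n (d x)) = d (rescale n x)"
proof -
  have "P (Suc n) (N n (d x)) = P (Suc n) (d (N n x))" using d_N[OF x] by simp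
  also have "\<dots> = avg n (N n (d x))" using P_d(1)[OF N_in[OF x]] d_N[OF x] by simp
  also have "\<dots> = of_nat (Suc n) *\<^sub>k avg n (d x)"
    by (simp only: N_as_avg linop_scale[OF l_avg] avg_avg[OF per_d[OF x]])
  finally show ?thesis unfolding rescale_def using P_d[OF x] by (simp only: fact_scale linop_scale[OF ld])
qed

lemma unscale_b:
  assumes x: "x \<in> C (Suc n)" shows "unscale n (N n (b x)) = b (unscale (Suc n) x)"
proof -
  have "P n (N n (b x)) = P n (b (N n x))" using b_N[OF x] by simp
  also have "\<dots> = avg n (N n (b x))" using P_b(1)[OF N_in[OF x]] b_N[OF x] by simp
  also have "\<dots> = of_nat (Suc n) *\<^sub>k avg n (b x)"
    by (simp only: N_as_avg linop_scale[OF l_avg] avg_avg[OF per_b[OF x]])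
  finally show ?thesis unfolding unscale_def using P_b[OF x] by (simp only: fact_scale linop_scale[OF lb])
qed

lemma unscale_d:
  assumes x: "x \<in> C n" shows "unscale (Suc n) (d x) = N n (d (unscale n x))"
proof -
  have "N n (d (unscale n x)) = fact n *\<^sub>k N n (avg n (d x))"
    unfolding unscale_def using P_d[OF x] by (simp only: linop_scale[OF ld] linop_scale[OF lN])
  also have "\<dots> = fact (Suc n) *\<^sub>k avg n (d x)"
    unfolding N_avg[OF per_d[OF x]] by (simp only: N_as_avg fact_scale)
  finally show ?thesis unfolding unscale_def using P_d[OF x] by simp
qed

abbreviation "complex_b fin \<equiv> cp fin C (\<lambda>_. b) (\<lambda>n x. N n (d x))"
abbreviation "complex_d fin \<equiv> cp fin C (\<lambda>n x. N n (b x)) (\<lambda>_. d)"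

lemma is_supercomplex_b: "is_supercomplex (complex_b fin)"
  by (rule is_supercomplex_cp[OF mixed_b lb linop_compose[OF lN ld]])

lemma is_supercomplex_d: "is_supercomplex (complex_d fin)"
  by (rule is_supercomplex_cp[OF mixed_d linop_compose[OF lN lb] ld])

lemma unscale_rescale: "unscale n (rescale n x) = P n (P n x)" "rescale n (unscale n x) = P n (P n x)"
  by (simp_all add: unscale_def rescale_def linop_scale[OF l_P])

text \<open>Both composites of \<open>rescale\<close> and \<open>unscale\<close> are
  \<open>P\<close> applied twice. As \<open>P z\<close> is a cocycle minus a coboundary, the
  comparison of \<open>P\<close> with the identity can be used for \<open>z\<close> and then for
  \<open>P z\<close>.\<close>

lemma P_P_coboundary:
  assumes S: "is_supercomplex (cp fin C l u)" and i: "i \<in> {0, 1}"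
    and P: "\<And>z. z \<in> cocycles (cp fin C l u) i \<Longrightarrow> z - (\<lambda>n. P n (z n)) \<in> coboundaries (cp fin C l u) i"
    and z: "z \<in> cocycles (cp fin C l u) i"
  shows "(\<lambda>n. P n (P n (z n))) - z \<in> coboundaries (cp fin C l u) i"
proof -
  let ?B = "coboundaries (cp fin C l u) i" and ?Z = "cocycles (cp fin C l u) i" and ?w = "\<lambda>n. P n (z n)"
  have BZ: "?B \<subseteq> ?Z"
    using S parity_cases[OF i] unfolding is_supercomplex_def by (auto simp: cocycles_def coboundaries_def)
  have "z - (z - ?w) \<in> ?Z"
    using csub_diff[OF csub_cocycles[OF S i] z] P[OF z] BZ by blast
  then have "?w - (\<lambda>n. P n (?w n)) \<in> ?B" by (intro P) simp
  from csub_uminus[OF csub_coboundaries[OF S i] csubD(2)[OF csub_coboundaries[OF S i] P[OF z] this]]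
  show ?thesis by simp
qed

lemma green_0: "green n 0 = 0" by (rule linop_zero[OF l_green])

text \<open>On a cocycle \<open>d b z = 0\<close>: apply \<open>d\<close> to the cocycle equation,
  whose other summand \<open>N d z\<close> it kills. Then \<open>z - P z\<close> reduces to
  \<open>green (b d z)\<close>, which is the boundary of \<open>green (d z)\<close>.\<close>

lemma P_homotopic_b:
  assumes i: "i \<in> {0, 1}" and z: "z \<in> cocycles (complex_b fin) i"
  shows "z - (\<lambda>n. P n (z n)) \<in> coboundaries (complex_b fin) i"
proof -
  let ?h = "total_diff (\<lambda>_ _. 0) (\<lambda>n x. green n (d x)) z"
  have zs: "z \<in> cp_space fin C i" and z0: "total_diff (\<lambda>_. b) (\<lambda>n x. N n (d x)) z = 0"
    using z by (auto simp: cocycles_def cp_def)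
  note zC = cp_spaceD(1)[OF zs]
  have h: "?h \<in> cp_space fin C (1 - i)"
    by (rule total_diff_in[where C = C and l = "\<lambda>_ _. 0" and u = "\<lambda>n x. green n (d x)", OF C _ _ _ _ i zs])
      (auto simp: C0 l_simps green_0 intro: green_in d_in)
  have dbz: "d (b (z n)) = 0" for n
  proof (cases n)
    case 0
    then show ?thesis using b_0[of "z 0"] zC[of 0] by (simp add: l_simps)
  next
    case (Suc m)
    have "d (total_diff (\<lambda>_. b) (\<lambda>n x. N n (d x)) z m) = 0"
      unfolding z0 by (simp add: l_simps zero_fun_apply)
    then show ?thesis unfolding Suc
      by (cases m) (auto simp: total_diff_Suc total_diff_0 l_simps d_N[OF d_in[OF zC]] dd[OF zC])
  qed
  have "z - (\<lambda>n. P n (z n)) = total_diff (\<lambda>_. b) (\<lambda>n x. N n (d x)) ?h"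
  proof
    fix n
    have 1: "(z - (\<lambda>n. P n (z n))) n = green n (b (d (z n)))"
      by (simp add: cochain_minus P_def dbz green_0)
    have 2: "b (?h (Suc n)) = green n (b (d (z n)))"
      by (simp add: total_diff_Suc b_green[OF d_in[OF zC]])
    show "(z - (\<lambda>n. P n (z n))) n = total_diff (\<lambda>_. b) (\<lambda>n x. N n (d x)) ?h n"
    proof (cases n)
      case 0
      then show ?thesis using 1 2 by (simp add: total_diff_0[of "\<lambda>_. b"])
    next
      case (Suc m)
      have "d (?h m) = 0"
        by (cases m) (auto simp: total_diff_Suc total_diff_0 l_simps d_green[OF d_in[OF zC]] dd[OF zC] green_0)
      then show ?thesis using 1 2 Suc by (simp add: total_diff_Suc[of "\<lambda>_. b"] l_simps)
    qed
  qed
  then show ?thesis using h by (auto simp: coboundaries_def cp_def)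
qed

text \<open>Applying \<open>b\<close> to the cocycle equation gives \<open>b d z = 0\<close>, and
  \<open>z - P z\<close> is the boundary of \<open>green (b z)\<close>.\<close>

lemma P_homotopic_d:
  assumes i: "i \<in> {0, 1}" and z: "z \<in> cocycles (complex_d fin) i"
  shows "z - (\<lambda>n. P n (z n)) \<in> coboundaries (complex_d fin) i"
proof -
  let ?h = "total_diff (\<lambda>n x. green n (b x)) (\<lambda>_ _. 0) z"
  have zs: "z \<in> cp_space fin C i" and z0: "total_diff (\<lambda>n x. N n (b x)) (\<lambda>_. d) z = 0"
    using z by (auto simp: cocycles_def cp_def)
  note zC = cp_spaceD(1)[OF zs]
  have h: "?h \<in> cp_space fin C (1 - i)"
    by (rule total_diff_in[where C = C and l = "\<lambda>n x. green n (b x)" and u = "\<lambda>_ _. 0", OF C _ _ _ _ i zs])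
      (auto simp: C0 l_simps green_0 intro: green_in b_in)
  have hn: "?h n = green n (b (z (Suc n)))" for n
    by (cases n) (auto simp: total_diff_Suc total_diff_0)
  have bdz: "b (d (z n)) = 0" for n
  proof -
    have "b (total_diff (\<lambda>n x. N n (b x)) (\<lambda>_. d) z (Suc n)) = 0"
      unfolding z0 by (simp add: l_simps zero_fun_apply)
    then show ?thesis
      by (simp add: total_diff_Suc l_simps b_N[OF b_in[OF zC]] bb[OF zC])
  qed
  have "z - (\<lambda>n. P n (z n)) = total_diff (\<lambda>n x. N n (b x)) (\<lambda>_. d) ?h"
  proof
    fix n
    have 1: "(z - (\<lambda>n. P n (z n))) n = green (n - 1) (d (b (z n)))"
      by (simp add: cochain_minus P_def bdz green_0)
    have 2: "b (?h n) = 0" for n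
      unfolding hn by (simp add: b_green[OF b_in[OF zC]] bb[OF zC] green_0)
    show "(z - (\<lambda>n. P n (z n))) n = total_diff (\<lambda>n x. N n (b x)) (\<lambda>_. d) ?h n"
    proof (cases n)
      case 0
      then show ?thesis using 1 2 b_0[of "z 0"] zC[of 0] by (simp add: total_diff_0[of "\<lambda>n x. N n (b x)"] l_simps green_0)
    next
      case (Suc m)
      then show ?thesis using 1 2
        by (simp add: total_diff_Suc[of "\<lambda>n x. N n (b x)"] l_simps hn d_green[OF b_in[OF zC]])
    qed
  qed
  then show ?thesis using h by (auto simp: coboundaries_def cp_def)
qed

lemma rescale_in: "x \<in> C n \<Longrightarrow> rescale n x \<in> C n"
  unfolding rescale_def by (intro fs.subspace_scale[OF C] P_in)

lemma unscale_in: "x \<in> C n \<Longrightarrow> unscale n x \<in> C n"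
  unfolding unscale_def by (intro fs.subspace_scale[OF C] P_in)

theorem rescale_quasi_iso: "quasi_iso (complex_b fin) (complex_d fin) (\<lambda>x n. rescale n (x n))"
proof (rule quasi_iso_homotopy[OF is_supercomplex_b is_supercomplex_d clin_degreewise[OF l_rescale] clin_degreewise[OF l_unscale]])
  fix i :: nat assume i: "i \<in> {0, 1}"
  show "(\<lambda>n. rescale n (x n)) \<in> fst (complex_d fin) i \<and>
      snd (complex_d fin) (\<lambda>n. rescale n (x n)) = (\<lambda>n. rescale n (snd (complex_b fin) x n))"
    if "x \<in> fst (complex_b fin) i" for x
    using that degreewise_in[where T = rescale and C = C and C' = C, OF rescale_in linop_zero[OF l_rescale]]
      total_diff_degreewise[where T = rescale and C = C and l = "\<lambda>_. b" and l' = "\<lambda>n x. N n (b x)" and u = "\<lambda>n x. N n (d x)" and u' = "\<lambda>_. d", OF rescale_b rescale_d l_rescale]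
    by (simp add: cp_def)
  show "(\<lambda>n. unscale n (x n)) \<in> fst (complex_b fin) i \<and>
      snd (complex_b fin) (\<lambda>n. unscale n (x n)) = (\<lambda>n. unscale n (snd (complex_d fin) x n))"
    if "x \<in> fst (complex_d fin) i" for x
    using that degreewise_in[where T = unscale and C = C and C' = C, OF unscale_in linop_zero[OF l_unscale]]
      total_diff_degreewise[where T = unscale and C = C and l' = "\<lambda>_. b" and l = "\<lambda>n x. N n (b x)" and u' = "\<lambda>n x. N n (d x)" and u = "\<lambda>_. d", OF unscale_b unscale_d l_unscale]
    by (simp add: cp_def)
  show "(\<lambda>n. unscale n (rescale n (x n))) - x \<in> coboundaries (complex_b fin) i" if "x \<in> cocycles (complex_b fin) i" for x
    unfolding unscale_rescale by (rule P_P_coboundary[OF is_supercomplex_b i P_homotopic_b[OF i] that])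
  show "(\<lambda>n. rescale n (unscale n (x n))) - x \<in> coboundaries (complex_d fin) i" if "x \<in> cocycles (complex_d fin) i" for x
    unfolding unscale_rescale by (rule P_P_coboundary[OF is_supercomplex_d i P_homotopic_d[OF i] that])
qed

end

section \<open>Normalization\<close>

text \<open>The part \<open>\<Sum>\<^sub>j\<^sub>\<ge>\<^sub>p (-1)\<^sup>j \<delta>\<^sub>j\<close> of the differential \<open>tins\<close>.\<close>

fun tail_list :: "('k::field, 'a) hopf \<Rightarrow> nat \<Rightarrow> 'a list \<Rightarrow> ('k, 'a) tensor" where
  "tail_list H 0 xs = inslist H xs"
| "tail_list H (Suc p) [] = 0"
| "tail_list H (Suc p) (x # xs) = - tpre H x (tail_list H p xs)"

definition ttail :: "('k::field, 'a) hopf \<Rightarrow> nat \<Rightarrow> ('k, 'a) tensor \<Rightarrow> ('k, 'a) tensor"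
  where "ttail H p t = tbind t (tail_list H p)"

text \<open>The cyclic permutation with sign \<open>(-1) ^ n\<close> on \<open>n + 1\<close>
  factors, written with \<open>tsgn\<close> so that no degree has to be supplied.\<close>

definition tlam :: "('k::field, 'a) hopf \<Rightarrow> ('k, 'a) tensor \<Rightarrow> ('k, 'a) tensor"
  where "tlam H t = - trot H (tsgn H t)"

text \<open>The last coface with the sign that it carries in \<open>tins\<close>.\<close>

definition tlast :: "('k::field, 'a) hopf \<Rightarrow> ('k, 'a) tensor \<Rightarrow> ('k, 'a) tensor"
  where "tlast H t = tapp H (tsgn H t) \<one>\<^bsub>H\<^esub>"

definition tnorm :: "('k::field, 'a) hopf \<Rightarrow> nat \<Rightarrow> ('k, 'a) tensor \<Rightarrow> ('k, 'a) tensor"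
  where "tnorm H n t = (\<Sum>j\<le>n. (tlam H ^^ j) t)"

text \<open>The lowering differential of the cocyclic module, carried over to coinvariant tensors,
  with \<open>tE\<close> in the role of the extra codegeneracy.\<close>

definition tdown :: "('k::field, 'a) hopf \<Rightarrow> nat \<Rightarrow> ('k, 'a) tensor \<Rightarrow> ('k, 'a) tensor"
  where "tdown H n t = tnorm H n (tE H (t - tlam H t))"

lemma linop_ops3 [linop_intros]:
  assumes "linop F"
  shows "linop (\<lambda>t. ttail H p (F t))" "linop (\<lambda>t. tlam H (F t))" "linop (\<lambda>t. tlast H (F t))"
  unfolding ttail_def tlam_def tlast_def by (intro linop_intros assms)+

lemmas linop_basic3 = linop_ops3[OF linop_id]

lemma linop_tlam_pow: "linop (tlam H ^^ j)"
  by (rule linop_funpow[OF linop_basic3(2) linop_id])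

lemma linop_tnorm: "linop (tnorm H n)"
proof -
  have "linop (\<lambda>t. \<Sum>j\<le>n. (tlam H ^^ j) t)" by (rule linop_sumI) (rule linop_tlam_pow)
  then show ?thesis by (simp add: tnorm_def[abs_def])
qed

lemma linop_tdown: "linop (tdown H n)"
proof -
  have "linop (\<lambda>t. tnorm H n (tE H (t - tlam H t)))"
    by (intro linop_compose[OF linop_tnorm] linop_intros)
  then show ?thesis by (simp add: tdown_def[abs_def])
qed

lemmas op_lin_simps4 = linop_basic3[THEN linop_add] linop_basic3[THEN linop_scale]
  linop_basic3[THEN linop_zero] linop_basic3[THEN linop_diff] linop_basic3[THEN linop_minus]

context hopf_algebra
begin

lemma tail_list_TT: "set xs \<subseteq> carrier H \<Longrightarrow> tail_list H p xs \<in> TT H"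
proof (induction xs arbitrary: p)
  case Nil
  then show ?case by (cases p) simp_all
next
  case (Cons x xs)
  then show ?case using inslist_TN[of xs] by (cases p) simp_all
qed

lemma mlin_tail_list: "mlin H (tail_list H p)"
proof (induction p)
  case 0
  then show ?case using mlin_inslist by (simp add: mlin_def)
next
  case (Suc p)
  show ?case
  proof (rule mlin_Cons[where g = "tail_list H p" and A = "\<lambda>x t. - tpre H x t"])
    fix xs assume "set xs \<subseteq> carrier H"
    from tail_list_TT[OF this] show "lin H (\<lambda>x. - tpre H x (tail_list H p xs))"
      by (simp add: lin_simps)
  qed (use Suc in \<open>auto intro!: linop_intros\<close>)
qed

lemma ttail_tens: "ttail H p (tens H xs) = tail_list H p xs"
  unfolding ttail_def by (rule tbind_tens[OF mlin_tail_list])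

lemma ttail_0 [simp]: "t \<in> TT H \<Longrightarrow> ttail H 0 t = tins H t"
  by (rule TT_eqI[where t = t]) (auto intro!: linop_intros simp: ttail_tens)

lemma ttail_Suc_Nil [simp]: "ttail H (Suc p) (tens H []) = 0"
  by (simp add: ttail_tens)

lemma ttail_Suc_tpre [simp]:
  "t \<in> TT H \<Longrightarrow> x \<in> carrier H \<Longrightarrow> ttail H (Suc p) (tpre H x t) = - tpre H x (ttail H p t)"
  by (rule TT_eqI[where t = t]) (auto intro!: linop_intros simp: ttail_tens)

lemma ttail_TT [simp]: "t \<in> TT H \<Longrightarrow> ttail H p t \<in> TT H"
  by (rule TT_into[OF linop_basic3(1) TT_subspace]) (auto simp: ttail_tens tail_list_TT)

lemma tins_minus_ttail:
  assumes "t \<in> TN H" shows "tins H t - ttail H 1 t = tpre H \<one> t"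
  by (rule TN_eqI[OF _ _ _ assms]) (auto intro!: linop_intros simp: ttail_tens)

lemma tens_tlm_TN: "set xs \<subseteq> carrier H \<Longrightarrow> x \<in> carrier H \<Longrightarrow> tlm H x (tens H xs) \<in> TN H"
  by (cases xs) auto

lemma tsg_tins_0:
  assumes "t \<in> TN H" shows "tsg H 0 (tins H t) = - ttail H 1 (tsg H 0 t)"
proof (rule TN_eqI[OF _ _ _ assms])
  fix x xs assume x: "x \<in> carrier H" "set xs \<subseteq> carrier H"
  show "tsg H 0 (tins H (tens H (x # xs))) = - ttail H 1 (tsg H 0 (tens H (x # xs)))"
  proof (cases xs)
    case Nil
    then show ?thesis using x by (simp add: tens_Cons op_lin_simps op_lin_simps2 op_lin_simps4 op_comm_TT del: tpre_tens)
  next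
    case (Cons y ys)
    then show ?thesis using x inslist_TN[of ys]
      by (simp add: tens_Cons op_lin_simps op_lin_simps2 op_comm_TT op_one del: tpre_tens)
  qed
qed (intro linop_intros)+

text \<open>The cosimplicial identities summed with signs. The cofaces \<open>k + 1\<close> and
  \<open>k + 2\<close> both compose with \<open>tsg H (Suc k)\<close> to the identity and cancel;
  lower ones leave \<open>tsg H k\<close> behind, higher ones \<open>tsg H (Suc k)\<close> with
  their index lowered by one, which reverses the sign.\<close>

lemma tsg_tins_Suc:
  assumes "t \<in> TN H"
  shows "tsg H (Suc k) (tins H t) = tins H (tsg H k t) - ttail H (Suc k) (tsg H k t) - ttail H (Suc (Suc k)) (tsg H (Suc k) t)"
proof -
  have "tsg H (Suc k) (tins H (tens H xs)) = tins H (tsg H k (tens H xs)) - ttail H (Suc k) (tsg H k (tens H xs)) -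
      ttail H (Suc (Suc k)) (tsg H (Suc k) (tens H xs))" if "set xs \<subseteq> carrier H" "xs \<noteq> []" for xs
    using that
  proof (induction xs arbitrary: k)
    case (Cons x zs)
    have c: "x \<in> carrier H" "set zs \<subseteq> carrier H" using Cons.prems by auto
    show ?case
    proof (cases k)
      case 0
      have Z: "tlm H x (tens H zs) \<in> TN H" by (rule tens_tlm_TN) (use c in auto)
      have s: "tsg H 0 (tins H (tens H zs)) = - ttail H 1 (tsg H 0 (tens H zs))" if "zs \<noteq> []"
        using tsg_tins_0[of "tens H zs"] c that by simp
      have s': "tpre H x (tsg H 0 (tins H (tens H zs))) = - tpre H x (ttail H 1 (tsg H 0 (tens H zs)))"
      proof (cases "zs = []")
        case True
        then show ?thesis using c by (simp add: tsg_tens op_lin_simps op_lin_simps4)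
      next
        case False
        then show ?thesis using s by (simp add: op_lin_simps)
      qed
      show ?thesis using c 0 tins_minus_ttail[OF Z] s'
        by (simp add: tens_Cons op_lin_simps op_lin_simps2 op_lin_simps4 op_one del: tpre_tens tins_tens)
    next
      case (Suc k')
      show ?thesis
      proof (cases "zs = []")
        case True
        then show ?thesis using c Suc by (cases k') (simp_all add: tsg_tens op_lin_simps op_lin_simps2 op_lin_simps4)
      next
        case False
        show ?thesis using c Suc Cons.IH[of k'] False
          by (simp add: tens_Cons op_lin_simps op_lin_simps2 op_lin_simps4 del: tpre_tens tins_tens)
      qed
    qed
  qed simp
  note * = this
  show ?thesis
    by (rule TN_eq_listI[OF _ _ _ assms]) (rule *, assumption+ | intro linop_intros)+
qed

text \<open>Of the two cofaces that \<open>tsg H k\<close> cancels, only the one with index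
  \<open>k + 1\<close> belongs to this tail, so the identity survives with its sign.\<close>

lemma tsg_ttail:
  assumes "t \<in> tpower H n" "k < n"
  shows "tsg H k (ttail H (Suc k) t) = (-1) ^ Suc k *\<^sub>k t - ttail H (Suc k) (tsg H k t)"
proof (rule tpower_eqI[OF _ _ _ assms(1)])
  have "tsg H k (ttail H (Suc k) (tens H xs)) = (-1) ^ Suc k *\<^sub>k tens H xs - ttail H (Suc k) (tsg H k (tens H xs))"
    if "set xs \<subseteq> carrier H" "k < length xs" for xs
    using that
  proof (induction xs arbitrary: k)
    case (Cons x zs)
    have c: "x \<in> carrier H" "set zs \<subseteq> carrier H" using Cons.prems by auto
    show ?case
    proof (cases k)
      case 0
      show ?thesis
      proof (cases zs)
        case Nil
        show ?thesis unfolding Nil using c(1) 0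
          by (simp add: tsg_tens tins_tens ttail_tens op_lin_simps op_lin_simps2 op_lin_simps4)
      next
        case (Cons y ys)
        then show ?thesis using c 0
          by (simp add: tens_Cons op_lin_simps op_lin_simps2 op_lin_simps4 op_comm_TT op_one del: tpre_tens tins_tens)
      qed
    next
      case (Suc k')
      then show ?thesis using c Cons.IH[of k'] Cons.prems
        by (simp add: tens_Cons op_lin_simps op_lin_simps2 op_lin_simps4 fs.scale_right_diff_distrib del: tpre_tens)
    qed
  qed simp
  then show "tsg H k (ttail H (Suc k) (tens H xs)) = (-1) ^ Suc k *\<^sub>k tens H xs - ttail H (Suc k) (tsg H k (tens H xs))"
    if "set xs \<subseteq> carrier H" "length xs = n" for xs
    using that assms(2) by blast
qed (intro linop_intros)+

lemma tsg_tsg: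
  assumes "t \<in> TT H" "i \<le> k" shows "tsg H i (tsg H (Suc k) t) = tsg H k (tsg H i t)"
proof (rule TT_eqI[OF _ _ _ assms(1)])
  have "tsg H i (tsg H (Suc k) (tens H xs)) = tsg H k (tsg H i (tens H xs))" if "set xs \<subseteq> carrier H" for xs
    using that assms(2)
  proof (induction xs arbitrary: i k)
    case (Cons x zs)
    have c: "x \<in> carrier H" "set zs \<subseteq> carrier H" using Cons.prems by auto
    show ?case
    proof (cases i)
      case 0
      have "tlm H x (tsg H k (tens H zs)) = tsg H k (tlm H x (tens H zs))"
      proof (cases zs)
        case (Cons y ys)
        then show ?thesis using c tsg_tlm[of "tens H zs" x k] by simp
      qed (use c in \<open>simp add: op_lin_simps op_lin_simps2\<close>)
      then show ?thesis using c 0 by (simp add: tens_Cons del: tpre_tens)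
    next
      case (Suc j)
      then obtain l where "k = Suc l" "j \<le> l" using Cons.prems by (cases k) auto
      then show ?thesis using c Suc Cons.IH[of j l] by (simp add: tens_Cons del: tpre_tens)
    qed
  qed (simp add: op_lin_simps2)
  then show "tsg H i (tsg H (Suc k) (tens H xs)) = tsg H k (tsg H i (tens H xs))" if "set xs \<subseteq> carrier H" for xs
    using that by blast
qed (intro linop_intros)+

lemma tsg_tins_partial:
  assumes "t \<in> TN H" "\<And>i. i < k \<Longrightarrow> tsg H i t = 0"
  shows "tsg H k (tins H t) = - ttail H (Suc k) (tsg H k t)"
proof (cases k)
  case 0
  then show ?thesis using tsg_tins_0[OF assms(1)] by simp
next
  case (Suc j)
  then show ?thesis using tsg_tins_Suc[OF assms(1), of j] assms(2)[of j] by (simp add: op_lin_simps2 op_lin_simps4)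
qed

text \<open>Put \<open>w = tsg H k x\<close>. Vanishing of \<open>tsg H k\<close> on
  \<open>tins H x\<close> means that the tail from \<open>k + 1\<close> on annihilates
  \<open>w\<close>; this forces \<open>tsg H k (tins H w) = (-1)^k w\<close>. Hence subtracting
  \<open>(-1)^k tins H w\<close> removes \<open>w\<close>, and the lower degeneracies stay
  zero.\<close>

lemma normalize_step:
  assumes x: "x \<in> tpower H (Suc (Suc n))" and k: "k < Suc n" and i: "\<And>i. i < k \<Longrightarrow> tsg H i x = 0"
    and d: "tsg H k (tins H x) = 0"
  shows "i < Suc k \<Longrightarrow> tsg H i (x - (-1) ^ k *\<^sub>k tins H (tsg H k x)) = 0"
proof -
  define w where "w = tsg H k x"
  have xN: "x \<in> TN H" by (rule tpower_TN[OF x]) simp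
  have w: "w \<in> tpower H (Suc n)" unfolding w_def using x by simp
  have wN: "w \<in> TN H" by (rule tpower_TN[OF w]) simp
  have wi: "tsg H i w = 0" if "i < k" for i
  proof -
    obtain l where l: "k = Suc l" using \<open>i < k\<close> by (cases k) auto
    then have "tsg H i w = tsg H l (tsg H i x)"
      unfolding w_def l using that xN l by (intro tsg_tsg) auto
    then show ?thesis using i that by (simp add: op_lin_simps2)
  qed
  have "ttail H (Suc k) w = 0" using tsg_tins_partial[OF xN i] d by (simp add: w_def)
  then have "(-1) ^ Suc k *\<^sub>k w = ttail H (Suc k) (tsg H k w)"
    using tsg_ttail[OF w k] by (simp add: op_lin_simps2)
  then have 1: "tsg H k (tins H w) = (-1) ^ k *\<^sub>k w"
    using tsg_tins_partial[OF wN wi] by simp (metis add.inverse_inverse)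
  have 2: "tsg H i (tins H w) = 0" if "i < k" for i
    using tsg_tins_partial[OF wN, of i] wi[of i] wi that by (simp add: op_lin_simps4)
  show "tsg H i (x - (-1) ^ k *\<^sub>k tins H (tsg H k x)) = 0" if "i < Suc k"
    using that i[of i] 1 2[of i] by (cases "i = k") (simp_all add: op_lin_simps2 w_def)
qed

end

section \<open>Coinvariant tensors and coinvariant forms\<close>

definition Wco :: "('k::field, 'a) hopf \<Rightarrow> nat \<Rightarrow> ('k, 'a) tensor set"
  where "Wco H n = {t \<in> tpower H (Suc n). tcor H t = tapp H t \<one>\<^bsub>H\<^esub>}"

definition Rco :: "('k::field, 'a) hopf \<Rightarrow> nat \<Rightarrow> ('k, 'a) tensor set"
  where "Rco H n = {t \<in> Wco H n. \<forall>i. tsg H i t = 0}"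

context hopf_algebra
begin

lemma Wco_subspace: "fs.subspace (Wco H n)"
  unfolding fs.subspace_def Wco_def
  using tpower_subspace[of H "Suc n"] by (auto simp: op_lin_simps op_lin_simps2 fs.subspace_def)

lemma Rco_subspace: "fs.subspace (Rco H n)"
  using Wco_subspace[of n] unfolding fs.subspace_def Rco_def by (auto simp: op_lin_simps2)

lemma Wco_tpower: "t \<in> Wco H n \<Longrightarrow> t \<in> tpower H (Suc n)"
  by (simp add: Wco_def)

lemma tphi_Wco: "t \<in> tpower H n \<Longrightarrow> tphi H t \<in> Wco H n"
  using tcor_tphi[OF tpower_TT] by (simp add: Wco_def)

text \<open>The degree is asked of \<open>tphi H t\<close> instead of \<open>t\<close>, because the
  degrees of values of \<open>hopf_up\<close> and \<open>cocyc\<close> are themselves read off after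
  applying \<open>tphi\<close>.\<close>

lemma tphi_TT_tpower_Wco: "t \<in> TT H \<Longrightarrow> tphi H t \<in> tpower H (Suc n) \<Longrightarrow> tphi H t \<in> Wco H n"
  using tcor_tphi by (simp add: Wco_def)

lemma Wco_tphi: "t \<in> Wco H n \<Longrightarrow> tphi H (tpsi H t) = t"
  by (rule tphi_tpsi) (auto simp: Wco_def intro: tpower_TN)

lemma Wco_tpsi: "t \<in> Wco H n \<Longrightarrow> tpsi H t \<in> tpower H n"
  by (rule tpsi_tpower) (simp add: Wco_def)

lemma codegen_TT: "t \<in> tpower H n \<Longrightarrow> i < n \<Longrightarrow> codegen H (Suc i) t \<in> TT H"
  by (rule tpower_into[OF linop_codegen TT_subspace]) (auto simp: codegen_tens codegen_list_TT)

lemma hopf_up_TT: "t \<in> tpower H n \<Longrightarrow> hopf_up H n t \<in> TT H"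
  by (rule tpower_into[OF linop_hopf_up TT_subspace]) (auto simp: hopf_up_tens upc_TT)

lemma tsg_Wco:
  assumes "t \<in> Wco H (Suc n)" "i < Suc n" shows "tsg H i t \<in> Wco H n"
proof -
  have p: "tpsi H t \<in> tpower H (Suc n)" by (rule Wco_tpsi[OF assms(1)])
  have "tsg H i t = tphi H (codegen H (Suc i) (tpsi H t))"
    using tsg_tphi[OF p assms(2)] Wco_tphi[OF assms(1)] by simp
  then show ?thesis
    using tphi_TT_tpower_Wco[OF codegen_TT[OF p assms(2)]] tsg_tpower[OF Wco_tpower[OF assms(1)], of i] by metis
qed

lemma tins_Wco:
  assumes "t \<in> Wco H n" shows "tins H t \<in> Wco H (Suc n)"
proof -
  have p: "tpsi H t \<in> tpower H n" by (rule Wco_tpsi[OF assms])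
  have "tins H t = tphi H (hopf_up H n (tpsi H t))"
    using tins_tphi[OF p] Wco_tphi[OF assms] by simp
  then show ?thesis
    using tphi_TT_tpower_Wco[OF hopf_up_TT[OF p]] tins_tpower[OF Wco_tpower[OF assms]] by metis
qed

lemma tsg_high:
  assumes "t \<in> tpower H (Suc m)" "m \<le> i" shows "tsg H i t = 0"
proof -
  have "tsg H i (tens H xs) = 0" if "set xs \<subseteq> carrier H" "length xs = Suc m" "m \<le> i" for xs i m
    using that
  proof (induction arbitrary: i m rule: TT_list_induct)
    case (Cons z zs)
    then show ?case
    proof (cases zs)
      case Nil
      then show ?thesis using Cons by (cases i) (auto simp: tsg_tens op_lin_simps)
    next
      case (Cons y ys)
      then obtain j m' where "i = Suc j" "m = Suc m'" using Cons.prems by (cases i; cases m) auto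
      then show ?thesis using Cons.prems Cons.hyps Cons.IH[of m' j] by (simp add: tens_Cons op_lin_simps del: tpre_tens)
    qed
  qed simp
  then show ?thesis using assms
    by (intro tpower_eqI[OF linop_basic(8) linop_const0 _ assms(1)]) auto
qed

text \<open>The degeneracies are removed one at a time in increasing order. Each correction is
  \<open>tins\<close> of a coinvariant, so \<open>tins H x\<close> does not change and the next step
  applies.\<close>

lemma normalize:
  assumes x: "x \<in> Wco H (Suc n)" and d: "tins H x \<in> Rco H (Suc (Suc n))"
  shows "\<exists>y\<in>Wco H n. x - tins H y \<in> Rco H (Suc n)"
proof -
  have "\<exists>y\<in>Wco H n. \<forall>i<k. tsg H i (x - tins H y) = 0" if "k \<le> Suc n" for k
    using that
  proof (induction k)
    case 0
    show ?case using fs.subspace_0[OF Wco_subspace] by auto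
  next
    case (Suc k)
    then obtain y where y: "y \<in> Wco H n" "\<forall>i<k. tsg H i (x - tins H y) = 0" by auto
    define x' where "x' = x - tins H y"
    have x': "x' \<in> Wco H (Suc n)" unfolding x'_def by (intro fs.subspace_diff[OF Wco_subspace] x tins_Wco y)
    have "tins H x' = tins H x"
      using tins_tins[OF tpower_TT[OF Wco_tpower[OF y(1)]]] by (simp add: x'_def op_lin_simps2)
    then have dx: "tsg H k (tins H x') = 0" using d by (simp add: Rco_def)
    define y' where "y' = y + (-1) ^ k *\<^sub>k tsg H k x'"
    have "y' \<in> Wco H n" unfolding y'_def
      by (intro fs.subspace_add[OF Wco_subspace] fs.subspace_scale[OF Wco_subspace] y tsg_Wco x') (use Suc in simp)
    moreover have "x - tins H y' = x' - (-1) ^ k *\<^sub>k tins H (tsg H k x')"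
      by (simp add: x'_def y'_def op_lin_simps2)
    moreover have "tsg H i (x' - (-1) ^ k *\<^sub>k tins H (tsg H k x')) = 0" if "i < Suc k" for i
      by (rule normalize_step[OF Wco_tpower[OF x'] _ _ dx that]) (use Suc y in \<open>auto simp: x'_def\<close>)
    ultimately show ?case by metis
  qed
  from this[of "Suc n"] obtain y where y: "y \<in> Wco H n" "\<forall>i<Suc n. tsg H i (x - tins H y) = 0" by auto
  have W: "x - tins H y \<in> Wco H (Suc n)" by (intro fs.subspace_diff[OF Wco_subspace] x tins_Wco y)
  have "tsg H i (x - tins H y) = 0" for i
    using y(2) tsg_high[OF Wco_tpower[OF W], of i] by (cases "i < Suc n") auto
  then show ?thesis using y W by (auto simp: Rco_def)
qed

lemma Wco_0: "t \<in> Wco H 0 \<Longrightarrow> t \<in> Rco H 0"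
  using tsg_high[of t 0] by (simp add: Rco_def Wco_def)

section \<open>The cyclic operator\<close>

lemma tlam_eq: "t \<in> tpower H (Suc n) \<Longrightarrow> tlam H t = (-1) ^ n *\<^sub>k trot H t"
  by (simp add: tlam_def tsgn_tpower op_lin_simps2)

lemma tlast_eq: "t \<in> tpower H n \<Longrightarrow> tlast H t = (-1) ^ n *\<^sub>k tapp H t \<one>"
  by (simp add: tlast_def tsgn_tpower op_lin_simps)

lemma tlam_tpower [simp]: "t \<in> tpower H (Suc n) \<Longrightarrow> tlam H t \<in> tpower H (Suc n)"
  by (simp add: tlam_eq fs.subspace_scale[OF tpower_subspace])

lemma tlam_pow_tpower [simp]: "t \<in> tpower H (Suc n) \<Longrightarrow> (tlam H ^^ j) t \<in> tpower H (Suc n)"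
  by (induction j) auto

lemma tnorm_tpower [simp]: "t \<in> tpower H (Suc n) \<Longrightarrow> tnorm H m t \<in> tpower H (Suc n)"
  unfolding tnorm_def by (intro fs.subspace_sum[OF tpower_subspace] tlam_pow_tpower)

lemma trot_pow_tens: "(trot H ^^ j) (tens H xs) = tens H (rotate j xs)"
proof (induction j)
  case (Suc j)
  have "trot H (tens H ys) = tens H (rotate1 ys)" for ys by (cases ys) auto
  then show ?case using Suc by simp
qed simp

lemma tlam_pow_eq: "t \<in> tpower H (Suc n) \<Longrightarrow> (tlam H ^^ j) t = (-1) ^ (n * j) *\<^sub>k (trot H ^^ j) t"
proof (induction j)
  case (Suc j)
  have l: "linop (trot H)" by (rule linop_basic(7))
  have "(trot H ^^ j) t \<in> tpower H (Suc n)" using Suc.prems by (induction j) auto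
  then have "(-1) ^ (n * j) *\<^sub>k (trot H ^^ j) t \<in> tpower H (Suc n)"
    by (rule fs.subspace_scale[OF tpower_subspace])
  then have "(tlam H ^^ Suc j) t = (-1) ^ n *\<^sub>k (-1) ^ (n * j) *\<^sub>k trot H ((trot H ^^ j) t)"
    using Suc by (simp add: tlam_eq linop_scale[OF l])
  then show ?case by (simp add: power_add)
qed simp

lemma tlam_cyclic:
  assumes "t \<in> tpower H (Suc n)" shows "(tlam H ^^ Suc n) t = t"
proof (rule tpower_eqI[OF linop_tlam_pow linop_id _ assms])
  fix xs assume xs: "set xs \<subseteq> carrier H" "length xs = Suc n"
  have "rotate (Suc n) xs = xs" using xs(2) by (metis rotate_id mod_self)
  moreover have "even (n * Suc n)" by simp
  then have "(- 1) ^ (n * Suc n) = (1 :: 'k)" by (simp only: neg_one_even_power)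
  ultimately show "(tlam H ^^ Suc n) (tens H xs) = tens H xs"
    using tlam_pow_eq[OF tens_in_tpower[OF xs], of "Suc n"] by (simp only: trot_pow_tens fs.scale_one)
qed

text \<open>Rearranged, the first identity says that \<open>tE\<close> contracts the complex with
  differential \<open>tins - tlast\<close>: it is an extra degeneracy. The omitted last coface
  contributes the cyclic operator through the second identity.\<close>

lemma tE_homotopy:
  assumes "t \<in> tpower H (Suc n)"
  shows "tE H (tins H t) + tins H (tE H t) - tlast H (tE H t) = t + tE H (tlast H t)"
    and "tE H (tlast H t) = - tlam H t"
proof -
  have *: "tE H (tins H (tens H xs)) + tins H (tE H (tens H xs)) - tlast H (tE H (tens H xs)) = tens H xs + tE H (tlast H (tens H xs))
      \<and> tE H (tlast H (tens H xs)) = - tlam H (tens H xs)"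
    if xs: "set xs \<subseteq> carrier H" "length xs = Suc n" for xs
  proof -
    obtain x ys where ys: "xs = x # ys" "x \<in> carrier H" "set ys \<subseteq> carrier H" "length ys = n"
      using xs by (cases xs) auto
    define u where "u = tens H ys"
    have u: "u \<in> tpower H n" unfolding u_def by (rule tens_in_tpower) (use ys in auto)
    have uT: "u \<in> TT H" by (rule tpower_TT[OF u])
    have s: "tens H xs = tpre H x u" using ys by (simp add: u_def)
    have p: "tpre H x u \<in> tpower H (Suc n)" "trm H x u \<in> tpower H n" using u ys by auto
    have 1: "tE H (tlast H (tpre H x u)) = (-1) ^ Suc n *\<^sub>k tapp H u x"
      using uT ys by (simp add: tlast_eq[OF p(1)] op_lin_simps2 op_comm_TT)
    have 2: "tlam H (tpre H x u) = (-1) ^ n *\<^sub>k tapp H u x"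
      using uT ys by (simp add: tlam_eq[OF p(1)])
    have 3: "tE H (tins H (tpre H x u)) = tpre H x u - trm H x (tins H u)"
      using uT ys by (simp add: op_lin_simps2 op_one)
    have 4: "tins H (tE H (tpre H x u)) = trm H x (tins H u) + (-1) ^ n *\<^sub>k (tapp H (trm H x u) \<one> - tapp H u x)"
      using uT ys by (simp add: tins_trm[OF u])
    have 5: "tlast H (tE H (tpre H x u)) = (-1) ^ n *\<^sub>k tapp H (trm H x u) \<one>"
      using uT ys by (simp add: tlast_eq[OF p(2)])
    show ?thesis unfolding s 1 2 3 4 5 by (simp add: fs.scale_right_diff_distrib)
  qed
  show "tE H (tins H t) + tins H (tE H t) - tlast H (tE H t) = t + tE H (tlast H t)"
    by (rule tpower_eqI[OF _ _ _ assms]) (use * in \<open>auto intro!: linop_intros\<close>)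
  show "tE H (tlast H t) = - tlam H t"
    by (rule tpower_eqI[OF _ _ _ assms]) (use * in \<open>auto intro!: linop_intros\<close>)
qed

lemma tkar_tlam:
  assumes "t \<in> tpower H (Suc n)" shows "tkar H t = tlam H t - tlast H (tE H t)"
  using tE_homotopy[OF assms] by (simp add: tkar_def algebra_simps)

text \<open>Equivalent to \<open>(1 - \<lambda>) d = (d - last) (1 - \<lambda>)\<close> for
  \<open>\<lambda> = tlam H\<close>. This and \<open>tnorm_tins\<close> are the two relations of the
  cyclic bicomplex.\<close>

lemma tlam_tins:
  assumes "t \<in> tpower H (Suc n)"
  shows "tlam H (tins H t) = tlast H t + tins H (tlam H t) - tlast H (tlam H t)"
proof (rule tpower_eqI[OF _ _ _ assms])
  fix xs assume xs: "set xs \<subseteq> carrier H" "length xs = Suc n"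
  obtain x ys where ys: "xs = x # ys" "x \<in> carrier H" "set ys \<subseteq> carrier H" "length ys = n"
    using xs by (cases xs) auto
  define u where "u = tens H ys"
  have u: "u \<in> tpower H n" unfolding u_def by (rule tens_in_tpower) (use ys in auto)
  have uT: "u \<in> TT H" by (rule tpower_TT[OF u])
  have s: "tens H xs = tpre H x u" using ys by (simp add: u_def)
  have p: "tpre H x u \<in> tpower H (Suc n)" "tapp H u x \<in> tpower H (Suc n)" using u ys by auto
  have i: "tins H (tpre H x u) \<in> tpower H (Suc (Suc n))" using p by simp
  have 1: "tlam H (tins H (tpre H x u)) = (-1) ^ Suc n *\<^sub>k (tapp H (tpre H x u) \<one> - tapp H (tins H u) x)"
    unfolding tlam_eq[OF i] using uT ys by (simp add: op_lin_simps2)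
  have 2: "tlast H (tpre H x u) = (-1) ^ Suc n *\<^sub>k tapp H (tpre H x u) \<one>"
    by (rule tlast_eq[OF p(1)])
  have 3: "tlam H (tpre H x u) = (-1) ^ n *\<^sub>k tapp H u x"
    using uT ys by (simp add: tlam_eq[OF p(1)])
  show "tlam H (tins H (tens H xs)) = tlast H (tens H xs) + tins H (tlam H (tens H xs)) - tlast H (tlam H (tens H xs))"
    unfolding s 1 2 3 using tlast_eq[OF p(2)] tins_tapp[OF u ys(2)]
    by (simp add: op_lin_simps2 op_lin_simps4 fs.scale_right_diff_distrib fs.scale_right_distrib)
qed (intro linop_intros)+

lemma tins_tens_sum:
  "set xs \<subseteq> carrier H \<Longrightarrow> tins H (tens H xs) = (\<Sum>i\<le>length xs. (-1) ^ i *\<^sub>k tens H (take i xs @ \<one> # drop i xs))"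
proof (induction xs)
  case (Cons x xs)
  have l: "linop (tpre H x)" by (rule linop_tpre[OF linop_id])
  have "(\<Sum>i\<le>length (x # xs). (-1) ^ i *\<^sub>k tens H (take i (x # xs) @ \<one> # drop i (x # xs))) =
      tens H (\<one> # x # xs) - tpre H x (\<Sum>i\<le>length xs. (-1) ^ i *\<^sub>k tens H (take i xs @ \<one> # drop i xs))"
    using Cons.prems by (simp add: sum.atMost_Suc_shift linop_sum[OF l] linop_scale[OF l] sum_negf del: sum.atMost_Suc)
  then show ?case using Cons by simp
qed simp

text \<open>Inserting \<open>1\<close> at position \<open>k\<close> can be done by rotating
  \<open>k\<close> factors to the end, appending \<open>1\<close>, and rotating on; the signs of the
  three steps multiply to \<open>(-1)^k\<close>.\<close>

lemma tins_cyclic: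
  assumes "t \<in> tpower H (Suc n)"
  shows "tins H t = (\<Sum>k\<le>Suc n. (tlam H ^^ (Suc n - k)) (tlast H ((tlam H ^^ k) t)))"
proof (rule tpower_eqI[OF _ _ _ assms])
  show "linop (\<lambda>t. \<Sum>k\<le>Suc n. (tlam H ^^ (Suc n - k)) (tlast H ((tlam H ^^ k) t)))"
    by (rule linop_sumI) (intro linop_compose[OF linop_tlam_pow] linop_ops3 linop_tlam_pow)
  fix xs assume xs: "set xs \<subseteq> carrier H" "length xs = Suc n"
  have "(tlam H ^^ (Suc n - k)) (tlast H ((tlam H ^^ k) (tens H xs))) = (-1) ^ k *\<^sub>k tens H (take k xs @ \<one> # drop k xs)"
    if k: "k \<le> Suc n" for k
  proof -
    define m where "m = Suc n - k"
    have m: "Suc n = m + k" "length (drop k xs) = m" using k xs by (simp_all add: m_def)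
    have r: "rotate k xs = drop k xs @ take k xs" using k xs(2) by (cases "k = Suc n") (simp_all add: rotate_drop_take)
    have r': "rotate m (drop k xs @ (take k xs @ [\<one>])) = (take k xs @ [\<one>]) @ drop k xs"
      using rotate_append[of "drop k xs" "take k xs @ [\<one>]"] m by simp
    have c: "set (drop k xs @ take k xs) \<subseteq> carrier H" "set (drop k xs @ take k xs @ [\<one>]) \<subseteq> carrier H"
      using xs(1) by (auto dest: in_set_takeD in_set_dropD)
    have p: "tens H (drop k xs @ take k xs) \<in> tpower H (Suc n)"
      "tens H (drop k xs @ take k xs @ [\<one>]) \<in> tpower H (Suc (Suc n))"
      using c xs(2) k by (intro tens_in_tpower; simp)+
    have "(tlam H ^^ m) (tlast H ((tlam H ^^ k) (tens H xs)))
        = (-1) ^ (n * k + Suc n + Suc n * m) *\<^sub>k tens H (take k xs @ \<one> # drop k xs)"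
      using tlam_pow_eq[OF tens_in_tpower[OF xs], of k] tlast_eq[OF p(1)] tlam_pow_eq[OF p(2), of m] r'
      by (simp only: trot_pow_tens r op_lin_simps4 linop_scale[OF linop_tlam_pow] tapp_tens[OF one_closed']
          append_assoc append_Cons append_Nil fs.scale_scale power_add mult.assoc)
    moreover have "even (n * k + Suc n + Suc n * m) \<longleftrightarrow> even k" using m(1) by (simp; presburger)
    then have "(-1) ^ (n * k + Suc n + Suc n * m) = ((-1) ^ k :: 'k)"
      by (cases "even k") (simp_all only: neg_one_even_power neg_one_odd_power simp_thms)
    ultimately show ?thesis unfolding m_def[symmetric] by (simp only:)
  qed
  then show "tins H (tens H xs) = (\<Sum>k\<le>Suc n. (tlam H ^^ (Suc n - k)) (tlast H ((tlam H ^^ k) (tens H xs))))"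
    unfolding tins_tens_sum[OF xs(1)] xs(2) by (intro sum.cong) auto
qed (intro linop_intros)

lemma tnorm_tlam:
  assumes "t \<in> tpower H (Suc n)"
  shows "tnorm H n (tlam H t) = tnorm H n t" "tlam H (tnorm H n t) = tnorm H n t"
    "tnorm H n ((tlam H ^^ j) t) = tnorm H n t"
proof -
  have s: "tnorm H n (tlam H u) = tnorm H n u" if "u \<in> tpower H (Suc n)" for u
  proof -
    have "(\<Sum>j\<le>n. (tlam H ^^ Suc j) u) + u = (\<Sum>j\<le>Suc n. (tlam H ^^ j) u)"
      by (simp add: sum.atMost_Suc_shift add.commute del: sum.atMost_Suc)
    then show ?thesis using tlam_cyclic[OF that]
      unfolding tnorm_def by (simp add: funpow_swap1 del: funpow.simps) (simp add: funpow_swap1)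
  qed
  show "tnorm H n (tlam H t) = tnorm H n t" by (rule s[OF assms])
  then show "tlam H (tnorm H n t) = tnorm H n t"
    unfolding tnorm_def by (simp add: linop_sum[OF linop_basic3(2)] funpow_swap1)
  show "tnorm H n ((tlam H ^^ j) t) = tnorm H n t"
  proof (induction j)
    case (Suc j)
    then show ?case using s[of "(tlam H ^^ j) t"] assms by simp
  qed simp
qed

lemma tlast_tpower [simp]: "t \<in> tpower H n \<Longrightarrow> tlast H t \<in> tpower H (Suc n)"
  by (simp add: tlast_eq fs.subspace_scale[OF tpower_subspace])

text \<open>Both sides are \<open>N\<^sub>n\<^sub>+\<^sub>1 \<circ> tlast \<circ> N\<^sub>n\<close>.\<close>

lemma tnorm_tins:
  assumes t: "t \<in> tpower H (Suc n)"
  shows "tnorm H (Suc n) (tins H t - tlast H t) = tins H (tnorm H n t)"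
proof -
  \<comment> \<open>The summand with \<open>k = Suc n\<close> is \<open>tlast\<close> itself, by
    \<open>tlam_cyclic\<close>.\<close>
  have 1: "tins H t - tlast H t = (\<Sum>k\<le>n. (tlam H ^^ (Suc n - k)) (tlast H ((tlam H ^^ k) t)))"
    using tins_cyclic[OF t] tlam_cyclic[OF t] by (simp del: funpow.simps)
  have "tnorm H (Suc n) (tins H t - tlast H t) = (\<Sum>k\<le>n. tnorm H (Suc n) ((tlam H ^^ (Suc n - k)) (tlast H ((tlam H ^^ k) t))))"
    unfolding 1 by (rule linop_sum[OF linop_tnorm])
  also have "\<dots> = (\<Sum>k\<le>n. tnorm H (Suc n) (tlast H ((tlam H ^^ k) t)))"
    by (intro sum.cong refl tnorm_tlam(3) tlast_tpower tlam_pow_tpower t)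
  also have "\<dots> = tnorm H (Suc n) (tlast H (tnorm H n t))"
    unfolding tnorm_def[of H n t] by (simp add: linop_sum[OF linop_basic3(3)] linop_sum[OF linop_tnorm])
  finally have 2: "tnorm H (Suc n) (tins H t - tlast H t) = tnorm H (Suc n) (tlast H (tnorm H n t))" .
  have "(tlam H ^^ k) (tnorm H n t) = tnorm H n t" for k
    by (induction k) (simp_all add: tnorm_tlam(2)[OF t])
  then have "tins H (tnorm H n t) = (\<Sum>k\<le>Suc n. (tlam H ^^ (Suc n - k)) (tlast H (tnorm H n t)))"
    using tins_cyclic[OF tnorm_tpower[OF t, of n]] by (simp del: funpow.simps sum.atMost_Suc)
  also have "\<dots> = tnorm H (Suc n) (tlast H (tnorm H n t))"
    unfolding tnorm_def[of H "Suc n"] by (rule sum.reindex_bij_witness[of _ "\<lambda>k. Suc n - k" "\<lambda>k. Suc n - k"]) auto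
  finally show ?thesis using 2 by simp
qed

lemma one_minus_tlam: "t \<in> tpower H (Suc n) \<Longrightarrow> t - tlam H t \<in> tpower H (Suc n)"
  by (intro fs.subspace_diff[OF tpower_subspace] tlam_tpower)

lemma tE_tins_one_minus_tlam:
  assumes "t \<in> tpower H (Suc n)"
  shows "tE H (tins H t - tlam H (tins H t)) =
    t - tlam H t - (tins H (tE H (t - tlam H t)) - tlast H (tE H (t - tlam H t)))"
proof -
  define s where "s = t - tlam H t"
  have s: "s \<in> tpower H (Suc n)" unfolding s_def by (rule one_minus_tlam[OF assms])
  have e: "tins H t - tlam H (tins H t) = tins H s - tlast H s"
    unfolding tlam_tins[OF assms] by (simp add: s_def op_lin_simps2 op_lin_simps4)
  show ?thesis unfolding e s_def[symmetric] using tE_homotopy(1)[OF s]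
    by (simp add: op_lin_simps2 algebra_simps)
qed

text \<open>With \<open>s = t - tlam H t\<close>, the contraction replaces \<open>tE\<close> of
  \<open>(1 - \<lambda>) d t = (d - last) s\<close> by \<open>s - (d - last) (tE H s)\<close>. The
  norm kills \<open>s\<close> and satisfies \<open>N (d - last) = d N\<close>.\<close>

lemma tdown_tins:
  assumes "t \<in> tpower H (Suc (Suc n))"
  shows "tdown H (Suc n) (tins H t) + tins H (tdown H n t) = 0"
proof -
  define e where "e = tE H (t - tlam H t)"
  have e: "e \<in> tpower H (Suc n)" unfolding e_def by (intro tE_tpower one_minus_tlam[OF assms])
  have "tdown H (Suc n) (tins H t) = tnorm H (Suc n) (t - tlam H t) - tnorm H (Suc n) (tins H e - tlast H e)"
    unfolding tdown_def tE_tins_one_minus_tlam[OF assms] e_def[symmetric]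
    by (simp add: linop_diff[OF linop_tnorm])
  also have "tnorm H (Suc n) (t - tlam H t) = 0"
    using tnorm_tlam(1)[OF assms] by (simp add: linop_diff[OF linop_tnorm])
  finally show ?thesis unfolding tnorm_tins[OF e] by (simp add: tdown_def e_def)
qed

lemma tdown_tins_0:
  assumes "t \<in> tpower H (Suc 0)" shows "tdown H 0 (tins H t) = 0"
proof -
  have "t - tlam H t = 0" using tlam_cyclic[OF assms] by simp
  then show ?thesis unfolding tdown_def tE_tins_one_minus_tlam[OF assms]
    by (simp add: op_lin_simps2 op_lin_simps4 linop_zero[OF linop_tnorm])
qed

lemma tdown_tdown:
  assumes "t \<in> tpower H (Suc (Suc (Suc n)))" shows "tdown H n (tdown H (Suc n) t) = 0"
proof -
  have "tlam H (tdown H (Suc n) t) = tdown H (Suc n) t"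
    unfolding tdown_def by (intro tnorm_tlam(2) tE_tpower one_minus_tlam assms)
  then show ?thesis unfolding tdown_def[of H n] by (simp add: op_lin_simps2 linop_zero[OF linop_tnorm])
qed

lemma tsg_tapp_last:
  assumes "t \<in> tpower H (Suc n)" "x \<in> carrier H" shows "tsg H n (tapp H t x) = trm H x t"
proof (rule tpower_eqI[OF _ _ _ assms(1)])
  show "tsg H n (tapp H (tens H xs) x) = trm H x (tens H xs)" if "set xs \<subseteq> carrier H" "length xs = Suc n" for xs
    using that
  proof (induction n arbitrary: xs)
    case 0
    then obtain y where "xs = [y]" by (auto simp: length_Suc_conv)
    then show ?case using 0 assms(2) by (simp add: tsg_tens)
  next
    case (Suc n)
    then obtain y z zs where y: "xs = y # z # zs" by (metis length_Suc_conv)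
    then show ?case using Suc.prems Suc.IH[of "z # zs"] assms(2)
      by (simp add: tens_Cons op_comm_TT op_comm_TN del: tpre_tens)
  qed
qed (intro linop_intros)+

text \<open>This matches the definition of the extra codegeneracy as the last codegeneracy after the
  cyclic operator, and it reduces coinvariance of \<open>tE\<close> to that of \<open>tsg\<close>
  and \<open>trot\<close>.\<close>

lemma tE_tsg_trot:
  assumes "t \<in> tpower H (Suc (Suc n))" shows "tE H t = tsg H n (trot H t)"
proof (rule tpower_eqI[OF _ _ _ assms])
  fix xs assume xs: "set xs \<subseteq> carrier H" "length xs = Suc (Suc n)"
  then obtain x ys where "xs = x # ys" "length ys = Suc n" by (auto simp: length_Suc_conv)
  then show "tE H (tens H xs) = tsg H n (trot H (tens H xs))"
    using tsg_tapp_last[OF tens_in_tpower[of ys H "Suc n"], of x] xs by simp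
qed (intro linop_intros)+

lemma tE_trot:
  assumes "t \<in> tpower H (Suc (Suc n))" shows "tE H (trot H t) = trot H (tsg H 0 t)"
proof (rule tpower_eqI[OF _ _ _ assms])
  fix xs assume xs: "set xs \<subseteq> carrier H" "length xs = Suc (Suc n)"
  then obtain x y ys where "xs = x # y # ys" by (metis length_Suc_conv)
  then show "tE H (trot H (tens H xs)) = trot H (tsg H 0 (tens H xs))"
    using xs by (simp add: tsg_tens)
qed (intro linop_intros)+

lemma Rco_eq: "Rco H n = Wco H n \<inter> formspan n"
  by (auto simp: Rco_def Wco_def formspan_eq)

lemma Rco_Wco: "t \<in> Rco H n \<Longrightarrow> t \<in> Wco H n" and Rco_formspan: "t \<in> Rco H n \<Longrightarrow> t \<in> formspan n"
  by (auto simp: Rco_eq)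

lemma tins_Rco: "t \<in> Rco H n \<Longrightarrow> tins H t \<in> Rco H (Suc n)"
  using tins_Wco tins_formspan by (auto simp: Rco_eq)

text \<open>On forms \<open>tE\<close> after a rotation vanishes, since it multiplies the first two
  factors, so \<open>1 - \<lambda>\<close> may be dropped. Further
  \<open>\<kappa>' = \<lambda> - last b'\<close> agrees with \<open>\<lambda>\<close> on the kernel
  of \<open>b'\<close>, where all powers in question live; so the cyclic norm is the sum of powers
  of \<open>\<kappa>'\<close>.\<close>

lemma tdown_Rco:
  assumes "t \<in> Rco H (Suc n)" shows "tdown H n t = ksum (tE H) (tins H) n (tE H t)"
proof -
  have f: "t \<in> formspan (Suc n)" and p: "t \<in> tpower H (Suc (Suc n))"
    using Rco_formspan[OF assms] formspan_tpower by auto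
  have "tE H (tlam H t) = 0"
    using tE_trot[OF p] f by (simp add: tlam_eq[OF p] op_lin_simps2 formspan_eq)
  then have "tdown H n t = tnorm H n (tE H t)" by (simp add: tdown_def op_lin_simps2)
  also have "(tlam H ^^ j) (tE H t) = (tkar H ^^ j) (tE H t)" for j
  proof (induction j)
    case (Suc j)
    have k: "(tkar H ^^ j) t \<in> formspan (Suc n)" by (rule tkar_pow_formspan[OF f])
    then have "(tkar H ^^ j) (tE H t) \<in> formspan n" "tE H ((tkar H ^^ j) (tE H t)) = 0"
      using tkar_pow_tE[OF f, of j] tE_formspan tE_tE_formspan by auto
    then show ?case using tkar_tlam[OF formspan_tpower] Suc by (simp add: op_lin_simps4)
  qed simp
  then have "tnorm H n (tE H t) = ksum (tE H) (tins H) n (tE H t)"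
    by (simp add: tnorm_def ksum_def kar_def[abs_def] tkar_def[abs_def])
  finally show ?thesis .
qed

end

context involutive_hopf_algebra
begin

lemma cocyc_TT: assumes "t \<in> TT H" shows "cocyc H t \<in> TT H"
proof (rule TT_into[OF linop_cocyc TT_subspace _ assms])
  fix xs assume "set xs \<subseteq> carrier H"
  then show "cocyc H (tens H xs) \<in> TT H"
    by (cases xs) (simp_all add: tens_Cons cocyc_tpre del: tpre_tens)
qed

lemma trot_Wco:
  assumes "t \<in> Wco H n" shows "trot H t \<in> Wco H n"
proof -
  have p: "tpsi H t \<in> TT H" by (rule tpower_TT[OF Wco_tpsi[OF assms]])
  have "trot H t = tphi H (cocyc H (tpsi H t))"
    using trot_tphi[OF p] Wco_tphi[OF assms] by simp
  then show ?thesis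
    using tphi_TT_tpower_Wco[OF cocyc_TT[OF p]] trot_tpower[OF Wco_tpower[OF assms]] by metis
qed

lemma tlam_Wco: "t \<in> Wco H n \<Longrightarrow> tlam H t \<in> Wco H n"
  using trot_Wco by (simp add: tlam_eq[OF Wco_tpower] fs.subspace_scale[OF Wco_subspace])

lemma tnorm_Wco: assumes "t \<in> Wco H n" shows "tnorm H m t \<in> Wco H n"
proof -
  have "(tlam H ^^ j) t \<in> Wco H n" for j by (induction j) (simp_all add: assms tlam_Wco)
  then show ?thesis unfolding tnorm_def by (intro fs.subspace_sum[OF Wco_subspace])
qed

lemma tE_Wco: "t \<in> Wco H (Suc n) \<Longrightarrow> tE H t \<in> Wco H n"
  using tsg_Wco[OF trot_Wco] by (simp add: tE_tsg_trot[OF Wco_tpower])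

lemma tE_Rco: "t \<in> Rco H (Suc n) \<Longrightarrow> tE H t \<in> Rco H n"
  using tE_Wco tE_formspan by (auto simp: Rco_eq)

lemma tdown_Wco: "t \<in> Wco H (Suc n) \<Longrightarrow> tdown H n t \<in> Wco H n"
  unfolding tdown_def by (intro tnorm_Wco tE_Wco fs.subspace_diff[OF Wco_subspace] tlam_Wco)

lemma mixed_Wco: "mixed_complex (Wco H) (tdown H) (\<lambda>_. tins H)"
  unfolding mixed_complex_def
proof (intro conjI allI ballI image_subsetI)
  show "fs.subspace (Wco H n)" for n by (rule Wco_subspace)
  show "linear_on (Wco H (Suc n)) (tdown H n)" for n by (rule linop_linear_on[OF linop_tdown])
  show "linear_on (Wco H n) (tins H)" for n by (rule linop_linear_on[OF linop_basic(5)])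
  show "tdown H n (tdown H (Suc n) x) = 0" if "x \<in> Wco H (Suc (Suc n))" for n x
    by (rule tdown_tdown[OF Wco_tpower[OF that]])
  show "tins H (tins H x) = 0" if "x \<in> Wco H n" for n x
    by (rule tins_tins[OF tpower_TT[OF Wco_tpower[OF that]]])
  show "tdown H (Suc n) (tins H x) + tins H (tdown H n x) = 0" if "x \<in> Wco H (Suc n)" for n x
    by (rule tdown_tins[OF Wco_tpower[OF that]])
  show "tdown H 0 (tins H x) = 0" if "x \<in> Wco H 0" for x
    by (rule tdown_tins_0[OF Wco_tpower[OF that]])
qed (simp_all add: tdown_Wco tins_Wco)

lemma tdown_in_Rco:
  assumes "x \<in> Rco H (Suc n)" shows "tdown H n x \<in> Rco H n"
proof -
  have "(tkar H ^^ j) (tE H x) \<in> formspan n" for j by (rule tkar_pow_formspan[OF tE_formspan[OF Rco_formspan[OF assms]]])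
  then have "tdown H n x \<in> formspan n"
    unfolding tdown_Rco[OF assms] ksum_def kar_def[abs_def] tkar_def[abs_def] by (intro fs.subspace_sum[OF formspan_subspace])
  then show ?thesis using tdown_Wco[OF Rco_Wco[OF assms]] by (simp add: Rco_eq)
qed

end

section \<open>Normalized cochains with finite support\<close>

text \<open>A cochain is moved into \<open>R\<close> from the top degree downwards, which terminates only for cochains of
  finite support.\<close>

lemma cp_sum_inclusion_quasi_iso:
  assumes W: "mixed_complex W l u" and l: "\<And>n. linop (l n)" and u: "\<And>n. linop (u n)"
    and R: "\<And>n. fs.subspace (R n)" "\<And>n. R n \<subseteq> W n" "W 0 \<subseteq> R 0"
    and lR: "\<And>n x. x \<in> R (Suc n) \<Longrightarrow> l' n x = l n x \<and> l n x \<in> R n"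
    and uR: "\<And>n x. x \<in> R n \<Longrightarrow> u n x \<in> R (Suc n)"
    and norm: "\<And>n x. x \<in> W (Suc n) \<Longrightarrow> u (Suc n) x \<in> R (Suc (Suc n)) \<Longrightarrow> \<exists>y\<in>W n. x - u n y \<in> R (Suc n)"
  shows "quasi_iso (cp True R l' u) (cp True W l u) (\<lambda>x. x)"
proof -
  have SL: "is_supercomplex (cp True W l u)" by (rule is_supercomplex_cp[OF W l u])
  have cl: "clin (total_diff l u)" by (rule clin_total_diff[OF l u])
  have Wsub: "fs.subspace (W n)" for n using W by (simp add: mixed_complex_def)
  have dd: "total_diff l u (total_diff l u x) = 0" and d_in: "total_diff l u x \<in> cp_space True W (1 - i)"
    if i: "i \<in> {0, 1}" and x: "x \<in> cp_space True W i" for i x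
  proof -
    have "x \<in> fst (cp True W l u) i" using x by (simp add: cp_def)
    note SL[unfolded is_supercomplex_def, THEN conjunct2, THEN bspec, OF i, THEN conjunct2, THEN bspec, OF this]
    then show "total_diff l u (total_diff l u x) = 0" "total_diff l u x \<in> cp_space True W (1 - i)"
      by (simp_all add: cp_def)
  qed
  have RW: "x \<in> cp_space True W i" if "x \<in> cp_space True R i" for x i
    using that R(2) by (auto simp: cp_space_def parity_prod_def)
  have dR: "total_diff l' u x = total_diff l u x \<and> total_diff l u x \<in> cp_space True R (1 - i)"
    if "i \<in> {0, 1}" "x \<in> cp_space True R i" for i x
  proof
    have "x n \<in> R n" for n by (rule cp_spaceD(1)[OF that(2)])
    then show "total_diff l' u x = total_diff l u x" using lR by (simp add: total_diff_def)
    show "total_diff l u x \<in> cp_space True R (1 - i)"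
      by (rule total_diff_in[where C = R and l = l and u = u, OF R(1) _ uR linop_zero[OF l] linop_zero[OF u] that]) (use lR in auto)
  qed
  \<comment> \<open>Induction on a bound \<open>N\<close> from which on all components lie in
    \<open>R\<close>; at \<open>N = 0\<close> the cochain itself is normalized.\<close>
  have push: "\<exists>y\<in>cp_space True W (1 - i). x - total_diff l u y \<in> cp_space True R i"
    if i: "i \<in> {0, 1}" and "x \<in> cp_space True W i" "\<And>n. total_diff l u x n \<in> R n" "\<And>n. n \<ge> N \<Longrightarrow> x n \<in> R n" for i x N
    using that(2-4)
  proof (induction N arbitrary: x)
    case 0
    have "0 \<in> cp_space True W (1 - i)" by (rule csubD(1)[OF csub_cp_space[OF Wsub]])
    moreover have "x - total_diff l u 0 \<in> cp_space True R i"
      using 0 by (auto simp: clin_0[OF cl] cp_space_def parity_prod_def)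
    ultimately show ?case by blast
  next
    case (Suc N)
    note x = Suc.prems
    have "\<exists>y\<in>cp_space True W (1 - i). \<forall>n\<ge>N. (x - total_diff l u y) n \<in> R n"
    proof (cases "x N \<in> R N")
      case True
      have "x n \<in> R n" if "n \<ge> N" for n using x(3)[of n] True that by (cases "n = N") auto
      moreover have "0 \<in> cp_space True W (1 - i)" by (rule csubD(1)[OF csub_cp_space[OF Wsub]])
      ultimately show ?thesis by (intro bexI[of _ 0]) (auto simp: clin_0[OF cl])
    next
      case False
      have "x 0 \<in> R 0" by (rule subsetD[OF R(3) cp_spaceD(1)[OF x(1)]])
      then have "N \<noteq> 0" using False by metis
      then obtain m where N: "N = Suc m" by (cases N) auto
      have par: "N mod 2 = i" using False cp_spaceD(2)[OF x(1), of N] fs.subspace_0[OF R(1), of N] by metis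
      \<comment> \<open>The component of the boundary in degree \<open>N + 1\<close> is
        \<open>l x_(N+2) + u x_N\<close>. As \<open>x_(N+2)\<close> lies in \<open>R\<close>
        already, so does \<open>u x_N\<close>, and \<open>norm\<close> applies.\<close>
      have "total_diff l u x (Suc N) - l (Suc N) (x (Suc (Suc N))) \<in> R (Suc N)"
        using x(2) lR[OF x(3)[of "Suc (Suc N)"]] by (intro fs.subspace_diff[OF R(1)]) auto
      then have "u N (x N) \<in> R (Suc N)" by (simp add: total_diff_Suc)
      then obtain y where y: "y \<in> W m" "x N - u m y \<in> R N"
        using norm[of "x N" m] cp_spaceD(1)[OF x(1), of N] N by auto
      \<comment> \<open>A correction concentrated in degree \<open>N - 1\<close> has its boundary in
        degrees \<open>N - 2\<close> and \<open>N\<close>, so the components above \<open>N\<close>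
        are untouched.\<close>
      define Y where "Y = (\<lambda>n. if n = m then y else 0)"
      have "m mod 2 = 1 - i" using par N i by auto presburger+
      then have "Y \<in> cp_space True W (1 - i)" using y(1) fs.subspace_0[OF Wsub]
        by (auto simp: Y_def cp_space_def parity_prod_def)
      moreover have "(x - total_diff l u Y) n \<in> R n" if nN: "n \<ge> N" for n
      proof (cases "n = N")
        case True
        then show ?thesis using y(2) N by (simp add: cochain_minus total_diff_Suc Y_def linop_zero[OF l])
      next
        case False
        then obtain k where "n = Suc k" "k > m" using nN N by (cases n) auto
        then show ?thesis using x(3)[of n] nN False
          by (simp add: cochain_minus total_diff_Suc Y_def linop_zero[OF l] linop_zero[OF u])
      qed
      ultimately show ?thesis by blast
    qed
    then obtain y where y: "y \<in> cp_space True W (1 - i)" "\<And>n. n \<ge> N \<Longrightarrow> (x - total_diff l u y) n \<in> R n" by blast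
    have i': "1 - i \<in> {0, 1}" by (rule parity_cases(1)[OF i])
    have dy: "total_diff l u y \<in> cp_space True W i" "total_diff l u (total_diff l u y) = 0"
      using d_in[OF i' y(1)] dd[OF i' y(1)] parity_cases(2)[OF i] by auto
    have "x - total_diff l u y \<in> cp_space True W i"
      by (rule csub_diff[OF csub_cp_space[OF Wsub] x(1) dy(1)])
    moreover have "total_diff l u (x - total_diff l u y) = total_diff l u x" by (simp add: clin_diff[OF cl] dy(2))
    ultimately obtain z where z: "z \<in> cp_space True W (1 - i)" "x - total_diff l u y - total_diff l u z \<in> cp_space True R i"
      using Suc.IH[of "x - total_diff l u y"] x(2) y(2) by auto
    have "x - total_diff l u (y + z) \<in> cp_space True R i" using z(2) by (simp add: clinD(1)[OF cl] diff_diff_eq)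
    then show ?case using csubD(2)[OF csub_cp_space[OF Wsub] y(1) z(1)] by blast
  qed
  have push': "\<exists>y\<in>cp_space True W (1 - i). x - total_diff l u y \<in> cp_space True R i"
    if i: "i \<in> {0, 1}" and x: "x \<in> cp_space True W i" "\<And>n. total_diff l u x n \<in> R n" for i x
  proof -
    have "finite {n. x n \<noteq> 0}" using x(1) by (simp add: cp_space_def)
    then obtain N where N: "\<And>n. x n \<noteq> 0 \<Longrightarrow> n < N" by (meson finite_nat_set_iff_bounded mem_Collect_eq)
    have "x n \<in> R n" if "n \<ge> N" for n using N[of n] that fs.subspace_0[OF R(1)] by (cases "x n = 0") auto
    then show ?thesis by (rule push[OF i x])
  qed
  show ?thesis unfolding quasi_iso_def
  proof (intro conjI ballI impI)
    show "clin (\<lambda>x. x)" by (simp add: clin_def)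
    fix i :: nat assume i: "i \<in> {0, 1}"
    have i': "1 - i \<in> {0, 1}" by (rule parity_cases(1)[OF i])
    show "x \<in> fst (cp True W l u) i" "snd (cp True W l u) x = snd (cp True R l' u) x"
      if "x \<in> fst (cp True R l' u) i" for x
      using that RW dR[OF i, of x] by (auto simp: cp_def)
    show "x \<in> coboundaries (cp True R l' u) i"
      if xc: "x \<in> cocycles (cp True R l' u) i" and xb: "x \<in> coboundaries (cp True W l u) i" for x
    proof -
      have x: "x \<in> cp_space True R i" using xc by (simp add: cocycles_def cp_def)
      obtain w where w: "w \<in> cp_space True W (1 - i)" "x = total_diff l u w"
        using xb by (auto simp: coboundaries_def cp_def)
      \<comment> \<open>The primitive \<open>w\<close> has a boundary in \<open>R\<close>, so it can
        be moved into \<open>R\<close> by subtracting a coboundary, which leaves its own boundary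
        unchanged.\<close>
      then obtain y where y: "y \<in> cp_space True W (1 - (1 - i))" "w - total_diff l u y \<in> cp_space True R (1 - i)"
        using push'[OF i' w(1)] cp_spaceD(1)[OF x] by auto
      have "total_diff l u (total_diff l u y) = 0" using dd[OF i, of y] y(1) parity_cases(2)[OF i] by auto
      then have "total_diff l' u (w - total_diff l u y) = x"
        using dR[OF i' y(2)] w(2) by (simp add: clin_diff[OF cl])
      then show ?thesis using y(2) by (auto simp: coboundaries_def cp_def)
    qed
    show "\<exists>x\<in>cocycles (cp True R l' u) i. x - y \<in> coboundaries (cp True W l u) i"
      if "y \<in> cocycles (cp True W l u) i" for y
    proof -
      have y: "y \<in> cp_space True W i" "total_diff l u y = 0" using that by (auto simp: cocycles_def cp_def)
      then obtain w where w: "w \<in> cp_space True W (1 - i)" "y - total_diff l u w \<in> cp_space True R i"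
        using push'[OF i y(1)] fs.subspace_0[OF R(1)] by (auto simp: zero_fun_def)
      have "total_diff l' u (y - total_diff l u w) = 0"
        using dR[OF i w(2)] dd[OF i' w(1)] y(2) by (simp add: clin_diff[OF cl])
      moreover have "- w \<in> cp_space True W (1 - i)" by (rule csub_uminus[OF csub_cp_space[OF Wsub] w(1)])
      then have "total_diff l u (- w) \<in> coboundaries (cp True W l u) i" by (auto simp: coboundaries_def cp_def)
      then have "y - total_diff l u w - y \<in> coboundaries (cp True W l u) i"
        using clin_diff[OF cl, of 0 w] by (simp add: clin_0[OF cl])
      ultimately show ?thesis using w(2) by (intro bexI[of _ "y - total_diff l u w"]) (auto simp: cocycles_def cp_def)
    qed
  qed
qed

lemma (in involutive_hopf_algebra) Rco_Wco_quasi_iso: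
  "quasi_iso (cp True (Rco H) (\<lambda>n x. ksum (tE H) (tins H) n (tE H x)) (\<lambda>_. tins H)) (cp True (Wco H) (tdown H) (\<lambda>_. tins H)) (\<lambda>x. x)"
proof (rule cp_sum_inclusion_quasi_iso[OF mixed_Wco linop_tdown linop_basic(5) Rco_subspace])
  show "Rco H n \<subseteq> Wco H n" for n by (simp add: Rco_eq)
  show "Wco H 0 \<subseteq> Rco H 0" using Wco_0 by blast
  show "ksum (tE H) (tins H) n (tE H x) = tdown H n x \<and> tdown H n x \<in> Rco H n" if "x \<in> Rco H (Suc n)" for n x
    using tdown_Rco[OF that] tdown_in_Rco[OF that] by simp
qed (simp_all add: tins_Rco normalize)

section \<open>Comparison with the cocyclic module\<close>

text \<open>Every identity is pulled back along the degreewise injective maps \<open>S\<close>,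
  including linearity of \<open>l'\<close> and \<open>u'\<close> on \<open>C'\<close>. In this way
  the Hopf mixed complex is obtained from the coinvariant tensors, with no computation with the
  cocyclic identities.\<close>

lemma mixed_complex_transport:
  assumes m: "mixed_complex C l u" and C': "\<And>n. fs.subspace (C' n)" and S: "\<And>n. linop (S n)"
    and SC: "\<And>n x. x \<in> C' n \<Longrightarrow> S n x \<in> C n" and inj: "\<And>n x. x \<in> C' n \<Longrightarrow> S n x = 0 \<Longrightarrow> x = 0"
    and l': "\<And>n x. x \<in> C' (Suc n) \<Longrightarrow> l' n x \<in> C' n \<and> S n (l' n x) = l n (S (Suc n) x)"
    and u': "\<And>n x. x \<in> C' n \<Longrightarrow> u' n x \<in> C' (Suc n) \<and> S (Suc n) (u' n x) = u n (S n x)"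
  shows "mixed_complex C' l' u'"
proof -
  note mD = m[unfolded mixed_complex_def]
  have eqI: "x = y" if "x \<in> C' n" "y \<in> C' n" "S n x = S n y" for n x y
    using inj[OF fs.subspace_diff[OF C' that(1,2)]] that(3) by (simp add: linop_diff[OF S])
  have lin: "linear_on (C' p) f"
    if f: "\<And>x. x \<in> C' p \<Longrightarrow> f x \<in> C' q \<and> S q (f x) = g (S p x)" and g: "linear_on (C p) g" for f g p q
    unfolding linear_on_def
  proof (intro conjI ballI allI)
    fix x y c assume x: "x \<in> C' p"
    show "f (c *\<^sub>k x) = c *\<^sub>k f x"
      by (rule eqI[of _ q]) (use x f[OF x] f[OF fs.subspace_scale[OF C' x], of c] g SC[OF x] fs.subspace_scale[OF C', of "f x" q c]
        in \<open>simp_all add: linop_scale[OF S] linear_on_def\<close>)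
    assume y: "y \<in> C' p"
    show "f (x + y) = f x + f y"
      by (rule eqI[of _ q]) (use f[OF x] f[OF y] f[OF fs.subspace_add[OF C' x y]] g SC[OF x] SC[OF y] fs.subspace_add[OF C', of "f x" q "f y"]
        in \<open>simp_all add: linop_add[OF S] linear_on_def\<close>)
  qed
  show ?thesis unfolding mixed_complex_def
  proof (intro conjI allI ballI image_subsetI)
    fix n
    show "linear_on (C' (Suc n)) (l' n)" by (rule lin[of _ _ n "l n"]) (use l' mD in blast)+
    show "linear_on (C' n) (u' n)" by (rule lin[of _ _ "Suc n" "u n"]) (use u' mD in blast)+
    show "l' n (l' (Suc n) x) = 0" if x: "x \<in> C' (Suc (Suc n))" for x
    proof -
      have "l n (l (Suc n) (S (Suc (Suc n)) x)) = 0" using mD SC[OF x] by blast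
      then show ?thesis using l'[OF x] l'[of "l' (Suc n) x" n] by (intro inj[of _ n]) simp_all
    qed
    show "u' (Suc n) (u' n x) = 0" if x: "x \<in> C' n" for x
    proof -
      have "u (Suc n) (u n (S n x)) = 0" using mD SC[OF x] by blast
      then show ?thesis using u'[OF x] u'[of "u' n x" "Suc n"] by (intro inj[of _ "Suc (Suc n)"]) simp_all
    qed
    show "l' (Suc n) (u' (Suc n) x) + u' n (l' n x) = 0" if x: "x \<in> C' (Suc n)" for x
    proof -
      have "l (Suc n) (u (Suc n) (S (Suc n) x)) + u n (l n (S (Suc n) x)) = 0" using mD SC[OF x] by blast
      then show ?thesis using u'[OF x] l'[OF x] u'[of "l' n x" n] l'[of "u' (Suc n) x" "Suc n"]
        by (intro inj[of _ "Suc n"]) (simp_all add: linop_add[OF S] fs.subspace_add[OF C'])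
    qed
  next
    show "l' 0 (u' 0 x) = 0" if x: "x \<in> C' 0" for x
    proof -
      have "l 0 (u 0 (S 0 x)) = 0" using mD SC[OF x] by blast
      then show ?thesis using u'[OF x] l'[of "u' 0 x" 0] by (intro inj[of _ 0]) simp_all
    qed
  qed (use l' u' C' in auto)
qed

lemma mixed_complex_cong:
  assumes "mixed_complex C l u"
    and "\<And>n x. x \<in> C (Suc n) \<Longrightarrow> l' n x = l n x" "\<And>n x. x \<in> C n \<Longrightarrow> u' n x = u n x"
  shows "mixed_complex C l' u'"
proof (rule mixed_complex_transport[OF assms(1), of C "\<lambda>_ x. x"])
  note mD = assms(1)[unfolded mixed_complex_def]
  show "fs.subspace (C n)" for n using mD by blast
  show "l' n x \<in> C n \<and> l' n x = l n x" if "x \<in> C (Suc n)" for n x using mD assms(2)[OF that] that by (auto simp: image_subset_iff)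
  show "u' n x \<in> C (Suc n) \<and> u' n x = u n x" if "x \<in> C n" for n x using mD assms(3)[OF that] that by (auto simp: image_subset_iff)
qed (simp_all add: linop_id)

context hopf_algebra
begin

lemma tphi_inj: "x \<in> TT H \<Longrightarrow> tphi H x = 0 \<Longrightarrow> x = 0"
  using tpsi_tphi[of x] by (simp add: op_lin_simps2)

text \<open>\<open>tpsi\<close> recovers \<open>x\<close> and lowers the degree by one, so a degree
  can be determined after applying \<open>tphi\<close>.\<close>

lemma tphi_eq_tpower: "x \<in> TT H \<Longrightarrow> tphi H x \<in> tpower H (Suc n) \<Longrightarrow> x \<in> tpower H n"
  using tpsi_tpower[of "tphi H x"] by simp

lemma hopf_up_tpower: "v \<in> tpower H n \<Longrightarrow> hopf_up H n v \<in> tpower H (Suc n)"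
  by (rule tphi_eq_tpower[OF hopf_up_TT]) (simp_all add: tins_tphi[symmetric])

lemma hopf_normalized_iff:
  assumes "v \<in> tpower H n" shows "v \<in> hopf_normalized H n \<longleftrightarrow> tphi H v \<in> Rco H n"
proof
  assume v: "v \<in> hopf_normalized H n"
  have "tsg H i (tphi H v) = 0" for i
  proof (cases "i < n")
    case True
    then show ?thesis using v by (simp add: tsg_tphi[OF assms] hopf_normalized_def op_lin_simps2)
  next
    case False
    then show ?thesis by (intro tsg_high[OF tphi_tpower[OF assms]]) simp
  qed
  then show "tphi H v \<in> Rco H n" using tphi_Wco[OF assms] by (simp add: Rco_def)
next
  assume v: "tphi H v \<in> Rco H n"
  have "codegen H (Suc i) v = 0" if "i < n" for i
    by (rule tphi_inj[OF codegen_TT[OF assms that]]) (use v in \<open>simp add: tsg_tphi[OF assms that, symmetric] Rco_def\<close>)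
  then have "codegen H i v = 0" if "i \<in> {1..n}" for i using that by (cases i) auto
  then show "v \<in> hopf_normalized H n" using assms by (simp add: hopf_normalized_def)
qed

lemma hopf_normalized_tpower: "v \<in> hopf_normalized H n \<Longrightarrow> v \<in> tpower H n"
  by (simp add: hopf_normalized_def)

lemma hopf_normalized_subspace: "fs.subspace (hopf_normalized H n)"
proof -
  have "hopf_normalized H n = {v \<in> tpower H n. tphi H v \<in> Rco H n}"
    using hopf_normalized_iff hopf_normalized_tpower by blast
  then show ?thesis
    using tpower_subspace[of H n] Rco_subspace[of n] by (simp add: fs.subspace_def op_lin_simps2)
qed

lemma linop_cocyc_norm: "linop (cocyc_norm H n)"
proof -
  have "linop (\<lambda>t. \<Sum>i\<le>n. (-1) ^ (i * n) *\<^sub>k (cocyc H ^^ i) t)"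
    by (intro linop_sumI linop_intros linop_funpow[OF linop_cocyc linop_id])
  then show ?thesis by (simp add: cocyc_norm_def[abs_def])
qed

lemma linop_extra_codegen: "linop (extra_codegen H n)"
proof -
  have "linop (\<lambda>t. codegen H (n + 1) (cocyc H t))" by (rule linop_compose[OF linop_codegen linop_cocyc])
  then show ?thesis by (simp add: extra_codegen_def[abs_def])
qed

lemma linop_hopf_down: "linop (hopf_down H n)"
proof -
  have "linop (\<lambda>t. cocyc_norm H n (extra_codegen H n (t - (-1) ^ (n + 1) *\<^sub>k cocyc H t)))"
    by (intro linop_compose[OF linop_cocyc_norm] linop_compose[OF linop_extra_codegen] linop_intros linop_cocyc)
  then show ?thesis by (simp add: hopf_down_def[abs_def])
qed

end

context involutive_hopf_algebra
begin

lemma cocyc_tpower: "v \<in> tpower H n \<Longrightarrow> cocyc H v \<in> tpower H n"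
  by (rule tphi_eq_tpower[OF cocyc_TT[OF tpower_TT]]) (simp_all add: trot_tphi[OF tpower_TT, symmetric])

lemma extra_codegen_TT: "v \<in> tpower H (Suc n) \<Longrightarrow> extra_codegen H n v \<in> TT H"
  using codegen_TT[OF cocyc_tpower] by (simp add: extra_codegen_def)

lemma tphi_extra_codegen:
  assumes v: "v \<in> tpower H (Suc n)" shows "tphi H (extra_codegen H n v) = tE H (tphi H v)"
  using tsg_tphi[OF cocyc_tpower[OF v], of n] trot_tphi[OF tpower_TT[OF v]] tE_tsg_trot[OF tphi_tpower[OF v]]
  by (simp add: extra_codegen_def)

lemma extra_codegen_tpower: "v \<in> tpower H (Suc n) \<Longrightarrow> extra_codegen H n v \<in> tpower H n"
  by (rule tphi_eq_tpower[OF extra_codegen_TT]) (simp_all add: tphi_extra_codegen)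

lemma cocyc_pow_tpower: "v \<in> tpower H n \<Longrightarrow> (cocyc H ^^ i) v \<in> tpower H n"
  by (induction i) (simp_all add: cocyc_tpower)

lemma tphi_cocyc_norm:
  assumes v: "v \<in> tpower H n" shows "tphi H (cocyc_norm H n v) = tnorm H n (tphi H v)"
proof -
  have p: "tphi H ((cocyc H ^^ i) v) = (trot H ^^ i) (tphi H v)" for i
  proof (induction i)
    case (Suc i)
    then show ?case using trot_tphi[OF tpower_TT[OF cocyc_pow_tpower[OF v]], of i] by simp
  qed simp
  have l: "linop (tphi H)" by (rule linop_basic(2))
  show ?thesis unfolding cocyc_norm_def tnorm_def linop_sum[OF l] linop_scale[OF l] p
    by (intro sum.cong refl) (simp add: tlam_pow_eq[OF tphi_tpower[OF v]] mult.commute)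
qed

lemma hopf_down_tphi:
  assumes v: "v \<in> tpower H (Suc n)"
  shows "hopf_down H n v \<in> tpower H n" "tphi H (hopf_down H n v) = tdown H n (tphi H v)"
proof -
  define w where "w = v - (-1) ^ (n + 1) *\<^sub>k cocyc H v"
  have w: "w \<in> tpower H (Suc n)" unfolding w_def
    by (intro fs.subspace_diff[OF tpower_subspace] fs.subspace_scale[OF tpower_subspace] v cocyc_tpower)
  \<comment> \<open>\<open>tphi H v\<close> has \<open>n + 2\<close> factors, so \<open>tlam\<close>
    carries the sign \<open>(-1) ^ (n + 1)\<close> that stands in \<open>hopf_down\<close>.\<close>
  have "tphi H w = tphi H v - tlam H (tphi H v)"
    using trot_tphi[OF tpower_TT[OF v]] by (simp add: w_def op_lin_simps2 tlam_eq[OF tphi_tpower[OF v]])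
  then show "tphi H (hopf_down H n v) = tdown H n (tphi H v)"
    unfolding hopf_down_def w_def[symmetric] tdown_def
    by (simp add: tphi_cocyc_norm[OF extra_codegen_tpower[OF w]] tphi_extra_codegen[OF w])
  show "hopf_down H n v \<in> tpower H n"
    unfolding hopf_down_def w_def[symmetric] cocyc_norm_def
    by (intro fs.subspace_sum[OF tpower_subspace] fs.subspace_scale[OF tpower_subspace] cocyc_pow_tpower extra_codegen_tpower w)
qed

lemma mixed_tpower: "mixed_complex (tpower H) (hopf_down H) (hopf_up H)"
  by (rule mixed_complex_transport[OF mixed_Wco tpower_subspace linop_basic(2)])
    (auto simp: tphi_Wco tins_tphi hopf_down_tphi hopf_up_tpower intro: tphi_inj tpower_TT)

lemma Rco_tpsi: "x \<in> Rco H n \<Longrightarrow> tpsi H x \<in> hopf_normalized H n"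
  using hopf_normalized_iff[OF Wco_tpsi[OF Rco_Wco]] Wco_tphi[OF Rco_Wco] by simp

lemma hopf_normalized_down_up:
  shows "v \<in> hopf_normalized H (Suc n) \<Longrightarrow> hopf_down H n v \<in> hopf_normalized H n \<and>
      tphi H (hopf_down H n v) = ksum (tE H) (tins H) n (tE H (tphi H v))"
    and "v \<in> hopf_normalized H n \<Longrightarrow> hopf_up H n v \<in> hopf_normalized H (Suc n)"
proof -
  assume n: "v \<in> hopf_normalized H (Suc n)"
  then have v: "v \<in> tpower H (Suc n)" by (rule hopf_normalized_tpower)
  have r: "tphi H v \<in> Rco H (Suc n)" using n hopf_normalized_iff[OF v] by simp
  show "hopf_down H n v \<in> hopf_normalized H n \<and>
      tphi H (hopf_down H n v) = ksum (tE H) (tins H) n (tE H (tphi H v))"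
    using hopf_down_tphi[OF v] tdown_Rco[OF r] tdown_in_Rco[OF r] hopf_normalized_iff by auto
next
  assume n: "v \<in> hopf_normalized H n"
  then have v: "v \<in> tpower H n" by (rule hopf_normalized_tpower)
  show "hopf_up H n v \<in> hopf_normalized H (Suc n)"
    using n hopf_normalized_iff[OF v] hopf_normalized_iff[OF hopf_up_tpower[OF v]] tins_Rco
    by (simp add: tins_tphi[OF v, symmetric])
qed

end

section \<open>The invariant subalgebras\<close>

lemma linop_image_subspace:
  assumes f: "linop f" and V: "fs.subspace V" shows "fs.subspace (f ` V)"
  unfolding fs.subspace_def
proof (intro conjI ballI allI)
  show "0 \<in> f ` V" using fs.subspace_0[OF V] linop_zero[OF f] by (metis imageI)
  fix x assume "x \<in> f ` V"
  then obtain u where u: "u \<in> V" "x = f u" by blast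
  show "c *\<^sub>k x \<in> f ` V" for c
    using fs.subspace_scale[OF V u(1)] linop_scale[OF f] u(2) by (metis imageI)
  fix y assume "y \<in> f ` V"
  then obtain v where v: "v \<in> V" "y = f v" by blast
  show "x + y \<in> f ` V"
    using fs.subspace_add[OF V u(1) v(1)] linop_add[OF f] u(2) v(2) by (metis imageI)
qed

lemma fs_span_image_closed:
  assumes "linop f" "A = fs.span S" "\<And>x. x \<in> S \<Longrightarrow> f x \<in> A" "x \<in> A" shows "f x \<in> A"
proof -
  have "x \<in> fs.span S" using assms by simp
  then show ?thesis
  proof (induction rule: fs.span_induct_alt)
    case base
    show ?case using assms(2) by (simp add: linop_zero[OF assms(1)] fs.span_zero)
  next
    case (step c y z)
    then show ?case using assms(2) assms(3)[OF step(1)]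
      by (simp add: linop_add[OF assms(1)] linop_scale[OF assms(1)] fs.span_add fs.span_scale)
  qed
qed

context involutive_hopf_algebra
begin

text \<open>\<open>tJ\<close> leads from right to left coinvariants, so it cannot be applied step by
  step here. The conjugate of \<open>tE\<close>, however, multiplies the last factor into the first
  one from the left: it is \<open>tsg H 0\<close> after the last factor has been rotated to the
  front, and both of these preserve right coinvariants.\<close>

lemma tF_Rco:
  assumes x: "x \<in> Rco H (Suc n)" shows "tF H x \<in> Rco H n"
proof -
  have W: "x \<in> Wco H (Suc n)" by (rule Rco_Wco[OF x])
  have p: "x \<in> tpower H (Suc (Suc n))" by (rule Wco_tpower[OF W])
  have "tJ H (tE H (tJ H x)) = tsg H 0 ((trot H ^^ Suc n) x)"
  proof (rule tpower_eqI[OF _ _ _ p])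
    show "linop (\<lambda>x. tsg H 0 ((trot H ^^ Suc n) x))"
      by (rule linop_compose[OF linop_basic(8) linop_funpow[OF linop_basic(7) linop_id]])
    fix xs assume xs: "set xs \<subseteq> carrier H" "length xs = Suc (Suc n)"
    define ys z where "ys = butlast xs" and "z = last xs"
    have "xs \<noteq> []" using xs(2) by auto
    then have s: "xs = ys @ [z]" and c: "z \<in> carrier H" "set ys \<subseteq> carrier H" "length ys = Suc n"
      using xs by (auto simp: ys_def z_def)
    have [simp]: "ys \<noteq> []" using c(3) by auto
    have T: "tlm H z (tens H ys) \<in> TT H" using c by simp
    have "(trot H ^^ Suc n) (tens H xs) = tpre H z (tens H ys)"
      unfolding trot_pow_tens s using rotate_append[of ys "[z]"] c by simp
    moreover have "tJ H (tE H (tJ H (tens H xs))) = tJ H (tJ H (tlm H z (tens H ys)))"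
      unfolding s using c tJ_tlm[of "tens H ys" z] by (simp add: antipode_closed)
    ultimately show "tJ H (tE H (tJ H (tens H xs))) = tsg H 0 ((trot H ^^ Suc n) (tens H xs))"
      using tJ_tJ[OF T] c tsg_0_tpre[of "tens H ys" z] by simp
  qed (intro linop_intros)+
  moreover have Wj: "(trot H ^^ j) x \<in> Wco H (Suc n)" for j by (induction j) (simp_all add: W trot_Wco)
  have "tsg H 0 ((trot H ^^ Suc n) x) \<in> Wco H n" by (rule tsg_Wco[OF Wj]) simp
  ultimately have "tF H x \<in> Wco H n" using tF_eq[OF p] by (simp add: fs.subspace_scale[OF Wco_subspace] fs.subspace_neg[OF Wco_subspace])
  then show ?thesis using tF_formspan[OF Rco_formspan[OF x]] by (simp add: Rco_eq)
qed

lemma OmegaR_eq: "OmegaR H = {t \<in> Omega H. tcor H t = tapp H t \<one>}"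
  by (auto simp: OmegaR_def coactR_eq tcat_single_right)

lemma OmegaL_eq: "OmegaL H = {t \<in> Omega H. tcol H t = tpre H \<one> t}"
  by (auto simp: OmegaL_def coactL_eq tcat_single_left)

lemma OmegaR_deg: "OmegaR H \<inter> formspan n = Rco H n"
  using formspan_Omega by (auto simp: OmegaR_eq Rco_eq Wco_def formspan_eq)

lemma tJ_Omega: "t \<in> Omega H \<Longrightarrow> tJ H t \<in> Omega H"
  by (rule Omega_into[OF linop_basic2(4) Omega_subspace])
    (auto intro: formspan_Omega[OF tJ_formspan[OF form_in_formspan[OF _ _ refl]]])

lemma OmegaL_tJ: "OmegaL H = tJ H ` OmegaR H"
proof
  have R: "tJ H t \<in> OmegaR H" if "t \<in> OmegaL H" for t
  proof -
    have t: "t \<in> Omega H" "tcol H t = tpre H \<one> t" and T: "t \<in> TT H" using that by (auto simp: OmegaL_eq)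
    have "tJ H (tcor H (tJ H t)) = tpre H \<one> t" using tJ_tcor[of "tJ H t"] T t by (simp add: tJ_tJ)
    then have "tJ H (tJ H (tcor H (tJ H t))) = tapp H (tJ H t) \<one>" using T by (simp add: tapp_antipode_one)
    then show ?thesis using T t by (simp add: tJ_tJ OmegaR_eq tJ_Omega)
  qed
  show "OmegaL H \<subseteq> tJ H ` OmegaR H"
  proof
    fix t assume t: "t \<in> OmegaL H"
    then have "t = tJ H (tJ H t)" by (simp add: tJ_tJ OmegaL_eq)
    then show "t \<in> tJ H ` OmegaR H" using R[OF t] by (rule image_eqI)
  qed
  show "tJ H ` OmegaR H \<subseteq> OmegaL H"
  proof (rule image_subsetI)
    fix t assume "t \<in> OmegaR H"
    then have t: "t \<in> Omega H" "tcor H t = tapp H t \<one>" and T: "t \<in> TT H" by (auto simp: OmegaR_eq)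
    have "tcol H (tJ H t) = tpre H \<one> (tJ H t)"
      using tJ_tcor[OF T] t(2) T by (simp add: tpre_antipode_one)
    then show "tJ H t \<in> OmegaL H" using t by (simp add: OmegaL_eq tJ_Omega)
  qed
qed

text \<open>Right multiplication by \<open>tphi H v\<close> passes through the recursion of
  \<open>philist\<close> down to the empty list, whose image is the unit. Coinvariants are therefore
  closed under products.\<close>

lemma odot_tphi_image:
  assumes "u \<in> TT H" "v \<in> TT H"
  shows "\<exists>w\<in>TT H. odot H (tphi H u) (tphi H v) = tphi H w"
proof -
  have sub: "fs.subspace (tphi H ` TT H)" by (rule linop_image_subspace[OF linop_basic(2) TT_subspace])
  have "odot H (tphi H u) (tphi H v) \<in> tphi H ` TT H"
  proof (rule TT_into[OF _ sub _ assms(1)])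
    show "linop (\<lambda>u. odot H (tphi H u) (tphi H v))" by (intro linop_intros)
    fix xs assume "set xs \<subseteq> carrier H"
    then show "odot H (tphi H (tens H xs)) (tphi H v) \<in> tphi H ` TT H"
    proof (induction rule: TT_list_induct)
      case Nil
      show ?case using assms(2) by (simp add: odot_single op_one)
    next
      case (Cons x xs)
      then obtain w where w: "w \<in> TT H" "odot H (philist H xs) (tphi H v) = tphi H w" by auto
      have "odot H (philist H (x # xs)) (tphi H v) = tphi H (tpre H x w)"
        using Cons.hyps w philist_TN[of xs] assms(2) by (simp add: odot_sw odot_tpre odot_tlm antipode_closed)
      moreover have "tpre H x w \<in> TT H" using Cons.hyps w(1) by simp
      ultimately show ?case by auto
    qed
  qed
  then show ?thesis by auto
qed

lemma odot_Rco:
  assumes s: "s \<in> Rco H m" and t: "t \<in> Rco H n" shows "odot H s t \<in> Rco H (m + n)"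
proof -
  have f: "odot H s t \<in> formspan (m + n)" using odot_formspan Rco_formspan s t by auto
  obtain w where w: "w \<in> TT H" "odot H s t = tphi H w"
    using odot_tphi_image[of "tpsi H s" "tpsi H t"] Wco_tphi[OF Rco_Wco[OF s]] Wco_tphi[OF Rco_Wco[OF t]]
      tpower_TT[OF Wco_tpsi[OF Rco_Wco[OF s]]] tpower_TT[OF Wco_tpsi[OF Rco_Wco[OF t]]] by auto
  then have "odot H s t \<in> Wco H (m + n)" using tphi_TT_tpower_Wco[OF w(1)] formspan_tpower[OF f] by simp
  then show ?thesis using f by (simp add: Rco_eq)
qed

text \<open>Stability on homogeneous elements, expressed by \<open>tins\<close>, \<open>tE\<close>
  and \<open>tF\<close>, which are linear on all tensors. The bundle is what \<open>tJ\<close>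
  transports from right to left coinvariants.\<close>

definition "omega_stable A \<longleftrightarrow> fs.subspace A \<and> A = fs.span (\<Union>n. A \<inter> formspan n) \<and> tens H [\<one>] \<in> A \<and>
  (\<forall>m n. \<forall>s\<in>A \<inter> formspan m. \<forall>t\<in>A \<inter> formspan n. odot H s t \<in> A) \<and>
  (\<forall>n. \<forall>s\<in>A \<inter> formspan n. tins H s \<in> A \<and> tE H s \<in> A \<and> tF H s \<in> A)"

lemma graded_span:
  assumes A: "fs.subspace A" "A \<subseteq> Omega H" and d: "\<And>n t. t \<in> A \<Longrightarrow> tdeg H n t \<in> A"
  shows "A = fs.span (\<Union>n. A \<inter> formspan n)"
proof
  show "fs.span (\<Union>n. A \<inter> formspan n) \<subseteq> A" by (rule fs.span_minimal[OF _ A(1)]) auto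
  show "A \<subseteq> fs.span (\<Union>n. A \<inter> formspan n)"
  proof
    fix t assume t: "t \<in> A"
    then have O: "t \<in> Omega H" using A(2) by auto
    obtain M where M: "t = (\<Sum>n<M. tdeg H n t)" using tdeg_sum[OF Omega_TN[OF O]] by auto
    have "(\<Sum>n<M. tdeg H n t) \<in> fs.span (\<Union>n. A \<inter> formspan n)"
      by (intro fs.span_sum fs.span_base) (use d[OF t] tdeg_Omega[OF O] in auto)
    then show "t \<in> fs.span (\<Union>n. A \<inter> formspan n)" using M by simp
  qed
qed

lemma one_formspan: "tens H [\<one>] \<in> formspan 0"
  using form_in_formspan[of \<one> "[]" 0] by simp

lemma stable_OmegaR: "omega_stable (OmegaR H)"
proof -
  have sub: "fs.subspace (OmegaR H)"
    using Omega_subspace unfolding OmegaR_eq fs.subspace_def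
    by (auto simp: op_lin_simps op_lin_simps2)
  have d: "tdeg H n t \<in> OmegaR H" if t: "t \<in> OmegaR H" for n t
  proof -
    have o: "t \<in> Omega H" "tcor H t = tapp H t \<one>" and T: "t \<in> TT H" using t by (auto simp: OmegaR_eq)
    \<comment> \<open>The coaction appends one factor, hence the shift of the index by one.\<close>
    have "tcor H (tdeg H n t) = tdeg H (Suc n) (tcor H t)"
      by (rule TT_eqI[OF _ _ _ T])
        (auto intro!: linop_intros simp: tdeg_tens tdeg_tpower[OF corlist_tpower] op_lin_simps2)
    also have "\<dots> = tapp H (tdeg H n t) \<one>" unfolding o(2)
      by (rule TT_eqI[OF _ _ _ T]) (auto intro!: linop_intros simp: tdeg_tens op_lin_simps)
    finally show ?thesis using formspan_Omega[OF tdeg_Omega[OF o(1)]] by (simp add: OmegaR_eq)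
  qed
  have one: "tens H [\<one>] \<in> Rco H 0" using tcor_tphi[of "tens H []"] one_formspan tens_in_tpower[of "[\<one>]" H 1]
    by (simp add: Rco_eq Wco_def)
  have b: "tE H s \<in> OmegaR H \<and> tF H s \<in> OmegaR H" if s: "s \<in> Rco H n" for s n
  proof (cases n)
    case 0
    then show ?thesis using tE_formspan_0 tF_formspan_0 Rco_formspan[of s 0] s fs.subspace_0[OF sub] by simp
  next
    case (Suc m)
    then show ?thesis using tE_Rco tF_Rco s OmegaR_deg[of m] by blast
  qed
  show ?thesis unfolding omega_stable_def OmegaR_deg
  proof (intro conjI allI ballI sub)
    have "OmegaR H = fs.span (\<Union>n. OmegaR H \<inter> formspan n)"
      by (rule graded_span[OF sub _ d]) (auto simp: OmegaR_eq)
    then show "OmegaR H = fs.span (\<Union>n. Rco H n)" by (simp only: OmegaR_deg)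
    show "tens H [\<one>] \<in> OmegaR H" using one OmegaR_deg[of 0] by blast
    show "odot H s t \<in> OmegaR H" if "s \<in> Rco H m" "t \<in> Rco H n" for m n s t
      using odot_Rco[OF that] OmegaR_deg[of "m + n"] by blast
    show "tins H s \<in> OmegaR H" if "s \<in> Rco H n" for n s
      using tins_Rco[OF that] OmegaR_deg[of "Suc n"] by blast
  qed (use b in auto)
qed

lemma stable_tJ:
  assumes A: "omega_stable A" and AO: "A \<subseteq> Omega H" shows "omega_stable (tJ H ` A)"
proof -
  note S = A[unfolded omega_stable_def]
  have l: "linop (tJ H)" by (rule linop_basic2(4))
  have sub: "fs.subspace A" using S by blast
  have JJ: "tJ H (tJ H t) = t" if "t \<in> A" for t using AO that by (auto intro!: tJ_tJ)
  have subJ: "fs.subspace (tJ H ` A)" by (rule linop_image_subspace[OF l sub])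
  have deg: "tJ H ` A \<inter> formspan n = tJ H ` (A \<inter> formspan n)" for n
  proof
    show "tJ H ` (A \<inter> formspan n) \<subseteq> tJ H ` A \<inter> formspan n" using tJ_formspan by auto
    show "tJ H ` A \<inter> formspan n \<subseteq> tJ H ` (A \<inter> formspan n)"
    proof
      fix t assume t: "t \<in> tJ H ` A \<inter> formspan n"
      then obtain s where s: "s \<in> A" "t = tJ H s" by blast
      have "s \<in> formspan n" using tJ_formspan[of t n] t s JJ by simp
      then show "t \<in> tJ H ` (A \<inter> formspan n)" using s by blast
    qed
  qed
  have span: "tJ H ` A = fs.span (\<Union>n. tJ H ` (A \<inter> formspan n))"
  proof
    show "fs.span (\<Union>n. tJ H ` (A \<inter> formspan n)) \<subseteq> tJ H ` A"
      by (rule fs.span_minimal[OF _ subJ]) auto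
    show "tJ H ` A \<subseteq> fs.span (\<Union>n. tJ H ` (A \<inter> formspan n))"
    proof (rule image_subsetI)
      fix t assume "t \<in> A"
      then have "t \<in> fs.span (\<Union>n. A \<inter> formspan n)" using S by blast
      then show "tJ H t \<in> fs.span (\<Union>n. tJ H ` (A \<inter> formspan n))"
      proof (induction rule: fs.span_induct_alt)
        case base
        show ?case by (simp add: linop_zero[OF l] fs.span_zero)
      next
        case (step c y z)
        then have "tJ H y \<in> fs.span (\<Union>n. tJ H ` (A \<inter> formspan n))" by (intro fs.span_base) auto
        then show ?case using step(2) by (simp add: linop_add[OF l] linop_scale[OF l] fs.span_add fs.span_scale)
      qed
    qed
  qed
  have ops: "tins H (tJ H s) \<in> tJ H ` A \<and> tE H (tJ H s) \<in> tJ H ` A \<and> tF H (tJ H s) \<in> tJ H ` A"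
    if s: "s \<in> A \<inter> formspan n" for s n
  proof -
    have p: "s \<in> tpower H (Suc n)" "tJ H s \<in> tpower H (Suc n)" and T: "s \<in> TT H"
      using s formspan_tpower[of s n] by (auto intro: tpower_TT)
    have a: "tins H s \<in> A" "tE H s \<in> A" "tF H s \<in> A" using S s by auto
    have "tins H (tJ H s) = (-1) ^ Suc n *\<^sub>k tJ H (tins H s)" using tJ_tins[OF p(1)] by (simp del: power_Suc)
    moreover have "tF H (tJ H s) = (-1) ^ n *\<^sub>k tJ H (tE H s)" using tF_eq[OF p(2)] T by (simp add: tJ_tJ)
    moreover have "tE H (tJ H s) = (-1) ^ n *\<^sub>k tJ H (tF H s)"
      using tF_eq[OF p(1)] tJ_tJ[OF tpower_TT[OF tE_tpower[OF p(2)]]] by (simp add: op_lin_simps3)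
    ultimately show ?thesis using a by (auto intro!: fs.subspace_scale[OF subJ] fs.subspace_neg[OF subJ])
  qed
  have "tJ H (tens H [\<one>]) = tens H [\<one>]" using tens_antipode_one[of "[]" "[]"] by simp
  then have one: "tens H [\<one>] \<in> tJ H ` A" using S by (metis imageI)
  have od: "odot H (tJ H s) (tJ H t) \<in> tJ H ` A" if "s \<in> A \<inter> formspan m" "t \<in> A \<inter> formspan n" for s t m n
    using tJ_odot[of t s] that formspan_TN S by (metis IntD2 imageI)
  show ?thesis unfolding omega_stable_def deg
  proof (intro conjI allI ballI subJ span one)
    fix m n s t assume "s \<in> tJ H ` (A \<inter> formspan m)" "t \<in> tJ H ` (A \<inter> formspan n)"
    then show "odot H s t \<in> tJ H ` A" using od by (elim imageE) simp
  next
    fix n s assume "s \<in> tJ H ` (A \<inter> formspan n)"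
    then obtain r where r: "s = tJ H r" "r \<in> A \<inter> formspan n" by (rule imageE)
    show "tins H s \<in> tJ H ` A" "tE H s \<in> tJ H ` A" "tF H s \<in> tJ H ` A"
      using ops[OF r(2)] unfolding r(1) by blast+
  qed
qed

lemma stable_OmegaL: "omega_stable (OmegaL H)"
  unfolding OmegaL_tJ by (rule stable_tJ[OF stable_OmegaR]) (auto simp: OmegaR_eq)

lemma dO_formspan: "x \<in> formspan n \<Longrightarrow> dO H x = tins H x" and bO'_formspan: "x \<in> formspan n \<Longrightarrow> bO' H x = tE H x"
  and bO_formspan: "x \<in> formspan n \<Longrightarrow> bO H x = tF H x"
  using dO_eq bO'_eq bO_eq formspan_Omega by auto

lemma BO'_formspan:
  assumes "x \<in> formspan n" shows "BO' H n x = ksum (tE H) (tins H) n (tins H x)"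
  using karoubi'_pow_eq[OF tins_formspan[OF assms]]
  by (simp add: BO'_def ksum_def dO_formspan[OF assms] kar_def[abs_def] tkar_def[abs_def])

lemma stable_dg:
  assumes A: "omega_stable A" and AO: "A \<subseteq> Omega H"
  shows "dg_subalgebra H A" "bO H ` A \<subseteq> A" "bO' H ` A \<subseteq> A" "karoubi H ` A \<subseteq> A" "karoubi' H ` A \<subseteq> A"
proof -
  note S = A[unfolded omega_stable_def]
  have sub: "fs.subspace A" and span: "A = fs.span (\<Union>n. A \<inter> formspan n)" using S by blast+
  have cl: "f x \<in> A" if "linop f" "\<And>n s. s \<in> A \<inter> formspan n \<Longrightarrow> f s \<in> A" "x \<in> A" for f x
    by (rule fs_span_image_closed[OF that(1) span _ that(3)]) (use that(2) in auto)
  have d: "dO H x \<in> A" if "x \<in> A" for x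
    using cl[OF linop_basic(5) _ that] S dO_eq AO that by (metis subsetD)
  have b': "bO' H x \<in> A" if "x \<in> A" for x
    using cl[OF linop_basic(6) _ that] S bO'_eq AO that by (metis subsetD)
  have b: "bO H x \<in> A" if "x \<in> A" for x
    using cl[OF linop_basic2(6) _ that] S bO_eq AO that by (metis subsetD)
  show "bO H ` A \<subseteq> A" "bO' H ` A \<subseteq> A" using b b' by auto
  show "karoubi H ` A \<subseteq> A" "karoubi' H ` A \<subseteq> A"
    unfolding karoubi_def[abs_def] karoubi'_def[abs_def]
    by (auto intro!: fs.subspace_diff[OF sub] d b b')
  have od: "odot H s t \<in> A" if "s \<in> A" "t \<in> A" for s t
    by (rule odot_into[OF sub, of _ "\<Union>n. A \<inter> formspan n" _ "\<Union>n. A \<inter> formspan n"])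
      (use that span S formspan_TN in auto)
  have "A = fs.span (\<Union>n. A \<inter> Omega_deg H n)" using span by (simp add: Omega_deg_eq)
  moreover have "tens H [\<one>] \<in> A" using S by blast
  ultimately show "dg_subalgebra H A"
    unfolding dg_subalgebra_def using sub AO od d by auto
qed

lemma mixed_subcomplex_stable:
  assumes A: "fs.subspace A" and m: "mixed_complex (Omega_deg H) (\<lambda>_. b) u"
    and b: "b ` A \<subseteq> A" and u: "\<And>n x. x \<in> A \<Longrightarrow> u n x \<in> A"
  shows "mixed_subcomplex (\<lambda>n. A \<inter> Omega_deg H n) (Omega_deg H) (\<lambda>_. b) u"
  unfolding mixed_subcomplex_def
proof (intro conjI allI m)
  note mD = m[unfolded mixed_complex_def]
  fix n
  show "fs.subspace (A \<inter> Omega_deg H n)" using A mD by (intro fs.subspace_inter) auto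
  show "b ` (A \<inter> Omega_deg H (Suc n)) \<subseteq> A \<inter> Omega_deg H n" using mD b by blast
  show "u n ` (A \<inter> Omega_deg H n) \<subseteq> A \<inter> Omega_deg H (Suc n)" using mD u by blast
qed simp

text \<open>The signs from \<open>tJ_tins\<close> and \<open>tF_eq\<close> cancel in both products
  of \<open>tins\<close> and \<open>tF\<close>, so \<open>tJ\<close> conjugates one Karoubi operator
  into the other. This is how the relation \<open>star\<close> reaches \<open>b\<close>.\<close>

lemma kar_tF:
  assumes "x \<in> formspan n" shows "(kar (tF H) (tins H) ^^ j) x = tJ H ((tkar H ^^ j) (tJ H x))"
proof (induction j)
  case 0
  show ?case using assms by (simp add: tJ_tJ formspan_TN)
next
  case (Suc j)
  define y where "y = (tkar H ^^ j) (tJ H x)"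
  have y: "y \<in> formspan n" unfolding y_def by (intro tkar_pow_formspan tJ_formspan assms)
  note t = formspan_tpower[OF y] formspan_tpower[OF tJ_formspan[OF y]]
  have T: "y \<in> TT H" "tE H (tins H y) \<in> TT H" "tins H (tE H y) \<in> TT H" "tE H y \<in> TT H" "tins H y \<in> TT H"
    using t(1) tins_tpower tE_tpower by (blast intro: tpower_TT)+
  have 1: "tF H (tins H (tJ H y)) = tJ H (tE H (tins H y))"
  proof -
    have "tins H (tJ H y) = (-1) ^ Suc n *\<^sub>k tJ H (tins H y)" using tJ_tins[OF t(1)] by (simp del: power_Suc)
    moreover have "tF H (tJ H (tins H y)) = (-1) ^ Suc n *\<^sub>k tJ H (tE H (tins H y))"
      using tF_eq[OF tJ_tpower[OF tins_tpower[OF t(1)]]] T by (simp add: tJ_tJ)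
    ultimately show ?thesis by (simp add: op_lin_simps3 del: power_Suc)
  qed
  have 2: "tins H (tF H (tJ H y)) = tJ H (tins H (tE H y))"
    using tF_eq[OF t(2)] tJ_tins[OF tE_tpower[OF t(1)]] T by (simp add: tJ_tJ op_lin_simps2)
  have "kar (tF H) (tins H) (tJ H y) = tJ H (tkar H y)"
    by (simp add: kar_def 1 2 tkar_def op_lin_simps3)
  then show ?case using Suc by (simp add: y_def)
qed

end

lemma karoubi_complex_tE:
  fixes H :: "('k::field_char_0, 'a) hopf" assumes "hopf_algebra H"
  shows "karoubi_complex (hopf_algebra.formspan H) (tE H) (tins H)"
proof -
  interpret hopf_algebra H by fact
  have k: "kar (tE H) (tins H) = tkar H" by (simp add: kar_def[abs_def] tkar_def[abs_def])
  show ?thesis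
    by unfold_locales (auto simp: k tE_formspan tE_formspan_0 tins_formspan tE_tE_formspan tins_tins formspan_TN tkar_star
      intro: formspan_subspace linop_basic)
qed

lemma karoubi_complex_Rco:
  fixes H :: "('k::field_char_0, 'a) hopf" assumes "involutive_hopf_algebra H"
  shows "karoubi_complex (Rco H) (tE H) (tins H)"
proof -
  interpret involutive_hopf_algebra H by fact
  have k: "kar (tE H) (tins H) = tkar H" by (simp add: kar_def[abs_def] tkar_def[abs_def])
  have dd: "tins H (tins H x) = 0" if "x \<in> Rco H n" for x n
    by (rule tins_tins[OF tpower_TT[OF Wco_tpower[OF Rco_Wco[OF that]]]])
  show ?thesis
    by unfold_locales (auto simp: k dd tE_Rco tE_formspan_0 tins_Rco tE_tE_formspan tkar_star Rco_formspan
      intro: Rco_subspace linop_basic Rco_formspan tE_formspan_0 tE_tE_formspan)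
qed

lemma karoubi_complex_tF:
  fixes H :: "('k::field_char_0, 'a) hopf" assumes "involutive_hopf_algebra H"
  shows "karoubi_complex (hopf_algebra.formspan H) (tF H) (tins H)"
proof -
  interpret involutive_hopf_algebra H by fact
  have FF: "tF H (tF H x) = 0" if x: "x \<in> formspan n" for x n
  proof (cases n)
    case 0
    then show ?thesis using tF_formspan_0 x by (simp add: op_lin_simps3)
  next
    case (Suc m)
    have e: "tE H (tJ H x) \<in> formspan m" using tE_formspan tJ_formspan x Suc by blast
    have "tE H (tE H (tJ H x)) = 0" by (rule tE_tE_formspan[OF tJ_formspan[OF x]])
    then show ?thesis using tF_eq[OF formspan_tpower[OF x]] tF_eq[OF tJ_tpower[OF formspan_tpower[OF e]]] tJ_tJ[of "tE H (tJ H x)"] formspan_TN[OF e]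
      by (simp add: op_lin_simps3)
  qed
  have star: "(kar (tF H) (tins H) ^^ n) x = x + tF H ((kar (tF H) (tins H) ^^ n) (tins H x))" if x: "x \<in> formspan n" for x n
  proof -
    define y where "y = (tkar H ^^ n) (tins H (tJ H x))"
    have y: "y \<in> formspan (Suc n)" unfolding y_def by (intro tkar_pow_formspan tins_formspan tJ_formspan x)
    have "tJ H (tins H x) = (-1) ^ Suc n *\<^sub>k tins H (tJ H x)" by (rule tJ_tins[OF formspan_tpower[OF x]])
    then have "(kar (tF H) (tins H) ^^ n) (tins H x) = (-1) ^ Suc n *\<^sub>k tJ H y"
      using kar_tF[OF tins_formspan[OF x], of n] by (simp add: y_def linop_scale[OF linop_tkar_pow] op_lin_simps3 del: power_Suc)
    moreover have "tF H (tJ H y) = (-1) ^ Suc n *\<^sub>k tJ H (tE H y)"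
      using tF_eq[OF formspan_tpower[OF tJ_formspan[OF y]]] formspan_TN[OF y] by (simp add: tJ_tJ)
    ultimately have "tF H ((kar (tF H) (tins H) ^^ n) (tins H x)) = tJ H (tE H y)"
      by (simp add: op_lin_simps3 del: power_Suc)
    then show ?thesis using kar_tF[OF x, of n] tkar_star[OF tJ_formspan[OF x]] formspan_TN[OF x]
      by (simp add: y_def op_lin_simps3 tJ_tJ)
  qed
  show ?thesis
    by unfold_locales (auto simp: tF_formspan tF_formspan_0 tins_formspan FF tins_tins formspan_TN star
      intro: formspan_subspace linop_basic linop_basic2)
qed

lemma mixed_Omega:
  fixes H :: "('k::field_char_0, 'a) hopf" assumes "involutive_hopf_algebra H"
  shows "mixed_complex (Omega_deg H) (\<lambda>_. bO H) (BO H)" "mixed_complex (Omega_deg H) (\<lambda>_. bO' H) (BO' H)"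
proof -
  interpret involutive_hopf_algebra H by fact
  interpret E: karoubi_complex formspan "tE H" "tins H" by (rule karoubi_complex_tE) unfold_locales
  interpret F: karoubi_complex formspan "tF H" "tins H" by (rule karoubi_complex_tF) fact
  have D: "Omega_deg H = formspan" by (rule ext) (rule Omega_deg_eq)
  have K: "karoubi H y = kar (tF H) (tins H) y" if y: "y \<in> formspan n" for y n
  proof -
    have "tF H y \<in> Omega H"
    proof (cases n)
      case 0
      then show ?thesis using tF_formspan_0 y fs.subspace_0[OF Omega_subspace] by simp
    next
      case (Suc m)
      then show ?thesis using y tF_formspan by (auto intro: formspan_Omega)
    qed
    then show ?thesis
      by (simp add: karoubi_def kar_def dO_formspan[OF y] bO_formspan[OF y] bO_formspan[OF tins_formspan[OF y]] dO_eq)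
  qed
  have "(karoubi H ^^ j) x = (kar (tF H) (tins H) ^^ j) x" if x: "x \<in> formspan n" for j x n
    by (induction j) (simp_all add: K[OF F.Kp_in[OF x]])
  then have B: "BO H n x = ksum (tF H) (tins H) n (tins H x)" if "x \<in> formspan n" for n x
    using tins_formspan[OF that] by (simp add: BO_def ksum_def dO_formspan[OF that])
  show "mixed_complex (Omega_deg H) (\<lambda>_. bO H) (BO H)" unfolding D
    by (rule mixed_complex_cong[OF F.mixed_b]) (simp_all add: bO_formspan B)
  show "mixed_complex (Omega_deg H) (\<lambda>_. bO' H) (BO' H)" unfolding D
    by (rule mixed_complex_cong[OF E.mixed_b]) (simp_all add: bO'_formspan BO'_formspan)
qed

section \<open>Naturality\<close>

text \<open>Both expressions are built from \<open>b\<close> and \<open>d\<close> with coefficients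
  depending only on the degree, so any linear map that commutes with \<open>b\<close> and
  \<open>d\<close> commutes with them.\<close>

lemma rescale_natural:
  assumes A: "karoubi_complex C b d" and B: "karoubi_complex C' b' d'" and T: "linop T"
    and b: "\<And>n x. x \<in> C n \<Longrightarrow> T (b x) = b' (T x)" and d: "\<And>n x. x \<in> C n \<Longrightarrow> T (d x) = d' (T x)"
    and x: "x \<in> C n"
  shows "T (ksum b d m x) = ksum b' d' m (T x)"
    and "T (karoubi_complex.rescale b d n x) = karoubi_complex.rescale b' d' n (T x)"
proof -
  interpret A: karoubi_complex C b d by (rule A)
  interpret B: karoubi_complex C' b' d' by (rule B)
  have ex: "\<exists>m. b x \<in> C m" if "x \<in> C n" for x n
    using that A.b_in A.b_0 A.C0 by (cases n) (metis, metis)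
  have db: "T (d (b x)) = d' (b' (T x))" if "x \<in> C n" for x n
    using ex[OF that] b[OF that] d by metis
  have bd: "T (b (d x)) = b' (d' (T x))" if "x \<in> C n" for x n
    using b[OF A.d_in[OF that]] d[OF that] by simp
  have K: "T ((kar b d ^^ j) x) = (kar b' d' ^^ j) (T x)" if "x \<in> C n" for x n j
  proof (induction j)
    case (Suc j)
    note y = A.Kp_in[OF that, of j]
    have "T (kar b d ((kar b d ^^ j) x)) = kar b' d' (T ((kar b d ^^ j) x))"
      unfolding kar_def[of b d "(kar b d ^^ j) x"] by (simp only: linop_diff[OF T] bd[OF y] db[OF y] kar_def[of b' d'])
    then show ?case using Suc by simp
  qed simp
  show "T (ksum b d m x) = ksum b' d' m (T x)"
    unfolding ksum_def linop_sum[OF T] by (intro sum.cong refl K[OF x])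
  have G: "T (A.green m x) = B.green m (T x)" if "x \<in> C n" for x m n
    unfolding A.green_def B.green_def linop_scale[OF T] linop_sum[OF T] K[OF that] ..
  have g1: "T (A.green n (b (d x))) = B.green n (b' (d' (T x)))"
    using G[OF A.bd_in[OF x]] bd[OF x] by simp
  have g2: "T (A.green (n - 1) (d (b x))) = B.green (n - 1) (d' (b' (T x)))"
    using G[OF A.db_in[OF x]] db[OF x] by simp
  show "T (A.rescale n x) = B.rescale n (T x)"
    unfolding A.rescale_def B.rescale_def A.P_def B.P_def by (simp only: linop_scale[OF T] linop_diff[OF T] g1 g2)
qed

section \<open>Functoriality in the Hopf algebra\<close>

locale hopf_morphism = A: hopf_algebra H + B: hopf_algebra H' for H H' :: "('k::field, 'a) hopf" +
  fixes f :: "'a \<Rightarrow> 'a"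
  assumes hom: "f \<in> hopf_hom H H'"
begin

lemma f_simps [simp]:
  shows "x \<in> carrier H \<Longrightarrow> f x \<in> carrier H'"
    and "x \<in> carrier H \<Longrightarrow> y \<in> carrier H \<Longrightarrow> f (x \<otimes>\<^bsub>H\<^esub> y) = f x \<otimes>\<^bsub>H'\<^esub> f y"
    and "x \<in> carrier H \<Longrightarrow> y \<in> carrier H \<Longrightarrow> f (x \<oplus>\<^bsub>H\<^esub> y) = f x \<oplus>\<^bsub>H'\<^esub> f y"
    and "f \<one>\<^bsub>H\<^esub> = \<one>\<^bsub>H'\<^esub>"
    and "x \<in> carrier H \<Longrightarrow> f (c \<odot>\<^bsub>H\<^esub> x) = c \<odot>\<^bsub>H'\<^esub> f x"
    and "x \<in> carrier H \<Longrightarrow> antipode H' (f x) = f (antipode H x)"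
  using hom by (auto simp: hopf_hom_def ring_hom_def)

lemma f_set [simp]: "set xs \<subseteq> carrier H \<Longrightarrow> f ` set xs \<subseteq> carrier H'"
  by auto

lemma linop_tmap: "linop (tmap H' f)"
  unfolding tmap_def[abs_def] by (intro linop_intros)

lemmas tmap_lin = linop_simps[OF linop_tmap]

lemma tmap_tens [simp]: "tmap H' f (tens H xs) = tens H' (map f xs)"
proof -
  have "mlin H (\<lambda>xs. tens H' (map f xs))"
  proof (rule A.mlinI)
    fix xs ys assume "set xs \<subseteq> carrier H" "set ys \<subseteq> carrier H"
    then have "lin H' (\<lambda>x. tens H' (map f xs @ x # map f ys))" by (intro B.lin_tens) auto
    then show "lin H (\<lambda>x. tens H' (map f (xs @ x # ys)))" by (simp add: lin_def)
  qed
  then show ?thesis unfolding tmap_def by (rule tbind_tens)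
qed

lemma tmap_TT [simp]: "t \<in> TT H \<Longrightarrow> tmap H' f t \<in> TT H'"
  by (rule TT_into[OF linop_tmap TT_subspace]) simp_all

lemma tmap_tpower: "t \<in> tpower H n \<Longrightarrow> tmap H' f t \<in> tpower H' n"
  by (rule tpower_into[OF linop_tmap tpower_subspace]) (simp_all add: tens_in_tpower)

lemma tmap_ops [simp]:
  assumes "t \<in> TT H" "x \<in> carrier H"
  shows "tmap H' f (tpre H x t) = tpre H' (f x) (tmap H' f t)"
    and "tmap H' f (tlm H x t) = tlm H' (f x) (tmap H' f t)"
    and "tmap H' f (trm H x t) = trm H' (f x) (tmap H' f t)"
proof -
  show "tmap H' f (tpre H x t) = tpre H' (f x) (tmap H' f t)"
    by (rule TT_eqI[OF linop_compose[OF linop_tmap] linop_tpre[OF linop_tmap] _ assms(1)])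
      (use assms(2) in \<open>auto intro!: linop_intros\<close>)
  show "tmap H' f (tlm H x t) = tlm H' (f x) (tmap H' f t)"
  proof (rule TT_eqI[OF linop_compose[OF linop_tmap] linop_tlm[OF linop_tmap] _ assms(1)])
    fix xs assume "set xs \<subseteq> carrier H"
    then show "tmap H' f (tlm H x (tens H xs)) = tlm H' (f x) (tmap H' f (tens H xs))"
      using assms(2) by (cases xs) (simp_all add: tmap_lin)
  qed (intro linop_intros)
  show "tmap H' f (trm H x t) = trm H' (f x) (tmap H' f t)"
  proof (rule TT_eqI[OF linop_compose[OF linop_tmap] linop_trm[OF linop_tmap] _ assms(1)])
    fix xs assume "set xs \<subseteq> carrier H"
    then show "tmap H' f (trm H x (tens H xs)) = trm H' (f x) (tmap H' f (tens H xs))"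
      using assms(2) by (cases xs rule: rev_cases) (simp_all add: tmap_lin)
  qed (intro linop_intros)
qed

text \<open>A morphism respects coproducts as tensors, while the decompositions chosen for
  \<open>x\<close> and for \<open>f x\<close> have nothing to do with each other; bilinearity of
  \<open>g\<close> makes the two sums agree.\<close>

lemma sw_hom:
  fixes g :: "'a \<Rightarrow> 'a \<Rightarrow> ('k, 'c) tensor"
  assumes x: "x \<in> carrier H" and g: "lin2 H' g"
  shows "sw H' (f x) g = sw H x (\<lambda>a b. g (f a) (f b))"
proof -
  have "sw H' (f x) (\<lambda>a b. tens H' [a, b]) = tmap H' f (sw H x (\<lambda>a b. tens H [a, b]))"
    using hom x B.comult_sw[of "f x"] A.comult_sw[OF x] by (simp add: hopf_hom_def)
  also have "\<dots> = sw H x (\<lambda>a b. tens H' [f a, f b])"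
    unfolding linop_of_sw[OF linop_tmap] by simp
  finally have "tbind (sw H' (f x) (\<lambda>a b. tens H' [a, b])) (\<lambda>l. if length l = 2 then g (l ! 0) (l ! 1) else 0)
      = tbind (sw H x (\<lambda>a b. tens H' [f a, f b])) (\<lambda>l. if length l = 2 then g (l ! 0) (l ! 1) else 0)"
    by simp
  then show ?thesis
    unfolding linop_of_sw[OF linop_tbind[OF linop_id]] B.sw_of_tens_eq(1)[OF g] .
qed

lemma tmap_philist: "set xs \<subseteq> carrier H \<Longrightarrow> tmap H' f (philist H xs) = philist H' (map f xs)"
proof (induction xs)
  case (Cons x xs)
  have x: "x \<in> carrier H" "set xs \<subseteq> carrier H" using Cons.prems by auto
  note T = A.philist_TN[OF x(2), THEN A.TN_TT'] and T' = B.philist_TN[of "map f xs", THEN B.TN_TT']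
  have "tmap H' f (philist H (x # xs)) = sw H x (\<lambda>a b. tmap H' f (tpre H a (tlm H (antipode H b) (philist H xs))))"
    by (simp add: linop_of_sw[OF linop_tmap])
  also have "\<dots> = sw H x (\<lambda>a b. tpre H' (f a) (tlm H' (antipode H' (f b)) (philist H' (map f xs))))"
    by (rule A.sw_cong) (use Cons.IH x T in simp)
  also have "\<dots> = sw H' (f x) (\<lambda>a b. tpre H' a (tlm H' (antipode H' b) (philist H' (map f xs))))"
    by (rule sw_hom[OF x(1), symmetric]) (use T' x in \<open>auto simp: B.lin_simps\<close>)
  finally show ?case by simp
qed simp

lemma tmap_tphi: "t \<in> TT H \<Longrightarrow> tmap H' f (tphi H t) = tphi H' (tmap H' f t)"
  by (rule TT_eqI[OF linop_compose[OF linop_tmap linop_basic(2)] linop_compose[OF linop_basic(2) linop_tmap]])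
    (simp_all add: tmap_philist)

lemma tmap_tins: "t \<in> TT H \<Longrightarrow> tmap H' f (tins H t) = tins H' (tmap H' f t)"
proof (rule TT_eqI[OF linop_compose[OF linop_tmap linop_basic(5)] linop_compose[OF linop_basic(5) linop_tmap]])
  fix xs assume "set xs \<subseteq> carrier H"
  then show "tmap H' f (tins H (tens H xs)) = tins H' (tmap H' f (tens H xs))"
  proof (induction xs)
    case (Cons x xs)
    then show ?case using A.inslist_TN[of xs, THEN A.TN_TT'] by (simp add: tmap_lin)
  qed simp
qed

lemma tmap_tE: "t \<in> TT H \<Longrightarrow> tmap H' f (tE H t) = tE H' (tmap H' f t)"
proof (rule TT_eqI[OF linop_compose[OF linop_tmap linop_basic(6)] linop_compose[OF linop_basic(6) linop_tmap]])
  fix xs assume "set xs \<subseteq> carrier H"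
  then show "tmap H' f (tE H (tens H xs)) = tE H' (tmap H' f (tens H xs))"
    by (cases xs) (simp_all add: tmap_lin)
qed

lemma tmap_trot: "t \<in> TT H \<Longrightarrow> tmap H' f (trot H t) = trot H' (tmap H' f t)"
proof (rule TT_eqI[OF linop_compose[OF linop_tmap linop_basic(7)] linop_compose[OF linop_basic(7) linop_tmap]])
  fix xs assume "set xs \<subseteq> carrier H"
  then show "tmap H' f (trot H (tens H xs)) = trot H' (tmap H' f (tens H xs))"
    by (cases xs) simp_all
qed

lemma tmap_tsg: "t \<in> TT H \<Longrightarrow> tmap H' f (tsg H i t) = tsg H' i (tmap H' f t)"
proof (rule TT_eqI[OF linop_compose[OF linop_tmap linop_basic(8)] linop_compose[OF linop_basic(8) linop_tmap]])
  fix xs assume "set xs \<subseteq> carrier H"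
  then show "tmap H' f (tsg H i (tens H xs)) = tsg H' i (tmap H' f (tens H xs))"
  proof (induction xs arbitrary: i)
    case (Cons x xs)
    then have c: "x \<in> carrier H" "set xs \<subseteq> carrier H" by auto
    show ?case
    proof (cases i)
      case 0
      have "tmap H' f (tlm H x (tens H xs)) = tlm H' (f x) (tens H' (map f xs))" using c by simp
      then show ?thesis using 0 by (simp add: A.tsg_tens B.tsg_tens)
    next
      case (Suc j)
      have "sglist H j xs \<in> TT H" using A.sglist_tpower[OF c(2)] by (rule tpower_TT)
      then show ?thesis using c Suc Cons.IH[OF c(2), of j] by (simp add: A.tsg_tens B.tsg_tens)
    qed
  qed (simp add: tmap_lin)
qed

lemma tmap_tlam_pow:
  assumes "t \<in> tpower H (Suc n)" shows "tmap H' f ((tlam H ^^ j) t) = (tlam H' ^^ j) (tmap H' f t)"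
proof (induction j)
  case (Suc j)
  have p: "(tlam H ^^ j) t \<in> tpower H (Suc n)" by (rule A.tlam_pow_tpower[OF assms])
  show ?case using Suc A.tlam_eq[OF p] B.tlam_eq[OF tmap_tpower[OF p]] tmap_trot[OF tpower_TT[OF p]]
    by (simp add: tmap_lin)
qed simp

lemma tmap_tdown:
  assumes "t \<in> tpower H (Suc (Suc n))" shows "tmap H' f (tdown H n t) = tdown H' n (tmap H' f t)"
proof -
  have s: "t - tlam H t \<in> tpower H (Suc (Suc n))" by (rule A.one_minus_tlam[OF assms])
  have e: "tE H (t - tlam H t) \<in> tpower H (Suc n)" by (rule A.tE_tpower[OF s])
  show ?thesis
    unfolding tdown_def tnorm_def linop_sum[OF linop_tmap] tmap_tlam_pow[OF e] tmap_tE[OF tpower_TT[OF s]]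
    using tmap_tlam_pow[OF assms, of 1] by (simp add: tmap_lin)
qed

lemma tmap_Wco:
  assumes "t \<in> Wco H n" shows "tmap H' f t \<in> Wco H' n" "tpsi H' (tmap H' f t) = tmap H' f (tpsi H t)"
proof -
  define v where "v = tpsi H t"
  have v: "v \<in> tpower H n" "t = tphi H v" using A.Wco_tpsi[OF assms] A.Wco_tphi[OF assms] by (simp_all add: v_def)
  have t: "tmap H' f t = tphi H' (tmap H' f v)" unfolding v(2) by (rule tmap_tphi[OF tpower_TT[OF v(1)]])
  show "tmap H' f t \<in> Wco H' n" unfolding t by (rule B.tphi_Wco[OF tmap_tpower[OF v(1)]])
  show "tpsi H' (tmap H' f t) = tmap H' f (tpsi H t)"
    unfolding t v_def[symmetric] by (rule B.tpsi_tphi[OF tpower_TT[OF tmap_tpower[OF v(1)]]])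
qed

lemma tmap_Rco: assumes "t \<in> Rco H n" shows "tmap H' f t \<in> Rco H' n"
proof -
  have W: "t \<in> Wco H n" by (rule A.Rco_Wco[OF assms])
  have "tsg H' i (tmap H' f t) = 0" for i
    using tmap_tsg[OF tpower_TT[OF A.Wco_tpower[OF W]], of i] assms by (simp add: Rco_def tmap_lin)
  then show ?thesis using tmap_Wco(1)[OF W] by (simp add: Rco_def)
qed

lemma tmap_hopf_normalized: assumes "v \<in> hopf_normalized H n" shows "tmap H' f v \<in> hopf_normalized H' n"
proof -
  have v: "v \<in> tpower H n" by (rule A.hopf_normalized_tpower[OF assms])
  then have "tphi H v \<in> Rco H n" using assms A.hopf_normalized_iff by simp
  from tmap_Rco[OF this] show ?thesis
    using B.hopf_normalized_iff[OF tmap_tpower[OF v]] tmap_tphi[OF tpower_TT[OF v]] by simp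
qed

text \<open>The two sides are compared after the injective map \<open>tphi\<close>, where the
  differential is an insertion of units and naturality is evident.\<close>

lemma tmap_hopf_up:
  assumes v: "v \<in> tpower H n" shows "tmap H' f (hopf_up H n v) = hopf_up H' n (tmap H' f v)"
proof -
  have T: "hopf_up H n v \<in> TT H" "hopf_up H' n (tmap H' f v) \<in> TT H'" "tphi H v \<in> TT H"
    using A.hopf_up_TT[OF v] B.hopf_up_TT[OF tmap_tpower[OF v]] tpower_TT[OF v] by auto
  have "tphi H' (tmap H' f (hopf_up H n v)) = tmap H' f (tins H (tphi H v))"
    using tmap_tphi[OF T(1)] A.tins_tphi[OF v] by simp
  also have "\<dots> = tphi H' (hopf_up H' n (tmap H' f v))"
    using tmap_tins[OF T(3)] tmap_tphi[OF tpower_TT[OF v]] B.tins_tphi[OF tmap_tpower[OF v]] by simp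
  finally have "tpsi H' (tphi H' (tmap H' f (hopf_up H n v))) = tpsi H' (tphi H' (hopf_up H' n (tmap H' f v)))"
    by (rule arg_cong)
  then show ?thesis unfolding B.tpsi_tphi[OF tmap_TT[OF T(1)]] B.tpsi_tphi[OF T(2)] .
qed

lemma tmap_hopf_down:
  assumes i: "involutive_hopf_algebra H" "involutive_hopf_algebra H'" and v: "v \<in> tpower H (Suc n)"
  shows "tmap H' f (hopf_down H n v) = hopf_down H' n (tmap H' f v)"
proof -
  note dA = involutive_hopf_algebra.hopf_down_tphi[OF i(1) v]
    and dB = involutive_hopf_algebra.hopf_down_tphi[OF i(2) tmap_tpower[OF v]]
  have "tphi H' (tmap H' f (hopf_down H n v)) = tmap H' f (tdown H n (tphi H v))"
    using tmap_tphi[OF tpower_TT[OF dA(1)]] dA(2) by simp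
  also have "\<dots> = tphi H' (hopf_down H' n (tmap H' f v))"
    using tmap_tdown[OF A.tphi_tpower[OF v]] tmap_tphi[OF tpower_TT[OF v]] dB(2) by simp
  finally have "tpsi H' (tphi H' (tmap H' f (hopf_down H n v))) = tpsi H' (tphi H' (hopf_down H' n (tmap H' f v)))"
    by (rule arg_cong)
  then show ?thesis unfolding B.tpsi_tphi[OF tmap_TT[OF tpower_TT[OF dA(1)]]] B.tpsi_tphi[OF tpower_TT[OF dB(1)]] .
qed

end

section \<open>The isomorphism\<close>

abbreviation "complexR fin H \<equiv> cp fin (Rco H) (\<lambda>_. tE H) (\<lambda>n x. ksum (tE H) (tins H) n (tins H x))"
abbreviation "complexR_down fin H \<equiv> cp fin (Rco H) (\<lambda>n x. ksum (tE H) (tins H) n (tE H x)) (\<lambda>_. tins H)"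

text \<open>The inclusion of normalized cochains into all cochains is the identity on
  representatives, so the same formula serves direct sums and direct products.\<close>

definition period_map :: "('k::field_char_0, 'a) hopf \<Rightarrow> (nat \<Rightarrow> ('k, 'a) tensor) \<Rightarrow> nat \<Rightarrow> ('k, 'a) tensor"
  where "period_map H x n = tpsi H (karoubi_complex.rescale (tE H) (tins H) n (x n))"

lemma period_map_quasi_iso:
  fixes H :: "('k::field_char_0, 'a) hopf" assumes "involutive_hopf_algebra H"
  shows "is_supercomplex (complexR fin H)"
    and "is_supercomplex (cp True (tpower H) (hopf_down H) (hopf_up H))"
    and "is_supercomplex (cp False (hopf_normalized H) (hopf_down H) (hopf_up H))"
    and "quasi_iso (complexR True H) (cp True (tpower H) (hopf_down H) (hopf_up H)) (period_map H)"
    and "quasi_iso (complexR False H) (cp False (hopf_normalized H) (hopf_down H) (hopf_up H)) (period_map H)"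
proof -
  interpret involutive_hopf_algebra H by fact
  interpret R: karoubi_complex "Rco H" "tE H" "tins H" by (rule karoubi_complex_Rco) fact
  show R: "is_supercomplex (complexR fin H)" for fin by (rule R.is_supercomplex_b)
  have D: "is_supercomplex (complexR_down fin H)" for fin by (rule R.is_supercomplex_d)
  show L: "is_supercomplex (cp True (tpower H) (hopf_down H) (hopf_up H))"
    by (rule is_supercomplex_cp[OF mixed_tpower linop_hopf_down linop_hopf_up])
  have W: "is_supercomplex (cp True (Wco H) (tdown H) (\<lambda>_. tins H))"
    by (rule is_supercomplex_cp[OF mixed_Wco linop_tdown linop_basic(5)])
  have mN: "mixed_complex (hopf_normalized H) (hopf_down H) (hopf_up H)"
  proof (rule mixed_complex_transport[OF R.mixed_d hopf_normalized_subspace linop_basic(2)])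
    fix n x
    { assume x: "x \<in> hopf_normalized H n"
      then show "tphi H x \<in> Rco H n" using hopf_normalized_iff hopf_normalized_tpower by blast
      show "x = 0" if "tphi H x = 0" using tphi_inj[OF tpower_TT[OF hopf_normalized_tpower[OF x]] that] .
      show "hopf_up H n x \<in> hopf_normalized H (Suc n) \<and> tphi H (hopf_up H n x) = tins H (tphi H x)"
        using hopf_normalized_down_up(2)[OF x] tins_tphi[OF hopf_normalized_tpower[OF x]] by simp }
    show "hopf_down H n x \<in> hopf_normalized H n \<and> tphi H (hopf_down H n x) = ksum (tE H) (tins H) n (tE H (tphi H x))"
      if "x \<in> hopf_normalized H (Suc n)" by (rule hopf_normalized_down_up(1)[OF that])
  qed
  show N: "is_supercomplex (cp False (hopf_normalized H) (hopf_down H) (hopf_up H))"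
    by (rule is_supercomplex_cp[OF mN linop_hopf_down linop_hopf_up])
  have psi_up: "tpsi H (tins H x) = hopf_up H n (tpsi H x)" if "x \<in> Wco H n" for n x
    using tins_tphi[OF Wco_tpsi[OF that]] Wco_tphi[OF that] tpsi_tphi[OF hopf_up_TT[OF Wco_tpsi[OF that]]] by simp
  have psi_down: "tpsi H (tdown H n x) = hopf_down H n (tpsi H x)" if "x \<in> Wco H (Suc n)" for n x
    using hopf_down_tphi[OF Wco_tpsi[OF that]] Wco_tphi[OF that] tpsi_tphi[OF tpower_TT[OF hopf_down_tphi(1)[OF Wco_tpsi[OF that]]]]
    by simp
  have T: "quasi_iso (cp True (Wco H) (tdown H) (\<lambda>_. tins H)) (cp True (tpower H) (hopf_down H) (hopf_up H)) (\<lambda>x n. tpsi H (x n))"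
    by (rule quasi_iso_degreewise_iso[where T = "\<lambda>_. tpsi H" and S = "\<lambda>_. tphi H", OF W L linop_basic(3) _ linop_basic(2)])
      (simp_all add: Wco_tpsi tphi_Wco Wco_tphi tpsi_tphi tpower_TT tdown_Wco tins_Wco psi_up psi_down)
  have T': "quasi_iso (complexR_down False H) (cp False (hopf_normalized H) (hopf_down H) (hopf_up H)) (\<lambda>x n. tpsi H (x n))"
  proof (rule quasi_iso_degreewise_iso[where T = "\<lambda>_. tpsi H" and S = "\<lambda>_. tphi H", OF D N linop_basic(3) _ linop_basic(2)])
    fix n x
    show "tpsi H x \<in> hopf_normalized H n" if "x \<in> Rco H n" by (rule Rco_tpsi[OF that])
    show "tphi H x \<in> Rco H n" if "x \<in> hopf_normalized H n"
      using that hopf_normalized_iff hopf_normalized_tpower by blast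
    show "tphi H (tpsi H x) = x" if "x \<in> Rco H n" by (rule Wco_tphi[OF Rco_Wco[OF that]])
    show "tpsi H (tphi H x) = x" if "x \<in> hopf_normalized H n"
      by (rule tpsi_tphi[OF tpower_TT[OF hopf_normalized_tpower[OF that]]])
    show "ksum (tE H) (tins H) n (tE H x) \<in> Rco H n \<and> tpsi H (ksum (tE H) (tins H) n (tE H x)) = hopf_down H n (tpsi H x)"
      if "x \<in> Rco H (Suc n)" using tdown_Rco[OF that] tdown_in_Rco[OF that] psi_down[OF Rco_Wco[OF that]] by simp
    show "tins H x \<in> Rco H (Suc n) \<and> tpsi H (tins H x) = hopf_up H n (tpsi H x)"
      if "x \<in> Rco H n" using tins_Rco[OF that] psi_up[OF Rco_Wco[OF that]] by simp
  qed
  have p: "period_map H = (\<lambda>x n. tpsi H (R.rescale n (x n)))" by (simp add: period_map_def fun_eq_iff)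
  show "quasi_iso (complexR False H) (cp False (hopf_normalized H) (hopf_down H) (hopf_up H)) (period_map H)"
    unfolding p by (rule quasi_iso_compose[OF R D N R.rescale_quasi_iso T'])
  show "quasi_iso (complexR True H) (cp True (tpower H) (hopf_down H) (hopf_up H)) (period_map H)"
    unfolding p by (rule quasi_iso_compose[OF R W L quasi_iso_compose[OF R D W R.rescale_quasi_iso Rco_Wco_quasi_iso] T])
qed

lemma hopf_morphismI:
  "involutive_hopf_algebra H \<Longrightarrow> involutive_hopf_algebra H' \<Longrightarrow> f \<in> hopf_hom H H' \<Longrightarrow> hopf_morphism H H' f"
  by (simp add: hopf_morphism_def hopf_morphism_axioms_def involutive_hopf_algebra_def)

text \<open>The parameters \<open>fin\<close> and \<open>C\<close> cover both statements: direct
  sums with all Hopf cochains and direct products with the normalized ones.\<close>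

lemma naturally_isomorphic_OmegaR:
  fixes C :: "('k::field_char_0, 'a) hopf \<Rightarrow> nat \<Rightarrow> ('k, 'a) tensor set"
  assumes qi: "\<And>H. involutive_hopf_algebra H \<Longrightarrow>
      quasi_iso (complexR fin H) (cp fin (C H) (hopf_down H) (hopf_up H)) (period_map H)"
    and L: "\<And>H. involutive_hopf_algebra H \<Longrightarrow> is_supercomplex (cp fin (C H) (hopf_down H) (hopf_up H))"
    and C: "\<And>H n. involutive_hopf_algebra H \<Longrightarrow> C H n \<subseteq> tpower H n"
    and CT: "\<And>H H' f n x. hopf_morphism H H' f \<Longrightarrow> x \<in> C H n \<Longrightarrow> tmap H' f x \<in> C H' n"
  shows "naturally_isomorphic_cohomology
    (\<lambda>H. cp fin (\<lambda>n. OmegaR H \<inter> Omega_deg H n) (\<lambda>_. bO' H) (BO' H)) (\<lambda>H. cp fin (C H) (hopf_down H) (hopf_up H))"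
proof (rule naturally_isomorphic_cohomologyI[where K' = "complexR fin" and F = period_map])
  fix H :: "('k, 'a) hopf" and i :: nat assume H: "involutive_hopf_algebra H"
  interpret involutive_hopf_algebra H by (rule H)
  show "is_supercomplex (complexR fin H)" by (rule period_map_quasi_iso(1)[OF H])
  have "(\<lambda>n. OmegaR H \<inter> Omega_deg H n) = Rco H" by (simp add: fun_eq_iff Omega_deg_eq OmegaR_deg)
  then show "cocycles (cp fin (\<lambda>n. OmegaR H \<inter> Omega_deg H n) (\<lambda>_. bO' H) (BO' H)) i = cocycles (complexR fin H) i \<and>
      coboundaries (cp fin (\<lambda>n. OmegaR H \<inter> Omega_deg H n) (\<lambda>_. bO' H) (BO' H)) i = coboundaries (complexR fin H) i"
    using cp_cong[of "Rco H" "\<lambda>_. bO' H" "\<lambda>_. tE H" "BO' H" "\<lambda>n x. ksum (tE H) (tins H) n (tins H x)" fin i]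
    by (simp add: bO'_formspan[OF Rco_formspan] BO'_formspan[OF Rco_formspan])
  show "is_supercomplex (cp fin (C H) (hopf_down H) (hopf_up H))" by (rule L[OF H])
  show "quasi_iso (complexR fin H) (cp fin (C H) (hopf_down H) (hopf_up H)) (period_map H)" by (rule qi[OF H])
next
  fix H H' :: "('k, 'a) hopf" and f i and x :: "nat \<Rightarrow> ('k, 'a) tensor"
  assume H: "involutive_hopf_algebra H" "involutive_hopf_algebra H'" and f: "f \<in> hopf_hom H H'" and i: "i \<in> {0, 1 :: nat}"
  interpret hopf_morphism H H' f by (rule hopf_morphismI[OF H f])
  { assume "x \<in> fst (complexR fin H) i"
    then have x: "x \<in> cp_space fin (Rco H) i" by (simp add: cp_def)
    note kA = karoubi_complex_Rco[OF H(1)] and kB = karoubi_complex_Rco[OF H(2)]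
    have RT: "y \<in> TT H" if "y \<in> Rco H n" for y n by (rule tpower_TT[OF A.Wco_tpower[OF A.Rco_Wco[OF that]]])
    have E: "tmap H' f (tE H y) = tE H' (tmap H' f y)" and D: "tmap H' f (tins H y) = tins H' (tmap H' f y)"
      if "y \<in> Rco H n" for y n using tmap_tE[OF RT[OF that]] tmap_tins[OF RT[OF that]] .
    have nat: "tmap H' f (ksum (tE H) (tins H) m y) = ksum (tE H') (tins H') m (tmap H' f y)"
        "tmap H' f (karoubi_complex.rescale (tE H) (tins H) n y) = karoubi_complex.rescale (tE H') (tins H') n (tmap H' f y)"
      if "y \<in> Rco H n" for y n m
      by (rule rescale_natural[where C = "Rco H" and C' = "Rco H'", OF kA kB linop_tmap _ _ that]; (erule E | erule D))+
    have "period_map H' (\<lambda>n. tmap H' f (x n)) n = tmap H' f (period_map H x n)" for n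
    proof -
      have xn: "x n \<in> Rco H n" by (rule cp_spaceD(1)[OF x])
      have "karoubi_complex.rescale (tE H) (tins H) n (x n) \<in> Rco H n"
        by (rule karoubi_complex.rescale_in[OF kA xn])
      from tmap_Wco(2)[OF A.Rco_Wco[OF this]] show ?thesis unfolding period_map_def nat(2)[OF xn] .
    qed
    moreover have "(\<lambda>n. tmap H' f (x n)) \<in> cp_space fin (Rco H') i"
      by (rule degreewise_in[where T = "\<lambda>_. tmap H' f" and C = "Rco H" and C' = "Rco H'", OF tmap_Rco _ x])
        (simp_all add: tmap_lin)
    moreover have "total_diff (\<lambda>_. tE H') (\<lambda>n x. ksum (tE H') (tins H') n (tins H' x)) (\<lambda>n. tmap H' f (x n)) =
        (\<lambda>n. tmap H' f (total_diff (\<lambda>_. tE H) (\<lambda>n x. ksum (tE H) (tins H) n (tins H x)) x n))"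
      by (rule total_diff_degreewise[where T = "\<lambda>_. tmap H' f" and C = "Rco H", OF _ _ linop_tmap x])
        (simp_all add: E D nat(1)[OF A.tins_Rco])
    ultimately show "period_map H' (\<lambda>n. tmap H' f (x n)) = (\<lambda>n. tmap H' f (period_map H x n)) \<and>
        (\<lambda>n. tmap H' f (x n)) \<in> fst (complexR fin H') i \<and>
        snd (complexR fin H') (\<lambda>n. tmap H' f (x n)) = (\<lambda>n. tmap H' f (snd (complexR fin H) x n))"
      by (simp add: cp_def fun_eq_iff) }
  { assume "x \<in> fst (cp fin (C H) (hopf_down H) (hopf_up H)) i"
    then have x: "x \<in> cp_space fin (C H) i" by (simp add: cp_def)
    have p: "y \<in> tpower H n" if "y \<in> C H n" for y n using C[OF H(1)] that by blast
    have "(\<lambda>n. tmap H' f (x n)) \<in> cp_space fin (C H') i"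
      by (rule degreewise_in[where T = "\<lambda>_. tmap H' f" and C = "C H" and C' = "C H'", OF CT _ x])
        (simp_all add: tmap_lin hopf_morphism_axioms)
    moreover have "total_diff (hopf_down H') (hopf_up H') (\<lambda>n. tmap H' f (x n)) =
        (\<lambda>n. tmap H' f (total_diff (hopf_down H) (hopf_up H) x n))"
      by (rule total_diff_degreewise[where T = "\<lambda>_. tmap H' f" and C = "C H", OF _ _ linop_tmap x])
        (simp_all add: tmap_hopf_down[OF H p] tmap_hopf_up[OF p])
    ultimately show "(\<lambda>n. tmap H' f (x n)) \<in> fst (cp fin (C H') (hopf_down H') (hopf_up H')) i \<and>
        snd (cp fin (C H') (hopf_down H') (hopf_up H')) (\<lambda>n. tmap H' f (x n)) =
        (\<lambda>n. tmap H' f (snd (cp fin (C H) (hopf_down H) (hopf_up H)) x n))"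
      by (simp add: cp_def) }
qed

lemma coinvariant_mixed_subcomplex:
  fixes H :: "('k::field_char_0, 'a) hopf"
  assumes H: "involutive_hopf_algebra H" and S: "A \<in> {OmegaR H, OmegaL H}"
  shows "dg_subalgebra H A \<and> bO H ` A \<subseteq> A \<and> karoubi H ` A \<subseteq> A \<and> bO' H ` A \<subseteq> A \<and> karoubi' H ` A \<subseteq> A \<and>
    mixed_subcomplex (\<lambda>n. A \<inter> Omega_deg H n) (Omega_deg H) (\<lambda>_. bO H) (BO H) \<and>
    mixed_subcomplex (\<lambda>n. A \<inter> Omega_deg H n) (Omega_deg H) (\<lambda>_. bO' H) (BO' H)"
proof -
  interpret involutive_hopf_algebra H by (rule H)
  have A: "omega_stable A" "A \<subseteq> Omega H"
    using S stable_OmegaR stable_OmegaL by (auto simp: OmegaR_eq OmegaL_eq)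
  note dg = stable_dg[OF A]
  have sub: "fs.subspace A" and d: "\<And>x. x \<in> A \<Longrightarrow> dO H x \<in> A"
    using dg(1) by (auto simp: dg_subalgebra_def)
  have pow: "(F ^^ j) x \<in> A" if "F ` A \<subseteq> A" "x \<in> A" for F j x
    using that by (induction j) auto
  have "mixed_subcomplex (\<lambda>n. A \<inter> Omega_deg H n) (Omega_deg H) (\<lambda>_. bO H) (BO H)"
    by (rule mixed_subcomplex_stable[OF sub mixed_Omega(1)[OF H] dg(2)])
      (auto simp: BO_def intro!: fs.subspace_sum[OF sub] pow[OF dg(4)] d)
  moreover have "mixed_subcomplex (\<lambda>n. A \<inter> Omega_deg H n) (Omega_deg H) (\<lambda>_. bO' H) (BO' H)"
    by (rule mixed_subcomplex_stable[OF sub mixed_Omega(2)[OF H] dg(3)])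
      (auto simp: BO'_def intro!: fs.subspace_sum[OF sub] pow[OF dg(5)] d)
  ultimately show ?thesis using dg by blast
qed

theorem theorem1:
  shows "(\<forall>H :: ('k::field_char_0, 'a) hopf. involutive_hopf_algebra H \<longrightarrow>
      (\<forall>A\<in>{OmegaR H, OmegaL H}.
        dg_subalgebra H A \<and>
        bO H ` A \<subseteq> A \<and> karoubi H ` A \<subseteq> A \<and> bO' H ` A \<subseteq> A \<and> karoubi' H ` A \<subseteq> A \<and>
        mixed_subcomplex (\<lambda>n. A \<inter> Omega_deg H n) (Omega_deg H) (\<lambda>_. bO H) (BO H) \<and>
        mixed_subcomplex (\<lambda>n. A \<inter> Omega_deg H n) (Omega_deg H) (\<lambda>_. bO' H) (BO' H))) \<and>
    naturally_isomorphic_cohomology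
      (\<lambda>H :: ('k, 'a) hopf. cp_sum (\<lambda>n. OmegaR H \<inter> Omega_deg H n) (\<lambda>_. bO' H) (BO' H))
      (\<lambda>H. cp_sum (tpower H) (hopf_down H) (hopf_up H)) \<and>
    naturally_isomorphic_cohomology
      (\<lambda>H :: ('k, 'a) hopf. cp_prod (\<lambda>n. OmegaR H \<inter> Omega_deg H n) (\<lambda>_. bO' H) (BO' H))
      (\<lambda>H. cp_prod (hopf_normalized H) (hopf_down H) (hopf_up H))"
  unfolding cp_sum_eq cp_prod_eq
proof (intro conjI[OF _ conjI])
  show "\<forall>H :: ('k, 'a) hopf. involutive_hopf_algebra H \<longrightarrow> (\<forall>A\<in>{OmegaR H, OmegaL H}.
      dg_subalgebra H A \<and>
      bO H ` A \<subseteq> A \<and> karoubi H ` A \<subseteq> A \<and> bO' H ` A \<subseteq> A \<and> karoubi' H ` A \<subseteq> A \<and>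
      mixed_subcomplex (\<lambda>n. A \<inter> Omega_deg H n) (Omega_deg H) (\<lambda>_. bO H) (BO H) \<and>
      mixed_subcomplex (\<lambda>n. A \<inter> Omega_deg H n) (Omega_deg H) (\<lambda>_. bO' H) (BO' H))"
    by (intro allI impI ballI) (rule coinvariant_mixed_subcomplex)
  show "naturally_isomorphic_cohomology
      (\<lambda>H :: ('k, 'a) hopf. cp True (\<lambda>n. OmegaR H \<inter> Omega_deg H n) (\<lambda>_. bO' H) (BO' H))
      (\<lambda>H. cp True (tpower H) (hopf_down H) (hopf_up H))"
    by (rule naturally_isomorphic_OmegaR[where C = tpower])
      (simp_all add: period_map_quasi_iso hopf_morphism.tmap_tpower)
  show "naturally_isomorphic_cohomology
      (\<lambda>H :: ('k, 'a) hopf. cp False (\<lambda>n. OmegaR H \<inter> Omega_deg H n) (\<lambda>_. bO' H) (BO' H))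
      (\<lambda>H. cp False (hopf_normalized H) (hopf_down H) (hopf_up H))"
    by (rule naturally_isomorphic_OmegaR[where C = hopf_normalized])
      (simp_all add: period_map_quasi_iso hopf_morphism.tmap_hopf_normalized, auto simp: hopf_normalized_def)
qed

end
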